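(* Let $P=\langle a,b \mid b^{-1}a^2b=a^{-2},\ a^{-1}b^2a=b^{-2}\rangle$ and let $B(4)\subset P$ be the ball of radius $4$ in the word metric with respect to $\{a^{\pm1},b^{\pm1}\}$. No unit of the integral group ring $\mathbb{Z}[P]$ with support contained in $B(4)$ has nontrivial reduction modulo $2$. Equivalently, every unit $u$ of $\mathbb{Z}[P]$ with $\operatorname{supp}(u)\subseteq B(4)$ is congruent modulo $2$ to a trivial unit. There is no restriction on the coefficients of $u$ or on the support of $u^{-1}$.
   Context: $P$ is the Hantzsche--Wendt (Promislow) group. $B(4)$ is the set of elements of $P$ that can be written as a product of at most $4$ elements of $\{a,a^{-1},b,b^{-1}\}$. For $u=\sum_{g\in P}u_g\,g$ in a group ring, $\operatorname{supp}(u)=\{g\in P:u_g\neq0\}$. The reduction modulo $2$ of $u\in\mathbb{Z}[P]$ is its image in $\mathbb{F}_2[P]$ under coefficientwise reduction. Trivial units of $\mathbb{Z}[P]$ are the elements $\pm g$ with $g\in P$; trivial units of $\mathbb{F}_2[P]$ are the elements $g\in P$. The reduction of a unit is called nontrivial if it is not a trivial unit of $\mathbb{F}_2[P]$. *)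

theory Defs
  imports Main "HOL-Library.Poly_Mapping" "HOL-Library.Z2"
begin

section \<open>The Hantzsche--Wendt (Promislow) group\<close>

text \<open>
  Words over the letters \<open>a, a\<inverse>, b, b\<inverse>\<close>: a letter is a generator together with a flag,
  where \<open>True\<close> marks the inverse of the generator.
\<close>

datatype pgen = GenA | GenB

type_synonym pword = "(pgen \<times> bool) list"

text \<open>
  The smallest congruence on words containing free cancellation and the two defining
  relations \<open>b\<inverse> a\<^sup>2 b = a\<^sup>-\<^sup>2\<close> and \<open>a\<inverse> b\<^sup>2 a = b\<^sup>-\<^sup>2\<close>.  Words modulo this congruence form the group
  presented by these relations.
\<close>

inductive pres_eq :: "pword \<Rightarrow> pword \<Rightarrow> bool" where
  pres_refl: "pres_eq w w"
| pres_sym: "pres_eq v w \<Longrightarrow> pres_eq w v"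
| pres_trans: "pres_eq u v \<Longrightarrow> pres_eq v w \<Longrightarrow> pres_eq u w"
| pres_append: "pres_eq v v' \<Longrightarrow> pres_eq w w' \<Longrightarrow> pres_eq (v @ w) (v' @ w')"
| pres_cancel: "pres_eq [(x, e), (x, \<not> e)] []"
| pres_rel_a: "pres_eq [(GenB, True), (GenA, False), (GenA, False), (GenB, False)]
                       [(GenA, True), (GenA, True)]"
| pres_rel_b: "pres_eq [(GenA, True), (GenB, False), (GenB, False), (GenA, False)]
                       [(GenB, True), (GenB, True)]"

quotient_type promislow = pword / pres_eq
  by (rule equivpI)
     (auto simp: reflp_def symp_def transp_def intro: pres_refl pres_sym pres_trans)

definition inv_word :: "pword \<Rightarrow> pword" where
  "inv_word w = rev (map (\<lambda>(x, e). (x, \<not> e)) w)"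

lemma inv_word_simps:
  "inv_word [] = []"
  "inv_word (v @ w) = inv_word w @ inv_word v"
  "inv_word ((x, e) # w) = inv_word w @ [(x, \<not> e)]"
  by (simp_all add: inv_word_def)

lemma inv_word_inv_word: "inv_word (inv_word w) = w"
  by (induction w) (auto simp: inv_word_simps)

lemma pres_eq_left_inverse: "pres_eq (inv_word w @ w) []"
proof (induction w)
  case Nil
  show ?case by (simp add: inv_word_simps pres_refl)
next
  case (Cons l w)
  obtain x e where l: "l = (x, e)" by (cases l)
  have "pres_eq ([(x, \<not> e), (x, e)] @ w) ([] @ w)"
    using pres_cancel[of x "\<not> e"] by (intro pres_append pres_refl) simp
  then have "pres_eq (inv_word w @ ([(x, \<not> e), (x, e)] @ w)) (inv_word w @ w)"
    by (intro pres_append pres_refl) simp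
  then show ?case
    using Cons.IH l by (auto simp: inv_word_simps intro: pres_trans)
qed

lemma pres_eq_right_inverse: "pres_eq (w @ inv_word w) []"
  using pres_eq_left_inverse[of "inv_word w"] by (simp add: inv_word_inv_word)

lemma pres_eq_inv_word:
  assumes "pres_eq v w"
  shows "pres_eq (inv_word v) (inv_word w)"
proof -
  have "pres_eq (inv_word v @ (w @ inv_word w)) (inv_word v @ [])"
    by (intro pres_append pres_refl pres_eq_right_inverse)
  moreover have "pres_eq ((inv_word v @ v) @ inv_word w) ((inv_word v @ w) @ inv_word w)"
    by (intro pres_append pres_refl assms)
  moreover have "pres_eq ((inv_word v @ v) @ inv_word w) ([] @ inv_word w)"
    by (intro pres_append pres_refl pres_eq_left_inverse)
  ultimately show ?thesis
    by (simp, meson pres_sym pres_trans)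
qed

text \<open>
  The group is written additively, although it is not commutative, because the convolution
  product on \<^typ>\<open>'g \<Rightarrow>\<^sub>0 'r\<close> is defined for index types in \<^class>\<open>monoid_add\<close>.
  Thus \<open>g + h\<close> is the product \<open>gh\<close>, \<open>0\<close> the identity, and \<open>- g\<close> the inverse of \<open>g\<close>.
\<close>

instantiation promislow :: group_add
begin

lift_definition zero_promislow :: promislow is "[]" .

lift_definition plus_promislow :: "promislow \<Rightarrow> promislow \<Rightarrow> promislow" is "(@)"
  by (rule pres_append)

lift_definition uminus_promislow :: "promislow \<Rightarrow> promislow" is inv_word
  by (rule pres_eq_inv_word)

definition minus_promislow :: "promislow \<Rightarrow> promislow \<Rightarrow> promislow" where
  "minus_promislow g h = g + - h"

instance
proof
  fix g h k :: promislow
  show "g + h + k = g + (h + k)" by transfer (simp add: pres_refl)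
  show "0 + g = g" by transfer (simp add: pres_refl)
  show "g + 0 = g" by transfer (simp add: pres_refl)
  show "- g + g = 0" by transfer (rule pres_eq_left_inverse)
  show "g + - h = g - h" by (simp add: minus_promislow_def)
qed

end

lift_definition pa :: promislow is "[(GenA, False)]" .

lift_definition pb :: promislow is "[(GenB, False)]" .

lemma promislow_relations:
  "- pb + (pa + pa) + pb = - (pa + pa)"
  "- pa + (pb + pb) + pa = - (pb + pb)"
  by (transfer, simp add: inv_word_def pres_rel_a pres_rel_b)+

definition word_ball :: "nat \<Rightarrow> promislow set" where
  "word_ball n = {sum_list gs | gs. length gs \<le> n \<and> set gs \<subseteq> {pa, - pa, pb, - pb}}"


section \<open>Group rings\<close>

type_synonym ZP = "promislow \<Rightarrow>\<^sub>0 int"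

type_synonym F2P = "promislow \<Rightarrow>\<^sub>0 bit"

definition ring_unit :: "'r::ring_1 \<Rightarrow> bool" where
  "ring_unit u \<longleftrightarrow> (\<exists>v. u * v = 1 \<and> v * u = 1)"

definition reduction_mod_2 :: "ZP \<Rightarrow> F2P" where
  "reduction_mod_2 = Poly_Mapping.map of_int"

lemma lookup_reduction_mod_2:
  "Poly_Mapping.lookup (reduction_mod_2 u) g = of_int (Poly_Mapping.lookup u g)"
  by (simp add: reduction_mod_2_def Poly_Mapping.map.rep_eq when_def)

definition trivial_unit_Z :: "ZP \<Rightarrow> bool" where
  "trivial_unit_Z u \<longleftrightarrow>
     (\<exists>g. u = Poly_Mapping.single g 1 \<or> u = - Poly_Mapping.single g 1)"

definition trivial_unit_F2 :: "F2P \<Rightarrow> bool" where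
  "trivial_unit_F2 u \<longleftrightarrow> (\<exists>g. u = Poly_Mapping.single g 1)"

definition congruent_mod_2 :: "ZP \<Rightarrow> ZP \<Rightarrow> bool" where
  "congruent_mod_2 u v \<longleftrightarrow> (\<exists>w. u - v = 2 * w)"

end

theory Submission imports Defs "HOL-Computational_Algebra.Polynomial_Factorial" "HOL-Analysis.Determinants" begin

text \<open>
  Acting on a lattice of finite index, \<open>P\<close> is graded by the levels of an infinite dihedral quotient, and
  \<open>\<int>[P]\<close> becomes a twisted product over the Laurent polynomials in \<open>x, y\<close>.  A one-sided unit of
  small length factors explicitly in terms of its four extremal coefficients, and the multiplicativity of a
  determinant norm turns this factorization into a norm equation.  The equation forces the extremal coefficients of a
  unit in the ball to be monomials on the lines \<open>x = -1\<close> and \<open>y = -1\<close>, where the norm forms are anisotropic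
  and positivity is available; divisibility by \<open>x + 1\<close> and \<open>y + 1\<close> together with the
  supports in the ball then rules out everything except \<open>\<plusminus>g\<close>.
\<close>

section \<open>Coordinates on the group\<close>

text \<open>Nontrivial units exist over the field with two elements, so the argument has to use the
  order on the integers. It does so where norm forms become definite. The norm of
  \<open>\<alpha> + \<beta> a\<close> is \<open>\<alpha> * \<sigma> \<alpha> - X * \<beta> *
  \<sigma> \<beta>\<close>; the values 1 and -1 of a variable are fixed by inversion, and at -1 the
  minus sign turns the form into a sum of two norms. This is the origin of the lines with value -1.
  On each of them one of the two norm forms is definite, and the other keeps an odd power of the
  remaining variable and is governed by parity of degrees. The radius enters through the levels,
  which run from -4 to 4. Even levels multiply as translations and odd ones as reflections, so both
  the extreme even and the extreme odd levels matter. Levels 4 and -4 cannot both occur in a unit,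
  and group inversion exchanges them; this leaves the levels -3 to 4, with extremal coefficients at
  4, 3, -2 and -3. The inverse needs no bound, because the relations come from the lowest and the
  highest level of a right inverse, wherever they lie.\<close>

definition sgx :: "int \<Rightarrow> int" where "sgx n = (if n mod 4 \<in> {0, 1} then 1 else - 1)"
definition sgy :: "int \<Rightarrow> int" where "sgy n = (if n mod 4 \<in> {0, 3} then 1 else - 1)"
definition sgn_par :: "int \<Rightarrow> int" where "sgn_par n = (if even n then 1 else - 1)"

lemmas sg_defs = sgx_def sgy_def sgn_par_def

lemma mod4_cases:
  obtains "(n::int) mod 4 = 0" | "n mod 4 = 1" | "n mod 4 = 2" | "n mod 4 = 3"
proof -
  have "0 \<le> n mod 4" "n mod 4 < 4" by simp_all
  then have "n mod 4 = 0 \<or> n mod 4 = 1 \<or> n mod 4 = 2 \<or> n mod 4 = 3" by presburger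
  then show ?thesis using that by metis
qed

lemma sgn_par_mod4: "sgn_par n = (if n mod 4 \<in> {0, 2} then 1 else - 1)"
  unfolding sgn_par_def by (auto; presburger)

lemma mod4_add: "(n + sgn_par n * m) mod 4 =
   (if n mod 4 \<in> {0, 2} then (n mod 4 + m mod 4) mod 4 else (n mod 4 - m mod 4) mod 4)" for n m :: int
  unfolding sgn_par_mod4 by (simp add: mod_simps)

lemma sg_mult:
  "sgx (n + sgn_par n * m) = sgx n * sgx m"
  "sgy (n + sgn_par n * m) = sgy n * sgy m"
  "sgn_par (n + sgn_par n * m) = sgn_par n * sgn_par m"
proof -
  show "sgx (n + sgn_par n * m) = sgx n * sgx m" "sgy (n + sgn_par n * m) = sgy n * sgy m"
    by (cases n rule: mod4_cases; cases m rule: mod4_cases; simp add: sgx_def sgy_def mod4_add)+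
  show "sgn_par (n + sgn_par n * m) = sgn_par n * sgn_par m"
    by (simp add: sgn_par_def)
qed

lemma sg_zero [simp]: "sgx 0 = 1" "sgy 0 = 1" "sgn_par 0 = 1"
  by (simp_all add: sg_defs)

type_synonym coord = "int \<times> int \<times> int"

text \<open>The third entry is the level, multiplied as in the infinite dihedral group: even levels
  translate and odd levels reflect. It acts on the other two entries by the signs \<open>sgx\<close>
  and \<open>sgy\<close>, which depend on the level mod 4. Lattice elements sit at even values of
  the first two entries and at levels divisible by 4, so that \<open>pa\<close> and
  \<open>pb\<close>, square roots of lattice elements, have integral coordinates.\<close>

fun cmul :: "coord \<Rightarrow> coord \<Rightarrow> coord" where
  "cmul (s, t, n) (s', t', n') = (s + sgx n * s', t + sgy n * t', n + sgn_par n * n')"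

lemma cmul_assoc: "cmul (cmul u v) w = cmul u (cmul v w)"
  by (cases u; cases v; cases w) (simp add: sg_mult distrib_left mult.assoc add.assoc)

lemma cmul_zero [simp]: "cmul (0, 0, 0) u = u" "cmul u (0, 0, 0) = u"
  by (cases u; simp)+

fun letter_coord :: "pgen \<times> bool \<Rightarrow> coord" where
  "letter_coord (GenA, e) = (if e then (- 1, 0, 1) else (1, 0, 1))"
| "letter_coord (GenB, e) = (if e then (0, - 1, - 1) else (0, 1, - 1))"

fun word_coord :: "pword \<Rightarrow> coord" where
  "word_coord [] = (0, 0, 0)"
| "word_coord (l # w) = cmul (letter_coord l) (word_coord w)"

lemma word_coord_append: "word_coord (v @ w) = cmul (word_coord v) (word_coord w)"
  by (induction v) (simp_all add: cmul_assoc)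

lemma word_coord_cong: "pres_eq v w \<Longrightarrow> word_coord v = word_coord w"
proof (induction rule: pres_eq.induct)
  case (pres_cancel x e)
  then show ?case by (cases x; cases e; simp add: sg_defs)
qed (simp_all add: word_coord_append, simp_all add: sg_defs)

lift_definition crd :: "promislow \<Rightarrow> coord" is word_coord
  by (rule word_coord_cong)

lemma crd_add: "crd (g + h) = cmul (crd g) (crd h)"
  by transfer (rule word_coord_append)

lemma crd_zero [simp]: "crd 0 = (0, 0, 0)"
  by transfer simp

lemma crd_gen [simp]:
  "crd pa = (1, 0, 1)" "crd (- pa) = (- 1, 0, 1)" "crd pb = (0, 1, - 1)" "crd (- pb) = (0, - 1, - 1)"
  by (transfer, simp add: inv_word_def)+

section \<open>Integer powers and the translation lattice spanned by the squares of a, b and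
  ab\<close>

definition zpow :: "'g::group_add \<Rightarrow> int \<Rightarrow> 'g" where
  "zpow g k = (if k \<ge> 0 then ((\<lambda>h. h + g) ^^ nat k) 0 else ((\<lambda>h. h - g) ^^ nat (- k)) 0)"

lemma zpow_0 [simp]: "zpow g 0 = 0"
  by (simp add: zpow_def)

lemma zpow_succ: "zpow g (k + 1) = zpow g k + g"
proof (cases "k \<ge> 0")
  case True
  then show ?thesis by (simp add: zpow_def nat_add_distrib)
next
  case False
  then have "nat (- k) = Suc (nat (- (k + 1)))" by simp
  with False show ?thesis by (cases "k = - 1") (simp_all add: zpow_def)
qed

lemma zpow_pred: "zpow g (k - 1) = zpow g k - g"
  using zpow_succ[of g "k - 1"] by (simp add: algebra_simps)

lemma zpow_add: "zpow g (j + k) = zpow g j + zpow g k"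
proof (induction k rule: int_induct[where k = 0])
  case (step1 i)
  then show ?case using zpow_succ[of g "j + i"] zpow_succ[of g i] by (simp add: add.assoc)
next
  case (step2 i)
  then show ?case using zpow_pred[of g "j + i"] zpow_pred[of g i]
    by (metis add_diff_eq)
qed simp

lemma zpow_1 [simp]: "zpow g 1 = g" "zpow g (- 1) = - g"
  using zpow_succ[of g 0] zpow_pred[of g 0] by simp_all

lemma zpow_conj:
  assumes "s + g = g' + s"
  shows "s + zpow g k = zpow g' k + s"
proof (induction k rule: int_induct[where k = 0])
  case (step1 i)
  have "s + zpow g (i + 1) = (s + zpow g i) + g" by (simp add: zpow_succ add.assoc)
  also have "\<dots> = zpow g' i + (s + g)" using step1 by (simp add: add.assoc)
  also have "\<dots> = zpow g' (i + 1) + s" using assms by (simp add: zpow_succ add.assoc)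
  finally show ?case .
next
  case (step2 i)
  have c: "s - g = - g' + s" using assms by (metis add.assoc add_diff_cancel diff_add_cancel left_minus add_0_left minus_add_cancel)
  have "s + zpow g (i - 1) = (s + zpow g i) - g" by (simp add: zpow_pred add_diff_eq)
  also have "\<dots> = zpow g' i + (s - g)" using step2 by (simp add: add_diff_eq)
  also have "\<dots> = zpow g' (i - 1) + s" unfolding c zpow_pred by (simp only: diff_conv_add_uminus add.assoc)
  finally show ?case .
qed simp

lemma zpow_uminus: "zpow (- g) k = zpow g (- k)"
proof (induction k rule: int_induct[where k = 0])
  case (step1 i)
  have e: "- (i + 1) = - i - 1" by simp
  show ?case unfolding e zpow_succ zpow_pred step1 by simp
next
  case (step2 i)
  have e: "- (i - 1) = - i + 1" by simp
  show ?case unfolding e zpow_succ zpow_pred step2 by simp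
qed simp

definition px :: promislow where "px = pa + pa"
definition py :: promislow where "py = pb + pb"
definition pc :: promislow where "pc = pa + pb"
definition pz :: promislow where "pz = pc + pc"

lemmas gen_defs = px_def py_def pz_def pc_def

lemma push: "s + (g + w) = g' + (s + w)" if "s + g = g' + s" for s g g' w :: "'g::semigroup_add"
  using that by (simp add: add.assoc[symmetric])

lemma conj_flip: "b + x = - x + b" if "- b + x + b = - x" for b x :: "'g::group_add"
proof -
  have "b + (- b + x + b) = b + - x" using that by simp
  then have "x + b = b + - x" by (simp add: add.assoc[symmetric])
  then have "- x + (x + b) + x = - x + (b + - x) + x" by simp
  then show ?thesis by (simp add: add.assoc)
qed

lemma conj_uminus: "s + - g = - g' + s" if "s + g = g' + s" for s g g' :: "'g::group_add"
  using zpow_conj[OF that, of "- 1"] by simp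

lemma comm_b_x: "pb + px = - px + pb"
  by (rule conj_flip) (use promislow_relations(1) in \<open>simp add: gen_defs add.assoc\<close>)

lemma comm_a_y: "pa + py = - py + pa"
  by (rule conj_flip) (use promislow_relations(2) in \<open>simp add: gen_defs add.assoc\<close>)

lemma comm_a_x: "pa + px = px + pa"
  by (simp add: px_def py_def pz_def add.assoc)

lemma comm_b_y: "pb + py = py + pb"
  by (simp add: px_def py_def pz_def add.assoc)

lemma comm_add: "(s + t) + g = g'' + (s + t)" if "t + g = g' + t" "s + g' = g'' + s"
  for s t g g' g'' :: "'g::group_add"
  using that by (simp add: add.assoc push)

lemma comm_c_x: "pc + px = - px + pc"
  unfolding pc_def by (rule comm_add[OF comm_b_x conj_uminus[OF comm_a_x]])

lemma comm_c_y: "pc + py = - py + pc"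
  unfolding pc_def by (rule comm_add[OF comm_b_y comm_a_y])

lemma comm_y_x: "py + px = px + py"
  using comm_add[OF comm_b_x conj_uminus[OF comm_b_x]] by (simp add: py_def)

lemma comm_z_x: "pz + px = px + pz"
  using comm_add[OF comm_c_x conj_uminus[OF comm_c_x]] by (simp add: pz_def)

lemma comm_z_y: "pz + py = py + pz"
  using comm_add[OF comm_c_y conj_uminus[OF comm_c_y]] by (simp add: pz_def)

lemma comm_c_z: "pc + pz = pz + pc"
  by (simp add: px_def py_def pz_def add.assoc)

lemma comm_a_z: "pa + pz = - pz + pa"
proof -
  \<comment> \<open>The relation \<open>pa + py = - py + pa\<close> reads
    \<open>py + - pa + py = - pa\<close>; stripping one letter \<open>pb\<close> from either side
    leaves this identity, which is what makes \<open>pa\<close> invert \<open>pz\<close>.\<close>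
  have 1: "pb + (- pa) + pb = - pb - pa - pb"
  proof -
    have "- pa + (pa + py) + - pa = - pa + (- py + pa) + - pa" by (simp only: comm_a_y)
    then have "py + - pa = - pa + - py" by (simp add: add.assoc del: add_uminus_conv_diff)
    then have "py + - pa + py = - pa" by (simp add: add.assoc del: add_uminus_conv_diff)
    then have "pb + (pb + (- pa) + pb) + pb = - pa" by (simp add: py_def add.assoc del: add_uminus_conv_diff)
    then have "- pb + (pb + (pb + (- pa) + pb) + pb) + - pb = - pb + - pa + - pb" by simp
    then show ?thesis by (simp add: add.assoc del: add_uminus_conv_diff) (simp add: diff_conv_add_uminus add.assoc del: add_uminus_conv_diff)
  qed
  have "pa + pz = (px + pb) + pa + pb" by (simp add: gen_defs add.assoc)
  also have "px + pb = pb + - px" using conj_uminus[OF comm_b_x] by simp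
  also have "(pb + - px) + pa + pb = pb + - pa + pb" by (simp add: px_def add.assoc minus_add del: add_uminus_conv_diff)
  also have "\<dots> = - pz + pa" unfolding 1 by (simp add: gen_defs add.assoc minus_add diff_conv_add_uminus del: add_uminus_conv_diff)
  finally show ?thesis .
qed

lemma comm_b_z: "pb + pz = - pz + pb"
proof -
  have "pb = - pa + pc" by (simp add: pc_def add.assoc)
  moreover have "- pa + pz = - pz + - pa"
  proof -
    have "- pa + (pa + - pz) + - pa = - pa + (pz + pa) + - pa" using conj_uminus[OF comm_a_z] by simp
    then show ?thesis by (simp add: add.assoc del: add_uminus_conv_diff)
  qed
  ultimately show ?thesis using comm_add[OF comm_c_z, of "- pa" "- pz"] by simp
qed

definition latt :: "int \<Rightarrow> int \<Rightarrow> int \<Rightarrow> promislow" where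
  "latt i j k = zpow px i + zpow py j + zpow pz k"

lemma zpow_commute: "zpow g i + zpow h j = zpow h j + zpow g i" if "g + h = h + g" for g h :: "'g::group_add"
  by (rule zpow_conj, rule zpow_conj[symmetric]) (simp add: that)

lemma latt_add: "latt i j k + latt i' j' k' = latt (i + i') (j + j') (k + k')"
proof -
  have c: "zpow py j + zpow px i' = zpow px i' + zpow py j" "zpow pz k + zpow px i' = zpow px i' + zpow pz k"
    "zpow pz k + zpow py j' = zpow py j' + zpow pz k"
    by (rule zpow_commute; rule comm_y_x comm_z_x comm_z_y)+
  show ?thesis unfolding latt_def zpow_add by (simp add: add.assoc push[OF c(1)] push[OF c(2)] push[OF c(3)])
qed

lemma latt_simps: "latt 0 0 0 = 0" "latt 1 0 0 = px" "latt 0 1 0 = py" "latt 0 0 1 = pz"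
  "latt (- 1) 0 0 = - px" "latt 0 (- 1) 0 = - py" "latt 0 0 (- 1) = - pz"
  by (simp_all add: latt_def)

lemma latt_move:
  "pa + latt i j k = latt i (- j) (- k) + pa"
  "pb + latt i j k = latt (- i) j (- k) + pb"
  "pc + latt i j k = latt (- i) (- j) k + pc"
proof -
  note cj = zpow_conj[of _ px px] zpow_conj[of _ px "- px", unfolded zpow_uminus]
    zpow_conj[of _ py py] zpow_conj[of _ py "- py", unfolded zpow_uminus]
    zpow_conj[of _ pz pz] zpow_conj[of _ pz "- pz", unfolded zpow_uminus]
  have a: "pa + zpow px i = zpow px i + pa" "pa + zpow py j = zpow py (- j) + pa" "pa + zpow pz k = zpow pz (- k) + pa"
    by (rule cj, rule comm_a_x comm_a_y comm_a_z)+
  have b: "pb + zpow px i = zpow px (- i) + pb" "pb + zpow py j = zpow py j + pb" "pb + zpow pz k = zpow pz (- k) + pb"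
    by (rule cj, rule comm_b_x comm_b_y comm_b_z)+
  have c: "pc + zpow px i = zpow px (- i) + pc" "pc + zpow py j = zpow py (- j) + pc" "pc + zpow pz k = zpow pz k + pc"
    by (rule cj, rule comm_c_x comm_c_y comm_c_z)+
  show "pa + latt i j k = latt i (- j) (- k) + pa" unfolding latt_def by (simp add: add.assoc push[OF a(1)] push[OF a(2)] a(3))
  show "pb + latt i j k = latt (- i) j (- k) + pb" unfolding latt_def by (simp add: add.assoc push[OF b(1)] push[OF b(2)] b(3))
  show "pc + latt i j k = latt (- i) (- j) k + pc" unfolding latt_def by (simp add: add.assoc push[OF c(1)] push[OF c(2)] c(3))
qed

definition rep :: "nat \<Rightarrow> promislow" where
  "rep r = (if r = 0 then 0 else if r = 1 then pa else if r = 2 then pb else pc)"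

lemma rep_move: "\<exists>i' j' k'. rep r + latt i j k = latt i' j' k' + rep r"
proof (cases "r = 0 \<or> r = 1 \<or> r = 2")
  case True
  then show ?thesis unfolding rep_def using latt_move[of i j k] by fastforce
next
  case False
  then show ?thesis unfolding rep_def using latt_move[of i j k] by fastforce
qed

lemma rep_gen: "\<exists>i j k s. rep r + pa = latt i j k + rep s" "\<exists>i j k s. rep r + pb = latt i j k + rep s"
proof -
  have ba: "pb + pa = latt (- 1) 1 (- 1) + pc"
  proof -
    have "latt (- 1) 1 (- 1) + pc = latt (- 1) 1 0 + (- pz + pc)"
      using latt_add[of "- 1" 1 0 0 0 "- 1"] by (simp add: latt_simps add.assoc[symmetric])
    also have "- pz + pc = - pc" by (simp add: pz_def add.assoc minus_add diff_conv_add_uminus del: add_uminus_conv_diff)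
    also have "latt (- 1) 1 0 = - px + py" using latt_add[of "- 1" 0 0 0 1 0] by (simp add: latt_simps)
    also have "- px + py + - pc = - px + (py + - pb) + - pa" by (simp add: pc_def add.assoc minus_add diff_conv_add_uminus del: add_uminus_conv_diff)
    also have "\<dots> = (- px + pb) + - pa" by (simp add: py_def add.assoc diff_conv_add_uminus del: add_uminus_conv_diff)
    also have "- px + pb = pb + px" by (simp add: comm_b_x)
    also have "pb + px + - pa = pb + pa" by (simp add: px_def add.assoc diff_conv_add_uminus del: add_uminus_conv_diff)
    finally show ?thesis by simp
  qed
  have aba: "pc + pa = latt 0 (- 1) 1 + pb"
  proof -
    have "latt 0 (- 1) 1 = pz + - py" using latt_add[of 0 0 1 0 "- 1" 0] by (simp add: latt_simps)
    then show ?thesis by (simp add: pz_def pc_def py_def add.assoc minus_add diff_conv_add_uminus del: add_uminus_conv_diff)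
  qed
  have abb: "pc + pb = latt 0 (- 1) 0 + pa" using comm_a_y by (simp add: latt_simps py_def pc_def add.assoc)
  have "rep 0 + pa = latt 0 0 0 + rep 1" "rep 1 + pa = latt 1 0 0 + rep 0" "rep 0 + pb = latt 0 0 0 + rep 2"
    "rep 1 + pb = latt 0 0 0 + rep 3" "rep 2 + pb = latt 0 1 0 + rep 0"
    "rep 2 + pa = latt (- 1) 1 (- 1) + rep 3" "rep 3 + pa = latt 0 (- 1) 1 + rep 2" "rep 3 + pb = latt 0 (- 1) 0 + rep 1"
    using ba aba abb by (simp_all add: rep_def latt_simps px_def py_def pc_def)
  moreover have "rep r \<in> {rep 0, rep 1, rep 2, rep 3}" by (simp add: rep_def)
  ultimately show "\<exists>i j k s. rep r + pa = latt i j k + rep s" "\<exists>i j k s. rep r + pb = latt i j k + rep s"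
    unfolding insert_iff empty_iff by (elim disjE; force)+
qed

lemma rep_gen_neg: "\<exists>i j k s. rep r - pa = latt i j k + rep s" "\<exists>i j k s. rep r - pb = latt i j k + rep s"
proof -
  have "- pa = latt (- 1) 0 0 + pa" "- pb = latt 0 (- 1) 0 + pb"
    by (simp_all add: latt_simps px_def py_def minus_add diff_conv_add_uminus add.assoc del: add_uminus_conv_diff)
  then have "rep r - pa = (rep r + latt (- 1) 0 0) + pa" "rep r - pb = (rep r + latt 0 (- 1) 0) + pb"
    by (simp_all only: add.assoc diff_conv_add_uminus)
  moreover obtain i j k where "rep r + latt (- 1) 0 0 = latt i j k + rep r" using rep_move by blast
  moreover obtain i' j' k' where "rep r + latt 0 (- 1) 0 = latt i' j' k' + rep r" using rep_move by blast
  moreover obtain i2 j2 k2 s where "rep r + pa = latt i2 j2 k2 + rep s" using rep_gen by blast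
  moreover obtain i3 j3 k3 s' where "rep r + pb = latt i3 j3 k3 + rep s'" using rep_gen by blast
  ultimately have "rep r - pa = latt (i + i2) (j + j2) (k + k2) + rep s" "rep r - pb = latt (i' + i3) (j' + j3) (k' + k3) + rep s'"
    by (simp_all only: add.assoc latt_add[symmetric])
  then show "\<exists>i j k s. rep r - pa = latt i j k + rep s" "\<exists>i j k s. rep r - pb = latt i j k + rep s" by blast+
qed

lemma promislow_word_induct [case_names zero step]:
  assumes "P 0" "\<And>g s. s \<in> {pa, - pa, pb, - pb} \<Longrightarrow> P g \<Longrightarrow> P (g + s)"
  shows "P g"
proof -
  have "P (abs_promislow w)" for w
  proof (induction w rule: rev_induct)
    case Nil
    then show ?case using assms(1) by (simp add: zero_promislow_def)
  next
    case (snoc l w)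
    have "abs_promislow (w @ [l]) = abs_promislow w + abs_promislow [l]"
      by (simp add: plus_promislow.abs_eq)
    moreover have "abs_promislow [l] \<in> {pa, - pa, pb, - pb}"
    proof (cases l)
      case (Pair x e)
      then show ?thesis
        by (cases x; cases e; simp add: pa_def pb_def uminus_promislow.abs_eq inv_word_def)
    qed
    ultimately show ?case using assms(2) snoc by metis
  qed
  then show ?thesis by (metis Quotient_abs_rep Quotient_promislow)
qed

text \<open>The four representatives 1, a, b, ab absorb each further letter at the cost of a lattice
  element. This bounds the presented group from above; the coordinates bound it from below.\<close>

lemma normal_form: "\<exists>i j k r. g = latt i j k + rep r"
proof (induction g rule: promislow_word_induct)
  case zero
  have "0 = latt 0 0 0 + rep 0" by (simp add: latt_simps rep_def)
  then show ?case by blast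
next
  case (step g s)
  then obtain i j k r where g: "g = latt i j k + rep r" by blast
  have "\<exists>i j k r'. rep r + s = latt i j k + rep r'"
    using step.hyps rep_gen[of r] rep_gen_neg[of r] unfolding insert_iff empty_iff diff_conv_add_uminus by metis
  then obtain i' j' k' r' where "rep r + s = latt i' j' k' + rep r'" by blast
  then have "g + s = latt (i + i') (j + j') (k + k') + rep r'"
    unfolding g by (simp only: add.assoc latt_add[symmetric])
  then show ?case by blast
qed

lemma crd_zpow:
  assumes "crd g = (s, t, n)" "sgx n = 1" "sgy n = 1" "sgn_par n = 1"
  shows "crd (zpow g k) = (s * k, t * k, n * k)"
proof (induction k rule: int_induct[where k = 0])
  case (step1 i)
  have "crd (zpow g (i + 1)) = crd (g + zpow g i)" using zpow_add[of g 1 i] by (simp add: add.commute)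
  then show ?case by (simp add: crd_add step1 assms algebra_simps)
next
  case (step2 i)
  have "zpow g i = g + zpow g (i - 1)" using zpow_add[of g 1 "i - 1"] by simp
  then have "cmul (s, t, n) (crd (zpow g (i - 1))) = (s * i, t * i, n * i)" using step2 by (metis assms(1) crd_add)
  then show ?case by (cases "crd (zpow g (i - 1))") (simp add: assms algebra_simps)
qed simp

lemma crd_latt: "crd (latt i j k) = (2 * i, 2 * j, 4 * k)"
proof -
  have "crd (zpow px i) = (2 * i, 0, 0)" "crd (zpow py j) = (0, 2 * j, 0)" "crd (zpow pz k) = (0, 0, 4 * k)"
    by (subst crd_zpow, (simp add: gen_defs crd_add sg_defs)+)+
  then show ?thesis by (simp add: latt_def crd_add sg_defs)
qed

text \<open>The lattice exponents and the representative of a normal form can be read off the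
  coordinates by parity. Hence the coefficient of a group element in \<open>u\<close> is the
  coefficient of one monomial at one level.\<close>

lemma crd_inj: "crd g = crd h \<Longrightarrow> g = h"
proof -
  assume e: "crd g = crd h"
  obtain i j k r where g: "g = latt i j k + rep r" using normal_form by blast
  obtain i' j' k' r' where h: "h = latt i' j' k' + rep r'" using normal_form by blast
  have c: "crd (latt i j k + rep r) = (case crd (rep r) of (s, t, n) \<Rightarrow> (2 * i + s, 2 * j + t, 4 * k + n))" for i j k r
  proof -
    have "sgx (4 * k) = 1" "sgy (4 * k) = 1" "sgn_par (4 * k) = 1" by (simp_all add: sg_defs)
    then show ?thesis by (simp add: crd_add crd_latt split: prod.splits)
  qed
  have r: "crd (rep r) = (if r = 0 then (0, 0, 0) else if r = 1 then (1, 0, 1) else if r = 2 then (0, 1, - 1) else (1, - 1, 2))" for r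
    by (simp add: rep_def pc_def crd_add sg_defs)
  have r4: "r = 0 \<or> r = 1 \<or> r = 2 \<or> (r \<noteq> 0 \<and> r \<noteq> 1 \<and> r \<noteq> 2)" for r :: nat by blast
  have rr: "(if r = 0 then 0 else if r = 1 then 1 else if r = 2 then 2 else (3::int)) = (if r' = 0 then 0 else if r' = 1 then 1 else if r' = 2 then 2 else 3)
    \<and> i = i' \<and> j = j' \<and> k = k'"
    using e unfolding g h c r using r4[of r] r4[of r'] by (elim disjE; simp) (elim conjE, presburger)+
  then have "rep r = rep r'" by (auto simp: rep_def split: if_splits)
  then show ?thesis using g h rr by simp
qed

section \<open>Linear extension on the group ring\<close>

text \<open>The target is an arbitrary commutative ring, so that the same sums give coefficients
  over the plane and over both lines, where different group elements can have the same image up to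
  sign.\<close>

definition lext :: "('g \<Rightarrow> 'a::comm_ring_1) \<Rightarrow> ('g \<Rightarrow>\<^sub>0 int) \<Rightarrow> 'a" where
  "lext f w = (\<Sum>g\<in>Poly_Mapping.keys w. of_int (Poly_Mapping.lookup w g) * f g)"

lemma lext_superset:
  assumes "finite S" "Poly_Mapping.keys w \<subseteq> S"
  shows "lext f w = (\<Sum>g\<in>S. of_int (Poly_Mapping.lookup w g) * f g)"
  unfolding lext_def using assms by (intro sum.mono_neutral_left) (auto simp: in_keys_iff)

lemma lext_add: "lext f (v + w) = lext f v + lext f w"
proof -
  let ?S = "Poly_Mapping.keys v \<union> Poly_Mapping.keys w"
  have "Poly_Mapping.keys (v + w) \<subseteq> ?S" by (rule keys_add)
  then have "lext f (v + w) = (\<Sum>g\<in>?S. of_int (Poly_Mapping.lookup (v + w) g) * f g)"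
    by (intro lext_superset) auto
  also have "\<dots> = (\<Sum>g\<in>?S. of_int (Poly_Mapping.lookup v g) * f g) + (\<Sum>g\<in>?S. of_int (Poly_Mapping.lookup w g) * f g)"
    by (simp add: lookup_add sum.distrib[symmetric] distrib_right)
  also have "\<dots> = lext f v + lext f w"
    by (subst (1 2) lext_superset[of ?S]) auto
  finally show ?thesis .
qed

lemma lext_zero [simp]: "lext f 0 = 0"
  by (simp add: lext_def)

lemma lext_single [simp]: "lext f (Poly_Mapping.single g c) = of_int c * f g"
  by (simp add: lext_def)

lemma lext_uminus: "lext f (- w) = - lext f w"
  using lext_add[of f w "- w"] by (simp add: eq_neg_iff_add_eq_0 add.commute)

lemma lext_minus: "lext f (v - w) = lext f v - lext f w"
  using lext_add[of f v "- w"] by (simp add: lext_uminus)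

lemma lext_sum: "lext f (sum h I) = (\<Sum>i\<in>I. lext f (h i))"
  by (induction I rule: infinite_finite_induct) (simp_all add: lext_add)

lemma lext_scale: "lext (\<lambda>g. c * f g) w = c * lext f w"
  by (simp add: lext_def sum_distrib_left algebra_simps)

lemma single_decomp: "w = (\<Sum>g\<in>Poly_Mapping.keys w. Poly_Mapping.single g (Poly_Mapping.lookup w g))"
  by (rule poly_mapping_eqI) (simp add: lookup_sum lookup_single when_def in_keys_iff)

lemma lext_mult:
  "lext f (v * w) = lext (\<lambda>g. lext (\<lambda>h. f (g + h)) w) v" for f :: "'g::monoid_add \<Rightarrow> 'a::comm_ring_1"
proof -
  have s: "lext f (Poly_Mapping.single g c * w) = of_int c * lext (\<lambda>h. f (g + h)) w" for g c
  proof -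
    have "Poly_Mapping.single g c * w =
        (\<Sum>h\<in>Poly_Mapping.keys w. Poly_Mapping.single g c * Poly_Mapping.single h (Poly_Mapping.lookup w h))"
      by (subst single_decomp) (simp add: sum_distrib_left)
    then show ?thesis
      by (simp add: lext_sum mult_single lext_def[of _ w] sum_distrib_left mult.assoc)
  qed
  have "v * w = (\<Sum>g\<in>Poly_Mapping.keys v. Poly_Mapping.single g (Poly_Mapping.lookup v g) * w)"
    by (subst single_decomp) (simp add: sum_distrib_right)
  then show ?thesis by (simp add: lext_sum s lext_def[of _ v])
qed

lemma lext_eq_0: "(\<And>g. g \<in> Poly_Mapping.keys w \<Longrightarrow> f g = 0) \<Longrightarrow> lext f w = 0"
  by (simp add: lext_def)

text \<open>Outside \<open>N\<close> a fibre of \<open>\<nu>\<close> may contain support; only its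
  total contribution has to vanish. This matters on the lines, where terms of one level can
  cancel.\<close>

lemma lext_group:
  assumes "finite N" "\<And>n. n \<notin> N \<Longrightarrow> lext (\<lambda>g. if \<nu> g = n then f g else 0) w = 0"
  shows "lext (\<lambda>g. f g * F (\<nu> g)) w = (\<Sum>n\<in>N. lext (\<lambda>g. if \<nu> g = n then f g else 0) w * F n)"
proof -
  let ?M = "N \<union> \<nu> ` Poly_Mapping.keys w"
  have "lext (\<lambda>g. f g * F (\<nu> g)) w =
     (\<Sum>g\<in>Poly_Mapping.keys w. \<Sum>n\<in>?M. if \<nu> g = n then of_int (Poly_Mapping.lookup w g) * f g * F n else 0)"
    unfolding lext_def using assms(1) by (intro sum.cong refl) (simp add: sum.delta' mult.assoc)
  also have "\<dots> = (\<Sum>n\<in>?M. lext (\<lambda>g. if \<nu> g = n then f g else 0) w * F n)"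
    unfolding lext_def by (subst sum.swap) (auto simp: sum_distrib_right intro!: sum.cong)
  also have "\<dots> = (\<Sum>n\<in>N. lext (\<lambda>g. if \<nu> g = n then f g else 0) w * F n)"
    using assms by (intro sum.mono_neutral_right) auto
  finally show ?thesis .
qed

section \<open>Coprime pairs\<close>

text \<open>In a GCD domain this is coprimality; the formulation avoids choosing gcds.\<close>

definition cop :: "'a::comm_ring_1 \<Rightarrow> 'a \<Rightarrow> bool" where
  "cop a b \<longleftrightarrow> (\<forall>d h. d dvd a * h \<and> d dvd b * h \<longrightarrow> d dvd h)"

lemma cop_commute: "cop a b \<longleftrightarrow> cop b a"
  unfolding cop_def by blast

lemma cop_0_right: "cop a 0 \<Longrightarrow> a dvd 1"
  unfolding cop_def by (metis dvd_0_right dvd_refl mult.right_neutral mult_zero_left)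

lemma cop_0_left: "cop 0 a \<Longrightarrow> a dvd 1"
  using cop_0_right cop_commute by blast

lemma cop_dvd: "cop a b \<Longrightarrow> a * s = b * t \<Longrightarrow> a dvd t"
  unfolding cop_def by (metis dvd_triv_left)

lemma cop_syzygy:
  fixes a b s t :: "'a::idom"
  assumes "cop a b" "a * s = b * t"
  shows "\<exists>e. t = a * e \<and> s = b * e"
proof (cases "a = 0")
  case True
  then obtain b' where b': "1 = b * b'" using cop_0_left assms(1) by (auto simp: dvd_def)
  have "t = 0" using True assms(2) b' by (metis mult_eq_0_iff mult_zero_left zero_neq_one)
  moreover have "s = b * (b' * s)" using b' by (metis mult.assoc mult_1)
  ultimately show ?thesis using True by (metis mult_zero_left)
next
  case False
  obtain e where e: "t = a * e" using cop_dvd[OF assms] by (auto simp: dvd_def)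
  then have "a * s = a * (b * e)" using assms(2) by (simp add: mult.left_commute)
  with False e show ?thesis by auto
qed

definition coprime_reps :: "'a::comm_ring_1 itself \<Rightarrow> bool" where
  "coprime_reps _ \<longleftrightarrow> (\<forall>a b :: 'a. \<exists>g a' b'. a = g * a' \<and> b = g * b' \<and> cop a' b')"

lemma coprime_repE:
  fixes a b :: "'a::comm_ring_1"
  assumes "coprime_reps TYPE('a)"
  obtains g a' b' where "a = g * a'" "b = g * b'" "cop a' b'"
  using assms unfolding coprime_reps_def by metis

text \<open>A matrix of determinant zero is a column times a row. Reducing the second column to a
  coprime pair makes the first column a multiple of the same pair by \<open>cop_syzygy\<close>; the
  common factor \<open>h\<close> is then split off from the row.\<close>

lemma rank_one_factor:
  fixes m11 m12 m21 m22 :: "'a::idom"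
  assumes "coprime_reps TYPE('a)" "m11 * m22 = m12 * m21" "m22 \<noteq> 0"
  shows "\<exists>a b h c d. cop a b \<and> cop c d \<and> m11 = a * h * c \<and> m12 = a * h * d \<and> m21 = b * h * c \<and> m22 = b * h * d"
proof -
  obtain g a b where g: "m12 = g * a" "m22 = g * b" "cop a b" using coprime_repE[OF assms(1)] by metis
  with assms(3) have "g \<noteq> 0" by auto
  then have "a * m21 = b * m11" using assms(2) g by (simp add: algebra_simps)
  then obtain s where s: "m11 = a * s" "m21 = b * s" using cop_syzygy[OF g(3)] by blast
  obtain h c d where h: "s = h * c" "g = h * d" "cop c d" using coprime_repE[OF assms(1)] by metis
  show ?thesis using g s h by (intro exI[of _ a] exI[of _ b] exI[of _ h] exI[of _ c] exI[of _ d]) (simp add: algebra_simps)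
qed

section \<open>Twisted coefficients\<close>

text \<open>Integer powers of a unit \<open>u\<close> whose inverse \<open>v\<close> is passed
  along, since the coefficient rings are not fields.\<close>

definition pw :: "'a::comm_ring_1 \<Rightarrow> 'a \<Rightarrow> int \<Rightarrow> 'a" where
  "pw u v k = (if k \<ge> 0 then u ^ nat k else v ^ nat (- k))"

lemma pw_simps [simp]: "pw u v 0 = 1" "pw u v 1 = u" "pw u v (- 1) = v"
  by (simp_all add: pw_def)

lemma pw_succ: "u * v = 1 \<Longrightarrow> pw u v (k + 1) = pw u v k * u"
proof (cases "k \<ge> 0")
  case True
  then show ?thesis by (simp add: pw_def nat_add_distrib)
next
  case False
  assume uv: "u * v = 1"
  obtain m where m: "k = - int (Suc m)" using False by (metis int_cases of_nat_0_le_iff)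
  have "v ^ Suc m * u = v ^ m" using uv by (simp add: mult.commute mult.left_commute) (simp add: mult.assoc[symmetric])
  then show ?thesis unfolding m pw_def by (auto simp: nat_add_distrib)
qed

lemma pw_add:
  assumes "u * v = 1"
  shows "pw u v (j + k) = pw u v j * pw u v k"
proof (induction k rule: int_induct[where k = 0])
  case (step1 i)
  then show ?case using pw_succ[OF assms, of "j + i"] pw_succ[OF assms, of i] by (simp add: algebra_simps)
next
  case (step2 i)
  have "pw u v (j + (i - 1)) * u = pw u v j * pw u v (i - 1) * u"
    using step2 pw_succ[OF assms, of "j + i - 1"] pw_succ[OF assms, of "i - 1"] by (simp add: algebra_simps)
  then have "pw u v (j + (i - 1)) * (u * v) = pw u v j * pw u v (i - 1) * (u * v)" by (simp only: mult.assoc[symmetric])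
  with assms show ?case by simp
qed simp

text \<open>The level determines the parities of the two other coordinates. The triple
  \<open>(prx n, pry n, n)\<close> serves as the representative of level \<open>n\<close>, and
  halving the differences to it gives the exponents of x and y.\<close>

definition prx :: "int \<Rightarrow> int" where "prx n = (if n mod 4 \<in> {1, 2} then 1 else 0)"
definition pry :: "int \<Rightarrow> int" where "pry n = (if n mod 4 \<in> {2, 3} then 1 else 0)"

definition lev :: "promislow \<Rightarrow> int" where "lev g = snd (snd (crd g))"

lemma crd_parity: "case crd g of (s, t, n) \<Rightarrow> even (s - prx n) \<and> even (t - pry n)"
proof (induction g rule: promislow_word_induct)
  case (step g s)
  obtain i j n where c: "crd g = (i, j, n)" by (cases "crd g")
  have m: "(n + 1) mod 4 = (n mod 4 + 1) mod 4" "(n - 1) mod 4 = (n mod 4 - 1) mod 4"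
    by (simp_all add: mod_simps)
  show ?case
    using step.hyps step.IH unfolding c crd_add
    by (cases n rule: mod4_cases; auto simp: c prx_def pry_def sgx_def sgy_def sgn_par_mod4 m)
qed (simp add: prx_def pry_def)

text \<open>\<open>\<sigma>\<close> and \<open>\<tau>\<close> are conjugation by a and by b on the
  Laurent ring in \<open>X\<close> and \<open>Y\<close>: a fixes x and inverts y, b fixes y and
  inverts x. Taking \<open>X\<close>, \<open>Y\<close> and their inverses as parameters allows one
  variable to be specialised to -1.\<close>

locale twisted =
  fixes \<sigma> \<tau> :: "'a::idom \<Rightarrow> 'a" and X Xi Y Yi :: 'a
  assumes \<sigma>_add: "\<sigma> (a + b) = \<sigma> a + \<sigma> b" and \<sigma>_mult: "\<sigma> (a * b) = \<sigma> a * \<sigma> b"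
    and \<tau>_add: "\<tau> (a + b) = \<tau> a + \<tau> b" and \<tau>_mult: "\<tau> (a * b) = \<tau> a * \<tau> b"
    and \<sigma>\<sigma> [simp]: "\<sigma> (\<sigma> a) = a" and \<tau>\<tau> [simp]: "\<tau> (\<tau> a) = a" and \<tau>\<sigma>: "\<tau> (\<sigma> a) = \<sigma> (\<tau> a)"
    and \<sigma>X [simp]: "\<sigma> X = X" "\<sigma> Xi = Xi" and \<tau>X [simp]: "\<tau> X = Xi" "\<tau> Xi = X"
    and \<sigma>Y [simp]: "\<sigma> Y = Yi" "\<sigma> Yi = Y" and \<tau>Y [simp]: "\<tau> Y = Y" "\<tau> Yi = Yi"
    and XXi: "X * Xi = 1" and YYi: "Y * Yi = 1"
begin

lemma \<sigma>_0 [simp]: "\<sigma> 0 = 0" using \<sigma>_add[of 0 0] by (metis add_cancel_right_right add_0)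
lemma \<tau>_0 [simp]: "\<tau> 0 = 0" using \<tau>_add[of 0 0] by (metis add_cancel_right_right add_0)
lemma \<sigma>_uminus: "\<sigma> (- a) = - \<sigma> a" using \<sigma>_add[of a "- a"] by (simp add: eq_neg_iff_add_eq_0 add.commute)
lemma \<tau>_uminus: "\<tau> (- a) = - \<tau> a" using \<tau>_add[of a "- a"] by (simp add: eq_neg_iff_add_eq_0 add.commute)
lemma \<sigma>_minus: "\<sigma> (a - b) = \<sigma> a - \<sigma> b" using \<sigma>_add[of a "- b"] by (simp add: \<sigma>_uminus)
lemma \<tau>_minus: "\<tau> (a - b) = \<tau> a - \<tau> b" using \<tau>_add[of a "- b"] by (simp add: \<tau>_uminus)
lemma \<sigma>_eq_0 [simp]: "\<sigma> a = 0 \<longleftrightarrow> a = 0" by (metis \<sigma>\<sigma> \<sigma>_0)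
lemma \<tau>_eq_0 [simp]: "\<tau> a = 0 \<longleftrightarrow> a = 0" by (metis \<tau>\<tau> \<tau>_0)
lemma \<sigma>_1 [simp]: "\<sigma> 1 = 1" by (metis \<sigma>\<sigma> \<sigma>_mult mult.left_neutral mult.right_neutral)
lemma \<tau>_1 [simp]: "\<tau> 1 = 1" by (metis \<tau>\<tau> \<tau>_mult mult.left_neutral mult.right_neutral)

lemmas hom_simps = \<sigma>_add \<sigma>_mult \<sigma>_uminus \<sigma>_minus \<tau>_add \<tau>_mult \<tau>_uminus \<tau>_minus \<tau>\<sigma>

lemma XXi' [simp]: "X * Xi = 1" "Xi * X = 1" "Y * Yi = 1" "Yi * Y = 1"
  "X * (Xi * c) = c" "Xi * (X * c) = c" "Y * (Yi * c) = c" "Yi * (Y * c) = c"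
  using XXi YYi by (simp_all add: mult.assoc[symmetric] mult.commute)

lemma XY_nz [simp]: "X \<noteq> 0" "Xi \<noteq> 0" "Y \<noteq> 0" "Yi \<noteq> 0"
  using XXi YYi by (metis mult_zero_left mult_zero_right zero_neq_one)+

lemma \<sigma>_of_int: "\<sigma> (of_int k) = of_int k"
  by (induction k rule: int_induct[where k = 0]) (simp_all add: \<sigma>_add \<sigma>_minus)
lemma \<tau>_of_int: "\<tau> (of_int k) = of_int k"
  by (induction k rule: int_induct[where k = 0]) (simp_all add: \<tau>_add \<tau>_minus)

definition phi :: "int \<Rightarrow> 'a \<Rightarrow> 'a" where
  "phi n = (if n mod 4 = 0 then id else if n mod 4 = 1 then \<sigma> else if n mod 4 = 2 then \<sigma> \<circ> \<tau> else \<tau>)"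

text \<open>The cocycle of the crossed product: multiplying the representatives of levels
  \<open>n\<close> and \<open>m\<close> gives \<open>mm n m\<close> times the representative of the
  product level. It is a unit monomial and differs from 1 only for odd \<open>n\<close>.\<close>

definition mm :: "int \<Rightarrow> int \<Rightarrow> 'a" where
  "mm n m = (if n mod 4 = 1 then (if prx m = 1 then X else 1) * (if pry m = 1 then Yi else 1)
     else if n mod 4 = 3 then (if prx m = 1 then Xi else 1) * (if pry m = 1 then Y else 1) else 1)"

lemma phi_sum: "phi n (sum f S) = (\<Sum>i\<in>S. phi n (f i))"
proof -
  have "\<sigma> (sum f S) = (\<Sum>i\<in>S. \<sigma> (f i))" "\<tau> (sum f S) = (\<Sum>i\<in>S. \<tau> (f i))" for f
    by (induction S rule: infinite_finite_induct) (simp_all add: \<sigma>_add \<tau>_add)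
  then show ?thesis by (simp add: phi_def)
qed

lemma phi_hom: "phi n (a * b) = phi n a * phi n b" "phi n (of_int k) = of_int k" "phi n 0 = 0" "phi n a = 0 \<longleftrightarrow> a = 0"
  by (simp_all add: phi_def hom_simps \<sigma>_of_int \<tau>_of_int)

lemma phi_lext: "phi n (lext f w) = lext (\<lambda>g. phi n (f g)) w"
  by (simp add: lext_def phi_sum phi_hom)

definition mon :: "promislow \<Rightarrow> 'a" where
  "mon g = (case crd g of (s, t, n) \<Rightarrow> pw X Xi ((s - prx n) div 2) * pw Y Yi ((t - pry n) div 2))"

lemma \<sigma>_power: "\<sigma> (a ^ k) = \<sigma> a ^ k" by (induction k) (simp_all add: \<sigma>_mult)
lemma \<tau>_power: "\<tau> (a ^ k) = \<tau> a ^ k" by (induction k) (simp_all add: \<tau>_mult)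

lemma phi_pw: "phi n (pw X Xi i) = pw X Xi (sgx n * i)" "phi n (pw Y Yi i) = pw Y Yi (sgy n * i)"
  by (cases n rule: mod4_cases; simp add: phi_def pw_def sgx_def sgy_def \<sigma>_power \<tau>_power)+

lemma mon_add: "mon (g + h) = mon g * phi (lev g) (mon h) * mm (lev g) (lev h)"
proof -
  obtain s t n where g: "crd g = (s, t, n)" by (cases "crd g")
  obtain s' t' m where h: "crd h = (s', t', m)" by (cases "crd h")
  have "even (s - prx n)" "even (t - pry n)" "even (s' - prx m)" "even (t' - pry m)"
    using crd_parity[of g] crd_parity[of h] by (simp_all add: g h)
  then obtain i j i' j' where ij: "s - prx n = 2 * i" "t - pry n = 2 * j" "s' - prx m = 2 * i'" "t' - pry m = 2 * j'"
    by (elim evenE) metis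
  \<comment> \<open>The exponents of \<open>X\<close> and \<open>Y\<close> in the cocycle are
    carries: they arise when coordinates 0 or 1 are combined with signs and reduced to 0 or 1
    again.\<close>
  define dx where "dx = (if n mod 4 = 1 then prx m else if n mod 4 = 3 then - prx m else 0)"
  define dy where "dy = (if n mod 4 = 1 then - pry m else if n mod 4 = 3 then pry m else 0)"
  have st: "s = 2 * i + prx n" "t = 2 * j + pry n" "s' = 2 * i' + prx m" "t' = 2 * j' + pry m"
    using ij by simp_all
  have x: "s + sgx n * s' - prx (n + sgn_par n * m) = 2 * (i + sgx n * i' + dx)"
    and y: "t + sgy n * t' - pry (n + sgn_par n * m) = 2 * (j + sgy n * j' + dy)"
    unfolding st dx_def dy_def
    by (cases n rule: mod4_cases; cases m rule: mod4_cases; simp add: sgx_def sgy_def prx_def pry_def mod4_add)+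
  have mm: "mm n m = pw X Xi dx * pw Y Yi dy"
    by (simp add: mm_def dx_def dy_def prx_def pry_def)
  have "mon (g + h) = pw X Xi (i + sgx n * i' + dx) * pw Y Yi (j + sgy n * j' + dy)"
    unfolding mon_def crd_add g h cmul.simps prod.case x y by simp
  moreover have "mon g = pw X Xi i * pw Y Yi j" "mon h = pw X Xi i' * pw Y Yi j'"
    unfolding mon_def g h prod.case ij by simp_all
  ultimately show ?thesis
    by (simp add: lev_def g h mm phi_hom phi_pw pw_add[OF XXi] pw_add[OF YYi] mult_ac)
qed

section \<open>Coefficients by level\<close>

definition cf :: "ZP \<Rightarrow> int \<Rightarrow> 'a" where
  "cf w n = lext (\<lambda>g. if lev g = n then mon g else 0) w"

lemma lev_add: "lev (g + h) = lev g + sgn_par (lev g) * lev h"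
  by (cases "crd g"; cases "crd h") (simp add: lev_def crd_add)

lemma sgn_par_sq: "sgn_par n * (sgn_par n * m) = m"
  by (simp add: sgn_par_def)

text \<open>Given the level \<open>n\<close> of the left factor and the level \<open>k\<close> of
  the product, the right factor has level \<open>sgn_par n * (k - n)\<close>, because the sign is
  its own inverse. Passing level \<open>n\<close> over the right coefficient applies
  \<open>phi n\<close>.\<close>

lemma cf_mult:
  assumes "finite N" "\<And>n. n \<notin> N \<Longrightarrow> cf v n = 0"
  shows "cf (v * w) k = (\<Sum>n\<in>N. cf v n * phi n (cf w (sgn_par n * (k - n))) * mm n (sgn_par n * (k - n)))"
proof -
  let ?m = "\<lambda>n. sgn_par n * (k - n)"
  have lv: "lev g + sgn_par (lev g) * lev h = k \<longleftrightarrow> lev h = ?m (lev g)" for g h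
    by (metis sgn_par_sq add_diff_cancel_left' diff_add_cancel add.commute)
  have "cf (v * w) k = lext (\<lambda>g. lext (\<lambda>h. if lev (g + h) = k then mon (g + h) else 0) w) v"
    by (simp add: cf_def lext_mult)
  also have "\<dots> = lext (\<lambda>g. mon g * (phi (lev g) (cf w (?m (lev g))) * mm (lev g) (?m (lev g)))) v"
  proof -
    have "lext (\<lambda>h. if lev (g + h) = k then mon (g + h) else 0) w = mon g * (phi (lev g) (cf w (?m (lev g))) * mm (lev g) (?m (lev g)))" for g
    proof -
      have "(\<lambda>h. if lev (g + h) = k then mon (g + h) else 0) =
        (\<lambda>h. (mon g * mm (lev g) (?m (lev g))) * phi (lev g) (if lev h = ?m (lev g) then mon h else 0))"
        by (rule ext, simp add: lev_add lv mon_add phi_hom)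
      then show ?thesis by (simp add: lext_scale cf_def phi_lext mult_ac)
    qed
    then show ?thesis by simp
  qed
  also have "\<dots> = (\<Sum>n\<in>N. cf v n * (phi n (cf w (?m n)) * mm n (?m n)))"
    unfolding cf_def[of v] using assms by (intro lext_group) (simp_all add: cf_def)
  finally show ?thesis by (simp add: mult.assoc)
qed

subsection \<open>A multiplicative norm\<close>

text \<open>Coefficients modulo the central-up-to-sign element \<open>(ab)\<^sup>2\<close>, i.e. in a crossed product of the
  Laurent ring with the Klein four-group, which acts on itself by 4 by 4 matrices.\<close>

definition sf :: "ZP \<Rightarrow> int \<Rightarrow> 'a" where
  "sf w r = lext (\<lambda>g. if lev g mod 4 = r mod 4 then mon g else 0) w"

lemma phi_mod: "phi (n mod 4) = phi n"
  by (simp add: phi_def)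

lemma mm_mod: "mm (n mod 4) (m mod 4) = mm n m"
  by (simp add: mm_def prx_def pry_def)

lemma mm_cong: "m mod 4 = m' mod 4 \<Longrightarrow> mm n m = mm n m'"
  by (simp add: mm_def prx_def pry_def)

lemma sgn_par_mod: "sgn_par (n mod 4) = sgn_par n"
  by (simp add: sgn_par_mod4)

lemma sf_mult:
  "sf (v * w) k = (\<Sum>n\<in>{0, 1, 2, 3}. sf v n * (phi n (sf w (sgn_par n * (k - n))) * mm n (sgn_par n * (k - n))))"
proof -
  let ?m = "\<lambda>n. sgn_par n * (k - n)"
  have lv: "lev (g + h) mod 4 = k mod 4 \<longleftrightarrow> lev h mod 4 = ?m (lev g) mod 4" for g h
  proof -
    have "lev (g + h) mod 4 = k mod 4 \<longleftrightarrow> 4 dvd (lev g + sgn_par (lev g) * lev h - k)"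
      by (simp add: lev_add mod_eq_dvd_iff)
    also have "\<dots> \<longleftrightarrow> 4 dvd (lev h - ?m (lev g))"
    proof (cases "even (lev g)")
      case False
      have "lev g - lev h - k = - (lev h - - (k - lev g))" by simp
      then show ?thesis using False by (simp only: sgn_par_def dvd_minus_iff if_False mult_minus1 add_uminus_conv_diff)
    qed (simp add: sgn_par_def algebra_simps)
    finally show ?thesis by (simp add: mod_eq_dvd_iff)
  qed
  have "sf (v * w) k = lext (\<lambda>g. lext (\<lambda>h. if lev (g + h) mod 4 = k mod 4 then mon (g + h) else 0) w) v"
    by (simp add: sf_def lext_mult)
  also have "\<dots> = lext (\<lambda>g. mon g * (phi (lev g) (sf w (?m (lev g))) * mm (lev g) (?m (lev g)))) v"
  proof -
    have "lext (\<lambda>h. if lev (g + h) mod 4 = k mod 4 then mon (g + h) else 0) w =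
       mon g * (phi (lev g) (sf w (?m (lev g))) * mm (lev g) (?m (lev g)))" for g
    proof -
      have "(\<lambda>h. if lev (g + h) mod 4 = k mod 4 then mon (g + h) else 0) =
        (\<lambda>h. (mon g * mm (lev g) (?m (lev g))) * phi (lev g) (if lev h mod 4 = ?m (lev g) mod 4 then mon h else 0))"
        proof (rule ext)
          fix h
          show "(if lev (g + h) mod 4 = k mod 4 then mon (g + h) else 0) =
            (mon g * mm (lev g) (?m (lev g))) * phi (lev g) (if lev h mod 4 = ?m (lev g) mod 4 then mon h else 0)"
          proof (cases "lev h mod 4 = ?m (lev g) mod 4")
            case True
            then show ?thesis using mm_cong[OF True, of "lev g"] by (simp add: lv mon_add mult_ac)
          qed (simp add: lv phi_hom)
        qed
      then show ?thesis by (simp add: lext_scale sf_def phi_lext mult_ac)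
    qed
    then show ?thesis by simp
  qed
  \<comment> \<open>Every ingredient depends on the level of \<open>g\<close> only mod 4, so the
    outer sum can be grouped into four classes.\<close>
  also have "\<dots> = lext (\<lambda>g. mon g * (phi (lev g mod 4) (sf w (?m (lev g mod 4))) * mm (lev g mod 4) (?m (lev g mod 4)))) v"
  proof -
    have c: "?m (n mod 4) mod 4 = ?m n mod 4" for n
      unfolding sgn_par_mod by (metis mod_diff_right_eq mod_mult_right_eq)
    have "phi (n mod 4) (sf w (?m (n mod 4))) * mm (n mod 4) (?m (n mod 4)) = phi n (sf w (?m n)) * mm n (?m n)" for n
    proof -
      have "mm (n mod 4) (?m (n mod 4)) = mm n (?m n)"
        unfolding mm_mod[of "n mod 4" "?m (n mod 4)", symmetric] c mod_mod_trivial by (rule mm_mod)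
      then show ?thesis by (simp add: phi_mod sf_def c)
    qed
    then show ?thesis by simp
  qed
  also have "\<dots> = (\<Sum>n\<in>{0, 1, 2, 3}. lext (\<lambda>g. if lev g mod 4 = n then mon g else 0) v * (phi n (sf w (?m n)) * mm n (?m n)))"
  proof (rule lext_group)
    fix n :: int assume n: "n \<notin> {0, 1, 2, 3}"
    have "lev g mod 4 \<noteq> n" for g using n by (metis mod4_cases insertCI)
    then show "lext (\<lambda>g. if lev g mod 4 = n then mon g else 0) v = 0" by (simp add: lext_eq_0)
  qed simp
  finally show ?thesis by (simp add: sf_def)
qed

lemma sf_eq_sum_cf:
  assumes "finite N" "\<And>n. n \<notin> N \<Longrightarrow> cf w n = 0"
  shows "sf w r = (\<Sum>n\<in>N. if n mod 4 = r mod 4 then cf w n else 0)"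
proof -
  have "sf w r = lext (\<lambda>g. mon g * (if lev g mod 4 = r mod 4 then 1 else 0)) w"
    unfolding sf_def by (intro arg_cong[where f = "\<lambda>f. lext f w"]) auto
  also have "\<dots> = (\<Sum>n\<in>N. cf w n * (if n mod 4 = r mod 4 then 1 else 0))"
    unfolding cf_def using assms by (intro lext_group) (simp_all add: cf_def)
  finally show ?thesis by (simp add: if_distrib cong: if_cong)
qed

text \<open>Row by row, the coefficients obtained when the representatives of levels 0, 1, 2, 3 are
  multiplied from the left to the element with coefficients \<open>s\<close>. The coefficient row of
  a product \<open>v * w\<close> is then the row of \<open>v\<close> times the matrix of
  \<open>w\<close>, which is why \<open>rmat\<close> is multiplicative.\<close>

definition rmat :: "(int \<Rightarrow> 'a) \<Rightarrow> 'a^4^4" where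
  "rmat s = vector [vector [s 0, s 1, s 2, s 3],
     vector [\<sigma> (s 1) * X, \<sigma> (s 0), \<sigma> (s 3) * Yi, \<sigma> (s 2) * X * Yi],
     vector [\<sigma> (\<tau> (s 2)), \<sigma> (\<tau> (s 3)), \<sigma> (\<tau> (s 0)), \<sigma> (\<tau> (s 1))],
     vector [\<tau> (s 3) * Y, \<tau> (s 2) * Xi * Y, \<tau> (s 1) * Xi, \<tau> (s 0)]]"

lemma vector_4 [simp]:
  "(vector [x, y, z, w] :: 'b::zero^4) $ 1 = x" "(vector [x, y, z, w] :: 'b::zero^4) $ 2 = y"
  "(vector [x, y, z, w] :: 'b::zero^4) $ 3 = z" "(vector [x, y, z, w] :: 'b::zero^4) $ 4 = w"
  by (simp_all add: vector_def)

lemma sf_neg: "sf u (- 1) = sf u 3" "sf u (- 2) = sf u 2" "sf u (- 3) = sf u 1"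
  by (simp_all add: sf_def)

lemma sf_mult_explicit:
  "sf (v * w) 0 = sf v 0 * sf w 0 + sf v 1 * \<sigma> (sf w 1) * X + sf v 2 * \<sigma> (\<tau> (sf w 2)) + sf v 3 * \<tau> (sf w 3) * Y"
  "sf (v * w) 1 = sf v 0 * sf w 1 + sf v 1 * \<sigma> (sf w 0) + sf v 2 * \<sigma> (\<tau> (sf w 3)) + sf v 3 * \<tau> (sf w 2) * Xi * Y"
  "sf (v * w) 2 = sf v 0 * sf w 2 + sf v 1 * \<sigma> (sf w 3) * Yi + sf v 2 * \<sigma> (\<tau> (sf w 0)) + sf v 3 * \<tau> (sf w 1) * Xi"
  "sf (v * w) 3 = sf v 0 * sf w 3 + sf v 1 * \<sigma> (sf w 2) * X * Yi + sf v 2 * \<sigma> (\<tau> (sf w 1)) + sf v 3 * \<tau> (sf w 0)"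
  by (simp_all only: sf_mult) (simp_all add: sgn_par_def sf_neg phi_def mm_def prx_def pry_def mult.assoc add.assoc)

lemma rmat_mult: "rmat (sf (v * w)) = rmat (sf v) ** rmat (sf w)"
  unfolding vec_eq_iff forall_4 matrix_matrix_mult_def
  by (simp only: sum_4 rmat_def vector_4 sf_mult_explicit vec_lambda_beta hom_simps \<sigma>\<sigma> \<tau>\<tau> \<sigma>X \<sigma>Y \<tau>X \<tau>Y)
    (intro conjI; simp add: distrib_left distrib_right mult_ac; simp add: add_ac mult_ac)

definition nrm :: "ZP \<Rightarrow> 'a" where "nrm w = det (rmat (sf w))"

lemma nrm_mult: "nrm (v * w) = nrm v * nrm w"
  by (simp add: nrm_def rmat_mult det_mul)

end


text \<open>The two patterns come from the subgroups of order two used below: coefficients at levels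
  0 and 1 pair the indices 1, 2 and 3, 4; coefficients at levels 0 and 3 pair 1, 4 and 2, 3.\<close>

lemma det_4_blocks:
  fixes A :: "'b::comm_ring_1^4^4"
  shows "A$1$3 = 0 \<Longrightarrow> A$1$4 = 0 \<Longrightarrow> A$2$3 = 0 \<Longrightarrow> A$2$4 = 0 \<Longrightarrow> A$3$1 = 0 \<Longrightarrow> A$3$2 = 0 \<Longrightarrow> A$4$1 = 0 \<Longrightarrow> A$4$2 = 0 \<Longrightarrow>
      det A = (A$1$1 * A$2$2 - A$1$2 * A$2$1) * (A$3$3 * A$4$4 - A$3$4 * A$4$3)" (is "PROP ?P")
    and "A$1$2 = 0 \<Longrightarrow> A$1$3 = 0 \<Longrightarrow> A$2$1 = 0 \<Longrightarrow> A$2$4 = 0 \<Longrightarrow> A$3$1 = 0 \<Longrightarrow> A$3$4 = 0 \<Longrightarrow> A$4$2 = 0 \<Longrightarrow> A$4$3 = 0 \<Longrightarrow>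
      det A = (A$1$1 * A$4$4 - A$1$4 * A$4$1) * (A$2$2 * A$3$3 - A$2$3 * A$3$2)" (is "PROP ?Q")
proof -
  have f1: "finite {2::4, 3, 4}" "1 \<notin> {2::4, 3, 4}" by auto
  have f2: "finite {3::4, 4}" "2 \<notin> {3::4, 4}" by auto
  have f3: "finite {4::4}" "3 \<notin> {4::4}" by auto
  note d = det_def[of A, unfolded UNIV_4 sum_over_permutations_insert[OF f1] sum_over_permutations_insert[OF f2]
    sum_over_permutations_insert[OF f3] permutes_sing]
  have ident: "p * (q * (r * s)) - p * (q * (t * u)) + (v * (w * (t * u)) - v * (w * (r * s))) = (p * q - v * w) * (r * s - t * u)"
    for p q r s t u v w :: 'b by (simp add: algebra_simps)
  have ident': "p * (q * (r * s)) - p * (t * (u * s)) + (v * (t * (u * w)) - v * (q * (r * w))) = (p * s - v * w) * (q * r - t * u)"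
    for p q r s t u v w :: 'b by (simp add: algebra_simps)
  show "PROP ?P" unfolding d
    apply (simp add: sign_swap_id permutation_swap_id permutation_compose sign_compose sign_id swap_id_eq)
    by (rule ident)
  show "PROP ?Q" unfolding d
    apply (simp add: sign_swap_id permutation_swap_id permutation_compose sign_compose sign_id swap_id_eq)
    by (rule ident')
qed


context twisted
begin

lemma nrm_K1:
  assumes "sf w 2 = 0" "sf w 3 = 0"
  shows "nrm w = (sf w 0 * \<sigma> (sf w 0) - X * sf w 1 * \<sigma> (sf w 1)) * \<tau> (sf w 0 * \<sigma> (sf w 0) - X * sf w 1 * \<sigma> (sf w 1))"
proof -
  have "nrm w = (sf w 0 * \<sigma> (sf w 0) - sf w 1 * (\<sigma> (sf w 1) * X)) *
      (\<sigma> (\<tau> (sf w 0)) * \<tau> (sf w 0) - \<sigma> (\<tau> (sf w 1)) * (\<tau> (sf w 1) * Xi))"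
    unfolding nrm_def by (subst det_4_blocks(1)) (simp_all only: rmat_def vector_4 assms \<sigma>_0 \<tau>_0 mult_zero_left)
  then show ?thesis by (simp only: hom_simps \<tau>X mult_ac)
qed

lemma nrm_K2:
  assumes "sf w 1 = 0" "sf w 2 = 0"
  shows "nrm w = (sf w 0 * \<tau> (sf w 0) - Y * sf w 3 * \<tau> (sf w 3)) * \<sigma> (sf w 0 * \<tau> (sf w 0) - Y * sf w 3 * \<tau> (sf w 3))"
proof -
  have "nrm w = (sf w 0 * \<tau> (sf w 0) - sf w 3 * (\<tau> (sf w 3) * Y)) *
      (\<sigma> (sf w 0) * \<sigma> (\<tau> (sf w 0)) - \<sigma> (sf w 3) * Yi * \<sigma> (\<tau> (sf w 3)))"
    unfolding nrm_def by (subst det_4_blocks(2)) (simp_all only: rmat_def vector_4 assms \<sigma>_0 \<tau>_0 mult_zero_left)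
  then show ?thesis by (simp only: hom_simps \<sigma>Y mult_ac)
qed

lemma finite_cf: "finite {n. cf w n \<noteq> 0}"
proof (rule finite_subset)
  show "{n. cf w n \<noteq> 0} \<subseteq> lev ` Poly_Mapping.keys w"
  proof
    fix n assume "n \<in> {n. cf w n \<noteq> 0}"
    then have "lext (\<lambda>g. if lev g = n then mon g else 0) w \<noteq> 0" by (simp add: cf_def)
    then obtain g where "g \<in> Poly_Mapping.keys w" "(if lev g = n then mon g else 0) \<noteq> 0"
      using lext_eq_0[of w "\<lambda>g. if lev g = n then mon g else 0"] by blast
    then show "n \<in> lev ` Poly_Mapping.keys w" by (auto split: if_splits)
  qed
qed simp

lemma cf_add: "cf (v + w) n = cf v n + cf w n" and cf_minus: "cf (v - w) n = cf v n - cf w n"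
  and cf_uminus: "cf (- w) n = - cf w n" and cf_zero [simp]: "cf 0 n = 0"
  by (simp_all add: cf_def lext_add lext_minus lext_uminus)

lemma mon_gens [simp]: "mon 0 = 1" "mon pa = 1" "mon pb = 1"
  by (simp_all add: mon_def prx_def pry_def)

lemma lev_gens [simp]: "lev 0 = 0" "lev pa = 1" "lev pb = - 1"
  by (simp_all add: lev_def)

lemma lext_one: "lext f 1 = f 0"
  by (simp add: lext_def)

lemma cf_one: "cf 1 n = (if n = 0 then 1 else 0)"
  by (simp add: cf_def lext_one)

lemma nrm_one: "nrm 1 = 1"
proof -
  have "sf 1 n = (if n mod 4 = 0 then 1 else 0)" for n
    by (simp add: sf_def lext_one)
  then show ?thesis using nrm_K1[of 1] by simp
qed

lemma nrm_unit: "u * v = 1 \<Longrightarrow> nrm u dvd 1"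
  using nrm_mult[of u v] nrm_one by (metis dvd_triv_left)

end

section \<open>Factorisation of short units\<close>

text \<open>\<open>lift\<close> realises each coefficient by a group ring element at level 0. The
  auxiliary factors of the structure theorem can so be built inside \<open>ZP\<close>, where
  associativity of the product is available.\<close>

locale twisted_ring = twisted +
  assumes reps: "coprime_reps TYPE('a)"
    and lift: "\<exists>w. cf w = (\<lambda>n. if n = 0 then \<alpha> else 0)"
begin

text \<open>Some lift is chosen. On the lines lifts are far from unique, so equalities between such
  elements are stated through \<open>cf\<close>, which determines products and norms.\<close>

definition ell :: "'a \<Rightarrow> ZP" where "ell \<alpha> = (SOME w. cf w = (\<lambda>n. if n = 0 then \<alpha> else 0))"

lemma cf_ell: "cf (ell \<alpha>) n = (if n = 0 then \<alpha> else 0)"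
  unfolding ell_def using fun_cong[OF someI_ex[OF lift[of \<alpha>]], of n] .

definition K1 :: "'a \<Rightarrow> 'a \<Rightarrow> ZP" where "K1 \<alpha> \<beta> = ell \<alpha> + ell \<beta> * Poly_Mapping.single pa 1"
definition K2 :: "'a \<Rightarrow> 'a \<Rightarrow> ZP" where "K2 \<alpha> \<beta> = ell \<alpha> + ell \<beta> * Poly_Mapping.single pb 1"

lemma cf_single: "cf (Poly_Mapping.single g 1) n = (if lev g = n then mon g else 0)"
  by (simp add: cf_def)

lemma cf_ell_mult: "cf (ell \<alpha> * w) k = \<alpha> * cf w k"
  by (subst cf_mult[where N = "{0}"]) (auto simp: cf_ell phi_def mm_def)

lemma cf_K1: "cf (K1 \<alpha> \<beta>) n = (if n = 0 then \<alpha> else if n = 1 then \<beta> else 0)"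
  by (simp add: K1_def cf_add cf_ell cf_ell_mult cf_single)

lemma cf_K2: "cf (K2 \<alpha> \<beta>) n = (if n = 0 then \<alpha> else if n = - 1 then \<beta> else 0)"
  by (simp add: K2_def cf_add cf_ell cf_ell_mult cf_single)

lemma K1_mult: "cf (K1 \<alpha> \<beta> * w) k = \<alpha> * cf w k + \<beta> * \<sigma> (cf w (1 - k)) * mm 1 (1 - k)"
  by (subst cf_mult[where N = "{0, 1}"]) (auto simp: cf_K1 phi_def mm_def sgn_par_def)

lemma K2_mult: "cf (K2 \<alpha> \<beta> * w) k = \<alpha> * cf w k + \<beta> * \<tau> (cf w (- 1 - k)) * mm 3 (- 1 - k)"
proof -
  have m: "mm (- 1) m = mm 3 m" "mm 0 m = 1" for m by (simp_all add: mm_def)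
  have c: "- k - 1 = - 1 - k" by simp
  show ?thesis
    by (subst cf_mult[where N = "{0, - 1}"]) (auto simp: cf_K2 phi_def m sgn_par_def c)
qed

lemma mult_K2: "cf (w * K2 \<alpha> \<beta>) k = cf w k * phi k \<alpha> +
   (if even k then cf w (k - 1) * phi (k - 1) \<beta> * mm (k - 1) 3 else cf w (k + 1) * phi (k + 1) \<beta>)"
proof -
  define k' where "k' = (if even k then k - 1 else k + 1)"
  let ?N = "{n. cf w n \<noteq> 0} \<union> {k, k'}"
  have "cf (w * K2 \<alpha> \<beta>) k = (\<Sum>n\<in>?N. cf w n * phi n (cf (K2 \<alpha> \<beta>) (sgn_par n * (k - n))) * mm n (sgn_par n * (k - n)))"
    by (rule cf_mult) (use finite_cf[of w] in auto)
  also have "\<dots> = (\<Sum>n\<in>{k, k'}. cf w n * phi n (cf (K2 \<alpha> \<beta>) (sgn_par n * (k - n))) * mm n (sgn_par n * (k - n)))"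
  proof (rule sum.mono_neutral_right)
    show "\<forall>n\<in>?N - {k, k'}. cf w n * phi n (cf (K2 \<alpha> \<beta>) (sgn_par n * (k - n))) * mm n (sgn_par n * (k - n)) = 0"
    proof
      fix n assume n: "n \<in> ?N - {k, k'}"
      then have "sgn_par n * (k - n) \<noteq> 0" by (simp add: sgn_par_def)
      moreover have "sgn_par n * (k - n) \<noteq> - 1"
      proof
        assume a: "sgn_par n * (k - n) = - 1"
        then have "even n \<and> k = n - 1 \<or> odd n \<and> k = n + 1" by (auto simp: sgn_par_def split: if_splits)
        then show False using n by (auto simp: k'_def split: if_splits)
      qed
      ultimately show "cf w n * phi n (cf (K2 \<alpha> \<beta>) (sgn_par n * (k - n))) * mm n (sgn_par n * (k - n)) = 0"
        by (simp add: cf_K2 phi_hom)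
    qed
  qed (use finite_cf[of w] in auto)
  also have "\<dots> = cf w k * phi k \<alpha> + cf w k' * phi k' \<beta> * mm k' (- 1)"
  proof -
    have 1: "sgn_par k' * (k - k') = - 1" "k \<noteq> k'" by (auto simp: k'_def sgn_par_def)
    have 2: "mm k 0 = 1" by (simp add: mm_def prx_def pry_def)
    have 3: "cf (K2 \<alpha> \<beta>) (- 1) = \<beta>" "cf (K2 \<alpha> \<beta>) 0 = \<alpha>" by (simp_all add: cf_K2)
    show ?thesis using 1(2) by (simp add: 1(1) 2 3)
  qed
  also have "mm k' (- 1) = mm k' 3" by (rule mm_cong) simp
  also have "mm k' 3 = (if even k then mm (k - 1) 3 else 1)"
  proof (cases "even k")
    case False
    then have "even (k + 1)" by simp
    then have "(k + 1) mod 4 \<noteq> 1" "(k + 1) mod 4 \<noteq> 3" by presburger+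
    with False show ?thesis by (simp add: k'_def mm_def)
  qed (simp add: k'_def)
  finally show ?thesis by (simp add: k'_def)
qed

lemma cf_nz_extremes:
  assumes "cf v \<noteq> (\<lambda>_. 0)"
  obtains lo hi where "lo \<le> hi" "cf v lo \<noteq> 0" "cf v hi \<noteq> 0" "\<And>n. n < lo \<Longrightarrow> cf v n = 0" "\<And>n. n > hi \<Longrightarrow> cf v n = 0"
proof -
  let ?S = "{n. cf v n \<noteq> 0}"
  have ne: "?S \<noteq> {}" using assms by auto
  have "Min ?S \<in> ?S" "Max ?S \<in> ?S" by (rule Min_in Max_in; use finite_cf[of v] ne in blast)+
  moreover have "\<And>n. n \<in> ?S \<Longrightarrow> Min ?S \<le> n \<and> n \<le> Max ?S" using finite_cf[of v] by auto
  ultimately show ?thesis by (intro that[of "Min ?S" "Max ?S"]) force+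
qed

lemma cf_mult_explicit:
  assumes "\<And>n. n < - 4 \<Longrightarrow> cf u n = 0" "\<And>n. n > 4 \<Longrightarrow> cf u n = 0"
  shows "cf (u * v) k =
     cf u (- 4) * cf v (k + 4) + cf u (- 3) * \<sigma> (cf v (- 3 - k)) * mm 1 (- 3 - k) + cf u (- 2) * \<sigma> (\<tau> (cf v (k + 2)))
   + cf u (- 1) * \<tau> (cf v (- 1 - k)) * mm 3 (- 1 - k) + cf u 0 * cf v k + cf u 1 * \<sigma> (cf v (1 - k)) * mm 1 (1 - k)
   + cf u 2 * \<sigma> (\<tau> (cf v (k - 2))) + cf u 3 * \<tau> (cf v (3 - k)) * mm 3 (3 - k) + cf u 4 * cf v (k - 4)"
proof -
  have z: "cf u n = 0" if "n \<notin> {- 4, - 3, - 2, - 1, 0, 1, 2, 3, 4}" for n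
  proof -
    have "n < - 4 \<or> n > 4" using that by auto
    then show ?thesis using assms by blast
  qed
  define t where "t = (\<lambda>n. cf u n * phi n (cf v (sgn_par n * (k - n))) * mm n (sgn_par n * (k - n)))"
  have e: "sgn_par (- 4) * (k - - 4) = k + 4" "sgn_par (- 3) * (k - - 3) = - 3 - k" "sgn_par (- 2) * (k - - 2) = k + 2"
    "sgn_par (- 1) * (k - - 1) = - 1 - k" "sgn_par 0 * (k - 0) = k" "sgn_par 1 * (k - 1) = 1 - k" "sgn_par 2 * (k - 2) = k - 2"
    "sgn_par 3 * (k - 3) = 3 - k" "sgn_par 4 * (k - 4) = k - 4"
    by (simp_all add: sgn_par_def)
  have m: "mm (- 3) = mm 1" "mm (- 1) = mm 3" "mm (- 4) m = 1" "mm 4 m = 1" "mm 0 m = 1" "mm 2 m = 1" "mm (- 2) m = 1" for m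
    by (auto simp add: mm_def fun_eq_iff)
  have "t (- 4) = cf u (- 4) * cf v (k + 4)" "t (- 3) = cf u (- 3) * \<sigma> (cf v (- 3 - k)) * mm 1 (- 3 - k)"
    "t (- 2) = cf u (- 2) * \<sigma> (\<tau> (cf v (k + 2)))" "t (- 1) = cf u (- 1) * \<tau> (cf v (- 1 - k)) * mm 3 (- 1 - k)"
    "t 0 = cf u 0 * cf v k" "t 1 = cf u 1 * \<sigma> (cf v (1 - k)) * mm 1 (1 - k)" "t 2 = cf u 2 * \<sigma> (\<tau> (cf v (k - 2)))"
    "t 3 = cf u 3 * \<tau> (cf v (3 - k)) * mm 3 (3 - k)" "t 4 = cf u 4 * cf v (k - 4)"
    unfolding t_def e m by (simp_all add: phi_def)
  moreover have "cf (u * v) k = (\<Sum>n\<in>{- 4, - 3, - 2, - 1, 0, 1, 2, 3, 4}. t n)"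
    unfolding t_def by (rule cf_mult) (use z in auto)
  ultimately show ?thesis by (simp add: add.assoc)
qed

section \<open>Relations between the extremal coefficients of a unit\<close>

lemma mm_top: "mm 3 lo * \<sigma> (mm 1 hi) = Y" if "lo = - 1 - hi"
proof -
  have "lo mod 4 = (- 1 - hi mod 4) mod 4" unfolding that by (simp add: mod_simps)
  then show ?thesis
    by (cases hi rule: mod4_cases) (simp_all add: mm_def prx_def pry_def \<sigma>_mult)
qed

lemma mm_mid: "mm 3 hi * \<tau> (mm 1 lo) = Xi" if "hi = 1 - lo"
proof -
  have "hi mod 4 = (1 - lo mod 4) mod 4" unfolding that by (simp add: mod_simps)
  then show ?thesis
    by (cases lo rule: mod4_cases) (simp_all add: mm_def prx_def pry_def \<tau>_mult)
qed

text \<open>Let \<open>v\<close> live on levels \<open>lo\<close> to \<open>hi\<close>. The top of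
  the product is \<open>4 + hi\<close> from even levels of \<open>u\<close> or \<open>3 - lo\<close>
  from odd ones, the bottom \<open>lo - 2\<close> or \<open>- 3 - hi\<close>. If
  \<open>lo + hi = - 1\<close> the candidates coincide at both ends, and eliminating the unknown
  ends of \<open>v\<close> from two equations gives the relation. Otherwise single terms survive at
  the ends: the one with \<open>cf u 4\<close> is impossible, the ones with
  \<open>cf u (- 2)\<close> and \<open>cf u 3\<close> make both sides zero.\<close>

lemma top_relation:
  assumes uv: "cf (u * v) = (\<lambda>n. if n = 0 then 1 else 0)"
    and u: "\<And>n. n < - 3 \<Longrightarrow> cf u n = 0" "\<And>n. n > 4 \<Longrightarrow> cf u n = 0" and T: "cf u 4 \<noteq> 0"
  shows "cf u 4 * \<sigma> (cf u (- 2)) = Y * cf u 3 * \<sigma> (cf u (- 3))"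
proof -
  let ?u = "cf u" and ?v = "cf v"
  have P: "(if k = 0 then 1 else 0) = ?u (- 3) * \<sigma> (?v (- 3 - k)) * mm 1 (- 3 - k) + ?u (- 2) * \<sigma> (\<tau> (?v (k + 2)))
   + ?u (- 1) * \<tau> (?v (- 1 - k)) * mm 3 (- 1 - k) + ?u 0 * ?v k + ?u 1 * \<sigma> (?v (1 - k)) * mm 1 (1 - k)
   + ?u 2 * \<sigma> (\<tau> (?v (k - 2))) + ?u 3 * \<tau> (?v (3 - k)) * mm 3 (3 - k) + ?u 4 * ?v (k - 4)" for k
    using cf_mult_explicit[of u v k] u uv by simp
  have "?v \<noteq> (\<lambda>_. 0)" using P[of 0] by auto
  then obtain lo hi where lh: "lo \<le> hi" "?v lo \<noteq> 0" "?v hi \<noteq> 0"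
    and z1: "\<And>n. n < lo \<Longrightarrow> ?v n = 0" and z2: "\<And>n. n > hi \<Longrightarrow> ?v n = 0"
    by (rule cf_nz_extremes) blast
  consider "lo + hi > - 1" | "lo + hi < - 1" | "lo = - 1 - hi" by linarith
  then show ?thesis
  proof cases
    case 1
    have "(if 4 + hi = 0 then 1 else 0) = ?u 4 * ?v hi"
      using P[of "4 + hi"] 1 by (simp add: z1 z2)
    with T lh have "hi = - 4" by (metis mult_eq_0_iff add.commute add_eq_0_iff)
    with 1 lh show ?thesis by linarith
  next
    case 2
    have "(if lo - 2 = 0 then 1 else 0) = ?u (- 2) * \<sigma> (\<tau> (?v lo))"
      using P[of "lo - 2"] 2 by (simp add: z1 z2)
    then have D: "?u (- 2) = 0" using 2 lh by (auto split: if_splits)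
    have "(if 3 - lo = 0 then 1 else 0) = ?u 3 * \<tau> (?v lo) * mm 3 lo"
      using P[of "3 - lo"] 2 D by (simp add: z1 z2)
    moreover have "mm 3 lo \<noteq> 0" by (simp add: mm_def)
    ultimately have "?u 3 = 0" using 2 lh by (auto split: if_splits)
    with D show ?thesis by simp
  next
    case 3
    \<comment> \<open>Neither end lies at level 0: \<open>4 + hi = 0\<close> or
      \<open>lo = 2\<close> would contradict \<open>lo \<le> hi\<close>.\<close>
    have E1: "?u 4 * ?v hi + ?u 3 * \<tau> (?v lo) * mm 3 lo = 0"
      using P[of "4 + hi"] 3 lh by (simp add: z1 z2 add.commute split: if_splits)
    have E2: "?u (- 2) * \<sigma> (\<tau> (?v lo)) + ?u (- 3) * \<sigma> (?v hi) * mm 1 hi = 0"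
      using P[of "lo - 2"] 3 lh by (simp add: z1 z2 add.commute split: if_splits)
    have E3: "\<sigma> (?u (- 2)) * \<tau> (?v lo) + \<sigma> (?u (- 3)) * ?v hi * \<sigma> (mm 1 hi) = 0"
      using arg_cong[OF E2, of \<sigma>] by (simp add: hom_simps)
    have "(?u 4 * \<sigma> (?u (- 2))) * \<tau> (?v lo) = (mm 3 lo * \<sigma> (mm 1 hi) * ?u 3 * \<sigma> (?u (- 3))) * \<tau> (?v lo)"
    proof -
      have a: "?u 4 * ?v hi = - (?u 3 * \<tau> (?v lo) * mm 3 lo)" using E1 by (simp add: eq_neg_iff_add_eq_0)
      have b: "\<sigma> (?u (- 2)) * \<tau> (?v lo) = - (\<sigma> (?u (- 3)) * ?v hi * \<sigma> (mm 1 hi))" using E3 by (simp add: eq_neg_iff_add_eq_0)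
      have "(?u 4 * \<sigma> (?u (- 2))) * \<tau> (?v lo) = - (\<sigma> (?u (- 3)) * \<sigma> (mm 1 hi) * (?u 4 * ?v hi))"
        unfolding mult.assoc b by (simp add: mult_ac)
      then show ?thesis unfolding a by (simp add: mult_ac)
    qed
    then show ?thesis using lh by (simp add: mm_top[OF 3])
  qed
qed

text \<open>The same comparison on levels -2 to 2. The term with \<open>cf w (- 2)\<close> at the
  bottom forces \<open>lo + hi \<ge> 1\<close>, which leaves the term with \<open>cf w 2\<close>
  alone at the top, so it vanishes; a second comparison on levels -2 to 1 gives the relation. The
  product is an element \<open>K\<close> of level 0 rather than 1 because \<open>w\<close> will be a
  unit multiplied by elements that need not be units.\<close>

lemma middle_relation:
  assumes uv: "cf (w * v) = (\<lambda>n. if n = 0 then K else 0)" "K \<noteq> 0"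
    and u: "\<And>n. n < - 2 \<Longrightarrow> cf w n = 0" "\<And>n. n > 2 \<Longrightarrow> cf w n = 0" and T: "cf w (- 2) \<noteq> 0"
  shows "cf w 2 = 0" "cf w (- 2) * \<tau> (cf w 0) = Xi * cf w (- 1) * \<tau> (cf w 1)"
proof -
  let ?u = "cf w" and ?v = "cf v"
  have P: "(if k = 0 then K else 0) = ?u (- 2) * \<sigma> (\<tau> (?v (k + 2)))
   + ?u (- 1) * \<tau> (?v (- 1 - k)) * mm 3 (- 1 - k) + ?u 0 * ?v k + ?u 1 * \<sigma> (?v (1 - k)) * mm 1 (1 - k)
   + ?u 2 * \<sigma> (\<tau> (?v (k - 2)))" for k
    using cf_mult_explicit[of w v k] u uv by simp
  have "?v \<noteq> (\<lambda>_. 0)" using P[of 0] uv(2) by auto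
  then obtain lo hi where lh: "lo \<le> hi" "?v lo \<noteq> 0" "?v hi \<noteq> 0"
    and z1: "\<And>n. n < lo \<Longrightarrow> ?v n = 0" and z2: "\<And>n. n > hi \<Longrightarrow> ?v n = 0"
    by (rule cf_nz_extremes) blast
  have nz: "mm a b \<noteq> 0" for a b by (simp add: mm_def)
  have ge: "lo + hi \<ge> 1"
  proof (rule ccontr)
    assume a: "\<not> lo + hi \<ge> 1"
    have "(if lo - 2 = 0 then K else 0) = ?u (- 2) * \<sigma> (\<tau> (?v lo))"
      using P[of "lo - 2"] a lh by (simp add: z1 z2)
    then show False using T a lh by (auto split: if_splits)
  qed
  have "(if 2 + hi = 0 then K else 0) = ?u 2 * \<sigma> (\<tau> (?v hi))"
    using P[of "2 + hi"] ge lh by (simp add: z1 z2)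
  then show W2: "?u 2 = 0" using ge lh by (auto split: if_splits)
  show "?u (- 2) * \<tau> (?u 0) = Xi * ?u (- 1) * \<tau> (?u 1)"
  proof (cases "lo + hi = 1")
    case True
    then have hi: "hi = 1 - lo" by simp
    have E1: "?u 0 * ?v hi + ?u 1 * \<sigma> (?v lo) * mm 1 lo = 0"
      using P[of hi] True lh W2 by (simp add: z1 z2 hi split: if_splits)
    have E2: "?u (- 2) * \<sigma> (\<tau> (?v lo)) + ?u (- 1) * \<tau> (?v hi) * mm 3 hi = 0"
      using P[of "lo - 2"] True lh by (simp add: z1 z2 hi split: if_splits)
    have E3: "\<tau> (?u 0) * \<tau> (?v hi) + \<tau> (?u 1) * \<sigma> (\<tau> (?v lo)) * \<tau> (mm 1 lo) = 0"
      using arg_cong[OF E1, of \<tau>] by (simp add: hom_simps)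
    have "(?u (- 2) * \<tau> (?u 0)) * \<tau> (?v hi) = (mm 3 hi * \<tau> (mm 1 lo) * ?u (- 1) * \<tau> (?u 1)) * \<tau> (?v hi)"
    proof -
      have a: "\<tau> (?u 0) * \<tau> (?v hi) = - (\<tau> (?u 1) * \<sigma> (\<tau> (?v lo)) * \<tau> (mm 1 lo))" using E3 by (simp add: eq_neg_iff_add_eq_0)
      have b: "?u (- 2) * \<sigma> (\<tau> (?v lo)) = - (?u (- 1) * \<tau> (?v hi) * mm 3 hi)" using E2 by (simp add: eq_neg_iff_add_eq_0)
      have "(?u (- 2) * \<tau> (?u 0)) * \<tau> (?v hi) = - (\<tau> (?u 1) * \<tau> (mm 1 lo) * (?u (- 2) * \<sigma> (\<tau> (?v lo))))"
        unfolding mult.assoc a by (simp add: mult_ac)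
      then show ?thesis unfolding b by (simp add: mult_ac)
    qed
    then show ?thesis using lh by (simp add: mm_mid[OF hi])
  next
    case False
    with ge have g2: "lo + hi \<ge> 2" by simp
    have "(if hi = 0 then K else 0) = ?u 0 * ?v hi"
      using P[of hi] g2 lh W2 by (simp add: z1 z2)
    then have W0: "?u 0 = 0" using g2 lh by (auto split: if_splits)
    have "(if - 1 - hi = 0 then K else 0) = ?u (- 1) * \<tau> (?v hi) * mm 3 hi"
      using P[of "- 1 - hi"] g2 lh W2 by (simp add: z1 z2)
    then have "?u (- 1) = 0" using g2 lh nz by (auto split: if_splits)
    with W0 show ?thesis by simp
  qed
qed

lemma cf_mult_supp:
  "cf (v * w) k = (\<Sum>n\<in>{n. cf v n \<noteq> 0}. cf v n * phi n (cf w (sgn_par n * (k - n))) * mm n (sgn_par n * (k - n)))"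
  by (rule cf_mult) (use finite_cf in auto)

lemma cf_mult_cong_right: "cf v = cf v' \<Longrightarrow> cf (w * v) = cf (w * v')"
  by (rule ext) (simp add: cf_mult_supp)

lemma cf_mult_cong_left: "cf w = cf w' \<Longrightarrow> cf (w * v) = cf (w' * v)"
  by (rule ext) (simp add: cf_mult_supp)

lemma mult_ell: "cf (w * ell \<alpha>) n = cf w n * phi n \<alpha>"
proof -
  have "cf (w * K2 \<alpha> 0) n = cf w n * phi n \<alpha>" by (simp add: mult_K2 phi_hom)
  moreover have "cf (K2 \<alpha> 0) = cf (ell \<alpha>)" by (auto simp: cf_K2 cf_ell)
  ultimately show ?thesis using cf_mult_cong_right by metis
qed

lemma sf_supp: "sf w r = (\<Sum>n\<in>{n. cf w n \<noteq> 0}. if n mod 4 = r mod 4 then cf w n else 0)"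
  by (rule sf_eq_sum_cf) (use finite_cf in auto)

lemma nrm_cong: "cf w = cf w' \<Longrightarrow> nrm w = nrm w'"
  by (simp only: nrm_def sf_supp[abs_def])

text \<open>The quadratic norm of \<open>\<alpha> + \<beta> a\<close>: multiplying
  \<open>K1 \<alpha> \<beta>\<close> by its conjugate
  \<open>K1 (\<sigma> \<alpha>) (- \<beta>)\<close> leaves just this value at level 0.
  \<open>N2\<close> is the analogue for b.\<close>

definition N1 :: "'a \<Rightarrow> 'a \<Rightarrow> 'a" where "N1 \<alpha> \<beta> = \<alpha> * \<sigma> \<alpha> - X * \<beta> * \<sigma> \<beta>"
definition N2 :: "'a \<Rightarrow> 'a \<Rightarrow> 'a" where "N2 \<alpha> \<beta> = \<alpha> * \<tau> \<alpha> - Y * \<beta> * \<tau> \<beta>"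

lemma nrm_K1_eq: "nrm (K1 \<alpha> \<beta>) = N1 \<alpha> \<beta> * \<tau> (N1 \<alpha> \<beta>)"
proof -
  have "sf (K1 \<alpha> \<beta>) r = (if 0 = r mod 4 then \<alpha> else 0) + (if 1 = r mod 4 then \<beta> else 0)" for r
    by (subst sf_eq_sum_cf[where N = "{0, 1}"]) (auto simp: cf_K1)
  then show ?thesis by (simp add: nrm_K1 N1_def)
qed

lemma nrm_K2_eq: "nrm (K2 \<alpha> \<beta>) = N2 \<alpha> \<beta> * \<sigma> (N2 \<alpha> \<beta>)"
proof -
  have "sf (K2 \<alpha> \<beta>) r = (if 0 = r mod 4 then \<alpha> else 0) + (if 3 = r mod 4 then \<beta> else 0)" for r
    by (subst sf_eq_sum_cf[where N = "{0, - 1}"]) (auto simp: cf_K2)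
  then show ?thesis by (simp add: nrm_K2 N2_def)
qed

lemma \<sigma>_N1 [simp]: "\<sigma> (N1 \<alpha> \<beta>) = N1 \<alpha> \<beta>"
  by (simp add: N1_def hom_simps mult_ac)

lemma \<tau>_N2 [simp]: "\<tau> (N2 \<alpha> \<beta>) = N2 \<alpha> \<beta>"
  by (simp add: N2_def \<tau>_minus \<tau>_mult mult_ac)

lemma cop_\<sigma>: "cop a b \<Longrightarrow> cop (\<sigma> a) (\<sigma> b)"
  unfolding cop_def
proof (intro allI impI, elim conjE)
  fix d h assume c: "\<forall>d h. d dvd a * h \<and> d dvd b * h \<longrightarrow> d dvd h" and 1: "d dvd \<sigma> a * h" "d dvd \<sigma> b * h"
  have s: "\<sigma> x dvd \<sigma> y" if "x dvd y" for x y using that by (auto simp: dvd_def \<sigma>_mult)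
  have "\<sigma> d dvd a * \<sigma> h" "\<sigma> d dvd b * \<sigma> h" using s[OF 1(1)] s[OF 1(2)] by (simp_all add: \<sigma>_mult)
  with c have "\<sigma> d dvd \<sigma> h" by blast
  from s[OF this] show "d dvd h" by simp
qed

lemma cop_\<tau>: "cop a b \<Longrightarrow> cop (\<tau> a) (\<tau> b)"
  unfolding cop_def
proof (intro allI impI, elim conjE)
  fix d h assume c: "\<forall>d h. d dvd a * h \<and> d dvd b * h \<longrightarrow> d dvd h" and 1: "d dvd \<tau> a * h" "d dvd \<tau> b * h"
  have s: "\<tau> x dvd \<tau> y" if "x dvd y" for x y using that by (auto simp: dvd_def \<tau>_mult)
  have "\<tau> d dvd a * \<tau> h" "\<tau> d dvd b * \<tau> h" using s[OF 1(1)] s[OF 1(2)] by (simp_all add: \<tau>_mult)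
  with c have "\<tau> d dvd \<tau> h" by blast
  from s[OF this] show "d dvd h" by simp
qed

end

text \<open>Anisotropy guarantees that the norms to be cancelled below are nonzero: the entry
  \<open>\<beta>\<close> will always be a factor of a nonzero extremal coefficient.\<close>

locale anisotropic_ring = twisted_ring +
  assumes aniso1: "N1 \<alpha> \<beta> = 0 \<Longrightarrow> \<beta> = 0" and aniso2: "N2 \<alpha> \<beta> = 0 \<Longrightarrow> \<beta> = 0"
begin

lemma mm_vals: "mm 1 2 = X * Yi" "mm 1 (- 1) = Yi" "mm 1 3 = Yi" "mm 1 (- 2) = X * Yi" "mm 1 0 = 1" "mm 1 1 = X" "mm 3 3 = Y" "mm (- 3) 3 = Yi"
   "mm 3 (- 1) = Y" "mm 3 0 = 1" "mm 3 1 = Xi" "mm (- 1) 3 = Y"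
  by (simp_all add: mm_def prx_def pry_def)

lemma phi_vals: "phi 0 = id" "phi 1 = \<sigma>" "phi 2 = \<sigma> \<circ> \<tau>" "phi 3 = \<tau>" "phi 4 = id" "phi (- 1) = \<tau>" "phi (- 2) = \<sigma> \<circ> \<tau>" "phi (- 3) = \<sigma>"
  by (simp_all add: phi_def)

text \<open>By \<open>top_relation\<close> the four extremal coefficients form a matrix of rank one.
  Its column and its row define elements \<open>g1\<close> and \<open>g4\<close> whose conjugates
  shorten \<open>u\<close> from both sides to \<open>w = g1' * u * g4'\<close> on levels -2 to 1,
  and \<open>w\<close> splits as a product \<open>F * G\<close> of two elements with two terms each.
  Taking norms gives an equation in which the interior of \<open>u\<close> appears only through
  \<open>nrm u\<close>, \<open>r\<close> and \<open>e\<close>.\<close>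

theorem short_unit_structure:
  assumes uv: "u * v = 1" and supp: "\<And>n. n < - 3 \<Longrightarrow> cf u n = 0" "\<And>n. n > 4 \<Longrightarrow> cf u n = 0" and T: "cf u 4 \<noteq> 0"
  obtains \<alpha>1 \<beta>1 \<alpha>4 \<beta>4 d h r e where
    "cop \<alpha>1 (\<sigma> \<beta>1)" "cop \<alpha>4 \<beta>4"
    "cf u (- 2) = \<alpha>1 * (d * h) * \<sigma> (\<tau> \<alpha>4)" "cf u (- 3) = \<alpha>1 * (d * h) * \<sigma> (\<tau> \<beta>4)"
    "cf u 3 = X * Yi * \<beta>1 * \<sigma> (d * h) * \<tau> \<alpha>4" "cf u 4 = X * \<beta>1 * \<sigma> (d * h) * \<tau> \<beta>4"
    "N2 r (N1 \<alpha>1 \<beta>1 * h) * \<sigma> (N2 r (N1 \<alpha>1 \<beta>1 * h)) * (N1 e (\<sigma> (N2 \<alpha>4 \<beta>4) * \<tau> d) * \<tau> (N1 e (\<sigma> (N2 \<alpha>4 \<beta>4) * \<tau> d)))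
       = nrm u * (N1 \<alpha>1 \<beta>1 * \<tau> (N1 \<alpha>1 \<beta>1)) * (N2 \<alpha>4 \<beta>4 * \<sigma> (N2 \<alpha>4 \<beta>4))"
    "\<And>n. \<alpha>1 = 0 \<Longrightarrow> \<alpha>4 = 0 \<Longrightarrow> r = 0 \<Longrightarrow> e = 0 \<Longrightarrow> n \<noteq> 4 \<Longrightarrow> cf u n = 0"
proof -
  let ?t = "cf u"
  have cuv: "cf (u * v) = (\<lambda>n. if n = 0 then 1 else 0)" unfolding uv by (rule ext) (rule cf_one)
  note rel = top_relation[OF cuv supp T]
  \<comment> \<open>The relation, conjugated by \<open>\<sigma>\<close> and scaled by units, is the
    vanishing of the determinant with first row \<open>?t (- 2)\<close>, \<open>?t (- 3)\<close> and
    a second row made from levels 3 and 4.\<close>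
  have "?t (- 2) * (\<sigma> (?t 4) * Xi) = ?t (- 3) * (\<sigma> (?t 3) * Xi * Yi)"
    using arg_cong[OF rel, of "\<lambda>z. \<sigma> z * Xi"] by (simp add: hom_simps mult_ac)
  moreover have "\<sigma> (?t 4) * Xi \<noteq> 0" using T by simp
  ultimately obtain a b h c f where cop: "cop a b" "cop c f"
    and m: "?t (- 2) = a * h * c" "?t (- 3) = a * h * f" "\<sigma> (?t 3) * Xi * Yi = b * h * c" "\<sigma> (?t 4) * Xi = b * h * f"
    using rank_one_factor[OF reps] by metis
  have C: "?t 3 = X * Yi * \<sigma> b * \<sigma> h * \<sigma> c"
  proof -
    have "\<sigma> (?t 3) * Xi * Yi * X * Y = b * h * c * X * Y" unfolding m(3) ..
    then have "\<sigma> (?t 3) = b * h * c * X * Y" by (simp add: mult_ac)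
    from arg_cong[OF this, of \<sigma>] show ?thesis by (simp add: \<sigma>_mult mult_ac)
  qed
  have T': "?t 4 = X * \<sigma> b * \<sigma> h * \<sigma> f"
  proof -
    have "\<sigma> (?t 4) * Xi * X = b * h * f * X" unfolding m(4) ..
    then have "\<sigma> (?t 4) = b * h * f * X" by (simp add: mult_ac)
    from arg_cong[OF this, of \<sigma>] show ?thesis by (simp add: \<sigma>_mult mult_ac)
  qed
  define \<alpha>1 \<beta>1 \<alpha>4 \<beta>4 where ab: "\<alpha>1 = a" "\<beta>1 = \<sigma> b" "\<alpha>4 = \<sigma> (\<tau> c)" "\<beta>4 = \<sigma> (\<tau> f)"
  have cop': "cop \<alpha>1 (\<sigma> \<beta>1)" "cop \<alpha>4 \<beta>4" using cop by (simp_all add: ab cop_\<sigma> cop_\<tau>)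
  have t: "?t (- 2) = \<alpha>1 * h * \<sigma> (\<tau> \<alpha>4)" "?t (- 3) = \<alpha>1 * h * \<sigma> (\<tau> \<beta>4)"
    "?t 3 = X * Yi * \<beta>1 * \<sigma> h * \<tau> \<alpha>4" "?t 4 = X * \<beta>1 * \<sigma> h * \<tau> \<beta>4"
    using m(1,2) C T' by (simp_all add: ab \<tau>\<sigma>)
  have nz: "\<beta>1 \<noteq> 0" "\<beta>4 \<noteq> 0" "h \<noteq> 0" using T unfolding t by auto
  define n1 n4 where n: "n1 = N1 \<alpha>1 \<beta>1" "n4 = N2 \<alpha>4 \<beta>4"
  have nnz: "n1 \<noteq> 0" "n4 \<noteq> 0" using aniso1[of \<alpha>1 \<beta>1] aniso2[of \<alpha>4 \<beta>4] nz by (auto simp: n)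
  have sn: "\<sigma> n1 = n1" "\<tau> n4 = n4" by (simp_all add: n)
  have n': "n1 = \<alpha>1 * \<sigma> \<alpha>1 - X * \<beta>1 * \<sigma> \<beta>1" "n4 = \<alpha>4 * \<tau> \<alpha>4 - Y * \<beta>4 * \<tau> \<beta>4"
    by (simp_all add: n N1_def N2_def)
  \<comment> \<open>Primes denote conjugates, so \<open>g1' * g1\<close> and \<open>g4' * g4\<close>
    have the norms \<open>n1\<close> and \<open>n4\<close> at level 0 and nothing else.\<close>
  define g1 g1' g4 g4' where g: "g1 = K1 \<alpha>1 \<beta>1" "g1' = K1 (\<sigma> \<alpha>1) (- \<beta>1)" "g4 = K2 \<alpha>4 \<beta>4" "g4' = K2 (\<tau> \<alpha>4) (- \<beta>4)"
  define u1 where "u1 = u * g4'"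
  define u2 where "u2 = g1' * u"
  define w where "w = g1' * u1"
  have u1: "cf u1 k = ?t k * phi k (\<tau> \<alpha>4) - (if even k then ?t (k - 1) * phi (k - 1) \<beta>4 * mm (k - 1) 3 else ?t (k + 1) * phi (k + 1) \<beta>4)" for k
  proof -
    have "phi m (- \<beta>4) = - phi m \<beta>4" for m by (simp add: phi_def \<sigma>_uminus \<tau>_uminus)
    then show ?thesis by (simp add: u1_def g mult_K2)
  qed
  have w1: "cf w k = \<sigma> \<alpha>1 * cf u1 k - \<beta>1 * \<sigma> (cf u1 (1 - k)) * mm 1 (1 - k)" for k
    by (simp add: w_def g K1_mult)
  have w2: "cf w k = cf u2 k * phi k (\<tau> \<alpha>4) - (if even k then cf u2 (k - 1) * phi (k - 1) \<beta>4 * mm (k - 1) 3 else cf u2 (k + 1) * phi (k + 1) \<beta>4)" for k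
  proof -
    have "phi m (- \<beta>4) = - phi m \<beta>4" for m by (simp add: phi_def \<sigma>_uminus \<tau>_uminus)
    moreover have "w = u2 * g4'" by (simp add: w_def u1_def u2_def mult.assoc)
    ultimately show ?thesis by (simp add: g mult_K2)
  qed
  \<comment> \<open>The rank one factorisation is made for these cancellations: \<open>g4'\<close>
    removes levels 4 and -3, and \<open>g1'\<close> then removes level 3.\<close>
  have u1_4: "cf u1 4 = 0" by (simp add: u1 phi_vals mm_vals t mult_ac)
  have u1_m3: "cf u1 (- 3) = 0" by (simp add: u1 phi_vals t mult_ac)
  have u1_3: "cf u1 3 = X * Yi * \<beta>1 * \<sigma> h * n4" by (simp add: u1 phi_vals t n' algebra_simps)
  have u1_m2: "cf u1 (- 2) = \<alpha>1 * h * \<sigma> n4" by (simp add: u1 phi_vals mm_vals t n' hom_simps algebra_simps)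
  have u1_z: "cf u1 k = 0" if "k < - 2 \<or> k > 3" for k
  proof (cases "k = 4 \<or> k = - 3")
    case False
    with that have k: "k < - 3 \<or> k > 4" by auto
    then have "?t k = 0" using supp by blast
    moreover have "even k \<Longrightarrow> ?t (k - 1) = 0" "odd k \<Longrightarrow> ?t (k + 1) = 0"
    proof -
      assume "even k"
      then have "k - 1 < - 3 \<or> k - 1 > 4" using k by presburger
      then show "?t (k - 1) = 0" using supp by blast
    next
      assume "odd k"
      then have "k + 1 < - 3 \<or> k + 1 > 4" using k by presburger
      then show "?t (k + 1) = 0" using supp by blast
    qed
    ultimately show ?thesis by (simp add: u1)
  qed (use u1_4 u1_m3 in auto)
  have w_z: "cf w k = 0" if "k < - 2 \<or> k > 2" for k
  proof (cases "k = 3")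
    case True
    then show ?thesis by (simp add: w1 u1_3 u1_m2 mm_vals hom_simps mult_ac)
  next
    case False
    then have "k < - 2 \<or> k > 3" "1 - k < - 2 \<or> 1 - k > 3" using that by auto
    then show ?thesis by (simp add: w1 u1_z)
  qed
  have w_m2: "cf w (- 2) = n1 * h * \<sigma> n4"
    by (simp add: w1 u1_m2 u1_3 mm_vals hom_simps n'(1) algebra_simps)
  define Z where "Z = n4 * \<sigma> n4"
  have phiZ: "phi k Z = Z" for k by (simp add: phi_def Z_def hom_simps sn mult_ac)
  \<comment> \<open>A right inverse of \<open>w\<close> up to the level 0 factor
    \<open>Z * n1\<close>. The extra \<open>\<sigma> n4\<close> completes \<open>n4\<close> to
    \<open>Z\<close>, which is fixed by all conjugations and can be moved past
    \<open>v\<close>.\<close>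
  define v' where "v' = (g4 * ell (\<sigma> n4)) * v * g1"
  have "cf (g4' * (g4 * ell (\<sigma> n4))) = cf (ell Z)"
  proof
    fix k
    have 1: "cf (g4 * ell (\<sigma> n4)) m = (if m = 0 then \<alpha>4 * \<sigma> n4 else if m = - 1 then \<beta>4 * \<sigma> n4 else 0)" for m
      by (simp add: mult_ell g cf_K2 phi_vals sn \<tau>\<sigma>)
    show "cf (g4' * (g4 * ell (\<sigma> n4))) k = cf (ell Z) k"
      unfolding g(4) K2_mult 1 cf_ell
      by (auto simp: hom_simps sn mm_vals Z_def mult_ac) (simp add: n'(2) algebra_simps)
  qed
  then have "cf (g4' * (g4 * ell (\<sigma> n4)) * v) = cf (ell Z * v)" by (rule cf_mult_cong_left)
  also have "\<dots> = cf (v * ell Z)" by (rule ext) (simp add: cf_ell_mult mult_ell phiZ mult.commute)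
  finally have "cf (u * (g4' * (g4 * ell (\<sigma> n4)) * v)) = cf (u * (v * ell Z))" by (rule cf_mult_cong_right)
  also have "u * (v * ell Z) = ell Z" by (simp add: mult.assoc[symmetric] uv)
  finally have "cf (g1' * (u * (g4' * (g4 * ell (\<sigma> n4)) * v)) * g1) = cf (g1' * ell Z * g1)"
    by (intro cf_mult_cong_left cf_mult_cong_right)
  also have "g1' * (u * (g4' * (g4 * ell (\<sigma> n4)) * v)) * g1 = w * v'"
    by (simp add: w_def u1_def v'_def mult.assoc)
  also have "cf (g1' * ell Z * g1) = (\<lambda>k. if k = 0 then Z * n1 else 0)"
  proof
    fix k
    have "\<sigma> Z = Z" using phiZ[of 1] by (simp add: phi_vals)
    then show "cf (g1' * ell Z * g1) k = (if k = 0 then Z * n1 else 0)"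
      unfolding mult.assoc g(2) K1_mult cf_ell_mult g(1) cf_K1
      by (auto simp: hom_simps mm_vals mult_ac) (simp add: n'(1) algebra_simps)
  qed
  finally have wv: "cf (w * v') = (\<lambda>k. if k = 0 then Z * n1 else 0)" .
  have "cf w (- 2) \<noteq> 0" "Z * n1 \<noteq> 0" using nnz nz by (simp_all add: w_m2 Z_def)
  then have w_2: "cf w 2 = 0" and mid: "cf w (- 2) * \<tau> (cf w 0) = Xi * cf w (- 1) * \<tau> (cf w 1)"
    using middle_relation[OF wv] w_z by blast+
  \<comment> \<open>Level 2 of \<open>w\<close> being zero is a syzygy between the coprime
    \<open>\<alpha>1\<close> and \<open>\<sigma> \<beta>1\<close>; solving it shows that
    \<open>n1\<close> divides level -1. The same with \<open>u2\<close> in place of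
    \<open>u1\<close> gives the divisor \<open>\<sigma> n4\<close> of level 1.\<close>
  obtain e0 where e0: "cf w (- 1) = n1 * e0"
  proof -
    have "\<sigma> \<alpha>1 * cf u1 2 = \<beta>1 * \<sigma> (cf u1 (- 1)) * Yi" using w_2 by (simp add: w1 mm_vals)
    from arg_cong[OF this, of "\<lambda>z. \<sigma> z * Yi"]
    have "\<alpha>1 * (\<sigma> (cf u1 2) * Yi) = \<sigma> \<beta>1 * cf u1 (- 1)" by (simp add: hom_simps mult_ac)
    then obtain e0 where e: "cf u1 (- 1) = \<alpha>1 * e0" "\<sigma> (cf u1 2) * Yi = \<sigma> \<beta>1 * e0"
      using cop_syzygy[OF cop'(1)] by blast
    have "cf w (- 1) = \<sigma> \<alpha>1 * cf u1 (- 1) - X * \<beta>1 * (\<sigma> (cf u1 2) * Yi)" by (simp add: w1 mm_vals mult_ac)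
    also have "\<dots> = n1 * e0" unfolding e by (simp add: n'(1) algebra_simps)
    finally show ?thesis by (rule that)
  qed
  obtain r0 where r0: "cf w 1 = \<sigma> n4 * r0"
  proof -
    have "\<sigma> \<alpha>4 * cf u2 2 = \<sigma> \<beta>4 * (cf u2 1 * Yi)" using w_2 by (simp add: w2 phi_vals mm_vals mult_ac)
    then obtain r0 where r: "cf u2 1 * Yi = \<sigma> \<alpha>4 * r0" "cf u2 2 = \<sigma> \<beta>4 * r0"
      using cop_syzygy[OF cop_\<sigma>[OF cop'(2)]] by blast
    have "cf w 1 = Y * (cf u2 1 * Yi) * \<sigma> (\<tau> \<alpha>4) - cf u2 2 * \<sigma> (\<tau> \<beta>4)" by (simp add: w2 phi_vals mult_ac)
    also have "\<dots> = \<sigma> n4 * (Y * r0)" unfolding r by (simp add: n'(2) hom_simps algebra_simps)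
    finally show ?thesis by (rule that)
  qed
  have "n1 * \<sigma> n4 * (h * \<tau> (cf w 0)) = n1 * \<sigma> n4 * (\<tau> r0 * (Xi * e0))"
    using mid unfolding w_m2 e0 r0 by (simp add: hom_simps sn mult_ac)
  then have mid': "h * \<tau> (cf w 0) = \<tau> r0 * (Xi * e0)" using nnz by simp
  \<comment> \<open>The common factor \<open>d\<close> of \<open>h\<close> and
    \<open>\<tau> r0\<close> goes to \<open>G\<close>, the remainder \<open>h'\<close> to
    \<open>F\<close>; coprimality of \<open>h'\<close> and \<open>r\<close> then yields the
    factorisation of level 0.\<close>
  obtain d h' r where split: "h = d * h'" "\<tau> r0 = d * r" "cop h' r" using coprime_repE[OF reps] by metis
  have "d \<noteq> 0" using split nz by auto
  with mid' have "h' * \<tau> (cf w 0) = r * (Xi * e0)" unfolding split by simp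
  then obtain e where e: "Xi * e0 = h' * e" "\<tau> (cf w 0) = r * e" using cop_syzygy[OF split(3)] by blast
  have e0': "e0 = X * h' * e" using arg_cong[OF e(1), of "\<lambda>z. X * z"] by (simp add: mult_ac)
  have w_0: "cf w 0 = \<tau> r * \<tau> e" using arg_cong[OF e(2), of \<tau>] by (simp add: \<tau>_mult)
  have r0': "r0 = \<tau> d * \<tau> r" using arg_cong[OF split(2), of \<tau>] by (simp add: \<tau>_mult)
  define F where "F = K2 (\<tau> r) (X * n1 * h')"
  define G where "G = K1 (\<tau> e) (\<sigma> n4 * \<tau> d)"
  have FG: "cf (F * G) = cf w"
  proof
    fix k
    consider "k = (- 2 :: int)" | "k = - 1" | "k = 0" | "k = 1" | "k = 2" | "k < - 2 \<or> k > 2" by linarith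
    then show "cf (F * G) k = cf w k"
    proof cases
      case 1
      then show ?thesis unfolding F_def G_def K2_mult cf_K1 by (simp add: mm_vals hom_simps sn w_m2 split mult_ac)
    next
      case 2
      then show ?thesis unfolding F_def G_def K2_mult cf_K1 by (simp add: mm_vals e0 e0' mult_ac)
    next
      case 3
      then show ?thesis unfolding F_def G_def K2_mult cf_K1 by (simp add: w_0)
    next
      case 4
      then show ?thesis unfolding F_def G_def K2_mult cf_K1 by (simp add: r0 r0' mult_ac)
    next
      case 5
      then show ?thesis unfolding F_def G_def K2_mult cf_K1 by (simp add: w_2)
    next
      case 6
      then show ?thesis unfolding F_def G_def K2_mult cf_K1 using w_z[of k] by auto
    qed
  qed
  have star: "nrm F * nrm G = nrm g1' * nrm u * nrm g4'"
    using nrm_cong[OF FG] by (simp add: nrm_mult w_def u1_def mult.assoc)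
  have nF: "nrm F = N2 r (n1 * h') * \<sigma> (N2 r (n1 * h'))"
    by (simp add: F_def nrm_K2_eq N2_def hom_simps mult_ac)
  have nG: "nrm G = N1 (\<tau> e) (\<sigma> n4 * \<tau> d) * \<tau> (N1 (\<tau> e) (\<sigma> n4 * \<tau> d))"
    by (simp add: G_def nrm_K1_eq)
  have ng: "nrm g1' = n1 * \<tau> n1" "nrm g4' = n4 * \<sigma> n4"
    by (simp_all add: g nrm_K1_eq nrm_K2_eq n N1_def N2_def hom_simps mult_ac)
  show ?thesis
  proof (rule that[of \<alpha>1 \<beta>1 \<alpha>4 \<beta>4 d h' r "\<tau> e"])
    show "N2 r (N1 \<alpha>1 \<beta>1 * h') * \<sigma> (N2 r (N1 \<alpha>1 \<beta>1 * h')) * (N1 (\<tau> e) (\<sigma> (N2 \<alpha>4 \<beta>4) * \<tau> d) * \<tau> (N1 (\<tau> e) (\<sigma> (N2 \<alpha>4 \<beta>4) * \<tau> d)))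
       = nrm u * (N1 \<alpha>1 \<beta>1 * \<tau> (N1 \<alpha>1 \<beta>1)) * (N2 \<alpha>4 \<beta>4 * \<sigma> (N2 \<alpha>4 \<beta>4))"
      using star unfolding nF nG ng n[symmetric] by (simp add: mult_ac)
  next
    \<comment> \<open>In this case \<open>F\<close>, \<open>G\<close>, \<open>g1'\<close> and
      \<open>g4'\<close> have one term each, so the single level -2 of \<open>w\<close> goes back to
      level 3 of \<open>u1\<close> and to level 4 of \<open>u\<close>.\<close>
    fix k assume z: "\<alpha>1 = 0" "\<alpha>4 = 0" "r = 0" "\<tau> e = 0" and k: "k \<noteq> (4 :: int)"
    have W: "cf w m = 0" if "m \<noteq> - 2" for m
    proof -
      have "cf w m = cf (F * G) m" by (simp add: FG)
      also have "\<dots> = 0" unfolding F_def G_def K2_mult cf_K1 using z that by auto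
      finally show ?thesis .
    qed
    have mnz: "mm i j \<noteq> 0" for i j by (simp add: mm_def)
    have U: "cf u1 m = 0" if "m \<noteq> 3" for m
    proof -
      have "cf w (1 - m) = 0" by (rule W) (use that in auto)
      then show ?thesis using z nz mnz by (simp add: w1)
    qed
    show "?t k = 0"
    proof (cases "even k")
      case True
      have "cf u1 (k - 1) = 0" by (rule U) (use k in auto)
      then show ?thesis using True z nz by (simp add: u1 phi_hom)
    next
      case False
      have "cf u1 (k + 1) = 0" by (rule U) (use False in auto)
      then show ?thesis using False z nz mnz by (simp add: u1 phi_hom)
    qed
  qed (use cop' t in \<open>simp_all add: split\<close>)
qed

end

section \<open>Laurent polynomials\<close>

type_synonym 'r laurent = "int \<Rightarrow>\<^sub>0 'r"
type_synonym L1 = "int laurent"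
type_synonym L2 = "int laurent laurent"

text \<open>One formula for every substitution needed on Laurent polynomials: \<open>h\<close> acts
  on coefficients and \<open>f\<close> on powers of the variable. It is a ring homomorphism once
  \<open>h\<close> is one and \<open>f\<close> turns sums of exponents into products.\<close>

definition glext :: "('a \<Rightarrow> 'b) \<Rightarrow> ('g \<Rightarrow> 'b) \<Rightarrow> ('g \<Rightarrow>\<^sub>0 'a::zero) \<Rightarrow> 'b::comm_ring_1" where
  "glext h f w = (\<Sum>g\<in>Poly_Mapping.keys w. h (Poly_Mapping.lookup w g) * f g)"

locale coeff_hom =
  fixes h :: "'a::comm_ring_1 \<Rightarrow> 'b::comm_ring_1"
  assumes h_add: "h (a + b) = h a + h b" and h_mult: "h (a * b) = h a * h b" and h_1 [simp]: "h 1 = 1"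
begin

lemma h_0 [simp]: "h 0 = 0" using h_add[of 0 0] by (metis add_cancel_right_right add_0)
lemma h_uminus: "h (- a) = - h a" using h_add[of a "- a"] by (simp add: eq_neg_iff_add_eq_0 add.commute)
lemma h_minus: "h (a - b) = h a - h b" using h_add[of a "- b"] by (simp add: h_uminus)
lemma h_dvd: "a dvd b \<Longrightarrow> h a dvd h b" by (auto simp: dvd_def h_mult)

lemma glext_superset:
  assumes "finite S" "Poly_Mapping.keys w \<subseteq> S"
  shows "glext h f w = (\<Sum>g\<in>S. h (Poly_Mapping.lookup w g) * f g)"
  unfolding glext_def using assms by (intro sum.mono_neutral_left) (auto simp: in_keys_iff)

lemma glext_add: "glext h f (v + w) = glext h f v + glext h f w"
proof -
  let ?S = "Poly_Mapping.keys v \<union> Poly_Mapping.keys w"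
  have "Poly_Mapping.keys (v + w) \<subseteq> ?S" by (rule keys_add)
  then have "glext h f (v + w) = (\<Sum>g\<in>?S. h (Poly_Mapping.lookup (v + w) g) * f g)"
    by (intro glext_superset) auto
  also have "\<dots> = (\<Sum>g\<in>?S. h (Poly_Mapping.lookup v g) * f g) + (\<Sum>g\<in>?S. h (Poly_Mapping.lookup w g) * f g)"
    by (simp add: lookup_add h_add sum.distrib[symmetric] distrib_right)
  also have "\<dots> = glext h f v + glext h f w"
    by (subst (1 2) glext_superset[of ?S]) auto
  finally show ?thesis .
qed

lemma glext_single [simp]: "glext h f (Poly_Mapping.single g c) = h c * f g"
  by (simp add: glext_def)

lemma glext_0 [simp]: "glext h f 0 = 0"
  by (simp add: glext_def)

lemma glext_sum: "glext h f (sum F I) = (\<Sum>i\<in>I. glext h f (F i))"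
  by (induction I rule: infinite_finite_induct) (simp_all add: glext_add)

lemma glext_mult:
  assumes "\<And>i j. f (i + j) = f i * f (j :: 'g::monoid_add)"
  shows "glext h f (v * w) = glext h f v * glext h f w"
proof -
  have d: "w = (\<Sum>g\<in>Poly_Mapping.keys w. Poly_Mapping.single g (Poly_Mapping.lookup w g))" for w :: "'g \<Rightarrow>\<^sub>0 'a"
    by (rule poly_mapping_eqI) (simp add: lookup_sum lookup_single when_def in_keys_iff)
  have "v * w = (\<Sum>g\<in>Poly_Mapping.keys v. \<Sum>k\<in>Poly_Mapping.keys w.
      Poly_Mapping.single (g + k) (Poly_Mapping.lookup v g * Poly_Mapping.lookup w k))"
    by (subst d[of v], subst d[of w]) (simp add: sum_product mult_single)
  then have "glext h f (v * w) = (\<Sum>g\<in>Poly_Mapping.keys v. \<Sum>k\<in>Poly_Mapping.keys w.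
      (h (Poly_Mapping.lookup v g) * f g) * (h (Poly_Mapping.lookup w k) * f k))"
    by (simp add: glext_sum h_mult assms mult_ac)
  then show ?thesis by (simp add: glext_def sum_product)
qed

lemma glext_hom:
  assumes "\<And>i j. f (i + j) = f i * f (j :: 'g::comm_monoid_add)" "f 0 = 1"
  shows "coeff_hom (glext h f)"
proof
  show "glext h f 1 = 1" using assms(2) by (simp add: glext_def)
qed (simp_all add: glext_add glext_mult assms)

end

lemma coeff_hom_comp: "coeff_hom f \<Longrightarrow> coeff_hom g \<Longrightarrow> coeff_hom (\<lambda>x. f (g x))"
  by (simp add: coeff_hom_def)

lemma coeff_hom_id: "coeff_hom (\<lambda>x. x)"
  by unfold_locales simp_all

lemma coeff_hom_const: "coeff_hom (Poly_Mapping.single 0 :: 'a::comm_ring_1 \<Rightarrow> 'g::comm_monoid_add \<Rightarrow>\<^sub>0 'a)"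
  by unfold_locales (simp_all add: single_add mult_single)

definition lrev :: "'r::comm_ring_1 laurent \<Rightarrow> 'r laurent" where
  "lrev = glext (Poly_Mapping.single 0) (\<lambda>i. Poly_Mapping.single (- i) 1)"

definition cmap :: "('a \<Rightarrow> 'b) \<Rightarrow> 'a::comm_ring_1 laurent \<Rightarrow> 'b::comm_ring_1 laurent" where
  "cmap h = glext (\<lambda>c. Poly_Mapping.single 0 (h c)) (\<lambda>i. Poly_Mapping.single i 1)"

lemma lrev_hom: "coeff_hom lrev"
  unfolding lrev_def by (rule coeff_hom.glext_hom[OF coeff_hom_const]) (simp_all add: mult_single)

lemma cmap_hom: "coeff_hom h \<Longrightarrow> coeff_hom (cmap h)"
  unfolding cmap_def
  by (rule coeff_hom.glext_hom[OF coeff_hom_comp[OF coeff_hom_const]]) (simp_all add: mult_single)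

lemma lookup_lrev: "Poly_Mapping.lookup (lrev f) i = Poly_Mapping.lookup f (- i)"
proof -
  have "Poly_Mapping.lookup (lrev f) i = (\<Sum>g\<in>Poly_Mapping.keys f. if g = - i then Poly_Mapping.lookup f g else 0)"
    unfolding lrev_def glext_def lookup_sum
    by (intro sum.cong refl) (auto simp: mult_single lookup_single when_def)
  then show ?thesis by (simp add: in_keys_iff)
qed

lemma lookup_cmap:
  assumes "h 0 = 0"
  shows "Poly_Mapping.lookup (cmap h f) i = h (Poly_Mapping.lookup f i)"
proof -
  have "Poly_Mapping.lookup (cmap h f) i = (\<Sum>g\<in>Poly_Mapping.keys f. if g = i then h (Poly_Mapping.lookup f g) else 0)"
    unfolding cmap_def glext_def lookup_sum
    by (intro sum.cong refl) (auto simp: mult_single lookup_single when_def)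
  then show ?thesis using assms by (simp add: in_keys_iff)
qed

lemma lrev_lrev [simp]: "lrev (lrev f) = f"
  by (rule poly_mapping_eqI) (simp add: lookup_lrev)

lemma lrev_single [simp]: "lrev (Poly_Mapping.single i c) = Poly_Mapping.single (- i) c"
  by (rule poly_mapping_eqI) (simp add: lookup_lrev lookup_single when_def)

lemma cmap_single [simp]: "h 0 = 0 \<Longrightarrow> cmap h (Poly_Mapping.single i c) = Poly_Mapping.single i (h c)"
  by (rule poly_mapping_eqI) (simp add: lookup_cmap lookup_single when_def)

lemma lrev_eq_0 [simp]: "lrev f = 0 \<longleftrightarrow> f = 0"
  by (metis lrev_lrev coeff_hom.h_0[OF lrev_hom])

lemma cmap_lrev: "h 0 = 0 \<Longrightarrow> cmap h (lrev f) = lrev (cmap h f)"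
  by (rule poly_mapping_eqI) (simp add: lookup_cmap lookup_lrev)

text \<open>\<open>L2\<close> keeps y as the outer and x as the inner variable. Exchanging them
  makes the lemmas on outer degrees available for x.\<close>

definition lswap :: "L2 \<Rightarrow> L2" where
  "lswap = glext (cmap (Poly_Mapping.single 0)) (\<lambda>j. Poly_Mapping.single 0 (Poly_Mapping.single j 1))"

lemma lswap_hom: "coeff_hom lswap"
  unfolding lswap_def by (rule coeff_hom.glext_hom[OF cmap_hom[OF coeff_hom_const]]) (simp_all add: mult_single)

lemma lookup_lswap: "Poly_Mapping.lookup (Poly_Mapping.lookup (lswap f) i) j = Poly_Mapping.lookup (Poly_Mapping.lookup f j) i"
proof -
  have 1: "Poly_Mapping.lookup (cmap (Poly_Mapping.single 0) c * Poly_Mapping.single 0 d) i = Poly_Mapping.single 0 (Poly_Mapping.lookup c i) * d"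
    for c :: L1 and d :: L1
  proof -
    have "cmap (Poly_Mapping.single 0) c * Poly_Mapping.single 0 d = cmap (\<lambda>z. Poly_Mapping.single 0 z * d) c"
      unfolding cmap_def glext_def sum_distrib_right by (intro sum.cong refl) (simp add: mult_single)
    then show ?thesis by (simp add: lookup_cmap)
  qed
  have "Poly_Mapping.lookup (Poly_Mapping.lookup (lswap f) i) j =
     (\<Sum>g\<in>Poly_Mapping.keys f. if g = j then Poly_Mapping.lookup (Poly_Mapping.lookup f g) i else 0)"
    unfolding lswap_def glext_def lookup_sum 1
    by (intro sum.cong refl) (auto simp: mult_single lookup_single when_def)
  then show ?thesis by (auto simp: in_keys_iff)
qed

lemma lswap_lswap [simp]: "lswap (lswap f) = f"
  by (rule poly_mapping_eqI, rule poly_mapping_eqI) (simp add: lookup_lswap)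

lemma lookup_cmap_lrev: "Poly_Mapping.lookup (cmap lrev f) i = lrev (Poly_Mapping.lookup f i)"
  by (rule lookup_cmap) (rule coeff_hom.h_0[OF lrev_hom])

lemma lswap_lrev: "lswap (lrev f) = cmap lrev (lswap f)"
proof (rule poly_mapping_eqI, rule poly_mapping_eqI)
  fix i j
  show "Poly_Mapping.lookup (Poly_Mapping.lookup (lswap (lrev f)) i) j = Poly_Mapping.lookup (Poly_Mapping.lookup (cmap lrev (lswap f)) i) j"
    by (simp only: lookup_cmap_lrev lookup_lrev lookup_lswap)
qed

lemma lswap_cmap_lrev: "lswap (cmap lrev f) = lrev (lswap f)"
proof (rule poly_mapping_eqI, rule poly_mapping_eqI)
  fix i j
  show "Poly_Mapping.lookup (Poly_Mapping.lookup (lswap (cmap lrev f)) i) j = Poly_Mapping.lookup (Poly_Mapping.lookup (lrev (lswap f)) i) j"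
    by (simp only: lookup_cmap_lrev lookup_lrev lookup_lswap)
qed

lemma lswap_single: "lswap (Poly_Mapping.single j (Poly_Mapping.single i c)) = Poly_Mapping.single i (Poly_Mapping.single j c)"
  by (rule poly_mapping_eqI, rule poly_mapping_eqI) (auto simp: lookup_lswap lookup_single when_def)

lemma lswap_eq_0 [simp]: "lswap f = 0 \<longleftrightarrow> f = 0"
  by (metis lswap_lswap coeff_hom.h_0[OF lswap_hom])

text \<open>Negative powers are evaluated by \<open>s\<close> itself, which is correct for
  \<open>s * s = 1\<close>; the values used are 1 and -1.\<close>

definition ev :: "'r::comm_ring_1 \<Rightarrow> 'r laurent \<Rightarrow> 'r" where
  "ev s = glext (\<lambda>c. c) (pw s s)"

lemma ev_hom: "s * s = 1 \<Longrightarrow> coeff_hom (ev s)"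
  unfolding ev_def by (rule coeff_hom.glext_hom[OF coeff_hom_id]) (simp_all add: pw_add)

lemma pw_one [simp]: "pw 1 1 i = 1"
  by (simp add: pw_def)

lemma pw_neg [simp]: "pw (- 1) (- 1) i = (if even i then 1 else - 1)"
  by (auto simp: pw_def even_nat_iff)

lemma ev_eq_sum:
  assumes "finite S" "\<And>i. i \<notin> S \<Longrightarrow> Poly_Mapping.lookup f i = 0"
  shows "ev s f = (\<Sum>i\<in>S. Poly_Mapping.lookup f i * pw s s i)"
proof -
  have "Poly_Mapping.keys f \<subseteq> S" using assms(2) by (auto simp: in_keys_iff)
  then show ?thesis unfolding ev_def by (rule coeff_hom.glext_superset[OF coeff_hom_id assms(1)])
qed

subsection \<open>Degrees\<close>

definition hi :: "'r::zero laurent \<Rightarrow> int" where "hi f = Max (Poly_Mapping.keys f)"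
definition lo :: "'r::zero laurent \<Rightarrow> int" where "lo f = Min (Poly_Mapping.keys f)"
definition wd :: "'r::zero laurent \<Rightarrow> int" where "wd f = hi f - lo f"

lemma hi_lo:
  assumes "f \<noteq> 0"
  shows "Poly_Mapping.lookup f (hi f) \<noteq> 0" "Poly_Mapping.lookup f (lo f) \<noteq> 0"
    "\<And>i. Poly_Mapping.lookup f i \<noteq> 0 \<Longrightarrow> lo f \<le> i \<and> i \<le> hi f" "lo f \<le> hi f"
proof -
  have k: "finite (Poly_Mapping.keys f)" "Poly_Mapping.keys f \<noteq> {}" using assms by simp_all
  have "hi f \<in> Poly_Mapping.keys f" "lo f \<in> Poly_Mapping.keys f"
    using Max_in[OF k] Min_in[OF k] by (simp_all only: hi_def lo_def)
  then show *: "Poly_Mapping.lookup f (hi f) \<noteq> 0" "Poly_Mapping.lookup f (lo f) \<noteq> 0"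
    by (simp_all only: in_keys_iff not_False_eq_True)
  show **: "lo f \<le> i \<and> i \<le> hi f" if "Poly_Mapping.lookup f i \<noteq> 0" for i
  proof -
    have "i \<in> Poly_Mapping.keys f" using that by (simp only: in_keys_iff not_False_eq_True)
    then show ?thesis using k(1) by (simp add: hi_def lo_def)
  qed
  show "lo f \<le> hi f" using *(1) ** by blast
qed

lemma hi_eqI: "Poly_Mapping.lookup f n \<noteq> 0 \<Longrightarrow> (\<And>i. Poly_Mapping.lookup f i \<noteq> 0 \<Longrightarrow> i \<le> n) \<Longrightarrow> hi f = n"
  unfolding hi_def by (rule Max_eqI) (auto simp: in_keys_iff)

lemma lo_eqI: "Poly_Mapping.lookup f n \<noteq> 0 \<Longrightarrow> (\<And>i. Poly_Mapping.lookup f i \<noteq> 0 \<Longrightarrow> n \<le> i) \<Longrightarrow> lo f = n"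
  unfolding lo_def by (rule Min_eqI) (auto simp: in_keys_iff)

lemma lookup_mult_sum:
  fixes f g :: "'r::comm_ring_1 laurent"
  shows "Poly_Mapping.lookup (f * g) n = (\<Sum>i\<in>Poly_Mapping.keys f. Poly_Mapping.lookup f i * Poly_Mapping.lookup g (n - i))"
proof -
  have d: "f = (\<Sum>i\<in>Poly_Mapping.keys f. Poly_Mapping.single i (Poly_Mapping.lookup f i))"
    by (rule poly_mapping_eqI) (simp add: lookup_sum lookup_single when_def in_keys_iff)
  have s: "Poly_Mapping.lookup (Poly_Mapping.single i c * g) n = c * Poly_Mapping.lookup g (n - i)" for i c
  proof -
    have dg: "g = (\<Sum>j\<in>Poly_Mapping.keys g. Poly_Mapping.single j (Poly_Mapping.lookup g j))"
      by (rule poly_mapping_eqI) (simp add: lookup_sum lookup_single when_def in_keys_iff)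
    have "Poly_Mapping.lookup (Poly_Mapping.single i c * g) n = (\<Sum>j\<in>Poly_Mapping.keys g. if j = n - i then c * Poly_Mapping.lookup g j else 0)"
      by (subst dg, unfold sum_distrib_left lookup_sum, intro sum.cong refl) (auto simp: mult_single lookup_single when_def)
    then show ?thesis by (simp add: in_keys_iff)
  qed
  have "Poly_Mapping.lookup (f * g) n = Poly_Mapping.lookup ((\<Sum>i\<in>Poly_Mapping.keys f. Poly_Mapping.single i (Poly_Mapping.lookup f i)) * g) n"
    by (simp only: d[symmetric])
  then show ?thesis by (simp only: sum_distrib_right lookup_sum s)
qed

lemma lookup_mult_superset:
  fixes f g :: "'r::comm_ring_1 laurent"
  assumes "finite S" "\<And>i. i \<notin> S \<Longrightarrow> Poly_Mapping.lookup f i = 0"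
  shows "Poly_Mapping.lookup (f * g) n = (\<Sum>i\<in>S. Poly_Mapping.lookup f i * Poly_Mapping.lookup g (n - i))"
  unfolding lookup_mult_sum using assms by (intro sum.mono_neutral_left) (auto simp: in_keys_iff)

lemma hi_lo_mult:
  fixes f g :: "'r::idom laurent"
  assumes "f \<noteq> 0" "g \<noteq> 0"
  shows "hi (f * g) = hi f + hi g" "lo (f * g) = lo f + lo g"
    "Poly_Mapping.lookup (f * g) (hi f + hi g) = Poly_Mapping.lookup f (hi f) * Poly_Mapping.lookup g (hi g)"
    "Poly_Mapping.lookup (f * g) (lo f + lo g) = Poly_Mapping.lookup f (lo f) * Poly_Mapping.lookup g (lo g)"
proof -
  have 1: "Poly_Mapping.lookup f i * Poly_Mapping.lookup g (hi f + hi g - i) = 0" if "i \<noteq> hi f" for i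
    using hi_lo(3)[OF assms(1), of i] hi_lo(3)[OF assms(2), of "hi f + hi g - i"] that by fastforce
  show t: "Poly_Mapping.lookup (f * g) (hi f + hi g) = Poly_Mapping.lookup f (hi f) * Poly_Mapping.lookup g (hi g)"
    using lookup_mult_superset[of "Poly_Mapping.keys f \<union> {hi f}" f g "hi f + hi g"] sum.mono_neutral_right[of "Poly_Mapping.keys f \<union> {hi f}" "{hi f}" "\<lambda>i. Poly_Mapping.lookup f i * Poly_Mapping.lookup g (hi f + hi g - i)"] 1
    by (simp add: in_keys_iff)
  have 2: "Poly_Mapping.lookup f i * Poly_Mapping.lookup g (lo f + lo g - i) = 0" if "i \<noteq> lo f" for i
    using hi_lo(3)[OF assms(1), of i] hi_lo(3)[OF assms(2), of "lo f + lo g - i"] that by fastforce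
  show b: "Poly_Mapping.lookup (f * g) (lo f + lo g) = Poly_Mapping.lookup f (lo f) * Poly_Mapping.lookup g (lo g)"
    using lookup_mult_superset[of "Poly_Mapping.keys f \<union> {lo f}" f g "lo f + lo g"] sum.mono_neutral_right[of "Poly_Mapping.keys f \<union> {lo f}" "{lo f}" "\<lambda>i. Poly_Mapping.lookup f i * Poly_Mapping.lookup g (lo f + lo g - i)"] 2
    by (simp add: in_keys_iff)
  have r: "lo f + lo g \<le> i \<and> i \<le> hi f + hi g" if "Poly_Mapping.lookup (f * g) i \<noteq> 0" for i
  proof -
    obtain j where "Poly_Mapping.lookup f j * Poly_Mapping.lookup g (i - j) \<noteq> 0"
      using \<open>Poly_Mapping.lookup (f * g) i \<noteq> 0\<close> unfolding lookup_mult_sum by (meson sum.neutral)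
    then have "Poly_Mapping.lookup f j \<noteq> 0" "Poly_Mapping.lookup g (i - j) \<noteq> 0" by auto
    then show ?thesis using hi_lo(3)[OF assms(1), of j] hi_lo(3)[OF assms(2), of "i - j"] by linarith
  qed
  show "hi (f * g) = hi f + hi g" by (rule hi_eqI) (use t r hi_lo assms in auto)
  show "lo (f * g) = lo f + lo g" by (rule lo_eqI) (use b r hi_lo assms in auto)
qed

lemma wd_mult: "f \<noteq> 0 \<Longrightarrow> g \<noteq> 0 \<Longrightarrow> wd (f * g) = wd f + wd g" for f g :: "'r::idom laurent"
  by (simp add: wd_def hi_lo_mult)

lemma wd_nonneg: "f \<noteq> 0 \<Longrightarrow> wd f \<ge> 0"
  using hi_lo(4) by (simp add: wd_def)

lemma hi_lo_lrev: "f \<noteq> 0 \<Longrightarrow> hi (lrev f) = - lo f" "f \<noteq> 0 \<Longrightarrow> lo (lrev f) = - hi f"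
  by (rule hi_eqI lo_eqI; use hi_lo[of f] in \<open>force simp: lookup_lrev\<close>)+

lemma wd_lrev [simp]: "wd (lrev f) = wd f"
  by (cases "f = 0") (simp_all add: wd_def hi_lo_lrev coeff_hom.h_0[OF lrev_hom])

lemma hi_lo_cmap:
  assumes "\<And>c. h c = 0 \<longleftrightarrow> c = 0"
  shows "hi (cmap h f) = hi f" "lo (cmap h f) = lo f"
proof -
  have "Poly_Mapping.keys (cmap h f) = Poly_Mapping.keys f"
    by (rule set_eqI) (simp only: in_keys_iff lookup_cmap assms)
  then show "hi (cmap h f) = hi f" "lo (cmap h f) = lo f" by (simp_all add: hi_def lo_def)
qed

lemma hi_lo_single [simp]: "c \<noteq> 0 \<Longrightarrow> hi (Poly_Mapping.single i c) = i" "c \<noteq> 0 \<Longrightarrow> lo (Poly_Mapping.single i c) = i"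
  by (simp_all add: hi_def lo_def)

lemma wd_single [simp]: "c \<noteq> 0 \<Longrightarrow> wd (Poly_Mapping.single i c) = 0"
  by (simp add: wd_def)

lemma wd_0_single:
  assumes "f \<noteq> 0" "wd f = 0"
  shows "f = Poly_Mapping.single (lo f) (Poly_Mapping.lookup f (lo f))"
  using hi_lo(3)[OF assms(1)] assms(2)
  by (intro poly_mapping_eqI) (force simp: wd_def lookup_single when_def)

lemma laurent_unit:
  fixes f :: "'r::idom laurent"
  assumes "f dvd 1"
  obtains i c where "f = Poly_Mapping.single i c" "c dvd 1"
proof -
  obtain g where g: "f * g = 1" using assms by (auto simp: dvd_def)
  then have nz: "f \<noteq> 0" "g \<noteq> 0" by auto
  have "wd (1 :: 'r laurent) = 0" by (simp add: wd_def hi_def lo_def)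
  then have w: "wd f + wd g = 0" using wd_mult[OF nz] g by simp
  then have w0: "wd f = 0" "wd g = 0" using wd_nonneg[OF nz(1)] wd_nonneg[OF nz(2)] by linarith+
  note f = wd_0_single[OF nz(1) w0(1)] and g' = wd_0_single[OF nz(2) w0(2)]
  have "Poly_Mapping.single (lo f) (Poly_Mapping.lookup f (lo f)) * Poly_Mapping.single (lo g) (Poly_Mapping.lookup g (lo g)) = 1"
    using g by (simp only: f[symmetric] g'[symmetric])
  then have "Poly_Mapping.lookup (Poly_Mapping.single (lo f + lo g) (Poly_Mapping.lookup f (lo f) * Poly_Mapping.lookup g (lo g))) 0 = 1"
    by (simp only: mult_single lookup_one_zero)
  then have "Poly_Mapping.lookup f (lo f) * Poly_Mapping.lookup g (lo g) = 1"
    by (simp add: lookup_single when_def split: if_splits)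
  then have "Poly_Mapping.lookup f (lo f) dvd 1" by (intro dvdI[of _ _ "Poly_Mapping.lookup g (lo g)"]) simp
  then show ?thesis by (rule that[OF f])
qed

lemma single_unit: "c dvd 1 \<Longrightarrow> Poly_Mapping.single i c dvd (1 :: 'r::comm_ring_1 laurent)"
proof -
  assume "c dvd 1"
  then obtain e where "c * e = 1" by (auto simp: dvd_def)
  then have "Poly_Mapping.single i c * Poly_Mapping.single (- i) e = 1" by (simp add: mult_single)
  then show ?thesis by (metis dvd_triv_left)
qed

subsection \<open>Coprime representatives\<close>

text \<open>Laurent polynomials are polynomials with the variables inverted, and \<open>cov\<close>
  says that a unit from the image of \<open>\<iota>\<close> clears denominators. A gcd of the
  cleared elements works; its cofactors stay coprime because any divisibility can be cleared in the
  same way and the resulting units undone at the end.\<close>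

lemma coprime_reps_transfer:
  fixes \<iota> :: "'p::factorial_ring_gcd \<Rightarrow> 'a::idom"
  assumes mult: "\<And>p q. \<iota> (p * q) = \<iota> p * \<iota> q" and inj: "\<And>p q. \<iota> p = \<iota> q \<Longrightarrow> p = q"
    and cov: "\<And>f. \<exists>m p. \<iota> m dvd 1 \<and> \<iota> m * f = \<iota> p"
  shows "coprime_reps TYPE('a)"
  unfolding coprime_reps_def
proof (intro allI)
  fix a b :: 'a
  obtain m p where m: "\<iota> m dvd 1" "\<iota> m * a = \<iota> p" using cov by blast
  obtain n q where n: "\<iota> n dvd 1" "\<iota> n * b = \<iota> q" using cov by blast
  obtain m' where m': "\<iota> m * m' = 1" using m by (auto simp: dvd_def)
  obtain n' where n': "\<iota> n * n' = 1" using n by (auto simp: dvd_def)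
  show "\<exists>g a' b'. a = g * a' \<and> b = g * b' \<and> cop a' b'"
  proof (cases "p = 0 \<and> q = 0")
    case True
    have z: "\<iota> 0 = 0"
    proof -
      obtain r s where "\<iota> r dvd 1" "\<iota> r * 0 = \<iota> s" using cov by blast
      then have "\<iota> s = 0" by simp
      then have "\<iota> (s * 0) = 0" by (simp add: mult del: mult_zero_right)
      then show ?thesis by simp
    qed
    have "\<iota> m \<noteq> 0" "\<iota> n \<noteq> 0" using m n by auto
    then have "a = 0" "b = 0" using m n True z by auto
    moreover have "cop 1 (0::'a)" by (simp add: cop_def)
    ultimately show ?thesis by (intro exI[of _ 0] exI[of _ 1] exI[of _ 0]) simp
  next
    case False
    then obtain p' q' where pq: "p = p' * gcd p q" "q = q' * gcd p q" "coprime p' q'"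
      using gcd_coprime_exists[of p q] by auto
    have a: "a = \<iota> (gcd p q) * (m' * \<iota> p')"
    proof -
      have "a = m' * (\<iota> m * a)" using m' by (metis mult.assoc mult.commute mult_1)
      then show ?thesis unfolding m(2) by (subst (asm) pq(1)) (simp add: mult mult_ac)
    qed
    have b: "b = \<iota> (gcd p q) * (n' * \<iota> q')"
    proof -
      have "b = n' * (\<iota> n * b)" using n' by (metis mult.assoc mult.commute mult_1)
      then show ?thesis unfolding n(2) by (subst (asm) pq(2)) (simp add: mult mult_ac)
    qed
    have "cop (m' * \<iota> p') (n' * \<iota> q')"
      unfolding cop_def
    proof (intro allI impI, elim conjE)
      fix d h assume d: "d dvd m' * \<iota> p' * h" "d dvd n' * \<iota> q' * h"
      obtain l t where l: "\<iota> l dvd 1" "\<iota> l * h = \<iota> t" using cov by blast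
      obtain k s where k: "\<iota> k dvd 1" "\<iota> k * d = \<iota> s" using cov by blast
      \<comment> \<open>The quotient \<open>e\<close> has denominators of its own, which is where
        the additional unit \<open>c\<close> comes from.\<close>
      have key: "\<exists>c. \<iota> c dvd 1 \<and> s dvd k * c * t * x" if "d dvd y * \<iota> x * h" "\<iota> z * y = 1" for x y z
      proof -
        have "d dvd \<iota> z * (y * \<iota> x * h)" using that(1) by (rule dvd_mult)
        then have "d dvd \<iota> x * h" using that(2) by (metis mult.assoc mult_1)
        then obtain e where e: "\<iota> x * h = d * e" by (auto simp: dvd_def)
        obtain c e' where c: "\<iota> c dvd 1" "\<iota> c * e = \<iota> e'" using cov by blast
        have "\<iota> (k * c * t * x) = (\<iota> k * \<iota> c * \<iota> l) * (\<iota> x * h)" by (simp add: mult l(2)[symmetric] mult_ac)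
        also have "\<dots> = \<iota> l * (\<iota> k * d) * (\<iota> c * e)" unfolding e by (simp add: mult_ac)
        also have "\<dots> = \<iota> (s * (l * e'))" unfolding k c by (simp add: mult mult_ac)
        finally have "k * c * t * x = s * (l * e')" by (rule inj)
        then show ?thesis using c(1) by (metis dvd_triv_left)
      qed
      obtain c1 where c1: "\<iota> c1 dvd 1" "s dvd k * c1 * t * p'" using key[OF d(1) m'] by blast
      obtain c2 where c2: "\<iota> c2 dvd 1" "s dvd k * c2 * t * q'" using key[OF d(2) n'] by blast
      have "s dvd (k * c1 * c2 * t) * p'" "s dvd (k * c1 * c2 * t) * q'"
        using dvd_mult[OF c1(2), of c2] dvd_mult[OF c2(2), of c1] by (simp_all add: mult_ac)
      then have "s dvd gcd ((k * c1 * c2 * t) * p') ((k * c1 * c2 * t) * q')" by (rule gcd_greatest)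
      then have "s dvd k * c1 * c2 * t" using pq(3) by (simp add: gcd_mult_left)
      then obtain x where "k * c1 * c2 * t = s * x" by (auto simp: dvd_def)
      then have "\<iota> (k * c1 * c2 * t) = \<iota> s * \<iota> x" using mult[of s x] by simp
      then have "\<iota> s dvd \<iota> (k * c1 * c2 * t)" by simp
      then have "\<iota> s dvd (\<iota> k * \<iota> c1 * \<iota> c2 * \<iota> l) * h" by (simp add: mult l(2)[symmetric] mult_ac)
      moreover have "d dvd \<iota> s" unfolding k(2)[symmetric] by simp
      ultimately have *: "d dvd (\<iota> k * \<iota> c1 * \<iota> c2 * \<iota> l) * h" by (rule dvd_trans[rotated])
      have "\<iota> k * \<iota> c1 * \<iota> c2 * \<iota> l dvd 1" using mult_dvd_mono[OF mult_dvd_mono[OF mult_dvd_mono[OF k(1) c1(1)] c2(1)] l(1)] by simp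
      then obtain U where U: "1 = (\<iota> k * \<iota> c1 * \<iota> c2 * \<iota> l) * U" by (rule dvdE)
      have "U * ((\<iota> k * \<iota> c1 * \<iota> c2 * \<iota> l) * h) = ((\<iota> k * \<iota> c1 * \<iota> c2 * \<iota> l) * U) * h" by (simp only: mult_ac)
      also have "\<dots> = h" unfolding U[symmetric] by (rule mult_1)
      finally have hU: "U * ((\<iota> k * \<iota> c1 * \<iota> c2 * \<iota> l) * h) = h" .
      show "d dvd h" using dvd_mult[OF *, of U] by (simp only: hU)
    qed
    then show ?thesis using a b by blast
  qed
qed

definition iota :: "('p \<Rightarrow> 'r) \<Rightarrow> 'p::comm_ring_1 poly \<Rightarrow> 'r::comm_ring_1 laurent" where
  "iota h p = (\<Sum>i\<le>degree p. Poly_Mapping.single (int i) (h (coeff p i)))"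

lemma lookup_iota: "h 0 = 0 \<Longrightarrow> Poly_Mapping.lookup (iota h p) k = (if k \<ge> 0 then h (coeff p (nat k)) else 0)"
proof -
  assume h0: "h 0 = 0"
  have "Poly_Mapping.lookup (iota h p) k = (\<Sum>i\<le>degree p. if int i = k then h (coeff p i) else 0)"
    by (simp add: iota_def lookup_sum lookup_single when_def)
  also have "\<dots> = (if k \<ge> 0 then h (coeff p (nat k)) else 0)"
  proof (cases "k \<ge> 0")
    case True
    then have "(\<Sum>i\<le>degree p. if int i = k then h (coeff p i) else 0) = (\<Sum>i\<le>degree p. if i = nat k then h (coeff p i) else 0)"
      by (intro sum.cong refl) auto
    then show ?thesis using True h0 by (simp add: coeff_eq_0)
  qed (auto intro!: sum.neutral)
  finally show ?thesis .
qed

lemma iota_pCons: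
  assumes "coeff_hom h"
  shows "iota h (pCons a p) = Poly_Mapping.single 0 (h a) + Poly_Mapping.single 1 1 * iota h p"
proof (rule poly_mapping_eqI)
  fix k
  have h0: "h 0 = 0" by (rule coeff_hom.h_0[OF assms])
  have "Poly_Mapping.lookup (Poly_Mapping.single 1 1 * iota h p) k = Poly_Mapping.lookup (iota h p) (k - 1)"
    using lookup_mult_superset[of "{1}" "Poly_Mapping.single (1::int) (1::'b)"] by (simp add: lookup_single when_def)
  then show "Poly_Mapping.lookup (iota h (pCons a p)) k = Poly_Mapping.lookup (Poly_Mapping.single 0 (h a) + Poly_Mapping.single 1 1 * iota h p) k"
    by (auto simp: lookup_iota h0 lookup_add lookup_single when_def coeff_pCons nat_diff_distrib split: nat.splits)
qed

lemma iota_hom: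
  assumes "coeff_hom h"
  shows "coeff_hom (iota h)"
proof
  have h0: "h 0 = 0" by (rule coeff_hom.h_0[OF assms])
  show add: "iota h (p + q) = iota h p + iota h q" for p q
    by (rule poly_mapping_eqI) (simp add: lookup_iota h0 lookup_add coeff_hom.h_add[OF assms])
  have i0: "iota h 0 = 0" by (rule poly_mapping_eqI) (simp add: lookup_iota h0)
  have sm: "iota h (smult a q) = Poly_Mapping.single 0 (h a) * iota h q" for a q
    by (induction q) (simp_all add: i0 iota_pCons[OF assms] distrib_left mult_single coeff_hom.h_mult[OF assms] mult.left_commute)
  show "iota h (p * q) = iota h p * iota h q" for p q
    by (induction p) (simp_all add: i0 iota_pCons[OF assms] add sm distrib_right mult.assoc h0)
  show "iota h 1 = 1" using iota_pCons[OF assms, of 1 0] by (simp add: i0 coeff_hom.h_1[OF assms] one_pCons)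
qed

lemma iota_inj:
  assumes "h 0 = 0" "\<And>a b. h a = h b \<Longrightarrow> a = b" "iota h p = iota h q"
  shows "p = q"
proof (rule poly_eqI)
  fix n
  have "h (coeff p n) = h (coeff q n)"
    using arg_cong[OF assms(3), of "\<lambda>f. Poly_Mapping.lookup f (int n)"] by (simp add: lookup_iota assms(1))
  then show "coeff p n = coeff q n" by (rule assms(2))
qed

lemma iota_cover:
  fixes f :: "'r::comm_ring_1 laurent"
  assumes "h 0 = 0" "\<And>i. \<exists>a. Poly_Mapping.lookup f i = h a"
  shows "\<exists>k p. Poly_Mapping.single (int k) 1 * f = iota h p"
proof -
  obtain k :: nat where k: "\<And>i. Poly_Mapping.lookup f i \<noteq> 0 \<Longrightarrow> - int k \<le> i"
  proof (cases "f = 0")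
    case False
    show ?thesis by (rule that[of "nat (- lo f)"]) (use hi_lo(3)[OF False] in force)
  qed (use that in auto)
  obtain c where c: "\<And>i. Poly_Mapping.lookup f i = h (c i)" using assms(2) by metis
  define c' where "c' = (\<lambda>i. if Poly_Mapping.lookup f i = 0 then 0 else c i)"
  have c': "Poly_Mapping.lookup f i = h (c' i)" for i by (simp add: c'_def c assms(1))
  define N where "N = nat (hi f + int k)"
  have N: "c' (int n - int k) = 0" if "n > N" for n
  proof (rule ccontr)
    assume "c' (int n - int k) \<noteq> 0"
    then have "Poly_Mapping.lookup f (int n - int k) \<noteq> 0" by (auto simp: c'_def split: if_splits)
    moreover from this have "f \<noteq> 0" by auto
    moreover have "hi f + int k \<le> int N" by (simp add: N_def)
    ultimately show False using hi_lo(3)[of f "int n - int k"] that by linarith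
  qed
  define p where "p = Abs_poly (\<lambda>n. c' (int n - int k))"
  have cp: "coeff p n = c' (int n - int k)" for n
    unfolding p_def by (subst coeff_Abs_poly[of N]) (use N in auto)
  have "Poly_Mapping.single (int k) 1 * f = iota h p"
  proof (rule poly_mapping_eqI)
    fix i
    have "Poly_Mapping.lookup (Poly_Mapping.single (int k) 1 * f) i = Poly_Mapping.lookup f (i - int k)"
      using lookup_mult_superset[of "{int k}" "Poly_Mapping.single (int k) (1::'r)"] by (simp add: lookup_single when_def)
    also have "\<dots> = Poly_Mapping.lookup (iota h p) i"
      using k[of "i - int k"] by (auto simp: lookup_iota assms(1) cp c'[symmetric])
    finally show "Poly_Mapping.lookup (Poly_Mapping.single (int k) 1 * f) i = Poly_Mapping.lookup (iota h p) i" .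
  qed
  then show ?thesis by blast
qed

lemma iota_monom:
  assumes "coeff_hom h"
  shows "iota h (monom c k) = Poly_Mapping.single (int k) (h c)"
  by (rule poly_mapping_eqI) (auto simp: lookup_iota coeff_hom.h_0[OF assms] lookup_single when_def)

lemma coprime_reps_L1: "coprime_reps TYPE(L1)"
proof (rule coprime_reps_transfer[of "iota (\<lambda>c::int. c)"])
  show "iota (\<lambda>c::int. c) (p * q) = iota (\<lambda>c. c) p * iota (\<lambda>c. c) q" for p q
    by (rule coeff_hom.h_mult[OF iota_hom[OF coeff_hom_id]])
  show "iota (\<lambda>c::int. c) p = iota (\<lambda>c. c) q \<Longrightarrow> p = q" for p q
    by (rule iota_inj[of "\<lambda>c::int. c"]) auto
  fix f :: L1
  obtain k p where "Poly_Mapping.single (int k) 1 * f = iota (\<lambda>c. c) p" using iota_cover[of "\<lambda>c::int. c" f] by auto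
  then show "\<exists>m p. iota (\<lambda>c::int. c) m dvd 1 \<and> iota (\<lambda>c. c) m * f = iota (\<lambda>c. c) p"
    using iota_monom[OF coeff_hom_id, of "1::int" k] by (metis single_unit dvd_refl)
qed

lemma coprime_reps_L2: "coprime_reps TYPE(L2)"
proof -
  let ?i1 = "iota (\<lambda>c::int. c)"
  let ?i2 = "iota ?i1"
  have h1: "coeff_hom ?i1" by (rule iota_hom[OF coeff_hom_id])
  have h2: "coeff_hom ?i2" by (rule iota_hom[OF h1])
  have inj1: "p = q" if "?i1 p = ?i1 q" for p q by (rule iota_inj[of "\<lambda>c::int. c"]) (use that in auto)
  show ?thesis
  proof (rule coprime_reps_transfer[of ?i2])
    show "?i2 (p * q) = ?i2 p * ?i2 q" for p q by (rule coeff_hom.h_mult[OF h2])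
    show "?i2 p = ?i2 q \<Longrightarrow> p = q" for p q
      by (rule iota_inj[of ?i1]) (use inj1 coeff_hom.h_0[OF h1] in auto)
    fix f :: L2
    have "\<exists>k p. Poly_Mapping.single (int k) 1 * Poly_Mapping.lookup f i = ?i1 p" for i
      using iota_cover[of "\<lambda>c::int. c" "Poly_Mapping.lookup f i"] by auto
    then obtain k p where kp: "\<And>i. Poly_Mapping.single (int (k i)) 1 * Poly_Mapping.lookup f i = ?i1 (p i)" by metis
    \<comment> \<open>A single power of the inner variable has to clear all coefficients; the sum of
      the individual exponents bounds each of them.\<close>
    define K where "K = (\<Sum>i\<in>Poly_Mapping.keys f. k i)"
    have K: "k i \<le> K" if "i \<in> Poly_Mapping.keys f" for i
      unfolding K_def by (rule member_le_sum) (use that in auto)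
    define f' where "f' = Poly_Mapping.single 0 (Poly_Mapping.single (int K) 1) * f"
    have lf: "Poly_Mapping.lookup f' i = Poly_Mapping.single (int K) 1 * Poly_Mapping.lookup f i" for i
      using lookup_mult_superset[of "{0}" "Poly_Mapping.single 0 (Poly_Mapping.single (int K) 1)" f i]
      by (simp add: f'_def lookup_single when_def)
    have "\<exists>a. Poly_Mapping.lookup f' i = ?i1 a" for i
    proof (cases "i \<in> Poly_Mapping.keys f")
      case True
      have "Poly_Mapping.lookup f' i = Poly_Mapping.single (int (K - k i)) 1 * (Poly_Mapping.single (int (k i)) 1 * Poly_Mapping.lookup f i)"
        unfolding lf mult.assoc[symmetric] using K[OF True] by (simp add: mult_single of_nat_diff)
      also have "\<dots> = ?i1 (monom 1 (K - k i) * p i)"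
        unfolding kp coeff_hom.h_mult[OF h1] iota_monom[OF coeff_hom_id] ..
      finally show ?thesis by blast
    next
      case False
      then have "Poly_Mapping.lookup f' i = ?i1 0" using coeff_hom.h_0[OF h1] by (simp add: lf in_keys_iff)
      then show ?thesis by blast
    qed
    then obtain l q where l: "Poly_Mapping.single (int l) 1 * f' = ?i2 q"
      using iota_cover[of ?i1 f'] coeff_hom.h_0[OF h1] by auto
    have m: "?i2 (monom (monom 1 K) l) = Poly_Mapping.single (int l) (Poly_Mapping.single (int K) 1)"
      unfolding iota_monom[OF h1] iota_monom[OF coeff_hom_id] ..
    then have "?i2 (monom (monom 1 K) l) * f = ?i2 q"
      using l by (simp add: f'_def mult.assoc[symmetric] mult_single)
    moreover have "?i2 (monom (monom 1 K) l) dvd 1" unfolding m by (intro single_unit) simp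
    ultimately show "\<exists>m p. ?i2 m dvd 1 \<and> ?i2 m * f = ?i2 p" by blast
  qed
qed

subsection \<open>The three coefficient rings\<close>

lemma lrev_add: "lrev (f + g) = lrev f + lrev g" and lrev_mult: "lrev (f * g) = lrev f * lrev g"
  and lrev_0 [simp]: "lrev 0 = 0" and lrev_1 [simp]: "lrev 1 = 1"
  by (rule coeff_hom.h_add[OF lrev_hom] coeff_hom.h_mult[OF lrev_hom] coeff_hom.h_0[OF lrev_hom] coeff_hom.h_1[OF lrev_hom])+

definition xrev :: "L2 \<Rightarrow> L2" where "xrev = cmap lrev"

lemma xrev_hom: "coeff_hom xrev"
  unfolding xrev_def by (rule cmap_hom[OF lrev_hom])

lemma lookup_xrev: "Poly_Mapping.lookup (xrev f) i = lrev (Poly_Mapping.lookup f i)"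
  by (simp add: xrev_def lookup_cmap_lrev)

lemma xrev_xrev: "xrev (xrev f) = f"
  by (rule poly_mapping_eqI) (simp add: lookup_xrev)

lemma xrev_lrev: "xrev (lrev f) = lrev (xrev f)"
  by (simp add: xrev_def cmap_lrev)

lemma xrev_single: "xrev (Poly_Mapping.single i c) = Poly_Mapping.single i (lrev c)"
  by (simp add: xrev_def)

lemma xrev_0 [simp]: "xrev 0 = 0"
  by (rule coeff_hom.h_0[OF xrev_hom])

lemma xrev_eq_0 [simp]: "xrev f = 0 \<longleftrightarrow> f = 0"
  by (metis xrev_xrev xrev_0)

lemma hi_lo_xrev [simp]: "hi (xrev f) = hi f" "lo (xrev f) = lo f"
  unfolding xrev_def by (rule hi_lo_cmap; simp)+

abbreviation xx :: L1 where "xx \<equiv> Poly_Mapping.single 1 1"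
abbreviation xi :: L1 where "xi \<equiv> Poly_Mapping.single (- 1) 1"

abbreviation "cf2 \<equiv> twisted.cf (Poly_Mapping.single 0 xx :: L2) (Poly_Mapping.single 0 xi) (Poly_Mapping.single 1 1) (Poly_Mapping.single (- 1) 1)"
abbreviation "cfY \<equiv> twisted.cf xx xi (- 1) (- 1)"
abbreviation "cfX \<equiv> twisted.cf (- 1) (- 1) xx xi"

lemma T2_twisted: "twisted (lrev :: L2 \<Rightarrow> L2) xrev (Poly_Mapping.single 0 xx) (Poly_Mapping.single 0 xi)
  (Poly_Mapping.single 1 1) (Poly_Mapping.single (- 1) 1)"
proof
  fix a b :: L2
  show "lrev (a + b) = lrev a + lrev b" by (rule lrev_add)
  show "lrev (a * b) = lrev a * lrev b" by (rule lrev_mult)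
  show "xrev (a + b) = xrev a + xrev b" by (rule coeff_hom.h_add[OF xrev_hom])
  show "xrev (a * b) = xrev a * xrev b" by (rule coeff_hom.h_mult[OF xrev_hom])
  show "lrev (lrev a) = a" by (rule lrev_lrev)
  show "xrev (xrev a) = a" by (rule xrev_xrev)
  show "xrev (lrev a) = lrev (xrev a)" by (rule xrev_lrev)
  show "lrev (Poly_Mapping.single 0 xx) = (Poly_Mapping.single 0 xx :: L2)" "lrev (Poly_Mapping.single 0 xi) = (Poly_Mapping.single 0 xi :: L2)"
    by (simp_all only: lrev_single minus_zero)
  show "xrev (Poly_Mapping.single 0 xx) = Poly_Mapping.single 0 xi" "xrev (Poly_Mapping.single 0 xi) = Poly_Mapping.single 0 xx"
    by (simp_all only: xrev_single lrev_single minus_minus)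
  show "lrev (Poly_Mapping.single 1 1 :: L2) = Poly_Mapping.single (- 1) 1" "lrev (Poly_Mapping.single (- 1) 1 :: L2) = Poly_Mapping.single 1 1"
    by (simp_all only: lrev_single minus_minus)
  show "xrev (Poly_Mapping.single 1 1) = Poly_Mapping.single 1 1" "xrev (Poly_Mapping.single (- 1) 1) = Poly_Mapping.single (- 1) 1"
    by (simp_all only: xrev_single lrev_1)
  show "Poly_Mapping.single 0 xx * Poly_Mapping.single 0 xi = (1 :: L2)"
    by (simp add: mult_single)
  show "Poly_Mapping.single 1 1 * Poly_Mapping.single (- 1) 1 = (1 :: L2)"
    by (simp add: mult_single)
qed

lemma lrev_uminus: "lrev (- f) = - lrev f"
  by (simp add: coeff_hom.h_uminus[OF lrev_hom])

text \<open>The line y = -1: inverting y does nothing there, so \<open>\<sigma>\<close> is the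
  identity, while \<open>\<tau>\<close> still inverts x. The line x = -1 below is the mirror
  image.\<close>

lemma TY_twisted: "twisted (\<lambda>f. f) (lrev :: L1 \<Rightarrow> L1) xx xi (- 1) (- 1)"
proof
  fix a b :: L1
  show "lrev (a + b) = lrev a + lrev b" by (rule lrev_add)
  show "lrev (a * b) = lrev a * lrev b" by (rule lrev_mult)
  show "lrev xx = xi" "lrev xi = xx" by (simp_all only: lrev_single minus_minus)
  show "lrev (- 1 :: L1) = - 1" by (simp only: lrev_uminus lrev_1)
  show "xx * xi = (1 :: L1)" by (simp add: mult_single)
qed (simp_all only: lrev_lrev lrev_uminus lrev_1, simp_all)

lemma TX_twisted: "twisted (lrev :: L1 \<Rightarrow> L1) (\<lambda>f. f) (- 1) (- 1) xx xi"
proof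
  fix a b :: L1
  show "lrev (a + b) = lrev a + lrev b" by (rule lrev_add)
  show "lrev (a * b) = lrev a * lrev b" by (rule lrev_mult)
  show "lrev xx = xi" "lrev xi = xx" by (simp_all only: lrev_single minus_minus)
  show "lrev (- 1 :: L1) = - 1" by (simp only: lrev_uminus lrev_1)
  show "xx * xi = (1 :: L1)" by (simp add: mult_single)
qed (simp_all only: lrev_lrev lrev_uminus lrev_1, simp_all)

lemma pw_single: "pw (Poly_Mapping.single 1 (1::'r::comm_ring_1)) (Poly_Mapping.single (- 1) 1) k = Poly_Mapping.single k 1"
proof -
  have "Poly_Mapping.single i (1::'r) ^ n = Poly_Mapping.single (int n * i) 1" for i :: int and n
    by (induction n) (simp_all add: mult_single distrib_right)
  then show ?thesis by (simp add: pw_def)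
qed

lemma pw_single0:
  fixes a b :: "'b::comm_ring_1"
  shows "pw (Poly_Mapping.single (0::int) a) (Poly_Mapping.single 0 b) k = Poly_Mapping.single 0 (pw a b k)"
proof -
  have "Poly_Mapping.single (0::int) a ^ n = Poly_Mapping.single 0 (a ^ n)" for a :: "'b::comm_ring_1" and n
    by (induction n) (simp_all add: mult_single)
  then show ?thesis by (simp add: pw_def)
qed

lemma crd_latt0: "crd (latt i j 0) = (2 * i, 2 * j, 0)"
  using crd_latt[of i j 0] by simp

context twisted
begin

lemma cf_latt: "cf (Poly_Mapping.single (latt i j 0) c) = (\<lambda>n. if n = 0 then of_int c * (pw X Xi i * pw Y Yi j) else 0)"
  by (rule ext) (simp add: cf_def lev_def mon_def crd_latt0 prx_def pry_def)

lemma liftable_sum: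
  assumes "finite I" "\<And>i. i \<in> I \<Longrightarrow> \<exists>w. cf w = (\<lambda>n. if n = 0 then f i else 0)"
  shows "\<exists>w. cf w = (\<lambda>n. if n = 0 then sum f I else 0)"
  using assms
proof (induction I rule: finite_induct)
  case empty
  have "cf 0 = (\<lambda>n. if n = 0 then sum f {} else 0)" by (rule ext) simp
  then show ?case by blast
next
  case (insert i I)
  then obtain w w' where "cf w = (\<lambda>n. if n = 0 then f i else 0)" "cf w' = (\<lambda>n. if n = 0 then sum f I else 0)"
    by blast
  then have "cf (w + w') = (\<lambda>n. if n = 0 then sum f (insert i I) else 0)"
    using insert.hyps by (auto simp: cf_add fun_eq_iff)
  then show ?case by blast
qed

end

lemma laurent_decomp: "f = (\<Sum>i\<in>Poly_Mapping.keys f. Poly_Mapping.single i (Poly_Mapping.lookup f i))"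
  by (rule poly_mapping_eqI) (simp add: lookup_sum lookup_single when_def in_keys_iff)

lemma of_int_single: "of_int c = Poly_Mapping.single 0 (of_int c :: 'r::comm_ring_1)"
  by (simp only: single_of_int)

lemma of_int_L1: "(of_int c :: L1) = Poly_Mapping.single 0 c"
  using of_int_single[of c, where 'r = int] by simp

lemma lift_TY: "\<exists>w. cfY w = (\<lambda>n. if n = 0 then \<alpha> else 0)"
proof -
  have 1: "\<exists>w. cfY w = (\<lambda>n. if n = 0 then Poly_Mapping.single i c else 0)" for i c
  proof -
    have "of_int c * (pw xx xi i * pw (- 1) (- 1) 0) = (Poly_Mapping.single i c :: L1)"
      by (simp only: pw_single of_int_L1 pw_simps mult_1_right mult_single add_0)
    then show ?thesis using twisted.cf_latt[OF TY_twisted, of i 0 c] by (intro exI[of _ "Poly_Mapping.single (latt i 0 0) c"]) (simp only:)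
  qed
  show ?thesis
    by (subst laurent_decomp[of \<alpha>], rule twisted.liftable_sum[OF TY_twisted finite_keys]) (rule 1)
qed

lemma lift_TX: "\<exists>w. cfX w = (\<lambda>n. if n = 0 then \<alpha> else 0)"
proof -
  have 1: "\<exists>w. cfX w = (\<lambda>n. if n = 0 then Poly_Mapping.single i c else 0)" for i c
  proof -
    have "of_int c * (pw (- 1) (- 1) 0 * pw xx xi i) = (Poly_Mapping.single i c :: L1)"
      by (simp only: pw_single of_int_L1 pw_simps mult_1_left mult_1_right mult_single add_0)
    then show ?thesis using twisted.cf_latt[OF TX_twisted, of 0 i c] by (intro exI[of _ "Poly_Mapping.single (latt 0 i 0) c"]) (simp only:)
  qed
  show ?thesis
    by (subst laurent_decomp[of \<alpha>], rule twisted.liftable_sum[OF TX_twisted finite_keys]) (rule 1)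
qed

lemma lift_T2: "\<exists>w. cf2 w = (\<lambda>n. if n = 0 then \<alpha> else 0)"
proof -
  have 1: "\<exists>w. cf2 w = (\<lambda>n. if n = 0 then Poly_Mapping.single j (Poly_Mapping.single i c) else 0)" for i j c
  proof -
    have "of_int c * (pw (Poly_Mapping.single 0 xx) (Poly_Mapping.single 0 xi) i * pw (Poly_Mapping.single 1 1) (Poly_Mapping.single (- 1) 1) j)
       = (Poly_Mapping.single j (Poly_Mapping.single i c) :: L2)"
      unfolding pw_single pw_single0 of_int_single[where 'r = L1] of_int_L1 by (simp only: mult_single add_0 add_0_right mult_1_right)
    then show ?thesis using twisted.cf_latt[OF T2_twisted, of i j c] by (intro exI[of _ "Poly_Mapping.single (latt i j 0) c"]) (simp only:)
  qed
  have 2: "\<exists>w. cf2 w = (\<lambda>n. if n = 0 then Poly_Mapping.single j a else 0)" for j a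
  proof -
    have "Poly_Mapping.single j (sum F I) = (\<Sum>i\<in>I. Poly_Mapping.single j (F i))" for F :: "int \<Rightarrow> L1" and I
      by (induction I rule: infinite_finite_induct) (simp_all only: sum.infinite sum.empty sum.insert single_zero single_add not_False_eq_True)
    then have "Poly_Mapping.single j a = (\<Sum>i\<in>Poly_Mapping.keys a. Poly_Mapping.single j (Poly_Mapping.single i (Poly_Mapping.lookup a i)))"
      by (subst laurent_decomp[of a]) (simp only:)
    then show ?thesis by (simp only:) (rule twisted.liftable_sum[OF T2_twisted finite_keys], rule 1)
  qed
  show ?thesis
    by (subst laurent_decomp[of \<alpha>], rule twisted.liftable_sum[OF T2_twisted finite_keys]) (rule 2)
qed

text \<open>For nonzero \<open>g\<close> the two sides would have top degrees
  \<open>2 * hi f\<close> and \<open>1 + 2 * hi g\<close>.\<close>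

lemma parity_norm:
  fixes f g :: "'r::idom laurent"
  assumes "\<And>f. f \<noteq> 0 \<Longrightarrow> \<theta> f \<noteq> 0 \<and> hi (\<theta> f) = hi f" "\<theta> 0 = 0" "f * \<theta> f = Poly_Mapping.single 1 1 * g * \<theta> g"
  shows "g = 0"
proof (rule ccontr)
  assume g: "g \<noteq> 0"
  have s: "Poly_Mapping.single 1 1 \<noteq> (0 :: 'r laurent)" by (metis lookup_single_eq lookup_zero zero_neq_one)
  have "Poly_Mapping.single 1 1 * g * \<theta> g \<noteq> 0" "hi (Poly_Mapping.single 1 1 * g * \<theta> g) = 1 + 2 * hi g"
    using assms(1)[OF g] g s by (simp_all add: hi_lo_mult)
  moreover have "f \<noteq> 0" using calculation(1) assms(2,3) by auto
  then have "hi (f * \<theta> f) = 2 * hi f" using assms(1) by (simp add: hi_lo_mult)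
  ultimately have "2 * hi f = 1 + 2 * hi g" using assms(3) by simp
  then show False by presburger
qed

lemma lookup_mult_lrev_0: "Poly_Mapping.lookup (f * lrev f) 0 = (\<Sum>i\<in>Poly_Mapping.keys f. (Poly_Mapping.lookup f i)\<^sup>2)" for f :: L1
  by (simp add: lookup_mult_sum lookup_lrev power2_eq_square)

text \<open>The constant term of \<open>f * lrev f\<close> is the sum of the squares of the
  coefficients of \<open>f\<close>. This is where the order on the integers enters.\<close>

lemma sum_norm_0:
  fixes f g :: L1
  assumes "f * lrev f + g * lrev g = 0"
  shows "g = 0"
proof -
  have "(\<Sum>i\<in>Poly_Mapping.keys f. (Poly_Mapping.lookup f i)\<^sup>2) + (\<Sum>i\<in>Poly_Mapping.keys g. (Poly_Mapping.lookup g i)\<^sup>2) = 0"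
    using arg_cong[OF assms, of "\<lambda>h. Poly_Mapping.lookup h 0"] by (simp add: lookup_add lookup_mult_lrev_0)
  moreover have "(\<Sum>i\<in>Poly_Mapping.keys f. (Poly_Mapping.lookup f i)\<^sup>2) \<ge> 0" "(\<Sum>i\<in>Poly_Mapping.keys g. (Poly_Mapping.lookup g i)\<^sup>2) \<ge> 0"
    by (simp_all add: sum_nonneg)
  ultimately have "(\<Sum>i\<in>Poly_Mapping.keys g. (Poly_Mapping.lookup g i)\<^sup>2) = 0" by linarith
  then have "\<forall>i\<in>Poly_Mapping.keys g. (Poly_Mapping.lookup g i)\<^sup>2 = 0" by (subst (asm) sum_nonneg_eq_0_iff) auto
  then have "Poly_Mapping.keys g = {}" by (metis equals0I in_keys_iff power2_eq_square mult_eq_0_iff)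
  then show ?thesis by simp
qed

lemma parity_norm_L1:
  fixes f g :: L1
  assumes "f * f - xx * g * g = 0"
  shows "g = 0"
  by (rule parity_norm[of "\<lambda>f. f" f g]) (use assms in auto)

lemma parity_norm_L2:
  fixes f g :: L2
  assumes "f * xrev f - Poly_Mapping.single 1 1 * g * xrev g = 0"
  shows "g = 0"
proof (rule parity_norm[of xrev f g])
  show "f \<noteq> 0 \<Longrightarrow> xrev f \<noteq> 0 \<and> hi (xrev f) = hi f" for f by simp
qed (use assms in simp_all)

lemma parity_norm_L2':
  fixes f g :: L2
  assumes "f * lrev f - Poly_Mapping.single 0 xx * g * lrev g = 0"
  shows "g = 0"
proof -
  have "lswap (f * lrev f - Poly_Mapping.single 0 xx * g * lrev g) = 0" using assms by (simp only: lswap_eq_0)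
  then have "lswap f * xrev (lswap f) - Poly_Mapping.single 1 1 * lswap g * xrev (lswap g) = 0"
    by (simp only: coeff_hom.h_mult[OF lswap_hom] coeff_hom.h_minus[OF lswap_hom] lswap_lrev lswap_single xrev_def single_one)
  then have "lswap g = 0" by (rule parity_norm_L2)
  then show ?thesis by simp
qed

lemma TY_ring: "twisted_ring (\<lambda>f. f) (lrev :: L1 \<Rightarrow> L1) xx xi (- 1) (- 1)"
  by (rule twisted_ring.intro[OF TY_twisted twisted_ring_axioms.intro[OF coprime_reps_L1 lift_TY]])

lemma TX_ring: "twisted_ring (lrev :: L1 \<Rightarrow> L1) (\<lambda>f. f) (- 1) (- 1) xx xi"
  by (rule twisted_ring.intro[OF TX_twisted twisted_ring_axioms.intro[OF coprime_reps_L1 lift_TX]])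

lemma T2_ring: "twisted_ring (lrev :: L2 \<Rightarrow> L2) xrev (Poly_Mapping.single 0 xx) (Poly_Mapping.single 0 xi)
  (Poly_Mapping.single 1 1) (Poly_Mapping.single (- 1) 1)"
  by (rule twisted_ring.intro[OF T2_twisted twisted_ring_axioms.intro[OF coprime_reps_L2 lift_T2]])

lemma TY_anisotropic: "anisotropic_ring (\<lambda>f. f) (lrev :: L1 \<Rightarrow> L1) xx xi (- 1) (- 1)"
proof (rule anisotropic_ring.intro[OF TY_ring anisotropic_ring_axioms.intro])
  fix f g :: L1
  show "twisted_ring.N1 (\<lambda>f. f) xx f g = 0 \<Longrightarrow> g = 0" unfolding twisted_ring.N1_def[OF TY_ring] by (rule parity_norm_L1)
  show "twisted_ring.N2 lrev (- 1) f g = 0 \<Longrightarrow> g = 0" unfolding twisted_ring.N2_def[OF TY_ring] by (rule sum_norm_0[of f]) simp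
qed

lemma TX_anisotropic: "anisotropic_ring (lrev :: L1 \<Rightarrow> L1) (\<lambda>f. f) (- 1) (- 1) xx xi"
proof (rule anisotropic_ring.intro[OF TX_ring anisotropic_ring_axioms.intro])
  fix f g :: L1
  show "twisted_ring.N1 lrev (- 1) f g = 0 \<Longrightarrow> g = 0" unfolding twisted_ring.N1_def[OF TX_ring] by (rule sum_norm_0[of f]) simp
  show "twisted_ring.N2 (\<lambda>f. f) xx f g = 0 \<Longrightarrow> g = 0" unfolding twisted_ring.N2_def[OF TX_ring] by (rule parity_norm_L1)
qed

lemma T2_anisotropic: "anisotropic_ring (lrev :: L2 \<Rightarrow> L2) xrev (Poly_Mapping.single 0 xx) (Poly_Mapping.single 0 xi)
  (Poly_Mapping.single 1 1) (Poly_Mapping.single (- 1) 1)"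
proof (rule anisotropic_ring.intro[OF T2_ring anisotropic_ring_axioms.intro])
  fix f g :: L2
  show "twisted_ring.N1 lrev (Poly_Mapping.single 0 xx) f g = 0 \<Longrightarrow> g = 0" unfolding twisted_ring.N1_def[OF T2_ring] by (rule parity_norm_L2')
  show "twisted_ring.N2 xrev (Poly_Mapping.single 1 1) f g = 0 \<Longrightarrow> g = 0" unfolding twisted_ring.N2_def[OF T2_ring] by (rule parity_norm_L2)
qed

lemmas structure_2 = anisotropic_ring.short_unit_structure[OF T2_anisotropic,
  unfolded twisted_ring.N1_def[OF T2_ring] twisted_ring.N2_def[OF T2_ring]]
lemmas structure_Y = anisotropic_ring.short_unit_structure[OF TY_anisotropic,
  unfolded twisted_ring.N1_def[OF TY_ring] twisted_ring.N2_def[OF TY_ring]]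
lemmas structure_X = anisotropic_ring.short_unit_structure[OF TX_anisotropic,
  unfolded twisted_ring.N1_def[OF TX_ring] twisted_ring.N2_def[OF TX_ring]]

section \<open>Integral Laurent polynomials in one variable\<close>

abbreviation hc :: "L1 \<Rightarrow> int" where "hc f \<equiv> Poly_Mapping.lookup f (hi f)"
abbreviation lc :: "L1 \<Rightarrow> int" where "lc f \<equiv> Poly_Mapping.lookup f (lo f)"
definition nsq :: "L1 \<Rightarrow> int" where "nsq f = (\<Sum>i\<in>Poly_Mapping.keys f. (Poly_Mapping.lookup f i)\<^sup>2)"

lemma nsq_eq: "nsq f = Poly_Mapping.lookup (f * lrev f) 0"
  unfolding nsq_def by (rule lookup_mult_lrev_0[symmetric])

lemma nsq_ge_sum:
  assumes "finite S"
  shows "(\<Sum>i\<in>S. (Poly_Mapping.lookup f i)\<^sup>2) \<le> nsq f"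
proof -
  have "(\<Sum>i\<in>S. (Poly_Mapping.lookup f i)\<^sup>2) = (\<Sum>i\<in>S \<inter> Poly_Mapping.keys f. (Poly_Mapping.lookup f i)\<^sup>2)"
    using assms by (intro sum.mono_neutral_right) (auto simp: in_keys_iff)
  also have "\<dots> \<le> nsq f" unfolding nsq_def by (intro sum_mono2) auto
  finally show ?thesis .
qed

lemma nsq_ge1: "(Poly_Mapping.lookup f i)\<^sup>2 \<le> nsq f"
  using nsq_ge_sum[of "{i}" f] by simp

lemma nsq_ge2: "i \<noteq> j \<Longrightarrow> (Poly_Mapping.lookup f i)\<^sup>2 + (Poly_Mapping.lookup f j)\<^sup>2 \<le> nsq f"
  using nsq_ge_sum[of "{i, j}" f] by simp

lemma nsq_nonneg: "nsq f \<ge> 0"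
  unfolding nsq_def by (simp add: sum_nonneg)

lemma nsq_pos: "f \<noteq> 0 \<Longrightarrow> nsq f > 0"
proof -
  assume "f \<noteq> 0"
  then have "(hc f)\<^sup>2 > 0" using hi_lo(1) by simp
  then show ?thesis using nsq_ge1[of f "hi f"] by linarith
qed

lemma nsq_ends: "f \<noteq> 0 \<Longrightarrow> wd f > 0 \<Longrightarrow> (hc f)\<^sup>2 + (lc f)\<^sup>2 \<le> nsq f"
  by (rule nsq_ge2) (simp add: wd_def)

lemma symmetric_ends:
  fixes f :: "'r::comm_ring_1 laurent"
  assumes "lrev f = f" "f \<noteq> 0"
  shows "lo f = - hi f" "Poly_Mapping.lookup f (lo f) = Poly_Mapping.lookup f (hi f)" "wd f = 2 * hi f"
proof -
  show *: "lo f = - hi f" using hi_lo_lrev(2)[OF assms(2)] assms(1) by simp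
  show "Poly_Mapping.lookup f (lo f) = Poly_Mapping.lookup f (hi f)" using lookup_lrev[of f "hi f"] unfolding assms(1) * by simp
  show "wd f = 2 * hi f" by (simp add: wd_def *)
qed

lemma symmetric_const:
  fixes f :: "'r::comm_ring_1 laurent"
  assumes "lrev f = f" "f \<noteq> 0" "wd f = 0"
  shows "f = Poly_Mapping.single 0 (Poly_Mapping.lookup f 0)"
  using wd_0_single[OF assms(2,3)] symmetric_ends[OF assms(1,2)] assms(3) by simp

lemma norm_sym: "lrev (f * lrev f) = f * lrev f" for f :: "'r::comm_ring_1 laurent"
  by (simp add: lrev_mult mult.commute)

text \<open>The symmetric element \<open>q\<close> on the left of the conclusion satisfies
  \<open>q * q = q - s * lrev s\<close> with \<open>s = r * G * h\<close>. Comparing constant terms,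
  the sum of the squares of the coefficients of \<open>q\<close> is at most its constant
  coefficient; an integral \<open>q \<noteq> 0\<close> with this property is 1.\<close>

lemma norm_gap:
  fixes R r N h G :: L1
  assumes R: "R = r * lrev r + (N * h) * lrev (N * h)" and eq: "R * R * (G * lrev G) = N * lrev N"
    and nz: "R \<noteq> 0" "G \<noteq> 0" "h \<noteq> 0"
  shows "R * (G * lrev G * (h * lrev h)) = 1"
proof -
  define q where "q = R * (G * lrev G * (h * lrev h))"
  have Rs: "lrev R = R" unfolding R by (simp add: lrev_add lrev_mult mult.commute)
  have qs: "lrev q = q" unfolding q_def by (simp add: lrev_mult Rs mult_ac)
  have "q * q = (R * R * (G * lrev G)) * (h * lrev h) * (G * lrev G * (h * lrev h))" by (simp add: q_def mult_ac)
  also have "\<dots> = ((N * h) * lrev (N * h)) * (G * lrev G * (h * lrev h))" unfolding eq by (simp add: lrev_mult mult_ac)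
  also have "\<dots> = (R - r * lrev r) * (G * lrev G * (h * lrev h))" by (simp add: R)
  also have "\<dots> = q - (r * G * h) * lrev (r * G * h)" by (simp add: q_def lrev_mult left_diff_distrib right_diff_distrib mult_ac)
  finally have "Poly_Mapping.lookup (q * q) 0 = Poly_Mapping.lookup (q - (r * G * h) * lrev (r * G * h)) 0" by (rule arg_cong)
  then have "nsq q = Poly_Mapping.lookup q 0 - nsq (r * G * h)" by (simp only: nsq_eq qs lookup_minus)
  then have le: "nsq q \<le> Poly_Mapping.lookup q 0" using nsq_nonneg[of "r * G * h"] by linarith
  have "q \<noteq> 0" using nz by (simp add: q_def)
  then have pos: "nsq q > 0" by (rule nsq_pos)
  have "(Poly_Mapping.lookup q 0)\<^sup>2 \<le> Poly_Mapping.lookup q 0" using nsq_ge1[of q 0] le by linarith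
  then have "Poly_Mapping.lookup q 0 * (Poly_Mapping.lookup q 0 - 1) \<le> 0" by (simp add: power2_eq_square right_diff_distrib)
  then have q0: "Poly_Mapping.lookup q 0 = 1" using le pos by (simp add: mult_le_0_iff)
  have "Poly_Mapping.lookup q i = 0" if "i \<noteq> 0" for i
  proof -
    have "(Poly_Mapping.lookup q i)\<^sup>2 + 1\<^sup>2 \<le> 1" using nsq_ge2[OF that, of q] le unfolding q0 by linarith
    then show ?thesis by simp
  qed
  then have "q = 1" by (intro poly_mapping_eqI) (simp add: q0 lookup_one when_def)
  then show ?thesis by (simp only: q_def)
qed

lemma hi_lo_diff:
  fixes f g :: "'r::ab_group_add laurent"
  shows "g \<noteq> 0 \<Longrightarrow> f = 0 \<or> hi f < hi g \<Longrightarrow> hi (f - g) = hi g \<and> Poly_Mapping.lookup (f - g) (hi g) = - Poly_Mapping.lookup g (hi g)"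
    "f \<noteq> 0 \<Longrightarrow> g = 0 \<or> hi g < hi f \<Longrightarrow> hi (f - g) = hi f \<and> Poly_Mapping.lookup (f - g) (hi f) = Poly_Mapping.lookup f (hi f)"
    "g \<noteq> 0 \<Longrightarrow> f = 0 \<or> lo g < lo f \<Longrightarrow> lo (f - g) = lo g \<and> Poly_Mapping.lookup (f - g) (lo g) = - Poly_Mapping.lookup g (lo g)"
    "f \<noteq> 0 \<Longrightarrow> g = 0 \<or> lo f < lo g \<Longrightarrow> lo (f - g) = lo f \<and> Poly_Mapping.lookup (f - g) (lo f) = Poly_Mapping.lookup f (lo f)"
proof -
  have hz: "Poly_Mapping.lookup k i = 0" if "k = 0 \<or> hi k < i" for k :: "'r laurent" and i
    using that hi_lo(3)[of k i] by fastforce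
  have lz: "Poly_Mapping.lookup k i = 0" if "k = 0 \<or> i < lo k" for k :: "'r laurent" and i
    using that hi_lo(3)[of k i] by fastforce
  show "hi (f - g) = hi g \<and> Poly_Mapping.lookup (f - g) (hi g) = - Poly_Mapping.lookup g (hi g)" if "g \<noteq> 0" "f = 0 \<or> hi f < hi g"
  proof -
    have *: "Poly_Mapping.lookup (f - g) (hi g) = - Poly_Mapping.lookup g (hi g)" using hz[OF that(2)] by (simp add: lookup_minus)
    moreover have "hi (f - g) = hi g"
    proof (rule hi_eqI)
      show "Poly_Mapping.lookup (f - g) (hi g) \<noteq> 0" using * hi_lo(1)[OF that(1)] by simp
      show "i \<le> hi g" if "Poly_Mapping.lookup (f - g) i \<noteq> 0" for i
        using that hz[of f i] hz[of g i] \<open>f = 0 \<or> hi f < hi g\<close> by (force simp: lookup_minus)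
    qed
    ultimately show ?thesis by simp
  qed
  show "hi (f - g) = hi f \<and> Poly_Mapping.lookup (f - g) (hi f) = Poly_Mapping.lookup f (hi f)" if "f \<noteq> 0" "g = 0 \<or> hi g < hi f"
  proof -
    have *: "Poly_Mapping.lookup (f - g) (hi f) = Poly_Mapping.lookup f (hi f)" using hz[OF that(2)] by (simp add: lookup_minus)
    moreover have "hi (f - g) = hi f"
    proof (rule hi_eqI)
      show "Poly_Mapping.lookup (f - g) (hi f) \<noteq> 0" using * hi_lo(1)[OF that(1)] by simp
      show "i \<le> hi f" if "Poly_Mapping.lookup (f - g) i \<noteq> 0" for i
        using that hz[of f i] hz[of g i] \<open>g = 0 \<or> hi g < hi f\<close> by (force simp: lookup_minus)
    qed
    ultimately show ?thesis by simp
  qed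
  show "lo (f - g) = lo g \<and> Poly_Mapping.lookup (f - g) (lo g) = - Poly_Mapping.lookup g (lo g)" if "g \<noteq> 0" "f = 0 \<or> lo g < lo f"
  proof -
    have *: "Poly_Mapping.lookup (f - g) (lo g) = - Poly_Mapping.lookup g (lo g)" using lz[OF that(2)] by (simp add: lookup_minus)
    moreover have "lo (f - g) = lo g"
    proof (rule lo_eqI)
      show "Poly_Mapping.lookup (f - g) (lo g) \<noteq> 0" using * hi_lo(2)[OF that(1)] by simp
      show "lo g \<le> i" if "Poly_Mapping.lookup (f - g) i \<noteq> 0" for i
        using that lz[of f i] lz[of g i] \<open>f = 0 \<or> lo g < lo f\<close> by (force simp: lookup_minus)
    qed
    ultimately show ?thesis by simp
  qed
  show "lo (f - g) = lo f \<and> Poly_Mapping.lookup (f - g) (lo f) = Poly_Mapping.lookup f (lo f)" if "f \<noteq> 0" "g = 0 \<or> lo f < lo g"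
  proof -
    have *: "Poly_Mapping.lookup (f - g) (lo f) = Poly_Mapping.lookup f (lo f)" using lz[OF that(2)] by (simp add: lookup_minus)
    moreover have "lo (f - g) = lo f"
    proof (rule lo_eqI)
      show "Poly_Mapping.lookup (f - g) (lo f) \<noteq> 0" using * hi_lo(2)[OF that(1)] by simp
      show "lo f \<le> i" if "Poly_Mapping.lookup (f - g) i \<noteq> 0" for i
        using that lz[of f i] lz[of g i] \<open>g = 0 \<or> lo f < lo g\<close> by (force simp: lookup_minus)
    qed
    ultimately show ?thesis by simp
  qed
qed

lemma single_1_nz [simp]: "Poly_Mapping.single i (1::'r::zero_neq_one) \<noteq> 0"
  by (metis lookup_single_eq lookup_zero zero_neq_one)

text \<open>The two norm forms below have ends of opposite parity, so that no cancellation can occur there.\<close>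

lemma parity_diff_ends:
  fixes A B :: "'r::idom laurent"
  assumes \<theta>: "\<forall>f. f \<noteq> 0 \<longrightarrow> \<theta> f \<noteq> 0 \<and> hi (\<theta> f) = hi f \<and> lo (\<theta> f) = lo f" "\<theta> 0 = 0" and B: "B \<noteq> 0"
    and N: "N = A * \<theta> A - Poly_Mapping.single 1 1 * B * \<theta> B"
  shows "N \<noteq> 0"
    "hi N = 1 + 2 * hi B \<and> Poly_Mapping.lookup N (hi N) = - (Poly_Mapping.lookup B (hi B) * Poly_Mapping.lookup (\<theta> B) (hi B)) \<or>
     A \<noteq> 0 \<and> hi N = 2 * hi A \<and> hi N > 1 + 2 * hi B \<and> Poly_Mapping.lookup N (hi N) = Poly_Mapping.lookup A (hi A) * Poly_Mapping.lookup (\<theta> A) (hi A)"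
    "lo N = 1 + 2 * lo B \<and> Poly_Mapping.lookup N (lo N) = - (Poly_Mapping.lookup B (lo B) * Poly_Mapping.lookup (\<theta> B) (lo B)) \<or>
     A \<noteq> 0 \<and> lo N = 2 * lo A \<and> lo N < 1 + 2 * lo B \<and> Poly_Mapping.lookup N (lo N) = Poly_Mapping.lookup A (lo A) * Poly_Mapping.lookup (\<theta> A) (lo A)"
    "A \<noteq> 0 \<Longrightarrow> hi N \<ge> 2 * hi A \<and> lo N \<le> 2 * lo A"
proof -
  let ?Q = "Poly_Mapping.single 1 1 * B * \<theta> B"
  have Qnz: "?Q \<noteq> 0" using \<theta>(1)[rule_format, OF B] B by simp
  have sB: "Poly_Mapping.single 1 1 * B \<noteq> 0" using B by simp
  have one: "(1::'r) \<noteq> 0" by simp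
  have tB: "\<theta> B \<noteq> 0" "hi (\<theta> B) = hi B" "lo (\<theta> B) = lo B" using \<theta>(1)[rule_format, OF B] by auto
  have Q: "hi ?Q = 1 + 2 * hi B" "lo ?Q = 1 + 2 * lo B"
    "Poly_Mapping.lookup ?Q (1 + 2 * hi B) = Poly_Mapping.lookup B (hi B) * Poly_Mapping.lookup (\<theta> B) (hi B)"
    "Poly_Mapping.lookup ?Q (1 + 2 * lo B) = Poly_Mapping.lookup B (lo B) * Poly_Mapping.lookup (\<theta> B) (lo B)"
    unfolding hi_lo_mult(1,2)[OF sB tB(1)] hi_lo_mult(1,2)[OF single_1_nz B] hi_lo_single[OF one] tB(2,3)
    using hi_lo_mult(3,4)[OF sB tB(1)] hi_lo_mult(3,4)[OF single_1_nz[of 1] B]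
    unfolding hi_lo_mult(1,2)[OF single_1_nz B] hi_lo_single[OF one] tB(2,3) lookup_single_eq
    by (simp_all only: mult_2 add.assoc mult_1)
  have A: "A * \<theta> A \<noteq> 0" "hi (A * \<theta> A) = 2 * hi A" "lo (A * \<theta> A) = 2 * lo A"
    "Poly_Mapping.lookup (A * \<theta> A) (2 * hi A) = Poly_Mapping.lookup A (hi A) * Poly_Mapping.lookup (\<theta> A) (hi A)"
    "Poly_Mapping.lookup (A * \<theta> A) (2 * lo A) = Poly_Mapping.lookup A (lo A) * Poly_Mapping.lookup (\<theta> A) (lo A)" if "A \<noteq> 0"
  proof -
    have tA: "\<theta> A \<noteq> 0" "hi (\<theta> A) = hi A" "lo (\<theta> A) = lo A" using \<theta>(1)[rule_format, OF that] by auto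
    show "A * \<theta> A \<noteq> 0" using that tA(1) by simp
    show "hi (A * \<theta> A) = 2 * hi A" "lo (A * \<theta> A) = 2 * lo A" using hi_lo_mult(1,2)[OF that tA(1)] tA(2,3) by linarith+
    show "Poly_Mapping.lookup (A * \<theta> A) (2 * hi A) = Poly_Mapping.lookup A (hi A) * Poly_Mapping.lookup (\<theta> A) (hi A)"
      "Poly_Mapping.lookup (A * \<theta> A) (2 * lo A) = Poly_Mapping.lookup A (lo A) * Poly_Mapping.lookup (\<theta> A) (lo A)"
      using hi_lo_mult(3,4)[OF that tA(1)] unfolding tA(2,3) by (simp_all only: mult_2)
  qed
  show "N \<noteq> 0"
  proof
    assume "N = 0"
    then have eq: "A * \<theta> A = ?Q" using N by simp
    then have "A \<noteq> 0" using Qnz by auto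
    then have "2 * hi A = 1 + 2 * hi B" using A(2) Q(1) eq by simp
    then show False by presburger
  qed
  have ne: "2 * hi A \<noteq> 1 + 2 * hi B" "2 * lo A \<noteq> 1 + 2 * lo B" by presburger+
  have H: "A = 0 \<or> hi (A * \<theta> A) < hi ?Q \<or> A \<noteq> 0 \<and> hi ?Q < hi (A * \<theta> A)"
    using A(2) Q(1) ne(1) by linarith
  show 1: "hi N = 1 + 2 * hi B \<and> Poly_Mapping.lookup N (hi N) = - (Poly_Mapping.lookup B (hi B) * Poly_Mapping.lookup (\<theta> B) (hi B)) \<or>
     A \<noteq> 0 \<and> hi N = 2 * hi A \<and> hi N > 1 + 2 * hi B \<and> Poly_Mapping.lookup N (hi N) = Poly_Mapping.lookup A (hi A) * Poly_Mapping.lookup (\<theta> A) (hi A)"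
  proof (cases "A \<noteq> 0 \<and> hi ?Q < hi (A * \<theta> A)")
    case True
    then show ?thesis using hi_lo_diff(2)[OF A(1), of ?Q] A Q unfolding N by auto
  next
    case False
    then have "A * \<theta> A = 0 \<or> hi (A * \<theta> A) < hi ?Q" using H by auto
    then show ?thesis using hi_lo_diff(1)[OF Qnz, of "A * \<theta> A"] Q unfolding N by auto
  qed
  have L: "A = 0 \<or> lo ?Q < lo (A * \<theta> A) \<or> A \<noteq> 0 \<and> lo (A * \<theta> A) < lo ?Q"
    using A(3) Q(2) ne(2) by linarith
  show 2: "lo N = 1 + 2 * lo B \<and> Poly_Mapping.lookup N (lo N) = - (Poly_Mapping.lookup B (lo B) * Poly_Mapping.lookup (\<theta> B) (lo B)) \<or>
     A \<noteq> 0 \<and> lo N = 2 * lo A \<and> lo N < 1 + 2 * lo B \<and> Poly_Mapping.lookup N (lo N) = Poly_Mapping.lookup A (lo A) * Poly_Mapping.lookup (\<theta> A) (lo A)"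
  proof (cases "A \<noteq> 0 \<and> lo (A * \<theta> A) < lo ?Q")
    case True
    then show ?thesis using hi_lo_diff(4)[OF A(1), of ?Q] A Q unfolding N by auto
  next
    case False
    then have "A * \<theta> A = 0 \<or> lo ?Q < lo (A * \<theta> A)" using L by auto
    then show ?thesis using hi_lo_diff(3)[OF Qnz, of "A * \<theta> A"] Q unfolding N by auto
  qed
  show "hi N \<ge> 2 * hi A \<and> lo N \<le> 2 * lo A" if "A \<noteq> 0"
  proof
    show "hi N \<ge> 2 * hi A"
    proof (rule ccontr)
      assume "\<not> ?thesis"
      then have "hi N = 1 + 2 * hi B" "hi (A * \<theta> A) > hi ?Q" using 1 A(2)[OF that] Q(1) that by auto
      then show False using hi_lo_diff(2)[OF A(1)[OF that], of ?Q] Q(1) unfolding N by auto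
    qed
    show "lo N \<le> 2 * lo A"
    proof (rule ccontr)
      assume "\<not> ?thesis"
      then have "lo N = 1 + 2 * lo B" "lo (A * \<theta> A) < lo ?Q" using 2 A(3)[OF that] Q(2) that by auto
      then show False using hi_lo_diff(4)[OF A(1)[OF that], of ?Q] Q(2) unfolding N by auto
    qed
  qed
qed

lemma parity_diff_wd_0:
  fixes A B :: "'r::idom laurent"
  assumes \<theta>: "\<forall>f. f \<noteq> 0 \<longrightarrow> \<theta> f \<noteq> 0 \<and> hi (\<theta> f) = hi f \<and> lo (\<theta> f) = lo f" "\<theta> 0 = 0" and B: "B \<noteq> 0"
    and N: "N = A * \<theta> A - Poly_Mapping.single 1 1 * B * \<theta> B" and wd: "wd N = 0"
  shows "A = 0" "wd B = 0"
proof -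
  note E = parity_diff_ends[where \<theta> = \<theta>, OF \<theta> B N]
  have hl: "hi N = lo N" using wd by (simp add: wd_def)
  show A: "A = 0"
  proof (rule ccontr)
    assume "A \<noteq> 0"
    note a = E(4)[OF this] hi_lo(4)[OF this] hi_lo(4)[OF B]
    have "hi N = 2 * hi A" using a hl by linarith
    moreover have "hi N = 1 + 2 * hi B" using E(2,3) a hl by linarith
    ultimately show False by presburger
  qed
  show "wd B = 0" using E(2,3) A hl by (auto simp: wd_def)
qed

lemma ev1: "coeff_hom (ev (- 1 :: int))"
  by (rule ev_hom) simp

lemma ev_single: "ev s (Poly_Mapping.single i c) = c * pw s s i"
  unfolding ev_def by (rule coeff_hom.glext_single[OF coeff_hom_id])

lemma ev_xx [simp]: "ev (- 1) xx = - 1"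
  by (simp add: ev_single)

lemma ev_lrev [simp]: "ev (- 1 :: int) (lrev f) = ev (- 1) f"
proof -
  have "ev (- 1 :: int) (lrev f) = (\<Sum>i\<in>uminus ` Poly_Mapping.keys f. Poly_Mapping.lookup (lrev f) i * pw (- 1) (- 1) i)"
    by (rule ev_eq_sum) (auto simp: lookup_lrev in_keys_iff image_iff, metis in_keys_iff minus_minus)
  also have "\<dots> = (\<Sum>i\<in>Poly_Mapping.keys f. Poly_Mapping.lookup f i * pw (- 1) (- 1) i)"
    by (subst sum.reindex) (simp_all add: lookup_lrev)
  also have "\<dots> = ev (- 1) f" by (rule ev_eq_sum[symmetric]) (auto simp: in_keys_iff)
  finally show ?thesis .
qed

text \<open>The factor theorem at -1, reduced to monomials: each
  \<open>Poly_Mapping.single i 1\<close> is congruent to its value modulo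
  \<open>1 + Poly_Mapping.single 1 1\<close>, for positive and negative exponents alike.\<close>

lemma ev_neg_dvd:
  fixes f :: "'r::comm_ring_1 laurent"
  assumes "ev (- 1) f = 0"
  shows "1 + Poly_Mapping.single 1 1 dvd f"
proof -
  let ?z = "1 + Poly_Mapping.single 1 (1::'r)"
  let ?m = "\<lambda>i. Poly_Mapping.single (0::int) (pw (- 1) (- 1) i :: 'r)"
  have m1: "?m (i + 1) = - ?m i" "?m (i - 1) = - ?m i" for i
    by (simp_all add: single_uminus)
  have p: "?z dvd Poly_Mapping.single i 1 - ?m i" for i
  proof (induction i rule: int_induct[where k = 0])
    case base
    then show ?case by simp
  next
    case (step1 i)
    have "Poly_Mapping.single (i + 1) 1 - ?m (i + 1) = Poly_Mapping.single 1 1 * (Poly_Mapping.single i 1 - ?m i) + ?m i * ?z"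
      unfolding m1 by (simp add: right_diff_distrib distrib_left mult_single add.commute mult.commute)
    then show ?case using step1 by simp
  next
    case (step2 i)
    have "Poly_Mapping.single (i - 1) 1 - ?m (i - 1) = Poly_Mapping.single (- 1) 1 * ((Poly_Mapping.single i 1 - ?m i) + ?m i * ?z)"
      unfolding m1 by (simp add: right_diff_distrib distrib_left mult_single add.commute mult.commute)
    then show ?case using step2 by simp
  qed
  have q: "?z dvd Poly_Mapping.single i c - Poly_Mapping.single 0 (c * pw (- 1) (- 1) i)" for i and c :: 'r
    using dvd_mult[OF p[of i], of "Poly_Mapping.single 0 c"] by (simp add: right_diff_distrib mult_single)
  have s: "(\<Sum>i\<in>I. Poly_Mapping.single (0::int) (F i)) = Poly_Mapping.single 0 (sum F I)" for F :: "int \<Rightarrow> 'r" and I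
    by (induction I rule: infinite_finite_induct) (simp_all add: single_add)
  have "ev (- 1) f = (\<Sum>i\<in>Poly_Mapping.keys f. Poly_Mapping.lookup f i * pw (- 1) (- 1) i)"
    by (rule ev_eq_sum) (auto simp: in_keys_iff)
  then have "(\<Sum>i\<in>Poly_Mapping.keys f. Poly_Mapping.single (0::int) (Poly_Mapping.lookup f i * pw (- 1) (- 1) i)) = 0"
    unfolding s using assms by simp
  then have "(\<Sum>i\<in>Poly_Mapping.keys f. Poly_Mapping.single i (Poly_Mapping.lookup f i) - Poly_Mapping.single 0 (Poly_Mapping.lookup f i * pw (- 1) (- 1) i)) = f"
    unfolding sum_subtractf by (simp add: laurent_decomp[symmetric])
  moreover have "?z dvd (\<Sum>i\<in>Poly_Mapping.keys f. Poly_Mapping.single i (Poly_Mapping.lookup f i) - Poly_Mapping.single 0 (Poly_Mapping.lookup f i * pw (- 1) (- 1) i))"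
    by (rule dvd_sum) (rule q)
  ultimately show ?thesis by (simp only:)
qed

lemma not_unit_z: "\<not> 1 + xx dvd 1"
proof
  assume "1 + xx dvd 1"
  then have "ev (- 1 :: int) (1 + xx) dvd ev (- 1) 1" by (rule coeff_hom.h_dvd[OF ev1])
  then show False by (simp add: coeff_hom.h_add[OF ev1] coeff_hom.h_1[OF ev1])
qed

lemma cop_ev:
  assumes "cop f g"
  shows "ev (- 1 :: int) f \<noteq> 0 \<or> ev (- 1 :: int) g \<noteq> 0"
proof (rule ccontr)
  assume "\<not> ?thesis"
  then have "1 + xx dvd f * 1" "1 + xx dvd g * 1" using ev_neg_dvd[of f] ev_neg_dvd[of g] by auto
  then have "1 + xx dvd 1" using assms unfolding cop_def by blast
  then show False using not_unit_z by blast
qed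

section \<open>The one-variable case\<close>

text \<open>A multiplicative quantity that ignores shifts and reversal. As twice the absolute
  product of the end coefficients is at most the sum of their squares, it can be compared with the
  constant term of a norm.\<close>

definition Lp :: "L1 \<Rightarrow> int" where "Lp f = hc f * lc f"

lemma Lp_mult: "f \<noteq> 0 \<Longrightarrow> g \<noteq> 0 \<Longrightarrow> Lp (f * g) = Lp f * Lp g"
  unfolding Lp_def using hi_lo_mult[of f g] by (simp add: mult_ac)

lemma Lp_lrev: "f \<noteq> 0 \<Longrightarrow> Lp (lrev f) = Lp f"
  by (simp add: Lp_def hi_lo_lrev lookup_lrev)

lemma Lp_nz: "f \<noteq> 0 \<Longrightarrow> Lp f \<noteq> 0"
  by (simp add: Lp_def hi_lo(1,2))

lemma Lp_wd_0: "wd f = 0 \<Longrightarrow> Lp f = (hc f)\<^sup>2"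
  by (simp add: Lp_def wd_def power2_eq_square)

lemma two_Lp_le_nsq: "f \<noteq> 0 \<Longrightarrow> wd f > 0 \<Longrightarrow> 2 * \<bar>Lp f\<bar> \<le> nsq f"
proof -
  assume "f \<noteq> 0" "wd f > 0"
  then have "(hc f)\<^sup>2 + (lc f)\<^sup>2 \<le> nsq f" by (rule nsq_ends)
  moreover have "0 \<le> (\<bar>hc f\<bar> - \<bar>lc f\<bar>)\<^sup>2" by simp
  ultimately show ?thesis by (simp add: Lp_def abs_mult power2_diff)
qed

lemma unit_wd: "f dvd 1 \<Longrightarrow> wd f = 0 \<and> \<bar>Lp f\<bar> = 1" for f :: L1
proof -
  assume "f dvd 1"
  then obtain i c where f: "f = Poly_Mapping.single i c" "c dvd 1" by (rule laurent_unit)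
  then have c: "\<bar>c\<bar> = 1" by simp
  then have "c \<noteq> 0" by auto
  then show ?thesis using c by (simp add: f Lp_def abs_mult)
qed

lemma mono_norm:
  fixes f :: L1
  assumes "f \<noteq> 0" "wd f = 0"
  shows "f * lrev f = Poly_Mapping.single 0 ((hc f)\<^sup>2)" "(ev (- 1) f)\<^sup>2 = (hc f)\<^sup>2" "ev (- 1) f \<noteq> 0"
proof -
  have hl: "hi f = lo f" using assms(2) by (simp add: wd_def)
  obtain j where f: "f = Poly_Mapping.single j (hc f)" using wd_0_single[OF assms] unfolding hl[symmetric] by blast
  obtain \<phi> where \<phi>: "\<phi> = hc f" by blast
  note f = f[folded \<phi>]
  show "f * lrev f = Poly_Mapping.single 0 ((hc f)\<^sup>2)"
    unfolding \<phi>[symmetric] by (subst (1 2) f) (simp add: mult_single power2_eq_square)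
  have "ev (- 1) f = \<phi> * pw (- 1) (- 1) j" by (subst f) (rule ev_single)
  then show *: "(ev (- 1) f)\<^sup>2 = (hc f)\<^sup>2" unfolding \<phi>[symmetric] by (simp split: if_splits)
  show "ev (- 1) f \<noteq> 0" using * hi_lo(1)[OF assms(1)] by auto
qed

lemma id_\<theta>: "\<forall>f. f \<noteq> 0 \<longrightarrow> f \<noteq> 0 \<and> hi f = hi f \<and> lo f = lo f"
  by simp

lemma int_sq_ge_abs: "\<bar>x\<bar> \<le> x\<^sup>2" for x :: int
proof (cases "x = 0")
  case False
  then have "\<bar>x\<bar> * 1 \<le> \<bar>x\<bar> * \<bar>x\<bar>" by (intro mult_left_mono) auto
  then show ?thesis by (simp add: power2_eq_square)
qed simp

text \<open>The norm equation on the line y = -1. \<open>N1\<close> and \<open>E\<close> are parity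
  forms, \<open>N4\<close> and \<open>R\<close> are sums of two norms. On the line x = -1 the same
  equation holds with the two kinds of factors exchanged, so one analysis serves both.\<close>

locale line_data =
  fixes a b c f d h r e N1 N4 R E eps :: L1
  assumes N1: "N1 = a * a - xx * b * b" and N4: "N4 = c * lrev c + f * lrev f"
    and R: "R = r * lrev r + (N1 * h) * lrev (N1 * h)" and E: "E = e * e - xx * (N4 * d) * (N4 * d)"
    and cab: "cop a b" and ccf: "cop c f" and nz: "b \<noteq> 0" "f \<noteq> 0" "d \<noteq> 0" "h \<noteq> 0"
    and star: "R * R * (E * lrev E) = eps * (N1 * lrev N1) * (N4 * N4)" and eps: "eps dvd 1"
begin

text \<open>The trivial solution; by the last clause of the structure theorem it puts
  \<open>u\<close> at level 4 alone.\<close>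

abbreviation units where "units \<equiv> a = 0 \<and> c = 0 \<and> r = 0 \<and> e = 0 \<and> b dvd 1 \<and> f dvd 1 \<and> d dvd 1 \<and> h dvd 1"

lemma syms: "lrev N4 = N4" "lrev R = R"
  unfolding N4 R by (simp_all add: lrev_add lrev_mult mult_ac)

lemmas N1_ends = parity_diff_ends[where \<theta> = "\<lambda>f. f", OF id_\<theta> refl nz(1) N1]

lemma N4_nz: "N4 \<noteq> 0"
  using sum_norm_0[of c f] nz(2) by (auto simp: N4)

lemma N4d_nz: "N4 * d \<noteq> 0"
  using N4_nz nz by simp

lemma R_nz: "R \<noteq> 0"
  using sum_norm_0[of r "N1 * h"] N1_ends(1) nz(4) by (auto simp: R)

lemmas E_ends = parity_diff_ends[where \<theta> = "\<lambda>f. f", OF id_\<theta> refl N4d_nz E]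

lemmas all_nz = N1_ends(1) N4_nz R_nz E_ends(1) nz

lemma lrev_nz: "lrev N1 \<noteq> 0" "lrev E \<noteq> 0"
  using all_nz by simp_all

lemma R0: "Poly_Mapping.lookup R 0 = nsq r + nsq (N1 * h)"
  unfolding R lookup_add nsq_eq ..

text \<open>\<open>R\<close> and \<open>N4\<close> are symmetric, so up to \<open>eps\<close> both
  sides have the form of an element times its reversal. Supports symmetric about 0 exclude a shift
  in \<open>eps\<close>, and positive constant terms exclude the sign.\<close>

lemma star1: "R * R * (E * lrev E) = (N1 * lrev N1) * (N4 * N4)"
proof -
  obtain k s where ks: "eps = Poly_Mapping.single k s" "s dvd 1" using eps by (rule laurent_unit)
  have snz: "s \<noteq> 0" using ks(2) by auto
  define U where "U = (R * E) * lrev (R * E)"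
  define V where "V = (N1 * N4) * lrev (N1 * N4)"
  have UV: "U = eps * V" using star by (simp add: U_def V_def lrev_mult syms mult_ac)
  have Unz: "U \<noteq> 0" and Vnz: "V \<noteq> 0" using all_nz by (simp_all add: U_def V_def)
  have enz: "eps \<noteq> 0" using UV Unz by auto
  have "hi U = k + hi V" "lo U = k + lo V"
    using hi_lo_mult(1,2)[OF enz Vnz] hi_lo_single[OF snz] by (simp_all add: UV ks)
  moreover have "lo U = - hi U" "lo V = - hi V"
    using symmetric_ends(1)[OF norm_sym] Unz Vnz unfolding U_def V_def by blast+
  ultimately have k: "k = 0" by linarith
  have "Poly_Mapping.lookup U 0 = s * Poly_Mapping.lookup V 0"
    unfolding UV ks k using lookup_mult_superset[of "{0}" "Poly_Mapping.single 0 s" V 0] by (simp add: lookup_single when_def)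
  then have "nsq (R * E) = s * nsq (N1 * N4)" by (simp only: nsq_eq U_def V_def)
  moreover have "nsq (R * E) > 0" "nsq (N1 * N4) > 0" using all_nz by (simp_all add: nsq_pos)
  ultimately have "s > 0" by (simp add: zero_less_mult_iff)
  then have "s = 1" using ks(2) by simp
  then have "eps = 1" by (simp add: ks k)
  then show ?thesis using star by simp
qed

lemma widths: "wd R + wd E = wd N1 + wd N4"
proof -
  have "wd (R * R * (E * lrev E)) = 2 * wd R + 2 * wd E" using all_nz lrev_nz by (simp add: wd_mult)
  moreover have "wd ((N1 * lrev N1) * (N4 * N4)) = 2 * wd N1 + 2 * wd N4" using all_nz lrev_nz by (simp add: wd_mult)
  ultimately show ?thesis using star1 by simp
qed

lemma ends_product: "\<bar>Lp R\<bar> * \<bar>Lp E\<bar> = \<bar>Lp N1\<bar> * Lp N4" "Lp N4 = (hc N4)\<^sup>2"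
proof -
  show 4: "Lp N4 = (hc N4)\<^sup>2" using symmetric_ends(2)[OF syms(1) N4_nz] by (simp add: Lp_def power2_eq_square)
  have "Lp (R * R * (E * lrev E)) = (Lp R * Lp E)\<^sup>2" using all_nz lrev_nz by (simp add: Lp_mult Lp_lrev power2_eq_square)
  moreover have "Lp ((N1 * lrev N1) * (N4 * N4)) = (Lp N1 * Lp N4)\<^sup>2" using all_nz lrev_nz by (simp add: Lp_mult Lp_lrev power2_eq_square)
  ultimately have "(Lp R * Lp E)\<^sup>2 = (Lp N1 * Lp N4)\<^sup>2" using star1 by simp
  then have "\<bar>Lp R * Lp E\<bar> = \<bar>Lp N1 * Lp N4\<bar>" by (simp only: power2_eq_iff abs_eq_iff)
  then show "\<bar>Lp R\<bar> * \<bar>Lp E\<bar> = \<bar>Lp N1\<bar> * Lp N4" by (simp add: abs_mult 4)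
qed

lemma wd_E: "wd E \<ge> 2 * wd N4 + 2 * wd d"
proof -
  have "hi E \<ge> 1 + 2 * hi (N4 * d)" "lo E \<le> 1 + 2 * lo (N4 * d)" using E_ends(2,3) by auto
  moreover have "wd (N4 * d) = wd N4 + wd d" using all_nz by (simp add: wd_mult)
  ultimately show ?thesis by (simp add: wd_def)
qed

lemma wd_even: "even (wd N4)" "even (wd R)"
  using symmetric_ends(3)[OF syms(1) N4_nz] symmetric_ends(3)[OF syms(2) R_nz] by simp_all

lemma wds: "wd N1 \<ge> 0" "wd N4 \<ge> 0" "wd R \<ge> 0" "wd E \<ge> 0" "wd d \<ge> 0" "wd h \<ge> 0" "wd f \<ge> 0"
  using all_nz by (simp_all add: wd_nonneg)

lemma hc_N4d: "hc (N4 * d) = hc N4 * hc d" "lc (N4 * d) = hc N4 * lc d"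
  using hi_lo_mult[OF N4_nz nz(3)] symmetric_ends(2)[OF syms(1) N4_nz] by simp_all

lemma lookup_N4_0: "Poly_Mapping.lookup N4 0 = nsq c + nsq f"
  unfolding N4 lookup_add nsq_eq ..

lemma N4_one: "wd N4 = 0 \<Longrightarrow> \<bar>Lp N4\<bar> = 1 \<Longrightarrow> N4 = 1"
proof -
  assume w: "wd N4 = 0" and L: "\<bar>Lp N4\<bar> = 1"
  have "hi N4 = 0" using symmetric_ends(3)[OF syms(1) N4_nz] w by simp
  then have "(Poly_Mapping.lookup N4 0)\<^sup>2 = 1" using L ends_product(2) by simp
  moreover have "Poly_Mapping.lookup N4 0 > 0" using nsq_pos[OF nz(2)] nsq_nonneg[of c] by (simp add: lookup_N4_0)
  ultimately have "Poly_Mapping.lookup N4 0 = 1" by (simp add: power2_eq_1_iff)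
  then show ?thesis using symmetric_const[OF syms(1) N4_nz w] by simp
qed

lemma N1_unit: "N1 dvd 1 \<Longrightarrow> a = 0 \<and> b dvd 1"
proof -
  assume u: "N1 dvd 1"
  have "a = 0" using parity_diff_wd_0(1)[where \<theta> = "\<lambda>f. f", OF id_\<theta> refl nz(1) N1] unit_wd[OF u] by simp
  then have "N1 = b * (- (xx * b))" by (simp add: N1 mult_ac)
  then have "b dvd N1" by (rule dvdI)
  then show ?thesis using u \<open>a = 0\<close> dvd_trans by blast
qed

text \<open>With \<open>N4 = 1\<close> the equation has the shape of \<open>norm_gap\<close> with
  \<open>G = E\<close>, so \<open>R\<close>, \<open>E\<close> and \<open>h\<close> are units. The
  constant terms of \<open>N4\<close> and \<open>R\<close> are then 1 and are sums of squares with a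
  nonzero contribution from \<open>f\<close> and \<open>N1 * h\<close>, which leaves
  \<open>c = 0\<close> and \<open>r = 0\<close>.\<close>

lemma N4_unit: "N4 = 1 \<Longrightarrow> units"
proof -
  assume N41: "N4 = 1"
  have "R * R * (E * lrev E) = N1 * lrev N1" using star1 by (simp add: N41)
  then have u: "R * (E * lrev E * (h * lrev h)) = 1" using all_nz by (intro norm_gap[OF R]) auto
  have hu: "h dvd 1" using u by (metis dvd_def mult.assoc mult.left_commute)
  have Eu: "E dvd 1" using u by (metis dvd_def mult.assoc mult.left_commute)
  have Ru: "R dvd 1" using u by (metis dvd_triv_left)
  have "lrev E dvd 1" using coeff_hom.h_dvd[OF lrev_hom Eu] by simp
  then have "R * R * (E * lrev E) dvd 1" using mult_dvd_mono[OF mult_dvd_mono[OF Ru Ru] mult_dvd_mono[OF Eu]] by simp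
  moreover have "N1 dvd R * R * (E * lrev E)" unfolding star1 by (simp add: mult.assoc)
  ultimately have "N1 dvd 1" by (rule dvd_trans[rotated])
  then have ab: "a = 0 \<and> b dvd 1" by (rule N1_unit)
  have "e = 0" using parity_diff_wd_0(1)[where \<theta> = "\<lambda>f. f", OF id_\<theta> refl N4d_nz E] unit_wd[OF Eu] by simp
  then have "E = d * (- (xx * N4 * N4 * d))" by (simp add: E mult_ac)
  then have "d dvd E" by (rule dvdI)
  then have du: "d dvd 1" using Eu by (rule dvd_trans)
  have "nsq c + nsq f = 1" using lookup_N4_0 by (simp add: N41)
  then have "\<not> nsq c > 0" using nsq_pos[OF nz(2)] by linarith
  then have c: "c = 0" using nsq_pos by blast
  then have "f * lrev f = 1" using N4 N41 by simp
  then have "f dvd 1" by (metis dvd_triv_left)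
  moreover have "r = 0"
  proof -
    have "R * lrev R dvd 1" using mult_dvd_mono[OF Ru Ru] by (simp add: syms)
    then have "\<bar>Lp R\<bar> = 1" "wd R = 0" using unit_wd[OF Ru] by auto
    then have "(Poly_Mapping.lookup R 0)\<^sup>2 = 1" using Lp_wd_0[of R] symmetric_ends(3)[OF syms(2) R_nz] by simp
    then have "nsq r + nsq (N1 * h) \<le> 1" using R0 by (auto simp: power2_eq_1_iff)
    then have "\<not> nsq r > 0" using nsq_pos[of "N1 * h"] all_nz by force
    then show ?thesis using nsq_pos by blast
  qed
  ultimately show ?thesis using ab c du hu \<open>e = 0\<close> by blast
qed

lemma e_zero_ends: "e = 0 \<Longrightarrow> Lp E = (Lp N4 * Lp d)\<^sup>2"
  using E_ends(2,3) by (auto simp: Lp_def hc_N4d symmetric_ends(2)[OF syms(1) N4_nz] power2_eq_square)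

text \<open>If \<open>N1\<close> has width 0, \<open>widths\<close> and \<open>wd_E\<close> leave no
  width for \<open>N4\<close> and \<open>E\<close>. Then \<open>e = 0\<close>, and the product of
  the end coefficients of \<open>E\<close> contains the square of that of \<open>N4\<close>, while
  \<open>ends_product\<close> allows only the first power.\<close>

lemma N1_unit_units: "N1 dvd 1 \<Longrightarrow> units"
proof -
  assume u: "N1 dvd 1"
  then have w: "wd N1 = 0" "\<bar>Lp N1\<bar> = 1" using unit_wd by blast+
  have w4: "wd N4 = 0" "wd E = 0" using widths wd_E wds w by linarith+
  have "e = 0" using parity_diff_wd_0(1)[where \<theta> = "\<lambda>f. f", OF id_\<theta> refl N4d_nz E] w4 by simp
  then have "\<bar>Lp R\<bar> * (Lp N4 * Lp d)\<^sup>2 = Lp N4" using ends_product(1) e_zero_ends w by simp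
  then have "Lp N4 * (\<bar>Lp R\<bar> * Lp N4 * (Lp d)\<^sup>2) = Lp N4 * 1" by (simp add: power2_eq_square mult_ac)
  then have "Lp N4 * (\<bar>Lp R\<bar> * (Lp d)\<^sup>2) = 1" using Lp_nz[OF N4_nz] by (simp add: mult_ac)
  then have "Lp N4 dvd 1" by (metis dvd_triv_left)
  then have "\<bar>Lp N4\<bar> = 1" by simp
  then show ?thesis using N4_unit N4_one w4 by blast
qed

lemma a_zero_units: "a = 0 \<Longrightarrow> units"
proof -
  assume a: "a = 0"
  have "b dvd a * 1" "b dvd b * 1" by (simp_all add: a)
  then have "b dvd 1" using cab unfolding cop_def by blast
  moreover have "xx dvd 1" by (rule single_unit) simp
  ultimately have "xx * b * b dvd 1" using mult_dvd_mono[of "xx * b" 1 b 1] mult_dvd_mono[of xx 1 b 1] by simp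
  then have "N1 dvd 1" by (simp add: N1 a)
  then show ?thesis by (rule N1_unit_units)
qed

lemma c_zero_units: "c = 0 \<Longrightarrow> units"
proof -
  assume c: "c = 0"
  have "f dvd c * 1" "f dvd f * 1" by (simp_all add: c)
  then have fu: "f dvd 1" using ccf unfolding cop_def by blast
  then have "lrev f dvd 1" using coeff_hom.h_dvd[OF lrev_hom fu] by simp
  then have "N4 dvd 1" using mult_dvd_mono[OF fu] by (simp add: N4 c)
  then show ?thesis using unit_wd N4_one N4_unit by blast
qed

lemma nsq_N1h: "wd N1 > 0 \<Longrightarrow> 2 * \<bar>Lp N1\<bar> \<le> nsq (N1 * h)"
proof -
  assume "wd N1 > 0"
  then have "2 * \<bar>Lp (N1 * h)\<bar> \<le> nsq (N1 * h)" using all_nz wds by (intro two_Lp_le_nsq) (simp_all add: wd_mult)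
  moreover have "\<bar>Lp N1\<bar> * 1 \<le> \<bar>Lp N1\<bar> * \<bar>Lp h\<bar>" using Lp_nz[OF nz(4)] by (intro mult_left_mono) auto
  ultimately show ?thesis using all_nz by (simp add: Lp_mult abs_mult)
qed

lemma R_const:
  assumes "wd R = 0"
  shows "R = Poly_Mapping.single 0 (Poly_Mapping.lookup R 0)" "Lp R = (Poly_Mapping.lookup R 0)\<^sup>2"
    "ev (- 1) R = Poly_Mapping.lookup R 0"
proof -
  show *: "R = Poly_Mapping.single 0 (Poly_Mapping.lookup R 0)" by (rule symmetric_const[OF syms(2) R_nz assms])
  have "hi R = 0" using symmetric_ends(3)[OF syms(2) R_nz] assms by simp
  then show "Lp R = (Poly_Mapping.lookup R 0)\<^sup>2" using Lp_wd_0[OF assms] by simp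
  show "ev (- 1) R = Poly_Mapping.lookup R 0" by (subst *) (simp add: ev_single)
qed

text \<open>A constant \<open>R\<close> is at least \<open>2 * \<bar>Lp N1\<bar>\<close>, since the
  squares of both ends of \<open>N1 * h\<close> contribute. If one end of \<open>E\<close> came from
  \<open>N4 * d\<close>, then \<open>Lp E\<close> would be at least \<open>Lp N4\<close> in absolute
  value, and \<open>ends_product\<close> would bound \<open>Lp R\<close>, hence \<open>R\<close>, by
  \<open>\<bar>Lp N1\<bar>\<close>. So \<open>e\<close> dominates \<open>E\<close> at both ends, and
  parity makes it exceed the width of the other term by 2.\<close>

lemma R_const_width:
  assumes R0w: "wd R = 0" and N1w: "wd N1 > 0"
  shows "wd N1 \<ge> wd N4 + 2 * wd d + 2"
proof (cases "hi E > 1 + 2 * hi (N4 * d) \<and> lo E < 1 + 2 * lo (N4 * d)")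
  case True
  then have "hi E = 2 * hi e" "lo E = 2 * lo e" using E_ends(2,3) by auto
  then have "hi E \<ge> 2 * hi (N4 * d) + 2" "lo E \<le> 2 * lo (N4 * d)" using True by linarith+
  moreover have "wd (N4 * d) = wd N4 + wd d" using all_nz by (simp add: wd_mult)
  ultimately have "wd E \<ge> 2 * (wd N4 + wd d) + 2" by (simp add: wd_def)
  moreover have "wd E = wd N1 + wd N4" using widths R0w by simp
  ultimately show ?thesis by simp
next
  case False
  have dnz: "(hc d)\<^sup>2 \<ge> 1" "(lc d)\<^sup>2 \<ge> 1" using hi_lo(1,2)[OF nz(3)] by (simp_all add: int_one_le_iff_zero_less)
  have nn: "(hc N4)\<^sup>2 \<ge> 0" by simp
  have Enz: "\<bar>hc E\<bar> \<ge> 1" "\<bar>lc E\<bar> \<ge> 1" using hi_lo(1,2)[OF E_ends(1)] by linarith+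
  have sq: "\<bar>- (x * y * (x * y))\<bar> = x\<^sup>2 * y\<^sup>2" "\<bar>x * y * (x * y)\<bar> = x\<^sup>2 * y\<^sup>2" for x y :: int
    by (simp_all only: abs_minus_cancel power2_eq_square[symmetric] power_mult_distrib[symmetric] abs_power2)
  have "\<bar>hc E\<bar> = (hc N4)\<^sup>2 * (hc d)\<^sup>2 \<or> \<bar>lc E\<bar> = (hc N4)\<^sup>2 * (lc d)\<^sup>2"
    using E_ends(2,3) False unfolding hc_N4d by (auto simp del: abs_mult simp: sq)
  then have "(hc N4)\<^sup>2 \<le> \<bar>hc E\<bar> \<or> (hc N4)\<^sup>2 \<le> \<bar>lc E\<bar>"
    using mult_left_mono[OF dnz(1) nn] mult_left_mono[OF dnz(2) nn] by auto
  then have "(hc N4)\<^sup>2 \<le> \<bar>Lp E\<bar>"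
  proof
    assume "(hc N4)\<^sup>2 \<le> \<bar>hc E\<bar>"
    also have "\<dots> \<le> \<bar>hc E\<bar> * \<bar>lc E\<bar>" using mult_left_mono[OF Enz(2), of "\<bar>hc E\<bar>"] by simp
    finally show ?thesis by (simp add: Lp_def abs_mult)
  next
    assume "(hc N4)\<^sup>2 \<le> \<bar>lc E\<bar>"
    also have "\<dots> \<le> \<bar>hc E\<bar> * \<bar>lc E\<bar>" using mult_right_mono[OF Enz(1), of "\<bar>lc E\<bar>"] by simp
    finally show ?thesis by (simp add: Lp_def abs_mult)
  qed
  then have "\<bar>Lp N1\<bar> * Lp N4 \<le> \<bar>Lp N1\<bar> * \<bar>Lp E\<bar>" unfolding ends_product(2) by (intro mult_left_mono) auto
  then have "\<bar>Lp R\<bar> * \<bar>Lp E\<bar> \<le> \<bar>Lp N1\<bar> * \<bar>Lp E\<bar>" using ends_product(1) by simp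
  then have le: "\<bar>Lp R\<bar> \<le> \<bar>Lp N1\<bar>" using Lp_nz[OF E_ends(1)] by simp
  have "2 * \<bar>Lp N1\<bar> \<le> Poly_Mapping.lookup R 0" using nsq_N1h[OF N1w] nsq_nonneg[of r] by (simp add: R0)
  also have "\<dots> \<le> \<bar>Lp R\<bar>" using int_sq_ge_abs[of "Poly_Mapping.lookup R 0"] by (simp add: R_const(2)[OF R0w])
  finally show ?thesis using le Lp_nz[OF N1_ends(1)] by linarith
qed

text \<open>At x = -1 reversal is invisible and \<open>xx\<close> becomes negative, so all four
  forms turn into sums of two squares. The square root of \<open>star1\<close> can therefore be
  taken without a sign.\<close>

lemma ev_values:
  shows "ev (- 1) N1 = (ev (- 1) a)\<^sup>2 + (ev (- 1) b)\<^sup>2" "ev (- 1) N4 = (ev (- 1) c)\<^sup>2 + (ev (- 1) f)\<^sup>2"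
    "ev (- 1) R = (ev (- 1) r)\<^sup>2 + (ev (- 1) N1 * ev (- 1) h)\<^sup>2"
    "ev (- 1) E = (ev (- 1) e)\<^sup>2 + (ev (- 1) N4 * ev (- 1) d)\<^sup>2"
    "ev (- 1) R * ev (- 1) E = ev (- 1) N1 * ev (- 1) N4"
    "ev (- 1) N1 > 0" "ev (- 1) N4 > 0"
proof -
  note hs = coeff_hom.h_add[OF ev1] coeff_hom.h_mult[OF ev1] coeff_hom.h_minus[OF ev1]
  show v1: "ev (- 1) N1 = (ev (- 1) a)\<^sup>2 + (ev (- 1) b)\<^sup>2" by (simp add: N1 hs power2_eq_square)
  show v4: "ev (- 1) N4 = (ev (- 1) c)\<^sup>2 + (ev (- 1) f)\<^sup>2" by (simp add: N4 hs power2_eq_square)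
  show vR: "ev (- 1) R = (ev (- 1) r)\<^sup>2 + (ev (- 1) N1 * ev (- 1) h)\<^sup>2" by (subst R) (simp add: hs power2_eq_square)
  show vE: "ev (- 1) E = (ev (- 1) e)\<^sup>2 + (ev (- 1) N4 * ev (- 1) d)\<^sup>2" by (subst E) (simp add: hs power2_eq_square)
  have "ev (- 1) (R * R * (E * lrev E)) = ev (- 1) ((N1 * lrev N1) * (N4 * N4) :: L1)" by (simp only: star1)
  then have "(ev (- 1) R * ev (- 1) E)\<^sup>2 = (ev (- 1) N1 * ev (- 1) N4)\<^sup>2" by (simp add: hs power2_eq_square mult_ac)
  then show "ev (- 1) R * ev (- 1) E = ev (- 1) N1 * ev (- 1) N4"
    by (rule power2_eq_imp_eq) (simp_all add: v1 v4 vR vE)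
  show "ev (- 1) N1 > 0" using cop_ev[OF cab] unfolding v1 by (simp add: sum_power2_gt_zero_iff)
  show "ev (- 1) N4 > 0" using cop_ev[OF ccf] unfolding v4 by (simp add: sum_power2_gt_zero_iff)
qed

text \<open>The values of \<open>R\<close> and \<open>E\<close> are at least the squares of those of
  \<open>N1\<close> and \<open>N4\<close>, yet the two products agree; positive integers with
  \<open>A\<^sup>2 * B\<^sup>2 \<le> A * B\<close> are both 1.\<close>

lemma ev_one:
  assumes "ev (- 1) h \<noteq> 0" "ev (- 1) d \<noteq> 0"
  shows "ev (- 1) N1 = 1" "ev (- 1) N4 = 1" "ev (- 1) R = 1"
proof -
  let ?A = "ev (- 1) N1" and ?B = "ev (- 1) N4" and ?R = "ev (- 1) R" and ?E = "ev (- 1) E"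
  have hd: "(ev (- 1) h)\<^sup>2 \<ge> 1" "(ev (- 1) d)\<^sup>2 \<ge> 1" using assms by (simp_all add: int_one_le_iff_zero_less)
  have R1: "?A\<^sup>2 \<le> ?R" unfolding ev_values(3) power_mult_distrib using mult_left_mono[OF hd(1) zero_le_power2[of ?A]] zero_le_power2[of "ev (- 1) r"] by linarith
  have E1: "?B\<^sup>2 \<le> ?E" unfolding ev_values(4) power_mult_distrib using mult_left_mono[OF hd(2) zero_le_power2[of ?B]] zero_le_power2[of "ev (- 1) e"] by linarith
  have "?A\<^sup>2 * ?B\<^sup>2 \<le> ?R * ?E" using R1 E1 by (intro mult_mono) (auto intro: order_trans[OF zero_le_power2])
  then have "(?A * ?B) * (?A * ?B) \<le> (?A * ?B) * 1" unfolding ev_values(5) by (simp add: power2_eq_square mult_ac)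
  then have "?A * ?B \<le> 1" using ev_values(6,7) by (simp add: mult_le_cancel_left_pos)
  moreover have "?A * 1 \<le> ?A * ?B" "1 * ?B \<le> ?A * ?B" using ev_values(6,7) by (intro mult_left_mono mult_right_mono; linarith)+
  ultimately show *: "?A = 1" "?B = 1" using ev_values(6,7) by linarith+
  then have "?R * ?E = 1" "?R \<ge> 1" using ev_values(5) R1 by simp_all
  then show "?R = 1" using pos_zmult_eq_1_iff[of ?R ?E] by linarith
qed

text \<open>Monomials do not vanish at -1, so \<open>ev_one\<close> applies and gives
  \<open>N4 = c * lrev c + 1\<close> with \<open>c\<close> vanishing at -1. A constant
  \<open>R\<close> is then 1 and makes \<open>N1\<close> a unit. Otherwise the bound 4 on the width
  of \<open>N1\<close> leaves one distribution of widths, in which the constant term of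
  \<open>R\<close> is too large for the value 1 at -1.\<close>

lemma units_width_0:
  assumes w: "wd d = 0" "wd h = 0" "wd f = 0" and N1w: "wd N1 \<le> 4"
  shows units
proof (rule ccontr)
  assume nu: "\<not> units"
  note v = ev_one[OF mono_norm(3)[OF nz(4) w(2)] mono_norm(3)[OF nz(3) w(1)]]
  have f1: "(ev (- 1) f)\<^sup>2 \<ge> 1" using mono_norm(3)[OF nz(2) w(3)] by (simp add: int_one_le_iff_zero_less)
  then have vf: "(ev (- 1) f)\<^sup>2 = 1" "(ev (- 1) c)\<^sup>2 = 0" using v(2) ev_values(2) zero_le_power2[of "ev (- 1) c"] by linarith+
  have N4c: "N4 = c * lrev c - (- 1)" using mono_norm(1,2)[OF nz(2) w(3)] vf(1) by (simp add: N4)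
  have c: "c \<noteq> 0" using c_zero_units nu by blast
  have wc: "wd c \<ge> 1" using wd_nonneg[OF c] mono_norm(3)[OF c] vf(2) by force
  have cc: "c * lrev c \<noteq> 0" "hi (c * lrev c) = wd c" using c hi_lo_mult(1)[OF c, of "lrev c"] by (simp_all add: hi_lo_lrev wd_def)
  have "hi (- 1 :: L1) = 0" unfolding single_one[symmetric] single_uminus[symmetric] by (rule hi_lo_single) simp
  then have "hi N4 = wd c" using hi_lo_diff(2)[OF cc(1), of "- 1"] cc(2) wc unfolding N4c by auto
  then have w4: "wd N4 = 2 * wd c" using symmetric_ends(3)[OF syms(1) N4_nz] by simp
  show False
  proof (cases "wd R = 0")
    case True
    then have "nsq r + nsq (N1 * h) = 1" using R_const(3) v(3) R0 by simp
    then have n: "nsq (N1 * h) \<le> 1" using nsq_nonneg[of r] by linarith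
    have N10: "wd N1 = 0" using nsq_N1h n Lp_nz[OF N1_ends(1)] wds(1) by (smt (verit))
    have "(hc N1 * hc h)\<^sup>2 \<le> 1" using nsq_ge1[of "N1 * h" "hi N1 + hi h"] hi_lo_mult(3)[OF N1_ends(1) nz(4)] n by simp
    moreover have "hc N1 * hc h \<noteq> 0" using hi_lo(1)[OF N1_ends(1)] hi_lo(1)[OF nz(4)] by simp
    ultimately have "(hc N1 * hc h)\<^sup>2 = 1" using zero_less_power2[of "hc N1 * hc h"] by linarith
    then have "(hc N1 * hc h) * (hc N1 * hc h) = 1" by (simp only: power2_eq_square)
    then have "hc N1 dvd 1" by (metis dvd_def mult.assoc)
    then have "lc N1 dvd 1" using N10 by (simp add: wd_def)
    then have "N1 dvd 1" by (subst wd_0_single[OF N1_ends(1) N10]) (rule single_unit)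
    then show False using N1_unit_units nu by blast
  next
    case False
    then have "wd R \<ge> 2" using wd_even(2) wds(3) by presburger
    \<comment> \<open>Here \<open>wd R + wd N4 \<le> wd N1 \<le> 4\<close>, and both summands on the
      left are at least 2.\<close>
    then have wE: "wd N1 = 4" "wd R = 2" "wd N4 = 2" "wd E = 4" using widths wd_E w(1) w4 wc N1w by linarith+
    have "wd (N4 * d) = 2" using all_nz wE w by (simp add: wd_mult)
    then have "hi E = 1 + 2 * hi (N4 * d) \<and> lo E = 1 + 2 * lo (N4 * d)"
      using E_ends(2,3) wE(4) by (auto simp: wd_def)
    then have "Lp E = (Lp N4 * Lp d)\<^sup>2" using E_ends(2,3)
      by (auto simp: Lp_def hc_N4d symmetric_ends(2)[OF syms(1) N4_nz] power2_eq_square)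
    then have "\<bar>Lp R\<bar> * (Lp N4 * Lp d)\<^sup>2 = \<bar>Lp N1\<bar> * Lp N4" using ends_product(1) by simp
    then have "(\<bar>Lp R\<bar> * Lp N4 * (Lp d)\<^sup>2) * Lp N4 = \<bar>Lp N1\<bar> * Lp N4" by (simp only: power2_eq_square mult_ac)
    then have eq: "\<bar>Lp R\<bar> * (Lp N4 * (Lp d)\<^sup>2) = \<bar>Lp N1\<bar>" using Lp_nz[OF N4_nz] by (simp add: mult_ac)
    have "Lp N4 * (Lp d)\<^sup>2 > 0" using Lp_nz[OF N4_nz] Lp_nz[OF nz(3)] ends_product(2) by (simp add: zero_less_mult_iff)
    then have "\<bar>Lp R\<bar> * 1 \<le> \<bar>Lp R\<bar> * (Lp N4 * (Lp d)\<^sup>2)" by (intro mult_left_mono) auto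
    then have RN: "\<bar>Lp R\<bar> \<le> \<bar>Lp N1\<bar>" using eq by simp
    define P where "P = N1 * h"
    have P: "P \<noteq> 0" "wd P = 4" using all_nz wE w by (simp_all add: P_def wd_mult)
    have "\<bar>Lp N1\<bar> * 1 \<le> \<bar>Lp N1\<bar> * \<bar>Lp h\<bar>" using Lp_nz[OF nz(4)] by (intro mult_left_mono) auto
    then have RP: "\<bar>Lp R\<bar> \<le> \<bar>Lp P\<bar>" using RN Lp_mult[OF N1_ends(1) nz(4)] by (simp add: P_def abs_mult)
    have norm_end: "hi (g * lrev g) = wd g \<and> Poly_Mapping.lookup (g * lrev g) (wd g) = Lp g" if "g \<noteq> 0" for g :: L1
      using hi_lo_mult(1,3)[OF that, of "lrev g"] that by (simp add: hi_lo_lrev wd_def lookup_lrev Lp_def)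
    have hR: "hi R = 1" using symmetric_ends(3)[OF syms(2) R_nz] wE by simp
    have rr: "r * lrev r = R - P * lrev P" by (simp add: R P_def)
    have PP: "P * lrev P \<noteq> 0" "hi (P * lrev P) = 4" "Poly_Mapping.lookup (P * lrev P) 4 = Lp P" using P norm_end[OF P(1)] by simp_all
    \<comment> \<open>\<open>R\<close> has top degree 1, so the degree 4 end of
      \<open>P * lrev P\<close> has to be cancelled by that of \<open>r * lrev r\<close>. Hence
      \<open>r\<close> is as wide as \<open>P\<close>, and both feed the constant term of
      \<open>R\<close>.\<close>
    have "hi (r * lrev r) = 4 \<and> Poly_Mapping.lookup (r * lrev r) 4 = - Lp P"
      using hi_lo_diff(1)[OF PP(1), of R] PP hR unfolding rr by simp
    moreover from this have r: "r \<noteq> 0" using Lp_nz[OF P(1)] by auto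
    ultimately have r4: "wd r = 4" "Lp r = - Lp P" using norm_end[OF r] by simp_all
    have "2 * \<bar>Lp P\<bar> \<le> nsq r" "2 * \<bar>Lp P\<bar> \<le> nsq P" using two_Lp_le_nsq[OF r] two_Lp_le_nsq[OF P(1)] r4 P by simp_all
    then have big: "4 * \<bar>Lp R\<bar> \<le> Poly_Mapping.lookup R 0" using RP R0 by (simp add: P_def)
    define \<rho> where "\<rho> = Poly_Mapping.lookup R 1"
    have Rm: "Poly_Mapping.lookup R (- 1) = \<rho>" using lookup_lrev[of R 1] by (simp add: syms \<rho>_def)
    have \<rho>: "\<rho> \<noteq> 0" using hi_lo(1)[OF R_nz] hR by (simp add: \<rho>_def)
    have "Lp R = \<rho> * \<rho>" using symmetric_ends(1)[OF syms(2) R_nz] hR Rm by (simp add: Lp_def \<rho>_def)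
    then have big': "4 * (\<rho> * \<rho>) \<le> Poly_Mapping.lookup R 0" using big by simp
    have "Poly_Mapping.lookup R i = 0" if "i \<notin> {- 1, 0, 1}" for i
      using hi_lo(3)[OF R_nz, of i] symmetric_ends(1)[OF syms(2) R_nz] hR that by force
    then have "ev (- 1) R = (\<Sum>i\<in>{- 1, 0, 1}. Poly_Mapping.lookup R i * pw (- 1) (- 1) i)" by (intro ev_eq_sum) auto
    \<comment> \<open>The value 1 at -1 is the constant term minus \<open>2 * \<rho>\<close>. With
      \<open>4 * (\<rho> * \<rho>)\<close> as a lower bound of the constant term no nonzero integer
      \<open>\<rho>\<close> is left.\<close>
    then have "Poly_Mapping.lookup R 0 = 1 + 2 * \<rho>" using v(3) Rm by (simp add: \<rho>_def)
    moreover have "\<bar>\<rho>\<bar> \<le> \<rho> * \<rho>" using int_sq_ge_abs[of \<rho>] by (simp add: power2_eq_square)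
    ultimately show False using big' \<rho> by linarith
  qed
qed

text \<open>If \<open>R\<close> is not constant, widths force \<open>e = 0\<close>, and
  \<open>norm_gap\<close> for the equation freed of \<open>N4 * N4\<close> makes \<open>N4\<close> a
  unit. If \<open>R\<close> is constant, \<open>R_const_width\<close> leaves \<open>N4\<close> a
  constant \<open>\<gamma>\<close>; were it at least 2, \<open>ev_one\<close> would make
  \<open>h\<close> a constant times \<open>1 + xx\<close> up to a shift, and the coefficients of
  \<open>N1 * h\<close> would make \<open>R\<close> too large compared with the value of
  \<open>N1\<close> at -1.\<close>

lemma units_width_1:
  assumes a: "a \<noteq> 0" and N1w: "wd N1 \<le> 2" and h1: "wd h \<le> 1"
  shows units
proof (rule ccontr)
  assume nu: "\<not> units"
  have "wd N1 \<noteq> 0" using parity_diff_wd_0(1)[where \<theta> = "\<lambda>f. f", OF id_\<theta> refl nz(1) N1] a by blast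
  then have N1p: "wd N1 > 0" using wds(1) by linarith
  show False
  proof (cases "wd R = 0")
    case False
    then have "wd R \<ge> 2" using wd_even(2) wds(3) by presburger
    then have w: "wd N4 = 0" "wd E = 0" using widths wd_E wds N1w by linarith+
    have e: "e = 0" using parity_diff_wd_0(1)[where \<theta> = "\<lambda>f. f", OF id_\<theta> refl N4d_nz E] w by simp
    \<comment> \<open>With \<open>e = 0\<close> one has \<open>E = - (xx * N4 * G)\<close>, so
      \<open>N4 * N4\<close> cancels from \<open>star1\<close> while a copy of \<open>N4\<close>
      remains inside \<open>G\<close>.\<close>
    define G where "G = N4 * d * d"
    have "E * lrev E = (xx * xi) * ((N4 * N4) * (G * lrev G))"
      by (simp add: E e G_def lrev_mult lrev_uminus syms mult_ac)
    then have EG: "E * lrev E = (N4 * N4) * (G * lrev G)" by (simp add: mult_single)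
    have "(N4 * N4) * (R * R * (G * lrev G)) = (N4 * N4) * (N1 * lrev N1)" using star1 unfolding EG by (simp add: mult_ac)
    then have "R * R * (G * lrev G) = N1 * lrev N1" using N4_nz by simp
    then have "R * (G * lrev G * (h * lrev h)) = 1" using all_nz by (intro norm_gap[OF R]) (auto simp: G_def)
    then have "N4 * (R * (d * d * lrev G * (h * lrev h))) = 1" by (simp add: G_def mult_ac)
    then have "N4 dvd 1" by (metis dvd_triv_left)
    then show False using unit_wd N4_one N4_unit nu by blast
  next
    case True
    have w: "wd N4 = 0" "wd d = 0" "wd N1 = 2" using R_const_width[OF True N1p] wds N1w by linarith+
    define \<gamma> where "\<gamma> = Poly_Mapping.lookup N4 0"
    have N4\<gamma>: "N4 = Poly_Mapping.single 0 \<gamma>" unfolding \<gamma>_def by (rule symmetric_const[OF syms(1) N4_nz w(1)])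
    have v4: "ev (- 1) N4 = \<gamma>" by (subst N4\<gamma>) (simp add: ev_single)
    have "\<gamma> > 0" using v4 ev_values(7) by simp
    moreover have "\<gamma> \<noteq> 1" using N4_unit nu N4\<gamma> by auto
    ultimately have \<gamma>: "\<gamma> \<ge> 2" by linarith
    have vd: "ev (- 1) d \<noteq> 0" by (rule mono_norm(3)[OF nz(3) w(2)])
    have vh: "ev (- 1) h = 0" using ev_one(2)[OF _ vd] v4 \<gamma> by force
    have wh: "wd h = 1" using mono_norm(3)[OF nz(4)] vh h1 wds(6) by force
    define k where "k = lc h"
    have k: "k \<noteq> 0" using hi_lo(2)[OF nz(4)] by (simp add: k_def)
    have hh: "hi h = lo h + 1" using wh by (simp add: wd_def)
    have hz: "Poly_Mapping.lookup h i = 0" if "i \<notin> {lo h, lo h + 1}" for i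
      using hi_lo(3)[OF nz(4), of i] hh that by force
    have "ev (- 1) h = (\<Sum>i\<in>{lo h, lo h + 1}. Poly_Mapping.lookup h i * pw (- 1) (- 1) i)" by (rule ev_eq_sum) (use hz in auto)
    then have k': "Poly_Mapping.lookup h (lo h + 1) = k" using vh by (simp add: k_def split: if_splits)
    have lP: "Poly_Mapping.lookup (N1 * h) (lo h + n) = k * (Poly_Mapping.lookup N1 n + Poly_Mapping.lookup N1 (n - 1))" for n
    proof -
      have "Poly_Mapping.lookup (h * N1) (lo h + n) = (\<Sum>i\<in>{lo h, lo h + 1}. Poly_Mapping.lookup h i * Poly_Mapping.lookup N1 (lo h + n - i))"
        by (rule lookup_mult_superset) (use hz in auto)
      also have "\<dots> = k * (Poly_Mapping.lookup N1 n + Poly_Mapping.lookup N1 (n - 1))" by (simp add: k' k_def[symmetric] distrib_left)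
      finally show ?thesis by (simp add: mult.commute)
    qed
    define m where "m = lo N1"
    define p where "p = Poly_Mapping.lookup N1 m"
    define q where "q = Poly_Mapping.lookup N1 (m + 1)"
    define s where "s = Poly_Mapping.lookup N1 (m + 2)"
    have hN: "hi N1 = m + 2" using w(3) by (simp add: wd_def m_def)
    have s: "s \<noteq> 0" using hi_lo(1)[OF N1_ends(1)] by (simp add: s_def hN)
    have Nz: "Poly_Mapping.lookup N1 i = 0" if "i \<notin> {m, m + 1, m + 2}" for i
      using hi_lo(3)[OF N1_ends(1), of i] hN that m_def by force
    \<comment> \<open>Three of the four coefficients of \<open>N1 * h\<close>; the omitted one is
      \<open>k * (s + q)\<close>.\<close>
    have "(\<Sum>i\<in>{lo h + m, lo h + (m + 1), lo h + (m + 3)}. (Poly_Mapping.lookup (N1 * h) i)\<^sup>2) \<le> nsq (N1 * h)" by (rule nsq_ge_sum) simp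
    then have sq: "(k * p)\<^sup>2 + (k * (q + p))\<^sup>2 + (k * s)\<^sup>2 \<le> nsq (N1 * h)"
      unfolding lP using Nz[of "m - 1"] Nz[of "m + 3"] by (simp add: lP p_def q_def s_def add.commute[of m 2] add.assoc)
    have "k\<^sup>2 \<ge> 1" using k by (simp add: int_one_le_iff_zero_less)
    then have "1 * (p\<^sup>2 + (q + p)\<^sup>2 + s\<^sup>2) \<le> k\<^sup>2 * (p\<^sup>2 + (q + p)\<^sup>2 + s\<^sup>2)" by (intro mult_right_mono) auto
    also have "\<dots> = (k * p)\<^sup>2 + (k * (q + p))\<^sup>2 + (k * s)\<^sup>2"
      unfolding power_mult_distrib by (simp only: distrib_left)
    also note sq
    also have "nsq (N1 * h) \<le> ev (- 1) R" using nsq_nonneg[of r] R0 unfolding R_const(3)[OF True] by linarith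
    finally have \<rho>: "p\<^sup>2 + (q + p)\<^sup>2 + s\<^sup>2 \<le> ev (- 1) R" by simp
    have "ev (- 1) N1 = (\<Sum>i\<in>{m, m + 1, m + 2}. Poly_Mapping.lookup N1 i * pw (- 1) (- 1) i)" by (rule ev_eq_sum) (use Nz in auto)
    then have "\<bar>ev (- 1) N1\<bar> = \<bar>p - q + s\<bar>" by (simp add: p_def q_def s_def split: if_splits)
    then have v1: "ev (- 1) N1 \<le> \<bar>p\<bar> + \<bar>q\<bar> + \<bar>s\<bar>" by linarith
    have "(ev (- 1) d)\<^sup>2 \<ge> 1" using vd by (simp add: int_one_le_iff_zero_less)
    then have "\<gamma>\<^sup>2 * 1 \<le> \<gamma>\<^sup>2 * (ev (- 1) d)\<^sup>2" by (intro mult_left_mono) auto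
    then have "\<gamma>\<^sup>2 \<le> ev (- 1) E" unfolding ev_values(4) v4 power_mult_distrib using zero_le_power2[of "ev (- 1) e"] by linarith
    then have "ev (- 1) R * \<gamma>\<^sup>2 \<le> ev (- 1) R * ev (- 1) E" by (rule mult_left_mono) (simp add: ev_values(3))
    then have "\<gamma> * (ev (- 1) R * \<gamma>) \<le> \<gamma> * ev (- 1) N1" unfolding ev_values(5) v4 by (simp add: power2_eq_square mult_ac)
    then have "ev (- 1) R * \<gamma> \<le> ev (- 1) N1" using \<gamma> by simp
    moreover have "ev (- 1) R * 2 \<le> ev (- 1) R * \<gamma>" by (rule mult_left_mono[OF \<gamma>]) (simp add: ev_values(3))
    ultimately have R2: "2 * ev (- 1) R \<le> ev (- 1) N1" by linarith
    \<comment> \<open>The contradiction rests on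
      \<open>\<bar>q\<bar> \<le> \<bar>p\<bar> + \<bar>q + p\<bar>\<close>: twice the three squares
      cannot be at most \<open>2 * \<bar>p\<bar> + \<bar>q + p\<bar> + \<bar>s\<bar>\<close> when
      \<open>s \<noteq> 0\<close>.\<close>
    obtain w where w: "w = (q + p)\<^sup>2" by blast
    have w0: "\<bar>q + p\<bar> \<le> w" "0 \<le> w" using int_sq_ge_abs[of "q + p"] by (simp_all add: w)
    have s0: "s\<^sup>2 > 0" using s by simp
    show False using R2 w0 s0 \<rho>[folded w] v1 int_sq_ge_abs[of p] int_sq_ge_abs[of s] by linarith
  qed
qed

text \<open>\<open>S\<close> collects the remaining factors of two extremal coefficients, so the
  hypotheses are the bounds of the ball on their exponents. Two admissible exponents for
  \<open>a * S\<close> give \<open>wd S \<le> 1\<close>, and the ends of \<open>N1\<close> give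
  \<open>wd N1 + 2 * wd S \<le> 4\<close>; the cases \<open>wd S = 0\<close> and
  \<open>wd S = 1\<close> are the two preceding lemmas.\<close>

theorem line_units:
  assumes S: "S \<noteq> 0" "wd S = wd d + wd h + wd f"
    and aS: "\<And>i. Poly_Mapping.lookup (a * S) i \<noteq> 0 \<Longrightarrow> - 1 \<le> i \<and> i \<le> 0"
    and bS: "\<And>i. Poly_Mapping.lookup (xx * b * S) i \<noteq> 0 \<Longrightarrow> - 1 \<le> i \<and> i \<le> 1"
  shows units
proof (cases "a = 0")
  case True
  then show ?thesis by (rule a_zero_units)
next
  case False
  have "hi a + hi S \<le> 0" "lo a + lo S \<ge> - 1"
    using aS[of "hi (a * S)"] aS[of "lo (a * S)"] hi_lo(1,2)[of "a * S"] False S(1) hi_lo_mult(1,2)[OF False S(1)] by auto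
  note A = this
  have xb: "xx * b \<noteq> 0" "hi (xx * b) = 1 + hi b" "lo (xx * b) = 1 + lo b"
    using nz(1) hi_lo_mult(1,2)[OF single_1_nz[of 1] nz(1)] by simp_all
  have "1 + hi b + hi S \<le> 1" "1 + lo b + lo S \<ge> - 1"
    using bS[of "hi (xx * b * S)"] bS[of "lo (xx * b * S)"] hi_lo(1,2)[of "xx * b * S"] nz(1) S(1) hi_lo_mult(1,2)[OF xb(1) S(1)] xb by auto
  note B = this
  have "hi N1 \<le> 1 - 2 * hi S" "lo N1 \<ge> - 3 - 2 * lo S" using N1_ends(2,3) A B by auto
  then have N1w: "wd N1 + 2 * wd S \<le> 4" by (simp add: wd_def)
  have aw: "wd a + wd S \<le> 1" "wd a \<ge> 0" using A wd_nonneg[OF False] by (simp_all add: wd_def)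
  show ?thesis
  proof (cases "wd S = 0")
    case True
    then show ?thesis using units_width_0 S(2) wds(5-7) N1w by simp
  next
    case wS: False
    then have "wd S = 1" using aw wd_nonneg[OF S(1)] by linarith
    then show ?thesis using units_width_1[OF False] S(2) wds(5-7) N1w by simp
  qed
qed

end

section \<open>Units of small length\<close>

definition mono_at :: "(int \<Rightarrow> 'a::comm_ring_1) \<Rightarrow> int \<Rightarrow> bool" where
  "mono_at c n \<longleftrightarrow> c n dvd 1 \<and> (\<forall>m. m \<noteq> n \<longrightarrow> c m = 0)"

text \<open>What multiplication by a generator does to the coefficients: an involution on levels, up
  to automorphisms and units, which is all that vanishing and being a unit can see.\<close>

definition relabel :: "(int \<Rightarrow> int) \<Rightarrow> (int \<Rightarrow> 'a::comm_ring_1) \<Rightarrow> (int \<Rightarrow> 'a) \<Rightarrow> bool" where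
  "relabel s c c' \<longleftrightarrow> (\<forall>k. s (s k) = k) \<and> (\<forall>k. c' k = 0 \<longleftrightarrow> c (s k) = 0) \<and> (\<forall>k. c' k dvd 1 \<longleftrightarrow> c (s k) dvd 1)"

lemma relabel_mono: "relabel s c c' \<Longrightarrow> \<exists>n. mono_at c' n \<Longrightarrow> \<exists>n. mono_at c n"
  unfolding relabel_def mono_at_def by metis

text \<open>The level that right multiplication by an element of odd level \<open>l\<close> carries
  to \<open>k\<close>.\<close>

definition gen_flip :: "int \<Rightarrow> int \<Rightarrow> int" where
  "gen_flip l k = (if odd k then k - l else k + l)"

lemma gen_flip_iff: "odd l \<Longrightarrow> sgn_par n * (k - n) = l \<longleftrightarrow> n = gen_flip l k"
  unfolding sgn_par_def gen_flip_def by (cases "odd k"; cases "odd n"; simp; presburger)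

context twisted
begin

lemma mm_unit: "mm n m dvd 1"
proof -
  have "X dvd 1" "Xi dvd 1" "Y dvd 1" "Yi dvd 1" by (metis XXi'(1-4) dvd_triv_left)+
  then show ?thesis using mult_dvd_mono[of X 1 Yi 1] mult_dvd_mono[of Xi 1 Y 1] by (simp add: mm_def)
qed

lemma unit_mult_iff: "b dvd 1 \<Longrightarrow> a * b dvd 1 \<longleftrightarrow> a dvd (1::'a)"
  using mult_dvd_mono[of a 1 b 1] by (metis dvd_mult_left mult_1)

lemma unit_nz: "b dvd 1 \<Longrightarrow> b \<noteq> (0::'a)"
  by auto

lemma relabel_left: "relabel (\<lambda>k. 1 - k) (cf u) (cf (Poly_Mapping.single pa 1 * u))"
proof -
  have c: "cf (Poly_Mapping.single pa 1 * u) k = \<sigma> (cf u (1 - k)) * mm 1 (1 - k)" for k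
    by (subst cf_mult[where N = "{1}"]) (auto simp: cf_def mon_gens lev_gens phi_def sgn_par_def)
  have s: "\<sigma> a dvd 1 \<longleftrightarrow> a dvd 1" for a by (metis \<sigma>\<sigma> \<sigma>_1 \<sigma>_mult dvd_def)
  show ?thesis unfolding relabel_def c using unit_nz[OF mm_unit] by (simp add: s unit_mult_iff[OF mm_unit])
qed

lemma relabel_right:
  assumes l: "odd (lev g)" and m: "mon g = 1"
  shows "relabel (gen_flip (lev g)) (cf u) (cf (u * Poly_Mapping.single g 1))"
proof -
  have c: "cf (u * Poly_Mapping.single g 1) k = cf u (gen_flip (lev g) k) * mm (gen_flip (lev g) k) (lev g)" for k
  proof -
    let ?n = "gen_flip (lev g) k"
    let ?N = "{n. cf u n \<noteq> 0} \<union> {?n}"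
    have e: "sgn_par n * (k - n) = lev g \<longleftrightarrow> n = ?n" for n
      by (rule gen_flip_iff[OF l])
    have "cf (u * Poly_Mapping.single g 1) k = (\<Sum>n\<in>?N. cf u n * phi n (cf (Poly_Mapping.single g 1) (sgn_par n * (k - n))) * mm n (sgn_par n * (k - n)))"
      by (rule cf_mult) (use finite_cf[of u] in auto)
    also have "\<dots> = (\<Sum>n\<in>?N. if n = ?n then cf u n * mm n (lev g) else 0)"
    proof (rule sum.cong[OF refl])
      fix n
      show "cf u n * phi n (cf (Poly_Mapping.single g 1) (sgn_par n * (k - n))) * mm n (sgn_par n * (k - n)) = (if n = ?n then cf u n * mm n (lev g) else 0)"
      proof (cases "n = ?n")
        case True
        then have s: "sgn_par n * (k - n) = lev g" using e by blast
        have "phi n 1 = 1" using phi_hom(2)[of n 1] by simp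
        then show ?thesis unfolding s using True by (simp add: cf_def m)
      next
        case False
        then have "sgn_par n * (k - n) \<noteq> lev g" using e by blast
        then show ?thesis using False by (simp add: cf_def phi_hom)
      qed
    qed
    also have "\<dots> = cf u ?n * mm ?n (lev g)" using finite_cf[of u] by simp
    finally show ?thesis .
  qed
  have s: "gen_flip (lev g) (gen_flip (lev g) k) = k" for k using l by (simp add: gen_flip_def)
  show ?thesis unfolding relabel_def c using unit_nz[OF mm_unit] by (simp add: s unit_mult_iff[OF mm_unit])
qed

lemmas relabel_pa = relabel_right[of pa, unfolded mon_gens lev_gens, simplified]
lemmas relabel_pb = relabel_right[of pb, unfolded mon_gens lev_gens, simplified]

text \<open>Only seven levels are occupied here, while \<open>rigid\<close> allows eight.
  Multiplying by a generator moves a nonzero coefficient to level 4 with -3 or 3 empty, or to a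
  level treated at an earlier stage; the stages \<open>S1\<close> to \<open>S4\<close> take the
  levels inwards.\<close>

lemma short_mono:
  assumes rigid: "\<And>u v. u * v = 1 \<Longrightarrow> (\<And>n. n < - 3 \<Longrightarrow> cf u n = 0) \<Longrightarrow> (\<And>n. n > 4 \<Longrightarrow> cf u n = 0) \<Longrightarrow> cf u 4 \<noteq> 0 \<Longrightarrow>
      cf u (- 3) = 0 \<or> cf u 3 = 0 \<Longrightarrow> mono_at (cf u) 4"
    and uv: "u * v = 1" and short: "\<And>n. n < - 3 \<or> n > 3 \<Longrightarrow> cf u n = 0"
  shows "\<exists>n. mono_at (cf u) n"
proof -
  have inv: "(Poly_Mapping.single pa 1 * u) * (v * Poly_Mapping.single (- pa) 1) = 1"
    "(u * Poly_Mapping.single g 1) * (Poly_Mapping.single (- g) 1 * v) = 1" if "u * v = 1" for u v :: ZP and g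
  proof -
    have "(Poly_Mapping.single pa 1 * u) * (v * Poly_Mapping.single (- pa) 1) = Poly_Mapping.single pa 1 * (u * v) * Poly_Mapping.single (- pa) 1"
      by (simp only: mult.assoc)
    then show "(Poly_Mapping.single pa 1 * u) * (v * Poly_Mapping.single (- pa) 1) = 1" by (simp add: that mult_single)
    have "(u * Poly_Mapping.single g 1) * (Poly_Mapping.single (- g) 1 * v) = u * (Poly_Mapping.single g 1 * Poly_Mapping.single (- g) 1) * v"
      by (simp only: mult.assoc)
    then show "(u * Poly_Mapping.single g 1) * (Poly_Mapping.single (- g) 1 * v) = 1" by (simp add: that mult_single)
  qed
  \<comment> \<open>Left multiplication by a moves level -3 to 4 and leaves -3 empty.\<close>
  have S1: "\<exists>n. mono_at (cf u) n" if uv: "u * v = 1" and short: "\<And>n. n < - 3 \<or> n > 3 \<Longrightarrow> cf u n = 0" and B: "cf u (- 3) \<noteq> 0" for u v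
  proof -
    let ?u = "Poly_Mapping.single pa 1 * u"
    have z: "cf ?u k = 0 \<longleftrightarrow> cf u (1 - k) = 0" for k using relabel_left[of u] by (simp add: relabel_def)
    have "mono_at (cf ?u) 4"
      by (rule rigid[OF inv(1)[OF uv]]) (use z short B in auto)
    then show ?thesis using relabel_mono[OF relabel_left] by blast
  qed
  \<comment> \<open>Right multiplication by b moves level 3 to 4 and leaves 3 empty.\<close>
  have S2: "\<exists>n. mono_at (cf u) n" if uv: "u * v = 1" and short: "\<And>n. n < - 3 \<or> n > 3 \<Longrightarrow> cf u n = 0" and C: "cf u (- 3) \<noteq> 0 \<or> cf u 3 \<noteq> 0" for u v
  proof (cases "cf u (- 3) = 0")
    case True
    let ?u = "u * Poly_Mapping.single pb 1"
    have z: "cf ?u k = 0 \<longleftrightarrow> cf u (gen_flip (- 1) k) = 0" for k using relabel_pb[of u] by (simp add: relabel_def)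
    have s: "gen_flip (- 1) 4 = 3" "gen_flip (- 1) 3 = 4" by (simp_all add: gen_flip_def)
    have o: "cf u (gen_flip (- 1) k) = 0" if "k < - 3 \<or> k > 4" for k
    proof (cases "gen_flip (- 1) k = - 3")
      case False
      then have "gen_flip (- 1) k < - 3 \<or> gen_flip (- 1) k > 3" using that by (simp add: gen_flip_def split: if_splits) presburger+
      then show ?thesis by (rule short)
    qed (simp add: True)
    have "mono_at (cf ?u) 4"
      by (rule rigid[OF inv(2)[OF uv]]) (use z o short C True in \<open>auto simp: s\<close>)
    then show ?thesis using relabel_mono[OF relabel_pb] by blast
  qed (rule S1[OF uv short])
  \<comment> \<open>Right multiplication by b moves level -2 to -3.\<close>
  have S3: "\<exists>n. mono_at (cf u) n" if uv: "u * v = 1" and short: "\<And>n. n < - 3 \<or> n > 3 \<Longrightarrow> cf u n = 0" and C: "cf u (- 3) \<noteq> 0 \<or> cf u 3 \<noteq> 0 \<or> cf u (- 2) \<noteq> 0" for u v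
  proof (cases "cf u (- 3) = 0 \<and> cf u 3 = 0")
    case True
    let ?u = "u * Poly_Mapping.single pb 1"
    have z: "cf ?u k = 0 \<longleftrightarrow> cf u (gen_flip (- 1) k) = 0" for k using relabel_pb[of u] by (simp add: relabel_def)
    have "cf u (gen_flip (- 1) k) = 0" if "k < - 3 \<or> k > 3" for k
    proof (cases "gen_flip (- 1) k = - 3 \<or> gen_flip (- 1) k = 3")
      case False
      then have "gen_flip (- 1) k < - 3 \<or> gen_flip (- 1) k > 3" using that by (simp add: gen_flip_def split: if_splits) presburger+
      then show ?thesis by (rule short)
    qed (use True in auto)
    moreover have "cf ?u (- 3) \<noteq> 0" unfolding z using C True by (simp add: gen_flip_def)
    ultimately have "\<exists>n. mono_at (cf ?u) n" by (intro S1[OF inv(2)[OF uv]]) (simp_all add: z)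
    then show ?thesis by (rule relabel_mono[OF relabel_pb])
  qed (rule S2[OF uv short], use C in auto)
  \<comment> \<open>Right multiplication by a moves level 2 to 3 and -1 to -2.\<close>
  have S4: "\<exists>n. mono_at (cf u) n" if uv: "u * v = 1" and short: "\<And>n. n < - 3 \<or> n > 3 \<Longrightarrow> cf u n = 0" and C: "cf u (- 3) \<noteq> 0 \<or> cf u 3 \<noteq> 0 \<or> cf u (- 2) \<noteq> 0 \<or> cf u 2 \<noteq> 0 \<or> cf u (- 1) \<noteq> 0" for u v
  proof (cases "cf u (- 3) = 0 \<and> cf u 3 = 0 \<and> cf u (- 2) = 0")
    case True
    let ?u = "u * Poly_Mapping.single pa 1"
    have z: "cf ?u k = 0 \<longleftrightarrow> cf u (gen_flip 1 k) = 0" for k using relabel_pa[of u] by (simp add: relabel_def)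
    have "cf u (gen_flip 1 k) = 0" if "k < - 3 \<or> k > 3" for k
    proof (cases "gen_flip 1 k = - 3 \<or> gen_flip 1 k = 3 \<or> gen_flip 1 k = - 2")
      case False
      then have "gen_flip 1 k < - 3 \<or> gen_flip 1 k > 3" using that by (simp add: gen_flip_def split: if_splits) presburger+
      then show ?thesis by (rule short)
    qed (use True in auto)
    moreover have "cf ?u 3 \<noteq> 0 \<or> cf ?u (- 2) \<noteq> 0" unfolding z using C True by (simp add: gen_flip_def)
    ultimately have "\<exists>n. mono_at (cf ?u) n" by (intro S3[OF inv(2)[OF uv]]) (auto simp: z)
    then show ?thesis by (rule relabel_mono[OF relabel_pa])
  qed (rule S3[OF uv short], use C in auto)
  show ?thesis
  proof (cases "cf u (- 3) \<noteq> 0 \<or> cf u 3 \<noteq> 0 \<or> cf u (- 2) \<noteq> 0 \<or> cf u 2 \<noteq> 0 \<or> cf u (- 1) \<noteq> 0")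
    case False
    let ?u = "u * Poly_Mapping.single pb 1"
    have z: "cf ?u k = 0 \<longleftrightarrow> cf u (gen_flip (- 1) k) = 0" for k using relabel_pb[of u] by (simp add: relabel_def)
    have o: "cf u k = 0" if "k \<noteq> 0" "k \<noteq> 1" for k
    proof (cases "k < - 3 \<or> k > 3")
      case False
      then have "k \<in> {- 3, - 2, - 1, 2, 3}" using that by auto
      then show ?thesis using \<open>\<not> (cf u (- 3) \<noteq> 0 \<or> cf u 3 \<noteq> 0 \<or> cf u (- 2) \<noteq> 0 \<or> cf u 2 \<noteq> 0 \<or> cf u (- 1) \<noteq> 0)\<close> by auto
    qed (rule short)
    have "cf u 0 \<noteq> 0 \<or> cf u 1 \<noteq> 0"
    proof (rule ccontr)
      assume "\<not> ?thesis"
      then have "cf u n = 0" for n using o by (cases "n = 0 \<or> n = 1") auto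
      then have "cf (u * v) 0 = 0" by (subst cf_mult[where N = "{}"]) auto
      then show False by (simp add: uv cf_one)
    qed
    \<comment> \<open>Right multiplication by b moves level 1 to 2 and 0 to -1.\<close>
    then have "cf ?u 2 \<noteq> 0 \<or> cf ?u (- 1) \<noteq> 0" unfolding z by (auto simp: gen_flip_def)
    moreover have "cf u (gen_flip (- 1) k) = 0" if "k < - 3 \<or> k > 3" for k
      by (rule o) (use that in \<open>auto simp: gen_flip_def split: if_splits\<close>)
    ultimately have "\<exists>n. mono_at (cf ?u) n" by (intro S4[OF inv(2)[OF uv]]) (auto simp: z)
    then show ?thesis by (rule relabel_mono[OF relabel_pb])
  qed (rule S4[OF uv short])
qed

end

subsection \<open>The lines\<close>

lemma dvd_1_mult: "a dvd 1 \<Longrightarrow> b dvd 1 \<Longrightarrow> a * b dvd (1::'a::comm_ring_1)"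
  using mult_dvd_mono[of a 1 b 1] by simp

lemma lrev_dvd_1 [simp]: "lrev f dvd 1 \<longleftrightarrow> f dvd 1"
  using coeff_hom.h_dvd[OF lrev_hom, of f 1] coeff_hom.h_dvd[OF lrev_hom, of "lrev f" 1] by auto

lemma mult_dvd_1_iff: "a * b dvd 1 \<longleftrightarrow> a dvd 1 \<and> b dvd (1::'a::comm_ring_1)"
  using dvd_1_mult by (metis dvd_mult_left dvd_mult_right)

lemma single_dvd_1 [simp]: "Poly_Mapping.single i 1 dvd (1 :: 'r::comm_ring_1 laurent)"
  by (rule single_unit) simp

text \<open>The first two alternatives of \<open>narrow\<close> make \<open>\<alpha>1\<close> or
  \<open>\<alpha>4\<close> vanish and serve \<open>short_mono\<close>; the third is what the ball
  provides.\<close>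

lemma line_Y:
  assumes uv: "u * v = 1" and supp: "\<And>n. n < - 3 \<Longrightarrow> cfY u n = 0" "\<And>n. n > 4 \<Longrightarrow> cfY u n = 0" and T: "cfY u 4 \<noteq> 0"
    and narrow: "cfY u (- 3) = 0 \<or> cfY u 3 = 0 \<or>
      (\<forall>i. Poly_Mapping.lookup (cfY u (- 3)) i \<noteq> 0 \<longrightarrow> - 1 \<le> i \<and> i \<le> 0) \<and> (\<forall>i. Poly_Mapping.lookup (cfY u 4) i \<noteq> 0 \<longrightarrow> - 1 \<le> i \<and> i \<le> 1)"
  shows "mono_at (cfY u) 4"
proof (rule structure_Y[OF uv supp T])
  fix \<alpha>1 \<beta>1 \<alpha>4 \<beta>4 d h r e :: L1
  let ?n1 = "\<alpha>1 * \<alpha>1 - xx * \<beta>1 * \<beta>1" and ?n4 = "\<alpha>4 * lrev \<alpha>4 - - 1 * \<beta>4 * lrev \<beta>4"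
  let ?R = "r * lrev r - - 1 * (?n1 * h) * lrev (?n1 * h)" and ?E = "e * e - xx * (?n4 * lrev d) * (?n4 * lrev d)"
  assume c: "cop \<alpha>1 \<beta>1" "cop \<alpha>4 \<beta>4" and B: "cfY u (- 3) = \<alpha>1 * (d * h) * lrev \<beta>4"
    and C: "cfY u 3 = xx * - 1 * \<beta>1 * (d * h) * lrev \<alpha>4" and T4: "cfY u 4 = xx * \<beta>1 * (d * h) * lrev \<beta>4"
    and star: "?R * ?R * (?E * lrev ?E) = twisted.nrm (\<lambda>f. f) lrev xx xi (- 1) (- 1) u * (?n1 * lrev ?n1) * (?n4 * ?n4)"
    and others: "\<And>n. \<alpha>1 = 0 \<Longrightarrow> \<alpha>4 = 0 \<Longrightarrow> r = 0 \<Longrightarrow> e = 0 \<Longrightarrow> n \<noteq> 4 \<Longrightarrow> cfY u n = 0"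
  have nz: "\<beta>1 \<noteq> 0" "\<beta>4 \<noteq> 0" "d \<noteq> 0" "h \<noteq> 0" using T unfolding T4 by auto
  interpret line_data \<alpha>1 \<beta>1 \<alpha>4 \<beta>4 "lrev d" h r e ?n1 ?n4 ?R ?E "twisted.nrm (\<lambda>f. f) lrev xx xi (- 1) (- 1) u"
    by unfold_locales (use c nz star twisted.nrm_unit[OF TY_twisted uv] in simp_all)
  have units
    using narrow
  proof (elim disjE conjE)
    assume "cfY u (- 3) = 0"
    then show units using nz by (intro a_zero_units) (simp add: B)
  next
    assume "cfY u 3 = 0"
    then show units using nz by (intro c_zero_units) (simp add: C)
  next
    assume s: "\<forall>i. Poly_Mapping.lookup (cfY u (- 3)) i \<noteq> 0 \<longrightarrow> - 1 \<le> i \<and> i \<le> 0" "\<forall>i. Poly_Mapping.lookup (cfY u 4) i \<noteq> 0 \<longrightarrow> - 1 \<le> i \<and> i \<le> 1"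
    show units
    proof (rule line_units[of "d * h * lrev \<beta>4"])
      show "d * h * lrev \<beta>4 \<noteq> 0" "wd (d * h * lrev \<beta>4) = wd (lrev d) + wd h + wd \<beta>4" using nz by (simp_all add: wd_mult)
      show "- 1 \<le> i \<and> i \<le> 0" if "Poly_Mapping.lookup (\<alpha>1 * (d * h * lrev \<beta>4)) i \<noteq> 0" for i
        using s(1) that unfolding B by (simp add: mult.assoc)
      show "- 1 \<le> i \<and> i \<le> 1" if "Poly_Mapping.lookup (xx * \<beta>1 * (d * h * lrev \<beta>4)) i \<noteq> 0" for i
        using s(2) that unfolding T4 by (simp add: mult.assoc)
    qed
  qed
  then show ?thesis using others by (auto simp: mono_at_def T4 mult_dvd_1_iff)
qed

lemma line_X:
  assumes uv: "u * v = 1" and supp: "\<And>n. n < - 3 \<Longrightarrow> cfX u n = 0" "\<And>n. n > 4 \<Longrightarrow> cfX u n = 0" and T: "cfX u 4 \<noteq> 0"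
    and narrow: "cfX u (- 3) = 0 \<or> cfX u 3 = 0 \<or>
      (\<forall>i. Poly_Mapping.lookup (cfX u 3) i \<noteq> 0 \<longrightarrow> - 1 \<le> i \<and> i \<le> 0) \<and> (\<forall>i. Poly_Mapping.lookup (cfX u 4) i \<noteq> 0 \<longrightarrow> - 1 \<le> i \<and> i \<le> 1)"
  shows "mono_at (cfX u) 4"
proof (rule structure_X[OF uv supp T])
  fix \<alpha>1 \<beta>1 \<alpha>4 \<beta>4 d h r e :: L1
  let ?n1 = "\<alpha>1 * lrev \<alpha>1 - - 1 * \<beta>1 * lrev \<beta>1" and ?n4 = "\<alpha>4 * \<alpha>4 - xx * \<beta>4 * \<beta>4"
  let ?R = "r * r - xx * (?n1 * h) * (?n1 * h)" and ?E = "e * lrev e - - 1 * (lrev ?n4 * d) * lrev (lrev ?n4 * d)"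
  assume c: "cop \<alpha>1 (lrev \<beta>1)" "cop \<alpha>4 \<beta>4" and B: "cfX u (- 3) = \<alpha>1 * (d * h) * lrev \<beta>4"
    and C: "cfX u 3 = - 1 * xi * \<beta>1 * lrev (d * h) * \<alpha>4" and T4: "cfX u 4 = - 1 * \<beta>1 * lrev (d * h) * \<beta>4"
    and star: "?R * lrev ?R * (?E * ?E) = twisted.nrm lrev (\<lambda>f. f) (- 1) (- 1) xx xi u * (?n1 * ?n1) * (?n4 * lrev ?n4)"
    and others: "\<And>n. \<alpha>1 = 0 \<Longrightarrow> \<alpha>4 = 0 \<Longrightarrow> r = 0 \<Longrightarrow> e = 0 \<Longrightarrow> n \<noteq> 4 \<Longrightarrow> cfX u n = 0"
  have nz: "\<beta>1 \<noteq> 0" "\<beta>4 \<noteq> 0" "d \<noteq> 0" "h \<noteq> 0" using T unfolding T4 by auto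
  have c1: "cop \<alpha>1 \<beta>1 \<or> cop (lrev \<alpha>1) \<beta>1"
    using c(1) coeff_hom.h_dvd[OF lrev_hom] unfolding cop_def by (metis lrev_lrev lrev_mult)
  \<comment> \<open>On x = -1 the definite norm is that of \<open>\<alpha>1\<close> and
    \<open>\<beta>1\<close>, so the pairs with index 4 and 1 trade places, and so do
    \<open>d\<close> with \<open>h\<close>, \<open>r\<close> with \<open>e\<close> and
    \<open>R\<close> with \<open>E\<close>; the reversals adapt the automorphisms.\<close>
  interpret line_data \<alpha>4 \<beta>4 "lrev \<alpha>1" \<beta>1 h "lrev d" e r ?n4 ?n1 ?E ?R "twisted.nrm lrev (\<lambda>f. f) (- 1) (- 1) xx xi u"
  proof unfold_locales
    show "cop (lrev \<alpha>1) \<beta>1"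
      unfolding cop_def
    proof (intro allI impI, elim conjE)
      fix k l assume "k dvd lrev \<alpha>1 * l" "k dvd \<beta>1 * l"
      then have "lrev k dvd lrev (lrev \<alpha>1 * l)" "lrev k dvd lrev (\<beta>1 * l)" using coeff_hom.h_dvd[OF lrev_hom] by blast+
      then have "lrev k dvd lrev l" using c(1) unfolding cop_def lrev_mult lrev_lrev by blast
      from coeff_hom.h_dvd[OF lrev_hom this] show "k dvd l" by simp
    qed
  qed (use c nz star twisted.nrm_unit[OF TX_twisted uv] in \<open>simp_all add: lrev_mult mult_ac\<close>)
  have units
    using narrow
  proof (elim disjE conjE)
    assume "cfX u (- 3) = 0"
    then show units using nz by (intro c_zero_units) (simp add: B)
  next
    assume "cfX u 3 = 0"
    then show units using nz by (intro a_zero_units) (simp add: C)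
  next
    assume s: "\<forall>i. Poly_Mapping.lookup (cfX u 3) i \<noteq> 0 \<longrightarrow> - 1 \<le> i \<and> i \<le> 0" "\<forall>i. Poly_Mapping.lookup (cfX u 4) i \<noteq> 0 \<longrightarrow> - 1 \<le> i \<and> i \<le> 1"
    \<comment> \<open>The factor \<open>xi\<close> is chosen so that \<open>\<alpha>4 * ?S\<close>
      and \<open>xx * \<beta>4 * ?S\<close> are the coefficients at levels 3 and 4 up to
      sign.\<close>
    let ?S = "xi * \<beta>1 * lrev (d * h)"
    show units
    proof (rule line_units[of ?S])
      show "?S \<noteq> 0" "wd ?S = wd h + wd (lrev d) + wd \<beta>1" using nz by (simp_all add: wd_mult lrev_mult)
      have "\<alpha>4 * ?S = - cfX u 3" "xx * \<beta>4 * ?S = (xx * xi) * - cfX u 4" unfolding C T4 by (simp_all add: mult_ac)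
      then have e: "\<alpha>4 * ?S = - cfX u 3" "xx * \<beta>4 * ?S = - cfX u 4" by (simp_all add: mult_single)
      show "- 1 \<le> i \<and> i \<le> 0" if "Poly_Mapping.lookup (\<alpha>4 * ?S) i \<noteq> 0" for i
        using s(1) that unfolding e by simp
      show "- 1 \<le> i \<and> i \<le> 1" if "Poly_Mapping.lookup (xx * \<beta>4 * ?S) i \<noteq> 0" for i
        using s(2) that unfolding e by simp
    qed
  qed
  then show ?thesis using others by (auto simp: mono_at_def T4 mult_dvd_1_iff)
qed

section \<open>The plane\<close>

text \<open>Width in x, while \<open>wd\<close> measures width in the outer variable y.\<close>

definition wx :: "L2 \<Rightarrow> int" where "wx f = wd (lswap f)"

lemma lswap_mult: "lswap (f * g) = lswap f * lswap g" and lswap_minus: "lswap (f - g) = lswap f - lswap g"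
  and lswap_1 [simp]: "lswap 1 = 1" and lswap_0 [simp]: "lswap 0 = 0"
  by (rule coeff_hom.h_mult[OF lswap_hom] coeff_hom.h_minus[OF lswap_hom] coeff_hom.h_1[OF lswap_hom] coeff_hom.h_0[OF lswap_hom])+

lemma lswap_xrev: "lswap (xrev f) = lrev (lswap f)" and lswap_lrev': "lswap (lrev f) = xrev (lswap f)"
  by (simp_all add: xrev_def lswap_cmap_lrev lswap_lrev)

lemma wd_xrev [simp]: "wd (xrev f) = wd f"
  by (simp add: wd_def)

lemma wx_rev [simp]: "wx (xrev f) = wx f" "wx (lrev f) = wx f"
  by (simp_all add: wx_def lswap_xrev lswap_lrev')

lemma wx_mult: "f \<noteq> 0 \<Longrightarrow> g \<noteq> 0 \<Longrightarrow> wx (f * g) = wx f + wx g"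
  by (simp add: wx_def lswap_mult wd_mult)

lemma wx_nonneg: "f \<noteq> 0 \<Longrightarrow> wx f \<ge> 0"
  by (simp add: wx_def wd_nonneg)

lemma unit_wd2: "f dvd 1 \<Longrightarrow> wd f = 0 \<and> wx f = 0" for f :: L2
proof -
  assume u: "f dvd 1"
  have "wd g = 0" if "g dvd 1" for g :: L2
  proof -
    obtain i c where "g = Poly_Mapping.single i c" "c dvd 1" using \<open>g dvd 1\<close> by (rule laurent_unit)
    then show ?thesis by (metis wd_single dvd_0_left zero_neq_one)
  qed
  moreover have "lswap f dvd 1" using coeff_hom.h_dvd[OF lswap_hom u] by simp
  ultimately show ?thesis using u by (simp add: wx_def)
qed

abbreviation X2 :: L2 where "X2 \<equiv> Poly_Mapping.single 0 xx"
abbreviation Y2 :: L2 where "Y2 \<equiv> Poly_Mapping.single 1 1"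

lemma lswap_XY [simp]: "lswap X2 = Y2" "lswap Y2 = X2"
proof -
  show "lswap X2 = Y2" by (simp only: lswap_single single_one)
  then show "lswap Y2 = X2" by (metis lswap_lswap)
qed

lemma XY_dvd_1 [simp]: "X2 dvd 1" "Y2 dvd 1"
  by (intro single_unit; simp)+

lemma X2_nz [simp]: "X2 \<noteq> 0"
  by (metis lswap_XY(1) lswap_0 single_1_nz)

lemma wd_uminus [simp]: "wd (- f) = wd f" for f :: "'r::ab_group_add laurent"
proof -
  have "Poly_Mapping.keys (- f) = Poly_Mapping.keys f" by (rule set_eqI) (simp add: in_keys_iff)
  then show ?thesis by (simp add: wd_def hi_def lo_def)
qed

lemma wx_uminus [simp]: "wx (- f) = wx f"
  by (simp add: wx_def coeff_hom.h_uminus[OF lswap_hom])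

lemma xrev_mult: "xrev (f * g) = xrev f * xrev g"
  by (rule coeff_hom.h_mult[OF xrev_hom])

lemma xrev_1 [simp]: "xrev 1 = 1"
  by (rule coeff_hom.h_1[OF xrev_hom])

lemma xrev_dvd_1 [simp]: "xrev f dvd 1 \<longleftrightarrow> f dvd 1"
  using coeff_hom.h_dvd[OF xrev_hom, of f 1] coeff_hom.h_dvd[OF xrev_hom, of "xrev f" 1] by (auto simp: xrev_xrev)

lemma xrev_\<theta>: "\<forall>f. f \<noteq> 0 \<longrightarrow> xrev f \<noteq> 0 \<and> hi (xrev f) = hi f \<and> lo (xrev f) = lo f"
  by simp

text \<open>No positivity is used in two variables; instead the width of \<open>E\<close> in x and
  the width of \<open>R\<close> in y are bounded below, because in these directions the two terms of
  each form have ends of different parity.\<close>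

locale plane_data =
  fixes a1 b1 a4 b4 d h r e n1 n4 R E eps :: L2
  assumes n1: "n1 = a1 * lrev a1 - X2 * b1 * lrev b1" and n4: "n4 = a4 * xrev a4 - Y2 * b4 * xrev b4"
    and R: "R = r * xrev r - Y2 * (n1 * h) * xrev (n1 * h)"
    and E: "E = e * lrev e - X2 * (lrev n4 * xrev d) * lrev (lrev n4 * xrev d)"
    and c1: "cop a1 (lrev b1)" and c4: "cop a4 b4" and nz: "b1 \<noteq> 0" "b4 \<noteq> 0" "d \<noteq> 0" "h \<noteq> 0"
    and star: "R * lrev R * (E * xrev E) = eps * (n1 * xrev n1) * (n4 * lrev n4)" and eps: "eps dvd 1"
begin

abbreviation g where "g \<equiv> lrev n4 * xrev d"

lemma n1': "lswap n1 = lswap a1 * xrev (lswap a1) - Y2 * lswap b1 * xrev (lswap b1)"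
  by (simp only: n1 lswap_mult lswap_minus lswap_lrev' lswap_XY)

lemma E': "lswap E = lswap e * xrev (lswap e) - Y2 * lswap g * xrev (lswap g)"
  by (simp only: E lswap_mult lswap_minus lswap_lrev' lswap_XY)

lemma lswap_b1: "lswap b1 \<noteq> 0"
  using nz by simp

lemmas n1_ends = parity_diff_ends[where \<theta> = xrev, OF xrev_\<theta> xrev_0 lswap_b1 n1']
lemmas n4_ends = parity_diff_ends[where \<theta> = xrev, OF xrev_\<theta> xrev_0 nz(2) n4]

lemma n_nz: "n1 \<noteq> 0" "n4 \<noteq> 0"
  using n1_ends(1) n4_ends(1) by auto

lemma g_nz: "lswap g \<noteq> 0" and n1h_nz: "n1 * h \<noteq> 0"
  using n_nz nz by simp_all

lemmas E_ends = parity_diff_ends[where \<theta> = xrev, OF xrev_\<theta> xrev_0 g_nz E']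
lemmas R_ends = parity_diff_ends[where \<theta> = xrev, OF xrev_\<theta> xrev_0 n1h_nz R]
lemmas n1_mono = parity_diff_wd_0[where \<theta> = xrev, OF xrev_\<theta> xrev_0 lswap_b1 n1']
lemmas n4_mono = parity_diff_wd_0[where \<theta> = xrev, OF xrev_\<theta> xrev_0 nz(2) n4]
lemmas E_mono = parity_diff_wd_0[where \<theta> = xrev, OF xrev_\<theta> xrev_0 g_nz E']
lemmas R_mono = parity_diff_wd_0[where \<theta> = xrev, OF xrev_\<theta> xrev_0 n1h_nz R]

lemma all_nz: "n1 \<noteq> 0" "n4 \<noteq> 0" "E \<noteq> 0" "R \<noteq> 0" "b1 \<noteq> 0" "b4 \<noteq> 0" "d \<noteq> 0" "h \<noteq> 0" "eps \<noteq> 0"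
  using n_nz E_ends(1) R_ends(1) nz eps by auto

lemma wds: "wd n1 \<ge> 0" "wd n4 \<ge> 0" "wd E \<ge> 0" "wd R \<ge> 0" "wd d \<ge> 0" "wd h \<ge> 0"
  "wx n1 \<ge> 0" "wx n4 \<ge> 0" "wx E \<ge> 0" "wx R \<ge> 0" "wx d \<ge> 0" "wx h \<ge> 0"
  using all_nz by (simp_all add: wd_nonneg wx_nonneg)

lemma widths: "wd R + wd E = wd n1 + wd n4" "wx R + wx E = wx n1 + wx n4"
proof -
  have "wd (R * lrev R * (E * xrev E)) = 2 * wd R + 2 * wd E" "wx (R * lrev R * (E * xrev E)) = 2 * wx R + 2 * wx E"
    using all_nz by (simp_all add: wd_mult wx_mult)
  moreover have "wd (eps * (n1 * xrev n1) * (n4 * lrev n4)) = 2 * wd n1 + 2 * wd n4"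
    "wx (eps * (n1 * xrev n1) * (n4 * lrev n4)) = 2 * wx n1 + 2 * wx n4"
    using all_nz unit_wd2[OF eps] by (simp_all add: wd_mult wx_mult)
  ultimately show "wd R + wd E = wd n1 + wd n4" "wx R + wx E = wx n1 + wx n4" unfolding star by linarith+
qed

lemma wd_g: "wx g = wx n4 + wx d" "wd g = wd n4 + wd d"
  using all_nz by (simp_all add: wx_mult wd_mult)

lemma wd_n1h: "wx (n1 * h) = wx n1 + wx h" "wd (n1 * h) = wd n1 + wd h"
  using all_nz by (simp_all add: wx_mult wd_mult)

lemma wx_E: "wx E \<ge> 2 * wx n4 + 2 * wx d"
proof -
  have "hi (lswap E) \<ge> 1 + 2 * hi (lswap g)" "lo (lswap E) \<le> 1 + 2 * lo (lswap g)" using E_ends(2,3) by auto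
  then have "wx E \<ge> 2 * wx g" by (simp add: wx_def wd_def)
  then show ?thesis using wd_g(1) by simp
qed

lemma wd_R: "wd R \<ge> 2 * wd n1 + 2 * wd h"
proof -
  have "hi R \<ge> 1 + 2 * hi (n1 * h)" "lo R \<le> 1 + 2 * lo (n1 * h)" using R_ends(2,3) by auto
  then have "wd R \<ge> 2 * wd (n1 * h)" by (simp add: wd_def)
  then show ?thesis using wd_n1h(2) by simp
qed

abbreviation units where "units \<equiv> a1 = 0 \<and> a4 = 0 \<and> r = 0 \<and> e = 0 \<and> b1 dvd 1 \<and> b4 dvd 1 \<and> d dvd 1 \<and> h dvd 1"

lemma n1_unit: "n1 dvd 1 \<Longrightarrow> a1 = 0 \<and> b1 dvd 1"
proof -
  assume u: "n1 dvd 1"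
  have a: "a1 = 0" using n1_mono(1) unit_wd2[OF u] by (simp add: wx_def)
  then have "n1 = b1 * (- (X2 * lrev b1))" by (simp add: n1 mult_ac)
  then show ?thesis using a u mult_dvd_1_iff by metis
qed

lemma n4_unit: "n4 dvd 1 \<Longrightarrow> a4 = 0 \<and> b4 dvd 1"
proof -
  assume u: "n4 dvd 1"
  have a: "a4 = 0" using n4_mono(1) unit_wd2[OF u] by simp
  then have "n4 = b4 * (- (Y2 * xrev b4))" by (simp add: n4 mult_ac)
  then show ?thesis using a u mult_dvd_1_iff by metis
qed

text \<open>\<open>a1 = 0\<close> makes \<open>b1\<close>, hence \<open>n1\<close>, a unit. The
  widths in x then leave \<open>E\<close> without the term in \<open>e\<close>, so
  \<open>E * xrev E\<close> contains \<open>n4 * lrev n4\<close> together with further conjugates of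
  \<open>n4\<close>. Cancelling against the right side of \<open>star\<close> exhibits
  \<open>R\<close>, \<open>n4\<close> and \<open>d\<close> as divisors of a unit. The next lemma is
  the mirror image.\<close>

lemma a1_zero_units: "a1 = 0 \<Longrightarrow> units"
proof -
  assume a: "a1 = 0"
  have "lrev b1 dvd a1 * 1" "lrev b1 dvd lrev b1 * 1" by (simp_all add: a)
  then have bu: "b1 dvd 1" using c1 unfolding cop_def by (metis lrev_dvd_1)
  then have nu: "n1 dvd 1" by (simp add: n1 a mult_dvd_1_iff)
  then have w0: "wd n1 = 0" "wx n1 = 0" using unit_wd2 by blast+
  then have w1: "wx n4 = 0" "wx d = 0" "wx E = 0" using widths wx_E wds by linarith+
  have e: "e = 0" using E_mono(1) w1 by (simp add: wx_def)
  then have E0: "E = - (X2 * g * lrev g)" by (simp add: E)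
  have "wd E = wd X2 + 2 * wd g" unfolding E0 using all_nz by (simp add: wd_mult wd_uminus)
  then have "wd E = 2 * wd n4 + 2 * wd d" using wd_g(2) unit_wd2[OF XY_dvd_1(1)] by simp
  then have w2: "wd R = 0" using widths(1) wd_R w0 wds by linarith
  have "R * lrev R * (E * xrev E) = (n4 * lrev n4) * ((X2 * xrev X2) * (R * lrev R) * (xrev n4 * xrev (lrev n4)) * (xrev d * lrev (xrev d) * d * lrev d))"
    by (simp add: E0 xrev_mult lrev_mult xrev_lrev xrev_xrev coeff_hom.h_uminus[OF xrev_hom] mult_ac)
  then have "(n4 * lrev n4) * ((X2 * xrev X2) * (R * lrev R) * (xrev n4 * xrev (lrev n4)) * (xrev d * lrev (xrev d) * d * lrev d)) = (n4 * lrev n4) * (eps * (n1 * xrev n1))"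
    unfolding star by (simp only: mult_ac)
  then have "(X2 * xrev X2) * (R * lrev R) * (xrev n4 * xrev (lrev n4)) * (xrev d * lrev (xrev d) * d * lrev d) = eps * (n1 * xrev n1)"
    using all_nz by simp
  moreover have "eps * (n1 * xrev n1) dvd 1" using eps nu by (simp add: mult_dvd_1_iff)
  ultimately have u: "R dvd 1" "n4 dvd 1" "d dvd 1" by (metis mult_dvd_1_iff xrev_dvd_1)+
  have r: "r = 0" using R_mono(1) w2 by simp
  have "R = h * (- (Y2 * n1 * xrev (n1 * h)))" by (simp add: R r mult_ac)
  then have "h dvd 1" using u(1) by (metis mult_dvd_1_iff)
  then show ?thesis using a bu e r u n4_unit by blast
qed

lemma a4_zero_units: "a4 = 0 \<Longrightarrow> units"
proof -
  assume a: "a4 = 0"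
  have "b4 dvd a4 * 1" "b4 dvd b4 * 1" by (simp_all add: a)
  then have bu: "b4 dvd 1" using c4 unfolding cop_def by metis
  then have nu: "n4 dvd 1" by (simp add: n4 a mult_dvd_1_iff)
  then have w0: "wd n4 = 0" "wx n4 = 0" using unit_wd2 by blast+
  then have w1: "wd R = 0" using widths wd_R wds by linarith
  have r: "r = 0" using R_mono(1) w1 by simp
  then have R0: "R = - (Y2 * (n1 * h) * xrev (n1 * h))" by (simp add: R)
  have "wx R = wx Y2 + 2 * wx (n1 * h)" unfolding R0 using all_nz by (simp add: wx_mult wx_uminus)
  then have "wx R = 2 * wx n1 + 2 * wx h" using wd_n1h(1) unit_wd2[OF XY_dvd_1(2)] by simp
  then have w2: "wx E = 0" using widths(2) wx_E w0 wds by linarith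
  have "R * lrev R * (E * xrev E) = (n1 * xrev n1) * ((Y2 * lrev Y2) * (E * xrev E) * (lrev n1 * lrev (xrev n1)) * (h * xrev h * lrev h * lrev (xrev h)))"
    by (simp add: R0 xrev_mult lrev_mult lrev_uminus mult_ac)
  then have "(n1 * xrev n1) * ((Y2 * lrev Y2) * (E * xrev E) * (lrev n1 * lrev (xrev n1)) * (h * xrev h * lrev h * lrev (xrev h))) = (n1 * xrev n1) * (eps * (n4 * lrev n4))"
    unfolding star by (simp only: mult_ac)
  then have "(Y2 * lrev Y2) * (E * xrev E) * (lrev n1 * lrev (xrev n1)) * (h * xrev h * lrev h * lrev (xrev h)) = eps * (n4 * lrev n4)"
    using all_nz by simp
  moreover have "eps * (n4 * lrev n4) dvd 1" using eps nu by (simp add: mult_dvd_1_iff)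
  ultimately have u: "E dvd 1" "n1 dvd 1" "h dvd 1" by (metis mult_dvd_1_iff lrev_dvd_1)+
  have e: "e = 0" using E_mono(1) w2 by (simp add: wx_def)
  have "E = xrev d * (- (X2 * lrev n4 * lrev g))" by (simp add: E e mult_ac)
  then have "d dvd 1" using u(1) by (metis mult_dvd_1_iff xrev_dvd_1)
  then show ?thesis using a bu e r u n1_unit by blast
qed

end

subsection \<open>Coordinates of the coefficients\<close>

text \<open>Passing to a line is a homomorphism of coefficient rings, so the coefficients on the
  lines are specialisations of those over the plane.\<close>

lemma cf_coeff_hom:
  assumes "coeff_hom \<phi>" and t: "twisted \<sigma> \<tau> X Xi Y Yi" "twisted \<sigma>' \<tau>' (\<phi> X) (\<phi> Xi) (\<phi> Y) (\<phi> Yi)"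
  shows "twisted.cf (\<phi> X) (\<phi> Xi) (\<phi> Y) (\<phi> Yi) u n = \<phi> (twisted.cf X Xi Y Yi u n)"
proof -
  interpret coeff_hom \<phi> by (rule assms)
  have i: "\<phi> (of_int k) = of_int k" for k
    by (induction k rule: int_induct[where k = 0]) (simp_all add: h_add h_minus)
  have s: "\<phi> (sum f I) = (\<Sum>i\<in>I. \<phi> (f i))" for f :: "promislow \<Rightarrow> _" and I
    by (induction I rule: infinite_finite_induct) (simp_all add: h_add)
  have p: "\<phi> (a ^ k) = \<phi> a ^ k" for a k by (induction k) (simp_all add: h_mult)
  show ?thesis
    unfolding twisted.cf_def[OF t(1)] twisted.cf_def[OF t(2)] twisted.mon_def[OF t(1)] twisted.mon_def[OF t(2)] lext_def s h_mult i
    by (intro sum.cong refl) (auto simp: h_mult pw_def p split: prod.splits)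
qed

lemma cfY_eq: "cfY u n = ev (- 1) (cf2 u n)"
proof -
  have h: "coeff_hom (ev (- 1 :: L1))" by (rule ev_hom) simp
  have *: "ev (- 1) X2 = xx" "ev (- 1) (Poly_Mapping.single 0 xi) = xi" "ev (- 1) Y2 = - 1" "ev (- 1) (Poly_Mapping.single (- 1) 1) = (- 1 :: L1)"
    by (simp_all add: ev_single)
  show ?thesis using cf_coeff_hom[OF h T2_twisted, unfolded *, OF TY_twisted] .
qed

lemma cfX_eq: "cfX u n = cmap (ev (- 1)) (cf2 u n)"
proof -
  have h: "coeff_hom (cmap (ev (- 1 :: int)))" by (rule cmap_hom[OF ev1])
  have z: "ev (- 1 :: int) 0 = 0" by (rule coeff_hom.h_0[OF ev1])
  have "cmap (ev (- 1)) X2 = Poly_Mapping.single 0 (- 1)" "cmap (ev (- 1)) (Poly_Mapping.single 0 xi) = Poly_Mapping.single 0 (- 1)"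
    "cmap (ev (- 1)) Y2 = xx" "cmap (ev (- 1)) (Poly_Mapping.single (- 1) 1) = xi"
    by (simp_all only: cmap_single[of "ev (- 1)", OF z]) (simp_all add: ev_single coeff_hom.h_1[OF ev1])
  then have *: "cmap (ev (- 1)) X2 = - 1" "cmap (ev (- 1)) (Poly_Mapping.single 0 xi) = - 1"
    "cmap (ev (- 1)) Y2 = xx" "cmap (ev (- 1)) (Poly_Mapping.single (- 1) 1) = xi"
    by (simp_all add: single_uminus)
  show ?thesis using cf_coeff_hom[OF h T2_twisted, unfolded *, OF TX_twisted] .
qed

abbreviation lk :: "L2 \<Rightarrow> int \<Rightarrow> int \<Rightarrow> int" where "lk f i j \<equiv> Poly_Mapping.lookup (Poly_Mapping.lookup f j) i"

lemma cf2_lookup: "lk (cf2 u n) i j = (\<Sum>g\<in>Poly_Mapping.keys u. if crd g = (2 * i + prx n, 2 * j + pry n, n) then Poly_Mapping.lookup u g else 0)"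
proof -
  have m: "of_int c * (if lev g = n then twisted.mon X2 (Poly_Mapping.single 0 xi) Y2 (Poly_Mapping.single (- 1) 1) g else 0)
      = (if lev g = n then Poly_Mapping.single ((fst (snd (crd g)) - pry n) div 2) (Poly_Mapping.single ((fst (crd g) - prx n) div 2) c) else (0 :: L2))" for c g
    unfolding twisted.mon_def[OF T2_twisted] pw_single pw_single0 of_int_single[where 'r = L1] of_int_L1
    by (cases "crd g") (simp add: lev_def mult_single)
  have "lk (of_int c * (if lev g = n then twisted.mon X2 (Poly_Mapping.single 0 xi) Y2 (Poly_Mapping.single (- 1) 1) g else 0)) i j
     = (if crd g = (2 * i + prx n, 2 * j + pry n, n) then c else 0)" for c g
  proof -
    obtain s t l where g: "crd g = (s, t, l)" by (cases "crd g")
    have "even (s - prx l)" "even (t - pry l)" using crd_parity[of g] by (simp_all add: g)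
    then have "l = n \<Longrightarrow> (t - pry n) div 2 = j \<longleftrightarrow> t = 2 * j + pry n" "l = n \<Longrightarrow> (s - prx n) div 2 = i \<longleftrightarrow> s = 2 * i + prx n"
      by (auto elim!: evenE)
    then show ?thesis unfolding m by (auto simp: g lev_def lookup_single when_def)
  qed
  then show ?thesis unfolding twisted.cf_def[OF T2_twisted] lext_def lookup_sum by simp
qed

text \<open>By injectivity of the coordinates no two group elements share a monomial at one level:
  over the plane the coefficients lose nothing, in contrast to the lines.\<close>

lemma cf2_lookup_crd: "crd g = (2 * i + prx n, 2 * j + pry n, n) \<Longrightarrow> lk (cf2 u n) i j = Poly_Mapping.lookup u g"
proof -
  assume c: "crd g = (2 * i + prx n, 2 * j + pry n, n)"
  have "lk (cf2 u n) i j = (\<Sum>k\<in>Poly_Mapping.keys u. if k = g then Poly_Mapping.lookup u k else 0)"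
    unfolding cf2_lookup c[symmetric]
  proof (rule sum.cong[OF refl])
    fix k
    show "(if crd k = crd g then Poly_Mapping.lookup u k else 0) = (if k = g then Poly_Mapping.lookup u k else 0)"
      using crd_inj[of k g] by (cases "k = g") auto
  qed
  then show ?thesis by (simp add: in_keys_iff)
qed

lemma cf2_lookup_nz: "lk (cf2 u n) i j \<noteq> 0 \<Longrightarrow> \<exists>g\<in>Poly_Mapping.keys u. crd g = (2 * i + prx n, 2 * j + pry n, n)"
proof (rule ccontr)
  assume nz: "lk (cf2 u n) i j \<noteq> 0" and "\<not> ?thesis"
  then have "(\<Sum>g\<in>Poly_Mapping.keys u. if crd g = (2 * i + prx n, 2 * j + pry n, n) then Poly_Mapping.lookup u g else 0) = 0"
    by (intro sum.neutral ballI if_not_P) blast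
  then show False using nz unfolding cf2_lookup by blast
qed

lemma crd_cases: obtains i j where "crd g = (2 * i + prx (lev g), 2 * j + pry (lev g), lev g)"
proof -
  obtain s t l where g: "crd g = (s, t, l)" by (cases "crd g")
  have l: "lev g = l" by (simp add: lev_def g)
  have "even (s - prx l)" "even (t - pry l)" using crd_parity[of g] by (simp_all add: g)
  then have "s = 2 * ((s - prx l) div 2) + prx l" "t = 2 * ((t - pry l) div 2) + pry l" by simp_all
  then show ?thesis using that[of "(s - prx l) div 2" "(t - pry l) div 2"] unfolding g l by simp
qed

lemma cf2_eq_0_iff: "cf2 u n = 0 \<longleftrightarrow> (\<forall>g\<in>Poly_Mapping.keys u. lev g \<noteq> n)"
proof
  assume z: "cf2 u n = 0"
  show "\<forall>g\<in>Poly_Mapping.keys u. lev g \<noteq> n"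
  proof (intro ballI notI)
    fix g assume g: "g \<in> Poly_Mapping.keys u" "lev g = n"
    obtain i j where "crd g = (2 * i + prx (lev g), 2 * j + pry (lev g), lev g)" by (rule crd_cases)
    then have "crd g = (2 * i + prx n, 2 * j + pry n, n)" unfolding g(2) .
    then have "Poly_Mapping.lookup u g = 0" using cf2_lookup_crd[of g i n j u] by (simp only: z lookup_zero)
    then show False using g(1) by (simp only: in_keys_iff not_True_eq_False)
  qed
next
  assume a: "\<forall>g\<in>Poly_Mapping.keys u. lev g \<noteq> n"
  show "cf2 u n = 0"
  proof (rule poly_mapping_eqI, rule poly_mapping_eqI)
    fix j i
    have "lk (cf2 u n) i j = 0"
    proof (rule ccontr)
      assume "lk (cf2 u n) i j \<noteq> 0"
      then obtain g where "g \<in> Poly_Mapping.keys u" "crd g = (2 * i + prx n, 2 * j + pry n, n)" using cf2_lookup_nz by blast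
      moreover from this have "lev g = n" by (simp add: lev_def)
      ultimately show False using a by blast
    qed
    then show "lk (cf2 u n) i j = lk 0 i j" by (simp only: lookup_zero)
  qed
qed

lemma mono_trivial:
  assumes "mono_at (cf2 u) n"
  shows "\<exists>g c. \<bar>c\<bar> = 1 \<and> u = Poly_Mapping.single g c"
proof -
  have "cf2 u n dvd 1" using assms by (simp add: mono_at_def)
  then obtain j f where jf: "cf2 u n = Poly_Mapping.single j f" "f dvd 1" by (rule laurent_unit)
  obtain i c where ic: "f = Poly_Mapping.single i c" "c dvd 1" using jf(2) by (rule laurent_unit)
  have c: "\<bar>c\<bar> = 1" using ic by simp
  then have "lk (cf2 u n) i j \<noteq> 0" by (auto simp: jf ic)
  then obtain g where g: "g \<in> Poly_Mapping.keys u" "crd g = (2 * i + prx n, 2 * j + pry n, n)" using cf2_lookup_nz by blast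
  have "u = Poly_Mapping.single g c"
  proof (rule poly_mapping_eqI)
    fix k
    show "Poly_Mapping.lookup u k = Poly_Mapping.lookup (Poly_Mapping.single g c) k"
    proof (cases "k \<in> Poly_Mapping.keys u")
      case True
      then have "cf2 u (lev k) \<noteq> 0" unfolding cf2_eq_0_iff by blast
      then have l: "lev k = n" using assms unfolding mono_at_def by metis
      obtain i' j' where k: "crd k = (2 * i' + prx n, 2 * j' + pry n, n)" using crd_cases[of k] unfolding l by blast
      have lk: "Poly_Mapping.lookup u k = lk (cf2 u n) i' j'" by (rule cf2_lookup_crd[OF k, symmetric])
      then have "lk (cf2 u n) i' j' \<noteq> 0" using True by (simp add: in_keys_iff)
      then have "i' = i" "j' = j" by (auto simp: jf ic lookup_single when_def split: if_splits)
      then have "k = g" using k g(2) by (intro crd_inj) simp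
      then show ?thesis using lk \<open>i' = i\<close> \<open>j' = j\<close> by (simp add: jf ic)
    next
      case False
      then have "k \<noteq> g" using g(1) by blast
      then show ?thesis using False by (simp add: in_keys_iff lookup_single when_def)
    qed
  qed
  then show ?thesis using c by blast
qed

text \<open>The triple \<open>(A, B, n)\<close> records the number of letters \<open>a\<^sup>\<plusminus>\<^sup>1\<close>, of letters \<open>b\<^sup>\<plusminus>\<^sup>1\<close> and the level of a word.\<close>

fun letter_counts :: "nat \<Rightarrow> (int \<times> int \<times> int) set" where
  "letter_counts 0 = {(0, 0, 0)}"
| "letter_counts (Suc k) = (\<lambda>(A, B, n). (A + 1, B, 1 - n)) ` letter_counts k \<union> (\<lambda>(A, B, n). (A, B + 1, - 1 - n)) ` letter_counts k"

lemma crd_sum_list: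
  "set gs \<subseteq> {pa, - pa, pb, - pb} \<Longrightarrow>
    \<exists>s t n A B. crd (sum_list gs) = (s, t, n) \<and> (A, B, n) \<in> letter_counts (length gs) \<and> \<bar>s\<bar> \<le> A \<and> \<bar>t\<bar> \<le> B"
proof (induction gs)
  case (Cons g gs)
  have "set gs \<subseteq> {pa, - pa, pb, - pb}" using Cons.prems by simp
  then obtain s t n A B where IH: "crd (sum_list gs) = (s, t, n)" "(A, B, n) \<in> letter_counts (length gs)" "\<bar>s\<bar> \<le> A" "\<bar>t\<bar> \<le> B"
    using Cons.IH by blast
  have "g = pa \<or> g = - pa \<or> g = pb \<or> g = - pb" using Cons.prems by simp
  then have "crd (sum_list (g # gs)) = (s + 1, - t, 1 - n) \<or> crd (sum_list (g # gs)) = (s - 1, - t, 1 - n)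
      \<or> crd (sum_list (g # gs)) = (- s, t + 1, - 1 - n) \<or> crd (sum_list (g # gs)) = (- s, t - 1, - 1 - n)"
    by (elim disjE) (simp_all add: crd_add IH(1) sg_defs)
  moreover have "(A + 1, B, 1 - n) \<in> letter_counts (length (g # gs))" "(A, B + 1, - 1 - n) \<in> letter_counts (length (g # gs))"
    using IH(2) by (force simp: image_iff)+
  moreover have "\<bar>s + 1\<bar> \<le> A + 1" "\<bar>s - 1\<bar> \<le> A + 1" "\<bar>t + 1\<bar> \<le> B + 1" "\<bar>t - 1\<bar> \<le> B + 1" "\<bar>- s\<bar> \<le> A" "\<bar>- t\<bar> \<le> B"
    using IH(3,4) by linarith+
  ultimately show ?case by blast
qed simp

text \<open>Besides the range of levels only the four extremal levels are bounded. The last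
  condition at level -2 cuts the corners off a square of exponents and is what
  \<open>D_shape_zero\<close> exploits.\<close>

definition ball_shape :: "coord \<Rightarrow> bool" where
  "ball_shape = (\<lambda>(s, t, n). \<bar>n\<bar> \<le> 4 \<and> (n = 4 \<longrightarrow> \<bar>s\<bar> \<le> 2 \<and> \<bar>t\<bar> \<le> 2) \<and> (n = - 3 \<longrightarrow> \<bar>s\<bar> \<le> 1 \<and> \<bar>t\<bar> \<le> 2) \<and> (n = 3 \<longrightarrow> \<bar>s\<bar> \<le> 2 \<and> \<bar>t\<bar> \<le> 1)
     \<and> (n = - 2 \<longrightarrow> \<bar>s\<bar> \<le> 3 \<and> \<bar>t\<bar> \<le> 3 \<and> \<bar>s\<bar> + \<bar>t\<bar> \<le> 4))"

lemma word_ball_shape: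
  assumes "g \<in> word_ball 4"
  shows "ball_shape (crd g)"
proof -
  obtain gs where gs: "g = sum_list gs" "length gs \<le> 4" "set gs \<subseteq> {pa, - pa, pb, - pb}" using assms by (auto simp: word_ball_def)
  obtain s t n A B where c: "crd g = (s, t, n)" "(A, B, n) \<in> letter_counts (length gs)" "\<bar>s\<bar> \<le> A" "\<bar>t\<bar> \<le> B"
    using crd_sum_list[OF gs(3)] gs(1) by blast
  have "length gs = 0 \<or> length gs = 1 \<or> length gs = 2 \<or> length gs = 3 \<or> length gs = 4" using gs(2) by linarith
  then have m: "(A, B, n) \<in> letter_counts 0 \<union> letter_counts 1 \<union> letter_counts 2 \<union> letter_counts 3 \<union> letter_counts 4"
    using c(2) by (elim disjE) (simp_all del: letter_counts.simps One_nat_def)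
  \<comment> \<open>A finite check over the triples reached by at most four letters; the signs of
    the letters have already been absorbed into absolute values.\<close>
  have "\<forall>(A, B, n) \<in> letter_counts 0 \<union> letter_counts 1 \<union> letter_counts 2 \<union> letter_counts 3 \<union> letter_counts 4.
      \<bar>n\<bar> \<le> 4 \<and> (n = 4 \<longrightarrow> A \<le> 2 \<and> B \<le> 2) \<and> (n = - 3 \<longrightarrow> A \<le> 1 \<and> B \<le> 2) \<and> (n = 3 \<longrightarrow> A \<le> 2 \<and> B \<le> 1)
      \<and> (n = - 2 \<longrightarrow> A \<le> 3 \<and> B \<le> 3 \<and> A + B \<le> 4)"
    by (simp add: eval_nat_numeral)
  note bspec[OF this m, unfolded prod.case]
  then have n: "\<bar>n\<bar> \<le> 4" "n = 4 \<Longrightarrow> A \<le> 2 \<and> B \<le> 2" "n = - 3 \<Longrightarrow> A \<le> 1 \<and> B \<le> 2" "n = 3 \<Longrightarrow> A \<le> 2 \<and> B \<le> 1"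
    "n = - 2 \<Longrightarrow> A \<le> 3 \<and> B \<le> 3 \<and> A + B \<le> 4" by simp_all
  show ?thesis
    unfolding c(1) ball_shape_def prod.case
  proof (intro conjI impI)
    show "\<bar>n\<bar> \<le> 4" by (rule n)
    show "\<bar>s\<bar> \<le> 2" "\<bar>t\<bar> \<le> 2" if "n = 4" using n(2)[OF that] c(3,4) by linarith+
    show "\<bar>s\<bar> \<le> 1" "\<bar>t\<bar> \<le> 2" if "n = - 3" using n(3)[OF that] c(3,4) by linarith+
    show "\<bar>s\<bar> \<le> 2" "\<bar>t\<bar> \<le> 1" if "n = 3" using n(4)[OF that] c(3,4) by linarith+
    show "\<bar>s\<bar> \<le> 3" "\<bar>t\<bar> \<le> 3" "\<bar>s\<bar> + \<bar>t\<bar> \<le> 4" if "n = - 2" using n(5)[OF that] c(3,4) by linarith+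
  qed
qed

lemma plane_structure:
  assumes uv: "u * v = 1" and supp: "\<And>n. n < - 3 \<Longrightarrow> cf2 u n = 0" "\<And>n. n > 4 \<Longrightarrow> cf2 u n = 0" and T: "cf2 u 4 \<noteq> 0"
  obtains a1 b1 a4 b4 d h r e n1 n4 R E eps where
    "plane_data a1 b1 a4 b4 d h r e n1 n4 R E eps"
    "cf2 u (- 2) = a1 * (d * h) * lrev (xrev a4)" "cf2 u (- 3) = a1 * (d * h) * lrev (xrev b4)"
    "cf2 u 3 = X2 * Poly_Mapping.single (- 1) 1 * b1 * lrev (d * h) * xrev a4" "cf2 u 4 = X2 * b1 * lrev (d * h) * xrev b4"
    "\<And>n. a1 = 0 \<Longrightarrow> a4 = 0 \<Longrightarrow> r = 0 \<Longrightarrow> e = 0 \<Longrightarrow> n \<noteq> 4 \<Longrightarrow> cf2 u n = 0"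
proof (rule structure_2[OF uv supp T])
  fix a1 b1 a4 b4 d h r e :: L2
  let ?n1 = "a1 * lrev a1 - X2 * b1 * lrev b1" and ?n4 = "a4 * xrev a4 - Y2 * b4 * xrev b4"
  let ?R = "r * xrev r - Y2 * (?n1 * h) * xrev (?n1 * h)" and ?E = "e * lrev e - X2 * (lrev ?n4 * xrev d) * lrev (lrev ?n4 * xrev d)"
  let ?eps = "twisted.nrm lrev xrev X2 (Poly_Mapping.single 0 xi) Y2 (Poly_Mapping.single (- 1) 1) u"
  assume c: "cop a1 (lrev b1)" "cop a4 b4"
    and D: "cf2 u (- 2) = a1 * (d * h) * lrev (xrev a4)" and B: "cf2 u (- 3) = a1 * (d * h) * lrev (xrev b4)"
    and C: "cf2 u 3 = X2 * Poly_Mapping.single (- 1) 1 * b1 * lrev (d * h) * xrev a4" and T4: "cf2 u 4 = X2 * b1 * lrev (d * h) * xrev b4"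
    and star: "?R * lrev ?R * (?E * xrev ?E) = ?eps * (?n1 * xrev ?n1) * (?n4 * lrev ?n4)"
    and others: "\<And>n. a1 = 0 \<Longrightarrow> a4 = 0 \<Longrightarrow> r = 0 \<Longrightarrow> e = 0 \<Longrightarrow> n \<noteq> 4 \<Longrightarrow> cf2 u n = 0"
  have nz: "b1 \<noteq> 0" "b4 \<noteq> 0" "d \<noteq> 0" "h \<noteq> 0" using T unfolding T4 by auto
  have "plane_data a1 b1 a4 b4 d h r e ?n1 ?n4 ?R ?E ?eps"
    by (rule plane_data.intro[OF refl refl refl refl c nz star twisted.nrm_unit[OF T2_twisted uv]])
  then show thesis using D B C T4 others by (rule that)
qed

text \<open>Up to units and automorphisms, the factors of levels -3 and 3 other than
  \<open>a1\<close> and \<open>a4\<close> all occur in the nonzero coefficient at level 4. So one of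
  \<open>a1\<close> and \<open>a4\<close> is zero.\<close>

lemma plane_rigid:
  assumes uv: "u * v = 1" and supp: "\<And>n. n < - 3 \<Longrightarrow> cf2 u n = 0" "\<And>n. n > 4 \<Longrightarrow> cf2 u n = 0" and T: "cf2 u 4 \<noteq> 0"
    and z: "cf2 u (- 3) = 0 \<or> cf2 u 3 = 0"
  shows "mono_at (cf2 u) 4"
proof (rule plane_structure[OF uv supp T])
  fix a1 b1 a4 b4 d h r e n1 n4 R E eps
  assume p: "plane_data a1 b1 a4 b4 d h r e n1 n4 R E eps"
    and B: "cf2 u (- 3) = a1 * (d * h) * lrev (xrev b4)" and C: "cf2 u 3 = X2 * Poly_Mapping.single (- 1) 1 * b1 * lrev (d * h) * xrev a4"
    and T4: "cf2 u 4 = X2 * b1 * lrev (d * h) * xrev b4"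
    and others: "\<And>n. a1 = 0 \<Longrightarrow> a4 = 0 \<Longrightarrow> r = 0 \<Longrightarrow> e = 0 \<Longrightarrow> n \<noteq> 4 \<Longrightarrow> cf2 u n = 0"
  interpret plane_data a1 b1 a4 b4 d h r e n1 n4 R E eps by (rule p)
  have "a1 = 0 \<or> a4 = 0" using z nz X2_nz single_1_nz[of "- 1", where 'r = L1] unfolding B C by auto
  then have units using a1_zero_units a4_zero_units by blast
  then show ?thesis using others XY_dvd_1(1) by (simp add: mono_at_def T4 mult_dvd_1_iff)
qed

lemma plane_short: "u * v = 1 \<Longrightarrow> (\<And>n. n < - 3 \<or> n > 3 \<Longrightarrow> cf2 u n = 0) \<Longrightarrow> \<exists>n. mono_at (cf2 u) n"
  by (rule twisted.short_mono[OF T2_twisted]) (rule plane_rigid, assumption+)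

subsection \<open>The supports in the ball\<close>

lemma ball_lk:
  assumes "Poly_Mapping.keys u \<subseteq> word_ball 4" "lk (cf2 u n) i j \<noteq> 0"
  shows "ball_shape (2 * i + prx n, 2 * j + pry n, n)"
proof -
  obtain g where "g \<in> Poly_Mapping.keys u" "crd g = (2 * i + prx n, 2 * j + pry n, n)" using cf2_lookup_nz[OF assms(2)] by blast
  then show ?thesis using word_ball_shape[of g] assms(1) by auto
qed

lemma ball_supp:
  assumes u: "Poly_Mapping.keys u \<subseteq> word_ball 4"
  shows "n < - 4 \<or> n > 4 \<Longrightarrow> cf2 u n = 0"
    "lk (cf2 u 4) i j \<noteq> 0 \<Longrightarrow> \<bar>i\<bar> \<le> 1 \<and> \<bar>j\<bar> \<le> 1"
    "lk (cf2 u (- 3)) i j \<noteq> 0 \<Longrightarrow> - 1 \<le> i \<and> i \<le> 0 \<and> \<bar>j\<bar> \<le> 1"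
    "lk (cf2 u 3) i j \<noteq> 0 \<Longrightarrow> \<bar>i\<bar> \<le> 1 \<and> - 1 \<le> j \<and> j \<le> 0"
    "lk (cf2 u (- 2)) i j \<noteq> 0 \<Longrightarrow> - 2 \<le> i \<and> i \<le> 1 \<and> - 2 \<le> j \<and> j \<le> 1 \<and> \<bar>2 * i + 1\<bar> + \<bar>2 * j + 1\<bar> \<le> 4"
proof -
  show "cf2 u n = 0" if "n < - 4 \<or> n > 4"
  proof (rule poly_mapping_eqI, rule poly_mapping_eqI, rule ccontr)
    fix j i assume "lk (cf2 u n) i j \<noteq> lk 0 i j"
    then have "lk (cf2 u n) i j \<noteq> 0" by (simp only: lookup_zero not_False_eq_True)
    from ball_lk[OF u this] have "\<bar>n\<bar> \<le> 4" unfolding ball_shape_def prod.case by (elim conjE)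
    then show False using that by (elim disjE; linarith)
  qed
  show "\<bar>i\<bar> \<le> 1 \<and> \<bar>j\<bar> \<le> 1" if "lk (cf2 u 4) i j \<noteq> 0"
  proof -
    have "\<bar>2 * i\<bar> \<le> 2 \<and> \<bar>2 * j\<bar> \<le> 2" using ball_lk[OF u that] by (simp add: ball_shape_def prx_def pry_def)
    then show ?thesis by presburger
  qed
  show "- 1 \<le> i \<and> i \<le> 0 \<and> \<bar>j\<bar> \<le> 1" if "lk (cf2 u (- 3)) i j \<noteq> 0"
  proof -
    have "\<bar>2 * i + 1\<bar> \<le> 1 \<and> \<bar>2 * j\<bar> \<le> 2" using ball_lk[OF u that] by (simp add: ball_shape_def prx_def pry_def)
    then show ?thesis by presburger
  qed
  show "\<bar>i\<bar> \<le> 1 \<and> - 1 \<le> j \<and> j \<le> 0" if "lk (cf2 u 3) i j \<noteq> 0"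
  proof -
    have "\<bar>2 * i\<bar> \<le> 2 \<and> \<bar>2 * j + 1\<bar> \<le> 1" using ball_lk[OF u that] by (simp add: ball_shape_def prx_def pry_def)
    then show ?thesis by presburger
  qed
  show "- 2 \<le> i \<and> i \<le> 1 \<and> - 2 \<le> j \<and> j \<le> 1 \<and> \<bar>2 * i + 1\<bar> + \<bar>2 * j + 1\<bar> \<le> 4" if "lk (cf2 u (- 2)) i j \<noteq> 0"
  proof -
    have "\<bar>2 * i + 1\<bar> \<le> 3 \<and> \<bar>2 * j + 1\<bar> \<le> 3 \<and> \<bar>2 * i + 1\<bar> + \<bar>2 * j + 1\<bar> \<le> 4"
      using ball_lk[OF u that] by (simp add: ball_shape_def prx_def pry_def)
    then show ?thesis by presburger
  qed
qed

lemma wd_le: "f \<noteq> 0 \<Longrightarrow> (\<And>j. Poly_Mapping.lookup f j \<noteq> 0 \<Longrightarrow> a \<le> j \<and> j \<le> b) \<Longrightarrow> wd f \<le> b - a \<and> a \<le> lo f \<and> hi f \<le> b"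
proof -
  assume f: "f \<noteq> 0" and b: "\<And>j. Poly_Mapping.lookup f j \<noteq> 0 \<Longrightarrow> a \<le> j \<and> j \<le> b"
  show ?thesis using b[OF hi_lo(1)[OF f]] b[OF hi_lo(2)[OF f]] by (simp add: wd_def)
qed

lemma lookup_nz_lk: "Poly_Mapping.lookup f j \<noteq> 0 \<Longrightarrow> \<exists>i. lk f i j \<noteq> 0" for f :: L2
  by (metis poly_mapping_eqI lookup_zero)

lemma lswap_nz_lk: "Poly_Mapping.lookup (lswap f) i \<noteq> 0 \<Longrightarrow> \<exists>j. lk f i j \<noteq> 0"
  by (metis lookup_nz_lk lookup_lswap)

lemma lookup_mult_pm1: "Poly_Mapping.lookup (c * pw (- 1) (- 1) j) i = Poly_Mapping.lookup c i * pw (- 1) (- 1) j" for c :: L1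
  by simp

lemma lookup_ev: "finite S \<Longrightarrow> (\<And>j. j \<notin> S \<Longrightarrow> Poly_Mapping.lookup f j = 0) \<Longrightarrow>
    Poly_Mapping.lookup (ev (- 1) f) i = (\<Sum>j\<in>S. lk f i j * pw (- 1) (- 1) j)"
  by (subst ev_eq_sum[of S]) (simp_all only: lookup_sum lookup_mult_pm1)

lemma ev_lswap: "ev (- 1) (lswap f) = cmap (ev (- 1)) f"
proof (rule poly_mapping_eqI)
  fix j
  let ?S = "Poly_Mapping.keys (lswap f)"
  have z: "Poly_Mapping.lookup (lswap f) i = 0" if "i \<notin> ?S" for i using that by (simp add: in_keys_iff)
  have "Poly_Mapping.lookup (ev (- 1) (lswap f)) j = (\<Sum>i\<in>?S. lk f i j * pw (- 1) (- 1) i)"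
    by (subst lookup_ev[of ?S]) (simp_all add: z lookup_lswap)
  also have "\<dots> = ev (- 1) (Poly_Mapping.lookup f j)"
    by (rule ev_eq_sum[symmetric]) (simp, metis z lookup_lswap lookup_zero)
  finally show "Poly_Mapping.lookup (ev (- 1) (lswap f)) j = Poly_Mapping.lookup (cmap (ev (- 1)) f) j"
    by (simp add: lookup_cmap coeff_hom.h_0[OF ev1])
qed

lemma ev_nz_lk: "Poly_Mapping.lookup (ev (- 1) f) i \<noteq> 0 \<Longrightarrow> \<exists>j. lk f i j \<noteq> 0"
proof (rule ccontr)
  assume nz: "Poly_Mapping.lookup (ev (- 1) f) i \<noteq> 0" and "\<not> (\<exists>j. lk f i j \<noteq> 0)"
  then have "(\<Sum>j\<in>Poly_Mapping.keys f. lk f i j * pw (- 1) (- 1) j) = 0" by simp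
  then show False using nz lookup_ev[of "Poly_Mapping.keys f" f i] by (simp add: in_keys_iff)
qed

definition phy :: "L2 \<Rightarrow> L1" where "phy = ev (- 1)"
definition phx :: "L2 \<Rightarrow> L1" where "phx f = ev (- 1) (lswap f)"

lemma phy_hom: "coeff_hom phy" and phx_hom: "coeff_hom phx"
proof -
  show "coeff_hom phy" unfolding phy_def by (rule ev_hom) simp
  then show "coeff_hom phx" unfolding phx_def[abs_def] phy_def by (rule coeff_hom_comp[OF _ lswap_hom])
qed

lemma cfY_phy: "cfY u n = phy (cf2 u n)" and cfX_phx: "cfX u n = phx (cf2 u n)"
  by (simp_all add: cfY_eq cfX_eq phy_def phx_def ev_lswap)

lemma ev_lrev_L2: "ev (- 1) (lrev f) = ev (- 1) f" for f :: L2
proof -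
  have "ev (- 1 :: L1) (lrev f) = (\<Sum>i\<in>uminus ` Poly_Mapping.keys f. Poly_Mapping.lookup (lrev f) i * pw (- 1) (- 1) i)"
    by (rule ev_eq_sum) (auto simp: lookup_lrev in_keys_iff image_iff, metis in_keys_iff minus_minus)
  also have "\<dots> = (\<Sum>i\<in>Poly_Mapping.keys f. Poly_Mapping.lookup f i * pw (- 1) (- 1) i)"
    by (subst sum.reindex) (simp_all add: lookup_lrev)
  also have "\<dots> = ev (- 1) f" by (rule ev_eq_sum[symmetric]) (auto simp: in_keys_iff)
  finally show ?thesis .
qed

lemma ev_xrev: "ev (- 1) (xrev f) = lrev (ev (- 1) f)"
proof (rule poly_mapping_eqI)
  fix i
  let ?S = "Poly_Mapping.keys f"
  have z: "Poly_Mapping.lookup f j = 0" if "j \<notin> ?S" for j using that by (simp add: in_keys_iff)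
  have "Poly_Mapping.lookup (ev (- 1) (xrev f)) i = (\<Sum>j\<in>?S. lk f (- i) j * pw (- 1) (- 1) j)"
    by (subst lookup_ev[of ?S]) (simp_all add: z lookup_xrev lookup_lrev)
  also have "\<dots> = Poly_Mapping.lookup (ev (- 1) f) (- i)" by (rule lookup_ev[symmetric]) (simp_all add: z)
  finally show "Poly_Mapping.lookup (ev (- 1) (xrev f)) i = Poly_Mapping.lookup (lrev (ev (- 1) f)) i" by (simp only: lookup_lrev)
qed

lemma ph_rev [simp]: "phy (lrev f) = phy f" "phy (xrev f) = lrev (phy f)" "phx (xrev f) = phx f" "phx (lrev f) = lrev (phx f)"
  by (simp_all add: phy_def phx_def ev_lrev_L2 ev_xrev lswap_lrev' lswap_xrev)

lemmas ph_hs = coeff_hom.h_mult[OF phy_hom] coeff_hom.h_mult[OF phx_hom] coeff_hom.h_1[OF phy_hom] coeff_hom.h_1[OF phx_hom]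
  coeff_hom.h_0[OF phy_hom] coeff_hom.h_0[OF phx_hom] coeff_hom.h_add[OF phy_hom] coeff_hom.h_add[OF phx_hom]

lemma ph_unit_nz: "f dvd 1 \<Longrightarrow> phy f \<noteq> 0 \<and> phx f \<noteq> 0"
  using coeff_hom.h_dvd[OF phy_hom, of f 1] coeff_hom.h_dvd[OF phx_hom, of f 1] by (auto simp: ph_hs)

lemma corner: "ev (- 1 :: int) (phy f) = ev (- 1) (phx f)"
proof -
  have "ev (- 1 :: int) (phy f) = ev (- 1) (\<Sum>j\<in>Poly_Mapping.keys f. Poly_Mapping.lookup f j * pw (- 1) (- 1) j)"
    unfolding phy_def by (subst ev_eq_sum[of "Poly_Mapping.keys f"]) (auto simp: in_keys_iff)
  also have "\<dots> = (\<Sum>j\<in>Poly_Mapping.keys f. ev (- 1) (Poly_Mapping.lookup f j) * pw (- 1) (- 1) j)"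
  proof -
    have s: "ev (- 1 :: int) (sum F I) = (\<Sum>i\<in>I. ev (- 1) (F i))" for F :: "int \<Rightarrow> L1" and I
      by (induction I rule: infinite_finite_induct) (simp_all add: coeff_hom.h_add[OF ev1] coeff_hom.h_0[OF ev1])
    show ?thesis unfolding s
      by (intro sum.cong refl) (auto simp: coeff_hom.h_mult[OF ev1] coeff_hom.h_uminus[OF ev1] coeff_hom.h_1[OF ev1])
  qed
  also have "\<dots> = ev (- 1) (phx f)"
    unfolding phx_def ev_lswap
    by (subst ev_eq_sum[of "Poly_Mapping.keys f" "cmap (ev (- 1)) f"]) (auto simp: lookup_cmap coeff_hom.h_0[OF ev1] in_keys_iff)
  finally show ?thesis .
qed

lemma line_Y_rigid:
  assumes "u * v = 1" "\<And>n. n < - 3 \<Longrightarrow> cfY u n = 0" "\<And>n. n > 4 \<Longrightarrow> cfY u n = 0" "cfY u 4 \<noteq> 0" and z: "cfY u (- 3) = 0 \<or> cfY u 3 = 0"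
  shows "mono_at (cfY u) 4"
proof (rule line_Y[OF assms(1-4)])
  show "cfY u (- 3) = 0 \<or> cfY u 3 = 0 \<or> P" for P using z by (elim disjE) simp_all
qed

lemma line_X_rigid:
  assumes "u * v = 1" "\<And>n. n < - 3 \<Longrightarrow> cfX u n = 0" "\<And>n. n > 4 \<Longrightarrow> cfX u n = 0" "cfX u 4 \<noteq> 0" and z: "cfX u (- 3) = 0 \<or> cfX u 3 = 0"
  shows "mono_at (cfX u) 4"
proof (rule line_X[OF assms(1-4)])
  show "cfX u (- 3) = 0 \<or> cfX u 3 = 0 \<or> P" for P using z by (elim disjE) simp_all
qed

text \<open>On each line either level 4 is occupied and the ball supplies the narrow supports, or
  the unit is short there.\<close>

lemma lines_mono:
  assumes uv: "u * v = 1" and u: "Poly_Mapping.keys u \<subseteq> word_ball 4" and m4: "cf2 u (- 4) = 0"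
  obtains n where "mono_at (\<lambda>n. phy (cf2 u n)) n" "mono_at (\<lambda>n. phx (cf2 u n)) n"
proof -
  have z: "cf2 u n = 0" if "n < - 3 \<or> n > 4" for n using ball_supp(1)[OF u, of n] m4 that by (cases "n = - 4") auto
  have zY: "cfY u n = 0" and zX: "cfX u n = 0" if "n < - 3 \<or> n > 4" for n
    by (simp_all only: cfY_phy cfX_phx z[OF that] ph_hs)
  have "\<exists>n. mono_at (cfY u) n"
  proof (cases "cfY u 4 = 0")
    case True
    show ?thesis
    proof (rule twisted.short_mono[OF TY_twisted _ uv])
      show "cfY u n = 0" if "n < - 3 \<or> n > 3" for n
        using zY[of n] True that by (cases "n = 4") auto
    qed (rule line_Y_rigid, assumption+)
  next
    case False
    have 1: "- 1 \<le> i \<and> i \<le> 0" if "Poly_Mapping.lookup (cfY u (- 3)) i \<noteq> 0" for i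
      using ev_nz_lk[of "cf2 u (- 3)" i] that ball_supp(3)[OF u] unfolding cfY_eq by blast
    have 2: "- 1 \<le> i \<and> i \<le> 1" if "Poly_Mapping.lookup (cfY u 4) i \<noteq> 0" for i
    proof -
      obtain j where "lk (cf2 u 4) i j \<noteq> 0" using ev_nz_lk[of "cf2 u 4" i] \<open>Poly_Mapping.lookup (cfY u 4) i \<noteq> 0\<close> unfolding cfY_eq by blast
      then show ?thesis using ball_supp(2)[OF u] by force
    qed
    have "mono_at (cfY u) 4" by (rule line_Y[OF uv _ _ False]) (use zY 1 2 in auto)
    then show ?thesis by blast
  qed
  then obtain n where n: "mono_at (cfY u) n" by blast
  have "\<exists>n. mono_at (cfX u) n"
  proof (cases "cfX u 4 = 0")
    case True
    show ?thesis
    proof (rule twisted.short_mono[OF TX_twisted _ uv])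
      show "cfX u n = 0" if "n < - 3 \<or> n > 3" for n
        using zX[of n] True that by (cases "n = 4") auto
    qed (rule line_X_rigid, assumption+)
  next
    case False
    have e: "\<exists>i. lk f i j \<noteq> 0" if "Poly_Mapping.lookup (cmap (ev (- 1)) f) j \<noteq> 0" for f j
    proof -
      have "Poly_Mapping.lookup f j \<noteq> 0" using that coeff_hom.h_0[OF ev1] by (auto simp: lookup_cmap)
      then show ?thesis by (rule lookup_nz_lk)
    qed
    have 1: "- 1 \<le> j \<and> j \<le> 0" if "Poly_Mapping.lookup (cfX u 3) j \<noteq> 0" for j
      using e[of "cf2 u 3" j] that ball_supp(4)[OF u] unfolding cfX_eq by blast
    have 2: "- 1 \<le> j \<and> j \<le> 1" if "Poly_Mapping.lookup (cfX u 4) j \<noteq> 0" for j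
    proof -
      obtain i where "lk (cf2 u 4) i j \<noteq> 0" using e[of "cf2 u 4" j] \<open>Poly_Mapping.lookup (cfX u 4) j \<noteq> 0\<close> unfolding cfX_eq by blast
      then show ?thesis using ball_supp(2)[OF u] by force
    qed
    have "mono_at (cfX u) 4" by (rule line_X[OF uv _ _ False]) (use zX 1 2 in auto)
    then show ?thesis by blast
  qed
  then obtain n' where n': "mono_at (cfX u) n'" by blast
  \<comment> \<open>The lines meet at x = y = -1: a coefficient that is a unit on one line has value
    1 or -1 there and cannot vanish on the other.\<close>
  have "n' = n"
  proof (rule ccontr)
    assume "n' \<noteq> n"
    then have "phx (cf2 u n) = 0" using n' unfolding mono_at_def cfX_phx by metis
    then have "ev (- 1 :: int) (phy (cf2 u n)) = 0" unfolding corner by (simp add: coeff_hom.h_0[OF ev1])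
    moreover have "ev (- 1 :: int) (phy (cf2 u n)) dvd ev (- 1) 1"
      using n unfolding mono_at_def cfY_phy by (blast intro: coeff_hom.h_dvd[OF ev1])
    ultimately show False by (simp add: coeff_hom.h_1[OF ev1])
  qed
  then show ?thesis using that[of n] n n' unfolding cfY_phy cfX_phx by blast
qed

subsection \<open>Divisibility along the lines\<close>

abbreviation zy :: L2 where "zy \<equiv> 1 + Y2"
abbreviation zx :: L2 where "zx \<equiv> 1 + X2"

lemma phy_0_dvd: "phy f = 0 \<longleftrightarrow> zy dvd f"
proof
  assume "zy dvd f"
  then obtain k where "f = zy * k" by (rule dvdE)
  moreover have "phy zy = 0" unfolding ph_hs by (simp add: phy_def ev_single)
  ultimately show "phy f = 0" by (simp add: ph_hs(1))
next
  assume "phy f = 0"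
  then show "zy dvd f" unfolding phy_def by (rule ev_neg_dvd)
qed

lemma phx_phy: "phx f = phy (lswap f)" "phy f = phx (lswap f)"
  by (simp_all add: phx_def phy_def)

lemma lswap_zy: "lswap zy = zx" "lswap zx = zy"
  by (simp_all only: coeff_hom.h_add[OF lswap_hom] lswap_XY lswap_1)

lemma phx_0_dvd: "phx f = 0 \<longleftrightarrow> zx dvd f"
  unfolding phx_phy(1) phy_0_dvd using coeff_hom.h_dvd[OF lswap_hom, of zy "lswap f"] coeff_hom.h_dvd[OF lswap_hom, of zx f]
  by (auto simp: lswap_zy)

lemma wd_zy: "zy \<noteq> 0" "wd zy = 1" "zx \<noteq> 0" "wx zx = 1" "wd zx = 0" "wx zy = 0" "phx zy \<noteq> 0" "phy zx \<noteq> 0"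
proof -
  have l: "Poly_Mapping.lookup zy j = (if j = 0 \<or> j = 1 then 1 else 0)" for j
    by (auto simp: lookup_add lookup_one when_def lookup_single)
  have "hi zy = 1" by (rule hi_eqI) (auto simp: l split: if_splits)
  moreover have "lo zy = 0" by (rule lo_eqI) (auto simp: l split: if_splits)
  ultimately show 1: "wd zy = 1" by (simp add: wd_def)
  show zn: "zy \<noteq> 0" using l[of 0] by (metis lookup_zero zero_neq_one)
  then show "zx \<noteq> 0" using lswap_zy by (metis lswap_eq_0)
  show "wx zx = 1" unfolding wx_def lswap_zy by (rule 1)
  have s: "zx = Poly_Mapping.single 0 (1 + xx)" by (simp only: single_add single_one)
  have "Poly_Mapping.lookup (1 + xx) 0 = 1" by (simp add: lookup_add lookup_single)
  then have xn: "1 + xx \<noteq> 0" by (metis lookup_zero zero_neq_one)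
  show "wd zx = 0" unfolding s by (rule wd_single[OF xn])
  then show "wx zy = 0" unfolding wx_def lswap_zy .
  show p: "phy zx \<noteq> 0" unfolding s phy_def using xn by (simp add: ev_single)
  then show "phx zy \<noteq> 0" unfolding phx_phy(1) lswap_zy .
qed

lemma dvd_both: "phy f = 0 \<Longrightarrow> phx f = 0 \<Longrightarrow> \<exists>k. f = zx * zy * k"
proof -
  assume f: "phy f = 0" "phx f = 0"
  have "zy dvd f" using f(1) by (simp only: phy_0_dvd)
  then obtain k where k: "f = zy * k" by (rule dvdE)
  have "phx zy * phx k = 0" using f(2) unfolding k ph_hs(2) .
  then have "phx k = 0" using wd_zy(7) by simp
  then obtain l where l: "k = zx * l" unfolding phx_0_dvd by (rule dvdE)
  have "f = zx * zy * l" unfolding k l by (simp only: mult_ac)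
  then show ?thesis by (rule exI)
qed

text \<open>The left side vanishes twice on y = -1. As \<open>U\<close> and \<open>B\<close> do not
  vanish on this line, \<open>1 + y\<close> divides \<open>C\<close> twice, which needs width
  2.\<close>

lemma double_root:
  assumes "phy T = 0" "phy S = 0" and eq: "T * S = U * C * B" and U: "U dvd 1" and B: "phy B \<noteq> 0" and C: "C \<noteq> 0" "wd C \<le> 1"
  shows False
proof -
  obtain T' where T: "T = zy * T'" using assms(1) unfolding phy_0_dvd by (rule dvdE)
  obtain S' where S: "S = zy * S'" using assms(2) unfolding phy_0_dvd by (rule dvdE)
  have Un: "phy U \<noteq> 0" using ph_unit_nz[OF U] by blast
  have "phy U * phy C * phy B = 0" using arg_cong[OF eq, of phy] assms(1) by (simp add: ph_hs(1))
  then have "phy C = 0" using Un B by simp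
  then obtain C' where C': "C = zy * C'" unfolding phy_0_dvd by (rule dvdE)
  have "zy * (zy * (T' * S')) = zy * (U * C' * B)" using eq unfolding T S C' by (simp only: mult_ac)
  then have e2: "zy * (T' * S') = U * C' * B" using wd_zy(1) by simp
  have "phy (zy * (T' * S')) = 0" unfolding phy_0_dvd by simp
  then have "phy C' = 0" using Un B unfolding e2 by (simp add: ph_hs(1))
  then obtain C'' where C'': "C' = zy * C''" unfolding phy_0_dvd by (rule dvdE)
  have "C'' \<noteq> 0" using C(1) C' C'' by auto
  then have "wd C \<ge> 2" using wd_zy(1,2) wd_nonneg[of C''] by (simp add: C' C'' wd_mult)
  then show False using C(2) by simp
qed

text \<open>The same count read the other way: two zeros on the right and none in \<open>T\<close>
  put both into \<open>S\<close>.\<close>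

lemma double_dvd:
  assumes eq: "T * S = U * C * B" and T: "phy T \<noteq> 0" and "phy C = 0" "phy B = 0"
  shows "\<exists>G. S = zy * zy * G"
proof -
  obtain C' where C: "C = zy * C'" using assms(3) unfolding phy_0_dvd by (rule dvdE)
  obtain B' where B: "B = zy * B'" using assms(4) unfolding phy_0_dvd by (rule dvdE)
  have "phy T * phy S = 0" using arg_cong[OF eq, of phy] assms(3) by (simp add: ph_hs(1))
  then have "phy S = 0" using T by simp
  then obtain S' where S: "S = zy * S'" unfolding phy_0_dvd by (rule dvdE)
  have "zy * (T * S') = zy * (zy * (U * C' * B'))" using eq unfolding C B S by (simp only: mult_ac)
  then have e: "T * S' = zy * (U * C' * B')" using wd_zy(1) by simp
  have "phy (zy * (U * C' * B')) = 0" unfolding phy_0_dvd by simp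
  then have "phy S' = 0" using T unfolding e[symmetric] by (simp add: ph_hs(1))
  then obtain G where "S' = zy * G" unfolding phy_0_dvd by (rule dvdE)
  then have "S = zy * zy * G" unfolding S by (simp only: mult.assoc)
  then show ?thesis by (rule exI)
qed

lemma lookup_single0_mult: "Poly_Mapping.lookup (Poly_Mapping.single 0 c * f) i = c * Poly_Mapping.lookup f i" for f :: L2
  by (subst lookup_mult_superset[of "{0}"]) (auto simp: lookup_single when_def)

text \<open>The support is a 4 by 4 square without its corners. For the exponents -2 and 1 of x only
  two exponents of y remain, too few for a nonzero multiple of the square of \<open>1 + y\<close>,
  so these columns vanish; what remains has two exponents of x, too few for the square of
  \<open>1 + x\<close>.\<close>

lemma D_shape_zero:
  assumes D: "\<And>i j. lk D i j \<noteq> 0 \<Longrightarrow> - 2 \<le> i \<and> i \<le> 1 \<and> - 2 \<le> j \<and> j \<le> 1 \<and> \<bar>2 * i + 1\<bar> + \<bar>2 * j + 1\<bar> \<le> 4"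
    and y: "D = zy * zy * G" and x: "lswap D = zy * zy * H"
  shows "D = 0"
proof (rule ccontr)
  assume nz: "D \<noteq> 0"
  have s: "zx = Poly_Mapping.single 0 (1 + xx)" by (simp only: single_add single_one)
  have xw: "1 + xx \<noteq> 0" "wd (1 + xx) = 1"
  proof -
    have l: "Poly_Mapping.lookup (1 + xx) j = (if j = 0 \<or> j = 1 then 1 else 0)" for j
      by (auto simp: lookup_add lookup_one when_def lookup_single)
    have "hi (1 + xx) = 1" by (rule hi_eqI) (auto simp: l split: if_splits)
    moreover have "lo (1 + xx) = 0" by (rule lo_eqI) (auto simp: l split: if_splits)
    ultimately show "wd (1 + xx) = 1" by (simp add: wd_def)
    show "1 + xx \<noteq> 0" using l[of 0] by (metis lookup_zero zero_neq_one)
  qed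
  have "lswap D = zx * zx * lswap G" unfolding y by (simp only: lswap_mult lswap_zy)
  then have col: "Poly_Mapping.lookup (lswap D) i = (1 + xx) * ((1 + xx) * Poly_Mapping.lookup (lswap G) i)" for i
    by (simp only: s mult.assoc lookup_single0_mult)
  have thin: "Poly_Mapping.lookup (lswap D) i = 0" if i: "i = - 2 \<or> i = 1" for i
  proof (rule ccontr)
    assume n: "Poly_Mapping.lookup (lswap D) i \<noteq> 0"
    have "- 1 \<le> j \<and> j \<le> 0" if "Poly_Mapping.lookup (Poly_Mapping.lookup (lswap D) i) j \<noteq> 0" for j
    proof -
      have "lk D i j \<noteq> 0" using that unfolding lookup_lswap .
      then have "\<bar>2 * i + 1\<bar> + \<bar>2 * j + 1\<bar> \<le> 4" using D by blast
      moreover have "\<bar>2 * i + 1\<bar> = 3" using i by (elim disjE) simp_all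
      ultimately show ?thesis by linarith
    qed
    then have "wd (Poly_Mapping.lookup (lswap D) i) \<le> 1" using wd_le[OF n, of "- 1" 0] by simp
    moreover have g: "Poly_Mapping.lookup (lswap G) i \<noteq> 0" using n col[of i] by (metis mult_zero_right)
    have "wd (Poly_Mapping.lookup (lswap D) i) = 1 + (1 + wd (Poly_Mapping.lookup (lswap G) i))"
      unfolding col wd_mult[OF xw(1) no_zero_divisors[OF xw(1) g]] wd_mult[OF xw(1) g] xw(2) ..
    ultimately show False using wd_nonneg[OF g] by linarith
  qed
  have sn: "lswap D \<noteq> 0" using nz by simp
  have "- 1 \<le> i \<and> i \<le> 0" if "Poly_Mapping.lookup (lswap D) i \<noteq> 0" for i
  proof -
    obtain j where "lk D i j \<noteq> 0" using lswap_nz_lk[OF \<open>Poly_Mapping.lookup (lswap D) i \<noteq> 0\<close>] by blast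
    then have "- 2 \<le> i" "i \<le> 1" using D by blast+
    moreover have "i \<noteq> - 2" "i \<noteq> 1" using thin[of i] that by auto
    ultimately show ?thesis by linarith
  qed
  then have "wd (lswap D) \<le> 1" using wd_le[OF sn, of "- 1" 0] by simp
  moreover have H: "H \<noteq> 0" using sn x by (metis mult_zero_right)
  have "wd (lswap D) = 1 + 1 + wd H"
    unfolding x wd_mult[OF no_zero_divisors[OF wd_zy(1) wd_zy(1)] H] wd_mult[OF wd_zy(1) wd_zy(1)] wd_zy(2) ..
  ultimately show False using wd_nonneg[OF H] by linarith
qed

text \<open>Infinite descent: 3 divides both numbers, and the quotients satisfy the same
  equation.\<close>

lemma no_sqrt3: "\<alpha> * \<alpha> = 3 * (\<beta> * \<beta>) \<Longrightarrow> \<beta> = 0" for \<alpha> \<beta> :: int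
proof (induction "nat \<bar>\<beta>\<bar>" arbitrary: \<alpha> \<beta> rule: less_induct)
  case less
  have d3: "3 dvd x" if "3 dvd x * x" for x :: int
  proof -
    have "x mod 3 = 0 \<or> x mod 3 = 1 \<or> x mod 3 = 2" by presburger
    moreover have "(x * x) mod 3 = ((x mod 3) * (x mod 3)) mod 3" by (simp add: mod_mult_eq)
    moreover have "(x * x) mod 3 = 0" using that by (simp only: dvd_eq_mod_eq_0)
    ultimately have "x mod 3 = 0" by (elim disjE) simp_all
    then show ?thesis by (simp only: dvd_eq_mod_eq_0)
  qed
  have "3 dvd \<alpha> * \<alpha>" unfolding less.prems by simp
  then have "3 dvd \<alpha>" by (rule d3)
  then obtain \<gamma> where g: "\<alpha> = 3 * \<gamma>" by (rule dvdE)
  have b: "\<beta> * \<beta> = 3 * (\<gamma> * \<gamma>)" using less.prems unfolding g by simp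
  then have "3 dvd \<beta> * \<beta>" by simp
  then have "3 dvd \<beta>" by (rule d3)
  then obtain \<delta> where d: "\<beta> = 3 * \<delta>" by (rule dvdE)
  have c: "\<gamma> * \<gamma> = 3 * (\<delta> * \<delta>)" using b unfolding d by simp
  show ?case
  proof (rule ccontr)
    assume "\<beta> \<noteq> 0"
    then have "nat \<bar>\<delta>\<bar> < nat \<bar>\<beta>\<bar>" using d by simp
    then have "\<delta> = 0" using less.hyps c by blast
    then show False using d \<open>\<beta> \<noteq> 0\<close> by simp
  qed
qed

text \<open>With \<open>A\<close> and \<open>B\<close> the squares of \<open>x\<close> and
  \<open>y\<close>, the equations become \<open>q * (A + B) = 2 * (A * B)\<close> and
  \<open>A * A + B * B + q * q = 3 * (A * B)\<close>. Eliminating \<open>q\<close> gives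
  \<open>A = B\<close>, hence \<open>q = A\<close>, and \<open>z * z\<close> is 3 or -1 times
  \<open>x * x\<close>.\<close>

lemma final_arith:
  fixes x y z p q s :: int
  assumes p: "p = - (x * x)" and s: "s = - (y * y)" and q: "q = z * z - 2 * (x * y)" and nz: "x \<noteq> 0" "y \<noteq> 0"
    and e1: "2 * (p * s) + q * (p + s) = 0" and e2: "p * p + q * q + s * s + 2 * (q * (p + s)) + p * s = 0"
  shows False
proof -
  define A B where "A = x * x" and "B = y * y"
  have pos: "A > 0" "B > 0" using nz by (simp_all add: A_def B_def zero_less_mult_iff) linarith+
  have pA: "p = - A" "s = - B" by (simp_all add: p s A_def B_def)
  have e1': "q * (A + B) = 2 * (A * B)" using e1 unfolding pA by (simp add: algebra_simps)
  have e2': "A * A + B * B + q * q = 3 * (A * B)" using e2 e1' unfolding pA by (simp add: algebra_simps)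
  have "(A - B) * (A - B) * (A * A + A * B + B * B) = 0" using e1' e2' by algebra
  moreover have "A * A + A * B + B * B > 0" using pos by (simp add: add_pos_pos)
  ultimately have AB: "A = B" by simp
  then have "2 * A * (q - A) = 0" using e1' by (simp add: algebra_simps)
  then have qA: "q = A" using pos by simp
  have "(x - y) * (x + y) = 0" using AB unfolding A_def B_def by (simp add: algebra_simps)
  then have "x = y \<or> x = - y" by auto
  then have "z * z = 3 * (x * x) \<or> z * z = - (x * x)" using q qA unfolding A_def by auto
  then show False
  proof
    assume "z * z = 3 * (x * x)"
    then show False using no_sqrt3 nz(1) by blast
  next
    assume "z * z = - (x * x)"
    moreover have "z * z \<ge> 0" "x * x > 0" using pos by (simp_all add: A_def)
    ultimately show False by linarith
  qed
qed

lemma cop_ph: "cop f g \<Longrightarrow> \<not> (phy f = 0 \<and> phy g = 0)" "cop f g \<Longrightarrow> \<not> (phx f = 0 \<and> phx g = 0)"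
proof -
  assume c: "cop f g"
  have u: "\<not> zy dvd 1" "\<not> zx dvd 1" using phy_0_dvd[of 1] phx_0_dvd[of 1] by (simp_all add: ph_hs)
  show "\<not> (phy f = 0 \<and> phy g = 0)"
  proof
    assume "phy f = 0 \<and> phy g = 0"
    then have "zy dvd f * 1" "zy dvd g * 1" by (simp_all add: phy_0_dvd)
    then show False using c u(1) unfolding cop_def by blast
  qed
  show "\<not> (phx f = 0 \<and> phx g = 0)"
  proof
    assume "phx f = 0 \<and> phx g = 0"
    then have "zx dvd f * 1" "zx dvd g * 1" by (simp_all add: phx_0_dvd)
    then show False using c u(2) unfolding cop_def by blast
  qed
qed

lemma ph_0_wd: "f \<noteq> 0 \<Longrightarrow> phy f = 0 \<Longrightarrow> wd f \<ge> 1" "f \<noteq> 0 \<Longrightarrow> phx f = 0 \<Longrightarrow> wx f \<ge> 1"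
proof -
  assume nz: "f \<noteq> 0"
  show "wd f \<ge> 1" if z: "phy f = 0"
  proof -
    obtain k where k: "f = zy * k" using z unfolding phy_0_dvd by (rule dvdE)
    then have "k \<noteq> 0" using nz by auto
    then show ?thesis unfolding k using wd_zy(1,2) wd_nonneg[of k] by (simp add: wd_mult)
  qed
  show "wx f \<ge> 1" if z: "phx f = 0"
  proof -
    obtain k where k: "f = zx * k" using z unfolding phx_0_dvd by (rule dvdE)
    then have "k \<noteq> 0" using nz by auto
    then show ?thesis unfolding k using wd_zy(3,4) wx_nonneg[of k] by (simp add: wx_mult)
  qed
qed

lemma wd_XY [simp]: "wd X2 = 0" "wx X2 = 0" "wd Y2 = 0" "wx Y2 = 0" "wd (Poly_Mapping.single (- 1) (1 :: L1)) = 0" "wx (Poly_Mapping.single (- 1) 1) = 0"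
  using unit_wd2[OF XY_dvd_1(1)] unit_wd2[OF XY_dvd_1(2)] unit_wd2[of "Poly_Mapping.single (- 1) 1"] by simp_all

lemma wx_single: "c \<noteq> 0 \<Longrightarrow> wx (Poly_Mapping.single j c) = wd c"
proof -
  assume c: "c \<noteq> 0"
  have "lk (Poly_Mapping.single j c) i k = (if k = j then Poly_Mapping.lookup c i else 0)" for i k
    by (simp add: lookup_single when_def)
  then have l: "Poly_Mapping.lookup (lswap (Poly_Mapping.single j c)) i = Poly_Mapping.single j (Poly_Mapping.lookup c i)" for i
    by (intro poly_mapping_eqI) (simp add: lookup_lswap lookup_single when_def)
  have "Poly_Mapping.keys (lswap (Poly_Mapping.single j c)) = Poly_Mapping.keys c"
    by (rule set_eqI) (simp only: in_keys_iff l, metis lookup_single_eq lookup_zero single_zero)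
  then show ?thesis by (simp add: wx_def wd_def hi_def lo_def)
qed

lemma wd_0_obtain:
  assumes "f \<noteq> 0" "wd f = 0"
  obtains j c where "f = Poly_Mapping.single j c" "c \<noteq> 0"
  using wd_0_single[OF assms] hi_lo(2)[OF assms(1)] by blast

lemma mono2: "f \<noteq> 0 \<Longrightarrow> wd f = 0 \<Longrightarrow> wx f = 0 \<Longrightarrow> \<exists>i j m. m \<noteq> 0 \<and> f = Poly_Mapping.single j (Poly_Mapping.single i m)" for f :: L2
  by (metis wd_0_obtain wx_single)

lemma wd_0_unit: "f \<noteq> 0 \<Longrightarrow> wd f = 0 \<Longrightarrow> phy f dvd 1 \<Longrightarrow> f dvd 1" "f \<noteq> 0 \<Longrightarrow> wx f = 0 \<Longrightarrow> phx f dvd 1 \<Longrightarrow> f dvd 1"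
proof -
  have *: "f dvd 1" if f: "f \<noteq> 0" "wd f = 0" "phy f dvd 1" for f :: L2
  proof -
    obtain j c where f': "f = Poly_Mapping.single j c" "c \<noteq> 0" using f(1,2) by (rule wd_0_obtain)
    have "c * pw (- 1) (- 1) j dvd 1" using f(3) by (simp only: f' phy_def ev_single)
    then have "c dvd 1" by (metis mult_dvd_1_iff)
    then show ?thesis unfolding f' by (rule single_unit)
  qed
  show "f \<noteq> 0 \<Longrightarrow> wd f = 0 \<Longrightarrow> phy f dvd 1 \<Longrightarrow> f dvd 1" by (rule *)
  assume "f \<noteq> 0" "wx f = 0" "phx f dvd 1"
  then have "lswap f dvd 1" by (intro *) (simp_all add: wx_def phx_phy(1))
  from coeff_hom.h_dvd[OF lswap_hom this] show "f dvd 1" by simp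
qed

section \<open>The augmentation at x = y = 1\<close>

definition om :: "L2 \<Rightarrow> int" where "om f = ev 1 (ev 1 f)"

lemma ev1_hom: "coeff_hom (ev (1 :: 'r::comm_ring_1))"
  by (rule ev_hom) simp

lemma ev1_lrev: "ev 1 (lrev f) = ev 1 f" for f :: "'r::comm_ring_1 laurent"
proof -
  have "ev 1 (lrev f) = (\<Sum>i\<in>uminus ` Poly_Mapping.keys f. Poly_Mapping.lookup (lrev f) i * pw 1 1 i)"
    by (rule ev_eq_sum) (auto simp: lookup_lrev in_keys_iff image_iff, metis in_keys_iff minus_minus)
  also have "\<dots> = (\<Sum>i\<in>Poly_Mapping.keys f. Poly_Mapping.lookup f i * pw 1 1 i)"
    by (subst sum.reindex) (simp_all add: lookup_lrev)
  also have "\<dots> = ev 1 f" by (rule ev_eq_sum[symmetric]) (auto simp: in_keys_iff)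
  finally show ?thesis .
qed

lemma om_hom: "coeff_hom om"
  using coeff_hom_comp[OF ev1_hom ev1_hom] by (simp add: om_def[abs_def])

lemma om_rev: "om (lrev f) = om f" "om (xrev f) = om f"
proof -
  show "om (lrev f) = om f" by (simp add: om_def ev1_lrev)
  have s: "ev (1 :: int) (sum F I) = (\<Sum>i\<in>I. ev 1 (F i))" for F :: "int \<Rightarrow> L1" and I
    by (induction I rule: infinite_finite_induct) (simp_all add: coeff_hom.h_add[OF ev1_hom] coeff_hom.h_0[OF ev1_hom])
  have "om (xrev f) = (\<Sum>j\<in>Poly_Mapping.keys f. ev 1 (Poly_Mapping.lookup (xrev f) j))"
    unfolding om_def by (subst ev_eq_sum[of "Poly_Mapping.keys f"]) (auto simp: s lookup_xrev in_keys_iff)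
  also have "\<dots> = (\<Sum>j\<in>Poly_Mapping.keys f. ev 1 (Poly_Mapping.lookup f j))" by (simp add: lookup_xrev ev1_lrev)
  also have "\<dots> = om f"
    unfolding om_def by (subst (2) ev_eq_sum[of "Poly_Mapping.keys f"]) (auto simp: s in_keys_iff)
  finally show "om (xrev f) = om f" .
qed

lemmas om_hs = coeff_hom.h_mult[OF om_hom] coeff_hom.h_add[OF om_hom] coeff_hom.h_minus[OF om_hom] coeff_hom.h_1[OF om_hom]

lemma om_single: "om (Poly_Mapping.single j (Poly_Mapping.single i m)) = m"
  by (simp add: om_def ev_single)

lemma om_XY: "om X2 = 1" "om Y2 = 1" "om zx = 2" "om zy = 2"
proof -
  show x: "om X2 = 1" by (rule om_single)
  show y: "om Y2 = 1" using om_single[of 1 0 1] by simp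
  show "om zx = 2" "om zy = 2" by (simp_all only: om_hs x y)
qed

lemma om_unit: "f dvd 1 \<Longrightarrow> \<bar>om f\<bar> = 1"
  using coeff_hom.h_dvd[OF om_hom, of f 1] by (simp add: om_hs)

text \<open>The bound is the gap from \<open>y * y\<close> to the next smaller square; the gap to
  the next larger one exceeds it.\<close>

lemma diff_sq_ge: "x * x - y * y \<noteq> 0 \<Longrightarrow> \<bar>x * x - y * y\<bar> \<ge> 2 * \<bar>y\<bar> - 1" for x y :: int
proof -
  define X Y where "X = \<bar>x\<bar>" and "Y = \<bar>y\<bar>"
  have e: "x * x = X * X" "y * y = Y * Y" by (simp_all add: X_def Y_def abs_mult_self)
  have p: "X \<ge> 0" "Y \<ge> 0" by (simp_all add: X_def Y_def)
  assume "x * x - y * y \<noteq> 0"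
  then have "X \<noteq> Y" unfolding e by auto
  then consider "X \<ge> Y + 1" | "X + 1 \<le> Y" by linarith
  then show ?thesis
  proof cases
    case 1
    then have "(Y + 1) * (Y + 1) \<le> X * X" using p by (intro mult_mono) auto
    then have "Y * Y + 2 * Y + 1 \<le> X * X" by (simp add: algebra_simps)
    then show ?thesis unfolding e Y_def[symmetric] by linarith
  next
    case 2
    then have "(X + 1) * (X + 1) \<le> Y * Y" "X * X \<le> (Y - 1) * (Y - 1)" using p by (intro mult_mono; simp)+
    then have "X * X \<le> Y * Y - 2 * Y + 1" by (simp add: algebra_simps)
    then show ?thesis unfolding e Y_def[symmetric] by linarith
  qed
qed

context plane_data
begin

text \<open>When the lines sit at level -2, both \<open>b1\<close> and \<open>b4\<close> vanish on
  both lines and use up all the width of \<open>T\<close>; the factors \<open>a1\<close>,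
  \<open>a4\<close>, \<open>d\<close>, \<open>h\<close> become units. At x = y = 1 the norms
  \<open>n1\<close> and \<open>n4\<close> are then 1 minus 16 times a nonzero square, while
  \<open>R\<close> and \<open>E\<close> are nonzero differences of squares in which the square of
  such a norm is subtracted, hence strictly larger in absolute value. This contradicts the equality
  of the products.\<close>

lemma case_D:
  assumes D: "D = a1 * (d * h) * lrev (xrev a4)" and B: "B = a1 * (d * h) * lrev (xrev b4)"
    and C: "C = X2 * Poly_Mapping.single (- 1) 1 * b1 * lrev (d * h) * xrev a4" and T: "T = X2 * b1 * lrev (d * h) * xrev b4"
    and wB: "wx B \<le> 1" and wC: "wd C \<le> 1" and wT: "wd T \<le> 2" "wx T \<le> 2"
    and zB: "phy B = 0" "phx B = 0" and zC: "phy C = 0" "phx C = 0" and uD: "phy D dvd 1" "phx D dvd 1"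
  shows False
proof -
  have uy: "phy a1 dvd 1" "phy d dvd 1" "phy h dvd 1" "phy a4 dvd 1" using uD(1) unfolding D ph_hs ph_rev mult_dvd_1_iff lrev_dvd_1 by blast+
  have ux: "phx a1 dvd 1" "phx d dvd 1" "phx h dvd 1" "phx a4 dvd 1" using uD(2) unfolding D ph_hs ph_rev mult_dvd_1_iff lrev_dvd_1 by blast+
  have ny: "phy a1 \<noteq> 0" "phy d \<noteq> 0" "phy h \<noteq> 0" "phy a4 \<noteq> 0" using uy by auto
  have nx: "phx a1 \<noteq> 0" "phx d \<noteq> 0" "phx h \<noteq> 0" "phx a4 \<noteq> 0" using ux by auto
  have XY: "phy X2 \<noteq> 0" "phx X2 \<noteq> 0" "phy (Poly_Mapping.single (- 1) 1) \<noteq> 0" "phx (Poly_Mapping.single (- 1) 1) \<noteq> 0"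
    using ph_unit_nz[OF XY_dvd_1(1)] ph_unit_nz[of "Poly_Mapping.single (- 1) 1"] by auto
  have z4: "phy b4 = 0" "phx b4 = 0" using zB ny nx unfolding B ph_hs ph_rev by simp_all
  have z1: "phy b1 = 0" "phx b1 = 0" using zC ny nx XY unfolding C ph_hs ph_rev by simp_all
  obtain k4 where k4: "b4 = zx * zy * k4" using dvd_both[OF z4] by blast
  obtain k1 where k1: "b1 = zx * zy * k1" using dvd_both[OF z1] by blast
  have knz: "k1 \<noteq> 0" "k4 \<noteq> 0" using nz k1 k4 by auto
  have anz: "a1 \<noteq> 0" "a4 \<noteq> 0" using ny by (auto simp: ph_hs)
  have wb: "wd b1 = 1 + wd k1" "wx b1 = 1 + wx k1" "wd b4 = 1 + wd k4" "wx b4 = 1 + wx k4"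
    unfolding k1 k4 using knz wd_zy by (simp_all add: wd_mult wx_mult)
  have wTe: "wd T = wd b1 + (wd d + wd h) + wd b4" "wx T = wx b1 + (wx d + wx h) + wx b4"
    unfolding T using nz by (simp_all add: wd_mult wx_mult)
  have wBe: "wx B = wx a1 + (wx d + wx h) + wx b4" unfolding B using nz anz by (simp add: wx_mult)
  have wCe: "wd C = wd b1 + (wd d + wd h) + wd a4" unfolding C using nz anz by (simp add: wd_mult)
  have nn: "wd k1 \<ge> 0" "wx k1 \<ge> 0" "wd k4 \<ge> 0" "wx k4 \<ge> 0" "wx a1 \<ge> 0" "wd a4 \<ge> 0" using knz anz by (simp_all add: wd_nonneg wx_nonneg)
  \<comment> \<open>\<open>T\<close> has width at most 2 in each direction, and
    \<open>zx * zy\<close> takes 1 from it in each direction in \<open>b1\<close> and again in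
    \<open>b4\<close>; the bounds on \<open>B\<close> and \<open>C\<close> dispose of the widths of
    \<open>a1\<close> in x and of \<open>a4\<close> in y.\<close>
  have w: "wd k1 = 0" "wx k1 = 0" "wd k4 = 0" "wx k4 = 0" "wx a1 = 0" "wd a4 = 0" "wd d = 0" "wd h = 0"
    using nn wds wT wB wC unfolding wTe wBe wCe wb by linarith+
  have u: "a1 dvd 1" "a4 dvd 1" "d dvd 1" "h dvd 1"
    using wd_0_unit(2)[OF anz(1) w(5) ux(1)] wd_0_unit(1)[OF anz(2) w(6) uy(4)] wd_0_unit(1)[OF nz(3) w(7) uy(2)] wd_0_unit(1)[OF nz(4) w(8) uy(3)] by blast+
  obtain m1 where m1: "om k1 = m1" "m1 \<noteq> 0" using mono2[OF knz(1) w(1,2)] om_single by blast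
  obtain m4 where m4: "om k4 = m4" "m4 \<noteq> 0" using mono2[OF knz(2) w(3,4)] om_single by blast
  have one: "om f * om f = 1" if "f dvd 1" for f using om_unit[OF that] by (metis abs_mult_self mult_1)
  have b: "om b1 = 4 * m1" "om b4 = 4 * m4" unfolding k1 k4 om_hs om_XY m1 m4 by simp_all
  define N M where "N = om n1" and "M = om n4"
  have N: "N = 1 - 16 * (m1 * m1)" unfolding N_def n1 om_hs om_rev om_XY b using one[OF u(1)] by simp
  have M: "M = 1 - 16 * (m4 * m4)" unfolding M_def n4 om_hs om_rev om_XY b using one[OF u(2)] by simp
  have "m1 * m1 \<ge> 1" "m4 * m4 \<ge> 1" using int_sq_ge_abs[of m1] int_sq_ge_abs[of m4] m1 m4 by (simp_all add: power2_eq_square)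
  then have big: "\<bar>N\<bar> \<ge> 15" "\<bar>M\<bar> \<ge> 15" unfolding N M by linarith+
  have Re: "om R = om r * om r - N * N" unfolding R om_hs om_rev om_XY N_def using one[OF u(4)] by (simp add: mult_ac; metis mult.left_commute mult_1_right)
  have Ee: "om E = om e * om e - M * M" unfolding E om_hs om_rev om_XY M_def using one[OF u(3)] by (simp add: mult_ac; metis mult.left_commute mult_1_right)
  have "om (R * lrev R * (E * xrev E)) = om (eps * (n1 * xrev n1) * (n4 * lrev n4))" by (simp only: star)
  then have "(om R * om E) * (om R * om E) = om eps * ((N * M) * (N * M))" unfolding om_hs om_rev N_def M_def by (simp only: mult_ac)
  then have "\<bar>(om R * om E) * (om R * om E)\<bar> = \<bar>om eps\<bar> * \<bar>(N * M) * (N * M)\<bar>" by (simp only: abs_mult)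
  then have "(om R * om E)\<^sup>2 = (N * M)\<^sup>2" using om_unit[OF eps] by (simp add: power2_eq_square)
  then have eq: "\<bar>om R\<bar> * \<bar>om E\<bar> = \<bar>N\<bar> * \<bar>M\<bar>" unfolding abs_mult[symmetric] by (simp only: power2_eq_iff abs_eq_iff)
  have "\<bar>N\<bar> * \<bar>M\<bar> \<noteq> 0" using big by auto
  then have "om R \<noteq> 0" "om E \<noteq> 0" using eq by auto
  then have "\<bar>om R\<bar> \<ge> 2 * \<bar>N\<bar> - 1" "\<bar>om E\<bar> \<ge> 2 * \<bar>M\<bar> - 1" unfolding Re Ee by (intro diff_sq_ge; simp)+
  then have "\<bar>N\<bar> + 1 \<le> \<bar>om R\<bar>" "\<bar>M\<bar> + 1 \<le> \<bar>om E\<bar>" using big by linarith+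
  then have "(\<bar>N\<bar> + 1) * (\<bar>M\<bar> + 1) \<le> \<bar>om R\<bar> * \<bar>om E\<bar>" by (intro mult_mono) auto
  then show False unfolding eq by (simp add: algebra_simps)
qed

end

lemma wx_ge: "Poly_Mapping.lookup f j \<noteq> 0 \<Longrightarrow> wd (Poly_Mapping.lookup f j) \<le> wx f" for f :: L2
proof -
  assume c: "Poly_Mapping.lookup f j \<noteq> 0"
  then have f: "lswap f \<noteq> 0" by auto
  have n: "Poly_Mapping.lookup (lswap f) i \<noteq> 0" if "lk f i j \<noteq> 0" for i
    using that lookup_lswap[of f i j] by (metis lookup_zero)
  have "hi (Poly_Mapping.lookup f j) \<le> hi (lswap f)" "lo (lswap f) \<le> lo (Poly_Mapping.lookup f j)"
    using hi_lo(3)[OF f n[OF hi_lo(1)[OF c]]] hi_lo(3)[OF f n[OF hi_lo(2)[OF c]]] by blast+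
  then show ?thesis by (simp add: wx_def wd_def)
qed

lemma hi_single0_mult:
  fixes f :: L2
  assumes "c \<noteq> 0" "f \<noteq> 0"
  shows "hi (Poly_Mapping.single 0 c * f) = hi f" "lo (Poly_Mapping.single 0 c * f) = lo f"
proof -
  have s: "Poly_Mapping.single 0 c \<noteq> (0 :: L2)" using assms(1) by (metis lookup_single_eq lookup_zero)
  show "hi (Poly_Mapping.single 0 c * f) = hi f" "lo (Poly_Mapping.single 0 c * f) = lo f"
    using hi_lo_mult(1,2)[OF s assms(2)] hi_lo_single[OF assms(1), where i = "0::int"] by simp_all
qed

lemma wd_norm: "c \<noteq> 0 \<Longrightarrow> wd (- (c * lrev c)) = 2 * wd c" for c :: L1
  by (simp add: wd_mult)

text \<open>\<open>\<nu>\<close> has three coefficients \<open>p\<close>, \<open>q\<close>,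
  \<open>s\<close>, where \<open>p\<close> and \<open>s\<close> are minus the squares of the two
  coefficients of \<open>\<beta>\<close>, and \<open>\<eta>\<close> is a constant times
  \<open>1 + xx\<close> up to a shift. The two vanishing coefficients of the norm of
  \<open>\<nu> * \<eta>\<close> are the two equations of \<open>final_arith\<close>.\<close>

lemma middle_coefficient:
  fixes \<alpha> \<beta> \<eta> \<nu> :: L1
  assumes \<nu>: "\<nu> = \<alpha> * \<alpha> - xx * \<beta> * \<beta>" and w: "wd \<alpha> = 0" "wd \<nu> = 2" "wd \<eta> = 1" and nz: "\<alpha> \<noteq> 0" "\<beta> \<noteq> 0" "\<eta> \<noteq> 0"
    and root: "ev (- 1) \<eta> = 0"
    and c: "Poly_Mapping.lookup (\<nu> * \<eta> * lrev (\<nu> * \<eta>)) 1 = 0" "Poly_Mapping.lookup (\<nu> * \<eta> * lrev (\<nu> * \<eta>)) 2 = 0"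
  shows False
proof -
  note E = parity_diff_ends[where \<theta> = "\<lambda>f. f", OF id_\<theta> refl nz(2) \<nu>]
  have hla: "hi \<alpha> = lo \<alpha>" using w(1) by (simp add: wd_def)
  have hl: "hi \<nu> = lo \<nu> + 2" using w(2) by (simp add: wd_def)
  \<comment> \<open>The single exponent of \<open>\<alpha>\<close> cannot provide both ends of
    \<open>\<nu>\<close>, and parity forbids that it provides just one, since the ends are 2
    apart.\<close>
  have "hi \<nu> \<noteq> 2 * hi \<alpha>"
  proof
    assume h: "hi \<nu> = 2 * hi \<alpha>"
    show False using E(3)
    proof (elim disjE conjE)
      assume "lo \<nu> = 1 + 2 * lo \<beta>"
      then show False using h hl by presburger
    next
      assume "lo \<nu> = 2 * lo \<alpha>"
      then show False using h hl hla by linarith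
    qed
  qed
  then have top: "hi \<nu> = 1 + 2 * hi \<beta>" "hc \<nu> = - (hc \<beta> * hc \<beta>)" using E(2) by auto
  have "lo \<nu> \<noteq> 2 * lo \<alpha>" using top(1) hl by presburger
  then have bot: "lo \<nu> = 1 + 2 * lo \<beta>" "lc \<nu> = - (lc \<beta> * lc \<beta>)" using E(3) by auto
  have hb: "hi \<beta> = lo \<beta> + 1" using top(1) bot(1) hl by linarith
  have "2 * hi \<alpha> \<le> hi \<nu>" "lo \<nu> \<le> 2 * lo \<alpha>" using E(4)[OF nz(1)] by blast+
  then have la: "lo \<alpha> = lo \<beta> + 1" using top(1) bot(1) hb hla by presburger
  define l where "l = lo \<beta>"
  define x y z where "x = Poly_Mapping.lookup \<beta> l" and "y = Poly_Mapping.lookup \<beta> (l + 1)" and "z = Poly_Mapping.lookup \<alpha> (l + 1)"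
  have xy: "x \<noteq> 0" "y \<noteq> 0" using hi_lo(1,2)[OF nz(2)] hb by (simp_all add: x_def y_def l_def)
  have bz: "Poly_Mapping.lookup \<beta> i = 0" if "i \<notin> {l, l + 1}" for i using hi_lo(3)[OF nz(2), of i] hb that by (force simp: l_def)
  have az: "Poly_Mapping.lookup \<alpha> i = 0" if "i \<notin> {l + 1}" for i using hi_lo(3)[OF nz(1), of i] hla la that by (force simp: l_def)
  have aa: "Poly_Mapping.lookup (\<alpha> * \<alpha>) (2 * l + 2) = z * z"
    by (subst lookup_mult_superset[of "{l + 1}"]) (use az in \<open>auto simp: z_def add.commute\<close>)
  have bb: "Poly_Mapping.lookup (\<beta> * \<beta>) (2 * l + 1) = 2 * (x * y)"
    by (subst lookup_mult_superset[of "{l, l + 1}"]) (use bz in \<open>auto simp: x_def y_def algebra_simps\<close>)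
  have xs: "Poly_Mapping.lookup (xx * f) i = Poly_Mapping.lookup f (i - 1)" for f i
    by (subst lookup_mult_superset[of "{1}"]) (auto simp: lookup_single when_def)
  define L where "L = lo \<nu>"
  have L: "L = 2 * l + 1" using bot(1) by (simp add: L_def l_def)
  define p q s where "p = Poly_Mapping.lookup \<nu> L" and "q = Poly_Mapping.lookup \<nu> (L + 1)" and "s = Poly_Mapping.lookup \<nu> (L + 2)"
  have p: "p = - (x * x)" using bot(2) by (simp add: p_def L_def x_def l_def)
  have s: "s = - (y * y)" using top(2) hl hb by (simp add: s_def L_def y_def l_def)
  have q: "q = z * z - 2 * (x * y)"
  proof -
    have "Poly_Mapping.lookup \<nu> (2 * l + 2) = Poly_Mapping.lookup (\<alpha> * \<alpha>) (2 * l + 2) - Poly_Mapping.lookup (xx * (\<beta> * \<beta>)) (2 * l + 2)"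
      by (simp only: \<nu> lookup_minus mult.assoc)
    moreover have "2 * l + 2 - 1 = 2 * l + 1" "L + 1 = 2 * l + 2" using L by simp_all
    ultimately show ?thesis unfolding q_def xs aa by (simp only: bb)
  qed
  have Nz: "Poly_Mapping.lookup \<nu> i = 0" if "i \<notin> {L, L + 1, L + 2}" for i using hi_lo(3)[OF E(1), of i] hl that by (force simp: L_def)
  define m where "m = lo \<eta>"
  define k where "k = Poly_Mapping.lookup \<eta> m"
  have he: "hi \<eta> = m + 1" using w(3) by (simp add: wd_def m_def)
  have k: "k \<noteq> 0" using hi_lo(2)[OF nz(3)] by (simp add: k_def m_def)
  have ez: "Poly_Mapping.lookup \<eta> i = 0" if "i \<notin> {m, m + 1}" for i using hi_lo(3)[OF nz(3), of i] he that by (force simp: m_def)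
  have "ev (- 1) \<eta> = (\<Sum>i\<in>{m, m + 1}. Poly_Mapping.lookup \<eta> i * pw (- 1) (- 1) i)" by (rule ev_eq_sum) (use ez in auto)
  then have k': "Poly_Mapping.lookup \<eta> (m + 1) = k" using root by (simp add: k_def split: if_splits)
  define P where "P = \<nu> * \<eta>"
  have lP: "Poly_Mapping.lookup P (m + n) = k * (Poly_Mapping.lookup \<nu> n + Poly_Mapping.lookup \<nu> (n - 1))" for n
  proof -
    have "Poly_Mapping.lookup (\<eta> * \<nu>) (m + n) = (\<Sum>i\<in>{m, m + 1}. Poly_Mapping.lookup \<eta> i * Poly_Mapping.lookup \<nu> (m + n - i))"
      by (rule lookup_mult_superset) (use ez in auto)
    also have "\<dots> = k * (Poly_Mapping.lookup \<nu> n + Poly_Mapping.lookup \<nu> (n - 1))" by (simp add: k' k_def[symmetric] distrib_left)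
    finally show ?thesis by (simp add: P_def mult.commute)
  qed
  define b where "b = m + L"
  have Pb: "Poly_Mapping.lookup P (b + n) = k * (Poly_Mapping.lookup \<nu> (L + n) + Poly_Mapping.lookup \<nu> (L + n - 1))" for n
    using lP[of "L + n"] by (simp only: b_def add.assoc)
  have P0: "Poly_Mapping.lookup P b = k * p" using Pb[of 0] Nz[of "L - 1"] by (simp add: p_def)
  have P1: "Poly_Mapping.lookup P (b + 1) = k * (q + p)" using Pb[of 1] by (simp add: p_def q_def)
  have P2: "Poly_Mapping.lookup P (b + 2) = k * (s + q)" using Pb[of 2] by (simp add: s_def q_def add.assoc add.commute[of L 1])
  have P3: "Poly_Mapping.lookup P (b + 3) = k * s" using Pb[of 3] Nz[of "L + 3"] by (simp add: s_def add.assoc add.commute[of L 2])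
  have Pz: "Poly_Mapping.lookup P i = 0" if "i \<notin> {b, b + 1, b + 2, b + 3}" for i
  proof -
    have "L + (i - b) \<notin> {L, L + 1, L + 2}" "L + (i - b) - 1 \<notin> {L, L + 1, L + 2}" using that by auto
    then show ?thesis using Pb[of "i - b"] Nz by simp
  qed
  have PP: "Poly_Mapping.lookup (P * lrev P) n = (\<Sum>i\<in>{b, b + 1, b + 2, b + 3}. Poly_Mapping.lookup P i * Poly_Mapping.lookup P (i - n))" for n
    by (subst lookup_mult_superset[of "{b, b + 1, b + 2, b + 3}"]) (use Pz in \<open>auto simp: lookup_lrev\<close>)
  have z1: "Poly_Mapping.lookup P (b - 1) = 0" "Poly_Mapping.lookup P (b - 2) = 0" using Pz by auto
  have "Poly_Mapping.lookup (P * lrev P) 2 = (k * (s + q)) * (k * p) + (k * s) * (k * (q + p))"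
    unfolding PP by (simp add: z1 P0 P1 P2 P3 add.commute[of 1 b] add.commute[of 2 b])
  then have "k * k * ((s + q) * p + s * (q + p)) = 0" using c(2) unfolding P_def by (simp add: algebra_simps)
  then have "(s + q) * p + s * (q + p) = 0" using k by (metis mult_eq_0_iff)
  then have e1: "2 * (p * s) + q * (p + s) = 0" by algebra
  have "Poly_Mapping.lookup (P * lrev P) 1 = (k * (q + p)) * (k * p) + (k * (s + q)) * (k * (q + p)) + (k * s) * (k * (s + q))"
    unfolding PP by (simp add: z1 P0 P1 P2 P3 add.commute[of 1 b] add.commute[of 2 b])
  then have "k * k * ((q + p) * p + (s + q) * (q + p) + s * (s + q)) = 0" using c(1) unfolding P_def by (simp add: algebra_simps)
  then have "(q + p) * p + (s + q) * (q + p) + s * (s + q) = 0" using k by (metis mult_eq_0_iff)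
  then have e2: "p * p + q * q + s * s + 2 * (q * (p + s)) + p * s = 0" by algebra
  show False by (rule final_arith[OF p s q xy e1 e2])
qed

context plane_data
begin

text \<open>All four extremal coefficients vanish on both lines, and coprimality puts these zeros
  into \<open>d * h\<close>. The widths in the ball then make \<open>n1\<close> a Laurent polynomial
  in x alone and \<open>n4\<close> one in y alone. Comparing the ends of \<open>R\<close> in y and
  of \<open>E\<close> in x fixes all widths, and the middle coefficient of \<open>R\<close> in y
  yields the situation of \<open>middle_coefficient\<close>.\<close>

lemma case_zero:
  assumes D: "D = a1 * (d * h) * lrev (xrev a4)" and B: "B = a1 * (d * h) * lrev (xrev b4)"
    and C: "C = X2 * Poly_Mapping.single (- 1) 1 * b1 * lrev (d * h) * xrev a4" and T: "T = X2 * b1 * lrev (d * h) * xrev b4"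
    and nzBC: "B \<noteq> 0" "C \<noteq> 0"
    and Bx: "- 1 \<le> lo (lswap B)" "hi (lswap B) \<le> 0" and Tx: "- 1 \<le> lo (lswap T)" "hi (lswap T) \<le> 1"
    and Cy: "- 1 \<le> lo C" "hi C \<le> 0" and Ty: "- 1 \<le> lo T" "hi T \<le> 1" and wB: "wd B \<le> 2" and wC: "wx C \<le> 2"
    and zy0: "phy D = 0" "phy B = 0" "phy C = 0" "phy T = 0" and zx0: "phx D = 0" "phx B = 0" "phx C = 0" "phx T = 0"
  shows False
proof -
  let ?Yi = "Poly_Mapping.single (- 1) (1 :: L1)"
  have XY: "phy X2 \<noteq> 0" "phx X2 \<noteq> 0" "phy ?Yi \<noteq> 0" "phx ?Yi \<noteq> 0"
    using ph_unit_nz[OF XY_dvd_1(1)] ph_unit_nz[of ?Yi] by auto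
  have anz: "a1 \<noteq> 0" "a4 \<noteq> 0" using nzBC by (auto simp: B C)
  \<comment> \<open>If \<open>d * h\<close> did not vanish on the line, every product of one of
    \<open>a1\<close>, \<open>b1\<close> with one of \<open>a4\<close>, \<open>b4\<close> would, so
    one of the coprime pairs would vanish entirely.\<close>
  have dhy: "phy d = 0 \<or> phy h = 0"
  proof (rule ccontr)
    assume n: "\<not> ?thesis"
    have "phy a1 = 0 \<or> phy a4 = 0" "phy a1 = 0 \<or> phy b4 = 0" "phy b1 = 0 \<or> phy a4 = 0" "phy b1 = 0 \<or> phy b4 = 0"
      using zy0 n XY unfolding B C D T ph_hs ph_rev by simp_all
    then show False using cop_ph(1)[OF c1] cop_ph(1)[OF c4] by auto
  qed
  have dhx: "phx d = 0 \<or> phx h = 0"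
  proof (rule ccontr)
    assume n: "\<not> ?thesis"
    have "phx a1 = 0 \<or> phx a4 = 0" "phx a1 = 0 \<or> phx b4 = 0" "phx b1 = 0 \<or> phx a4 = 0" "phx b1 = 0 \<or> phx b4 = 0"
      using zx0 n XY unfolding B C D T ph_hs ph_rev by simp_all
    then show False using cop_ph(2)[OF c1] cop_ph(2)[OF c4] by auto
  qed
  have wdh: "wd d + wd h \<ge> 1" "wx d + wx h \<ge> 1"
    using dhy dhx ph_0_wd[OF nz(3)] ph_0_wd[OF nz(4)] wds by linarith+
  have nn: "wd a1 \<ge> 0" "wx a1 \<ge> 0" "wd a4 \<ge> 0" "wx a4 \<ge> 0" "wd b1 \<ge> 0" "wx b1 \<ge> 0" "wd b4 \<ge> 0" "wx b4 \<ge> 0"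
    using anz nz by (simp_all add: wd_nonneg wx_nonneg)
  have wBe: "wx B = wx a1 + (wx d + wx h) + wx b4" "wd B = wd a1 + (wd d + wd h) + wd b4"
    unfolding B using nz anz by (simp_all add: wx_mult wd_mult)
  have wCe: "wd C = wd b1 + (wd d + wd h) + wd a4" "wx C = wx b1 + (wx d + wx h) + wx a4"
    unfolding C using nz anz by (simp_all add: wd_mult wx_mult)
  have wBC: "wx B \<le> 1" "wd C \<le> 1" using Bx Cy by (simp_all add: wx_def wd_def)
  have w: "wx a1 = 0" "wx b4 = 0" "wx d + wx h = 1" "wd b1 = 0" "wd a4 = 0" "wd d + wd h = 1"
    "wd a1 + wd b4 \<le> 1" "wx b1 + wx a4 \<le> 1"
    using wBC wB wC wdh nn unfolding wBe wCe by linarith+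
  have snz: "lswap a1 \<noteq> 0" "lswap b1 \<noteq> 0" "lswap d \<noteq> 0" "lswap h \<noteq> 0" "lswap b4 \<noteq> 0" "lswap a4 \<noteq> 0" using anz nz by simp_all
  have n1w: "wx n1 \<le> 2"
  proof -
    have hB: "hi (lswap B) = hi (lswap a1) + (hi (lswap d) + hi (lswap h)) - lo (lswap b4)"
      "lo (lswap B) = lo (lswap a1) + (lo (lswap d) + lo (lswap h)) - hi (lswap b4)"
      unfolding B using snz by (simp_all add: lswap_mult hi_lo_mult lswap_lrev' lswap_xrev hi_lo_lrev)
    have hT: "hi (lswap T) = 1 + hi (lswap b1) + (hi (lswap d) + hi (lswap h)) - lo (lswap b4)"
      "lo (lswap T) = 1 + lo (lswap b1) + (lo (lswap d) + lo (lswap h)) - hi (lswap b4)"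
      unfolding T using snz by (simp_all add: lswap_mult hi_lo_mult lswap_lrev' lswap_xrev hi_lo_lrev)
    have ww: "hi (lswap b4) = lo (lswap b4)" "hi (lswap d) + hi (lswap h) = lo (lswap d) + lo (lswap h) + 1"
      using w(2,3) by (simp_all add: wx_def wd_def)
    have "hi (lswap n1) = 1 + 2 * hi (lswap b1) \<or> hi (lswap n1) = 2 * hi (lswap a1)"
      "lo (lswap n1) = 1 + 2 * lo (lswap b1) \<or> lo (lswap n1) = 2 * lo (lswap a1)"
      using n1_ends(2,3) by blast+
    then have "hi (lswap n1) - lo (lswap n1) \<le> 2" using Bx Tx ww unfolding hB hT by (elim disjE; linarith)
    then show ?thesis by (simp add: wx_def wd_def)
  qed
  have n4w: "wd n4 \<le> 2"
  proof -
    have hC: "hi C = - 1 + hi b1 - (lo d + lo h) + hi a4" "lo C = - 1 + lo b1 - (hi d + hi h) + lo a4"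
      unfolding C using nz anz by (simp_all add: lrev_mult hi_lo_mult hi_lo_lrev)
    have hT: "hi T = hi b1 - (lo d + lo h) + hi b4" "lo T = lo b1 - (hi d + hi h) + lo b4"
      unfolding T using nz anz by (simp_all add: lrev_mult hi_lo_mult hi_lo_lrev)
    have ww: "hi b1 = lo b1" "hi d + hi h = lo d + lo h + 1" using w(4,6) by (simp_all add: wd_def)
    have "hi n4 = 1 + 2 * hi b4 \<or> hi n4 = 2 * hi a4" "lo n4 = 1 + 2 * lo b4 \<or> lo n4 = 2 * lo a4"
      using n4_ends(2,3) by blast+
    then have "hi n4 - lo n4 \<le> 2" using Cy Ty ww unfolding hC hT by (elim disjE; linarith)
    then show ?thesis by (simp add: wd_def)
  qed
  have b1: "wx R + wx n4 + 2 * wx d \<le> wx n1" using widths(2) wx_E by linarith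
  have b2: "wd E + wd n1 + 2 * wd h \<le> wd n4" using widths(1) wd_R by linarith
  \<comment> \<open>Here both terms of \<open>n1\<close> have a single exponent of x at their ends:
    if one term provides both ends of \<open>n1\<close> the width is 0, otherwise it is odd.\<close>
  have odd_wd: "wx n1 \<noteq> 2" if "wx b1 = 0"
  proof
    assume w2: "wx n1 = 2"
    have q: "hi (lswap b1) = lo (lswap b1)" "hi (lswap a1) = lo (lswap a1)" "hi (lswap n1) = lo (lswap n1) + 2"
      using that w(1) w2 by (simp_all add: wx_def wd_def)
    show False using n1_ends(2,3) q by (elim disjE conjE; presburger)
  qed
  have odd_wd': "wd n4 \<noteq> 2" if "wd b4 = 0"
  proof
    assume w2: "wd n4 = 2"
    have q: "hi b4 = lo b4" "hi a4 = lo a4" "hi n4 = lo n4 + 2"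
      using that w(5) w2 by (simp_all add: wd_def)
    show False using n4_ends(2,3) q by (elim disjE conjE; presburger)
  qed
  have norm_width: "wd (F * lrev F - X2 * G * lrev G) = 2 * wd F" if "F \<noteq> 0" "G \<noteq> 0" "wd G = 0" "wd F \<ge> 1" for F G :: L2
  proof -
    have f: "F * lrev F \<noteq> 0" "hi (F * lrev F) = wd F" "lo (F * lrev F) = - wd F"
      using that(1) by (simp_all add: hi_lo_mult hi_lo_lrev wd_def)
    have g: "hi (X2 * G * lrev G) = wd G" "lo (X2 * G * lrev G) = - wd G"
      using that(2) by (simp_all add: hi_lo_mult hi_lo_lrev wd_def)
    have "hi (X2 * G * lrev G) < hi (F * lrev F)" "lo (F * lrev F) < lo (X2 * G * lrev G)" using f g that by linarith+
    then show ?thesis using hi_lo_diff(2)[OF f(1)] hi_lo_diff(4)[OF f(1)] f(2,3) by (simp add: wd_def)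
  qed
  \<comment> \<open>Width in \<open>a4\<close> would leave none for \<open>b1\<close> and give
    \<open>n4\<close> width 2 in x; the balance of widths then requires width 2 of \<open>n1\<close>
    as well, contradicting \<open>odd_wd\<close>.\<close>
  have a4x: "wx a4 = 0"
  proof (rule ccontr)
    assume "wx a4 \<noteq> 0"
    then have a: "wx a4 = 1" "wx b1 = 0" using w(8) nn by linarith+
    have "lswap n4 = lswap a4 * lrev (lswap a4) - X2 * lswap b4 * lrev (lswap b4)"
      unfolding n4 by (simp only: lswap_mult lswap_minus lswap_xrev lswap_XY)
    then have "wx n4 = 2 * wd (lswap a4)" using norm_width[OF snz(6,5)] w(2) a(1) by (simp add: wx_def)
    then have "wx n4 = 2" using a(1) by (simp add: wx_def)
    then have "wx n1 = 2" using b1 n1w wds by linarith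
    then show False using odd_wd a by blast
  qed
  have a1y: "wd a1 = 0"
  proof (rule ccontr)
    assume "wd a1 \<noteq> 0"
    then have a: "wd a1 = 1" "wd b4 = 0" using w(7) nn by linarith+
    have "wd n1 = 2 * wd a1" unfolding n1 using norm_width[OF anz(1) nz(1)] w(4) a(1) by simp
    then have "wd n4 = 2" using b2 n4w wds a(1) by linarith
    then show False using odd_wd' a by blast
  qed
  obtain ja \<alpha> where \<alpha>: "a1 = Poly_Mapping.single ja \<alpha>" "\<alpha> \<noteq> 0" using anz(1) a1y by (rule wd_0_obtain)
  obtain jb \<beta> where \<beta>: "b1 = Poly_Mapping.single jb \<beta>" "\<beta> \<noteq> 0" using nz(1) w(4) by (rule wd_0_obtain)
  define \<nu> where "\<nu> = \<alpha> * \<alpha> - xx * \<beta> * \<beta>"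
  have n1s: "n1 = Poly_Mapping.single 0 \<nu>" unfolding n1 \<alpha> \<beta> \<nu>_def by (simp add: mult_single single_diff mult.assoc)
  have \<nu>nz: "\<nu> \<noteq> 0" using n_nz(1) n1s by auto
  have w\<nu>: "wx n1 = wd \<nu>" "wd n1 = 0" unfolding n1s using \<nu>nz by (simp_all add: wx_single)
  have w\<alpha>: "wd \<alpha> = 0" using w(1) wx_single[OF \<alpha>(2)] \<alpha>(1) by simp
  have n1p: "wx n1 \<ge> 1"
  proof (rule ccontr)
    assume "\<not> ?thesis"
    then have "wx n1 = 0" using wds(7) by linarith
    then show False using n1_mono(1) snz(1) by (simp add: wx_def)
  qed
  obtain i4 \<alpha>4 where \<alpha>4: "lswap a4 = Poly_Mapping.single i4 \<alpha>4" "\<alpha>4 \<noteq> 0" using snz(6) a4x unfolding wx_def by (rule wd_0_obtain)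
  obtain k4 \<beta>4 where \<beta>4: "lswap b4 = Poly_Mapping.single k4 \<beta>4" "\<beta>4 \<noteq> 0" using snz(5) w(2) unfolding wx_def by (rule wd_0_obtain)
  define \<nu>4 where "\<nu>4 = \<alpha>4 * \<alpha>4 - xx * \<beta>4 * \<beta>4"
  have "lswap n4 = lswap a4 * lrev (lswap a4) - X2 * lswap b4 * lrev (lswap b4)"
    unfolding n4 by (simp only: lswap_mult lswap_minus lswap_xrev lswap_XY)
  then have n4s: "lswap n4 = Poly_Mapping.single 0 \<nu>4" unfolding \<alpha>4 \<beta>4 \<nu>4_def by (simp add: mult_single single_diff mult.assoc)
  have \<nu>4nz: "\<nu>4 \<noteq> 0" using n_nz(2) n4s by (metis lswap_eq_0 single_zero)
  have w\<nu>4: "wd n4 = wd \<nu>4" using wx_single[OF \<nu>4nz, of 0] unfolding n4s[symmetric] wx_def by simp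
  have wxn4: "wx n4 = 0" unfolding wx_def n4s using \<nu>4nz by simp
  have Rx: "wx R \<le> wx n1" using b1 wds by linarith
  have lnh: "Poly_Mapping.lookup (n1 * h) j = \<nu> * Poly_Mapping.lookup h j" for j unfolding n1s by (rule lookup_single0_mult)
  \<comment> \<open>An end coefficient of \<open>R\<close> in y that came from \<open>n1 * h\<close>
    would be a norm with at least twice the width of \<open>\<nu>\<close>, more than
    \<open>R\<close> has in x.\<close>
  have big: "wd (- (\<nu> * c * lrev (\<nu> * c))) > wx n1" if "c \<noteq> 0" for c
  proof -
    have "\<nu> * c \<noteq> 0" using \<nu>nz that by simp
    then have "wd (- (\<nu> * c * lrev (\<nu> * c))) = 2 * wd (\<nu> * c)" by (rule wd_norm)
    also have "\<dots> = 2 * (wd \<nu> + wd c)" by (simp only: wd_mult[OF \<nu>nz that])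
    finally have e: "wd (- (\<nu> * c * lrev (\<nu> * c))) = 2 * (wd \<nu> + wd c)" .
    have arith: "n < 2 * (a + b)" if "1 \<le> n" "0 \<le> b" "n = a" for a b n :: int using that by presburger
    show ?thesis unfolding e by (rule arith[OF n1p wd_nonneg[OF that] w\<nu>(1)])
  qed
  have hn: "hi (n1 * h) = hi h" "lo (n1 * h) = lo h" unfolding n1s by (rule hi_single0_mult[OF \<nu>nz nz(4)])+
  have Rhi: "r \<noteq> 0 \<and> hi R = 2 * hi r \<and> hi R > 1 + 2 * hi h \<and> Poly_Mapping.lookup R (hi R) = Poly_Mapping.lookup r (hi r) * Poly_Mapping.lookup (xrev r) (hi r)"
  proof (rule ccontr)
    assume "\<not> ?thesis"
    then have "Poly_Mapping.lookup R (hi R) = - (\<nu> * Poly_Mapping.lookup h (hi h) * lrev (\<nu> * Poly_Mapping.lookup h (hi h)))"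
      using R_ends(2) unfolding hn lookup_xrev lnh by blast
    then have "wx n1 < wd (Poly_Mapping.lookup R (hi R))" using big[OF hi_lo(1)[OF nz(4)]] by simp
    then show False using wx_ge[OF hi_lo(1)[OF all_nz(4)]] Rx by linarith
  qed
  have Rlo: "lo R = 2 * lo r \<and> lo R < 1 + 2 * lo h \<and> Poly_Mapping.lookup R (lo R) = Poly_Mapping.lookup r (lo r) * Poly_Mapping.lookup (xrev r) (lo r)"
  proof (rule ccontr)
    assume "\<not> ?thesis"
    then have "Poly_Mapping.lookup R (lo R) = - (\<nu> * Poly_Mapping.lookup h (lo h) * lrev (\<nu> * Poly_Mapping.lookup h (lo h)))"
      using R_ends(3) unfolding hn lookup_xrev lnh by blast
    then have "wx n1 < wd (Poly_Mapping.lookup R (lo R))" using big[OF hi_lo(2)[OF nz(4)]] by simp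
    then show False using wx_ge[OF hi_lo(2)[OF all_nz(4)]] Rx by linarith
  qed
  have r: "r \<noteq> 0" using Rhi by blast
  have hr: "hi h + 1 \<le> hi r" "lo r \<le> lo h" using Rhi Rlo by linarith+
  have arith: "2 * (a - b) + 2 \<le> c - d" if "a + 1 \<le> x" "y \<le> b" "c = 2 * x" "d = 2 * y" for a b c d x y :: int
    using that by presburger
  have "wd R \<ge> 2 * wd h + 2"
    unfolding wd_def by (rule arith[OF hr Rhi[THEN conjunct2, THEN conjunct1] Rlo[THEN conjunct1]])
  \<comment> \<open>\<open>r\<close> dominates at both ends, so \<open>R\<close> has width at least
    2 in y, while \<open>n4\<close> has at most 2 and \<open>n1\<close> has none; the balance of
    widths is saturated.\<close>
  then have y: "wd h = 0" "wd R = 2" "wd E = 0" "wd n4 = 2" using widths(1) w\<nu>(2) n4w wds by linarith+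
  have sE: "wx (lswap E) = wd E" by (simp add: wx_def)
  have lg: "Poly_Mapping.lookup (lswap g) j = lrev \<nu>4 * Poly_Mapping.lookup (lrev (lswap d)) j" for j
    unfolding lswap_mult lswap_lrev' lswap_xrev n4s xrev_single by (rule lookup_single0_mult)
  have big4: "wd (- (Poly_Mapping.lookup (lswap g) j * lrev (Poly_Mapping.lookup (lswap g) j))) > 0" if "Poly_Mapping.lookup (lswap g) j \<noteq> 0" for j
  proof -
    have n: "lrev \<nu>4 \<noteq> 0" "Poly_Mapping.lookup (lrev (lswap d)) j \<noteq> 0" using that unfolding lg by auto
    have "wd (Poly_Mapping.lookup (lswap g) j) = wd \<nu>4 + wd (Poly_Mapping.lookup (lrev (lswap d)) j)" unfolding lg wd_mult[OF n] wd_lrev ..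
    then show ?thesis using wd_norm[OF that] w\<nu>4 y(4) wd_nonneg[OF n(2)] by linarith
  qed
  have sEn: "lswap E \<noteq> 0" using all_nz by simp
  have Ehi: "hi (lswap E) > 1 + 2 * hi (lswap g) \<and> hi (lswap E) = 2 * hi (lswap e)"
  proof (rule ccontr)
    assume "\<not> ?thesis"
    then have "Poly_Mapping.lookup (lswap E) (hi (lswap E)) = - (Poly_Mapping.lookup (lswap g) (hi (lswap g)) * lrev (Poly_Mapping.lookup (lswap g) (hi (lswap g))))"
      using E_ends(2) unfolding lookup_xrev by blast
    then have "0 < wd (Poly_Mapping.lookup (lswap E) (hi (lswap E)))" using big4[OF hi_lo(1)[OF g_nz]] by simp
    then show False using wx_ge[OF hi_lo(1)[OF sEn]] sE y(3) by linarith
  qed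
  have Elo: "lo (lswap E) < 1 + 2 * lo (lswap g) \<and> lo (lswap E) = 2 * lo (lswap e)"
  proof (rule ccontr)
    assume "\<not> ?thesis"
    then have "Poly_Mapping.lookup (lswap E) (lo (lswap E)) = - (Poly_Mapping.lookup (lswap g) (lo (lswap g)) * lrev (Poly_Mapping.lookup (lswap g) (lo (lswap g))))"
      using E_ends(3) unfolding lookup_xrev by blast
    then have "0 < wd (Poly_Mapping.lookup (lswap E) (lo (lswap E)))" using big4[OF hi_lo(2)[OF g_nz]] by simp
    then show False using wx_ge[OF hi_lo(2)[OF sEn]] sE y(3) by linarith
  qed
  obtain p1 p2 p3 p4 where pp: "p1 = hi (lswap E)" "p2 = lo (lswap E)" "p3 = hi (lswap g)" "p4 = lo (lswap g)" by blast
  have "p1 \<ge> 2 * p3 + 2" "p2 \<le> 2 * p4" using Ehi Elo unfolding pp[symmetric] by presburger+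
  moreover have "wx E = p1 - p2" "wx g = p3 - p4" by (simp_all only: wx_def wd_def pp)
  ultimately have "wx E \<ge> 2 * (wx n4 + wx d) + 2" unfolding wd_g(1)[symmetric] by simp
  then have "wx E \<ge> 2 * wx n4 + 2 * wx d + 2" by (simp add: distrib_left)
  \<comment> \<open>The mirror argument for the ends of \<open>E\<close> saturates the balance of
    widths in x.\<close>
  then have x: "wx d = 0" "wx R = 0" "wx n1 = 2" using widths(2) n1w wxn4 wds by linarith+
  then have wh: "wx h = 1" using w(3) by simp
  obtain m \<eta> where \<eta>: "h = Poly_Mapping.single m \<eta>" "\<eta> \<noteq> 0" using nz(4) y(1) by (rule wd_0_obtain)
  have w\<eta>: "wd \<eta> = 1" using wh wx_single[OF \<eta>(2)] \<eta>(1) by simp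
  have "phx d \<noteq> 0" using ph_0_wd(2)[OF nz(3)] x(1) by force
  then have "phx h = 0" using dhx by blast
  then have "cmap (ev (- 1)) h = 0" unfolding phx_def ev_lswap .
  then have "Poly_Mapping.lookup (cmap (ev (- 1)) h) m = 0" by simp
  then have root: "ev (- 1) \<eta> = 0" unfolding lookup_cmap[of "ev (- 1)", OF coeff_hom.h_0[OF ev1]] by (simp add: \<eta>)
  have hh: "hi h = m" "lo h = m" unfolding \<eta>(1) using \<eta>(2) by simp_all
  have rr: "lo r = m" "hi r = m + 1"
  proof -
    have "2 * hi r - 2 * lo r = 2" using y(2) Rhi Rlo unfolding wd_def by linarith
    moreover have "2 * hi r > 1 + 2 * m" "2 * lo r < 1 + 2 * m" using Rhi Rlo hh by auto
    ultimately show "lo r = m" "hi r = m + 1" by presburger+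
  qed
  define r0 r1 where "r0 = Poly_Mapping.lookup r m" and "r1 = Poly_Mapping.lookup r (m + 1)"
  have rn: "r0 \<noteq> 0" "r1 \<noteq> 0" using hi_lo(1,2)[OF r] by (simp_all add: r0_def r1_def rr)
  have R0: "Poly_Mapping.lookup R (2 * m) = r0 * lrev r0"
  proof -
    have l: "lo R = 2 * m" using Rlo unfolding rr(1) by blast
    have "Poly_Mapping.lookup R (lo R) = Poly_Mapping.lookup r (lo r) * Poly_Mapping.lookup (xrev r) (lo r)" using Rlo by blast
    then show ?thesis unfolding l rr(1) lookup_xrev r0_def .
  qed
  have R2: "Poly_Mapping.lookup R (2 * (m + 1)) = r1 * lrev r1"
  proof -
    have l: "hi R = 2 * (m + 1)" using Rhi unfolding rr(2) by blast
    have "Poly_Mapping.lookup R (hi R) = Poly_Mapping.lookup r (hi r) * Poly_Mapping.lookup (xrev r) (hi r)" using Rhi by blast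
    then show ?thesis unfolding l rr(2) lookup_xrev r1_def .
  qed
  have "wd (r0 * lrev r0) \<le> 0" "wd (r1 * lrev r1) \<le> 0"
    using wx_ge[of R "2 * m"] wx_ge[of R "2 * (m + 1)"] rn x(2) unfolding R0 R2 by simp_all
  then have wr: "wd r0 = 0" "wd r1 = 0" using rn wd_nonneg[of r0] wd_nonneg[of r1] by (simp_all add: wd_mult)
  obtain s0 \<rho>0 where \<rho>0: "r0 = Poly_Mapping.single s0 \<rho>0" "\<rho>0 \<noteq> 0" using rn(1) wr(1) by (rule wd_0_obtain)
  obtain s1 \<rho>1 where \<rho>1: "r1 = Poly_Mapping.single s1 \<rho>1" "\<rho>1 \<noteq> 0" using rn(2) wr(2) by (rule wd_0_obtain)
  define P where "P = \<nu> * \<eta>"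
  have Pnz: "P \<noteq> 0" using \<nu>nz \<eta>(2) by (simp add: P_def)
  \<comment> \<open>\<open>R\<close> has width 0 in x, and its lowest coefficient in y has a nonzero
    constant term, so 0 is the only exponent of x that occurs.\<close>
  have lone: "lk R i (2 * m + 1) = 0" if "i \<noteq> 0" for i
  proof -
    have "lk R 0 (2 * m) \<noteq> 0" unfolding R0 \<rho>0(1) using \<rho>0(2) by (simp add: mult_single)
    then have "Poly_Mapping.lookup (lswap R) 0 \<noteq> 0" using lookup_lswap[of R 0 "2 * m"] by (metis lookup_zero)
    moreover have sR: "lswap R \<noteq> 0" using all_nz by simp
    ultimately have "lo (lswap R) \<le> 0" "0 \<le> hi (lswap R)" using hi_lo(3) by blast+
    moreover have "hi (lswap R) = lo (lswap R)" using x(2) by (simp add: wx_def wd_def)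
    ultimately have z: "hi (lswap R) = 0" "lo (lswap R) = 0" by linarith+
    have "Poly_Mapping.lookup (lswap R) i = 0" using hi_lo(3)[OF sR, of i] z that by force
    then show ?thesis using lookup_lswap[of R i "2 * m + 1"] by (metis lookup_zero)
  qed
  have mid: "Poly_Mapping.lookup R (2 * m + 1) = r0 * lrev r1 + r1 * lrev r0 - P * lrev P"
  proof -
    have z: "Poly_Mapping.lookup r i = 0" if "i \<notin> {m, m + 1}" for i using hi_lo(3)[OF r, of i] rr that by force
    have "Poly_Mapping.lookup (r * xrev r) (2 * m + 1) = (\<Sum>i\<in>{m, m + 1}. Poly_Mapping.lookup r i * Poly_Mapping.lookup (xrev r) (2 * m + 1 - i))"
      by (rule lookup_mult_superset) (use z in auto)
    also have "\<dots> = r0 * lrev r1 + r1 * lrev r0" by (simp add: lookup_xrev r0_def r1_def)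
    finally have 1: "Poly_Mapping.lookup (r * xrev r) (2 * m + 1) = r0 * lrev r1 + r1 * lrev r0" .
    have "n1 * h = Poly_Mapping.single m P" by (simp add: n1s \<eta>(1) P_def mult_single)
    then have "Y2 * (n1 * h) * xrev (n1 * h) = Poly_Mapping.single (2 * m + 1) (P * lrev P)"
      by (simp add: xrev_single mult_single)
    then show ?thesis unfolding R by (simp add: lookup_minus 1)
  qed
  define t where "t = s0 - s1"
  have sides: "r0 * lrev r1 = Poly_Mapping.single t (\<rho>0 * \<rho>1)" "r1 * lrev r0 = Poly_Mapping.single (- t) (\<rho>0 * \<rho>1)"
    by (simp_all add: \<rho>0(1) \<rho>1(1) mult_single t_def mult.commute)
  have PP: "Poly_Mapping.lookup (P * lrev P) i = (if i = t then \<rho>0 * \<rho>1 else 0) + (if i = - t then \<rho>0 * \<rho>1 else 0)" if "i \<noteq> 0" for i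
  proof -
    have "Poly_Mapping.lookup (r0 * lrev r1 + r1 * lrev r0 - P * lrev P) i = 0" using lone[OF that] unfolding mid .
    then have "Poly_Mapping.lookup (P * lrev P) i = Poly_Mapping.lookup (Poly_Mapping.single t (\<rho>0 * \<rho>1)) i + Poly_Mapping.lookup (Poly_Mapping.single (- t) (\<rho>0 * \<rho>1)) i"
      unfolding sides lookup_minus lookup_add by linarith
    then show ?thesis by (auto simp: lookup_single when_def)
  qed
  \<comment> \<open>The coefficient of \<open>P * lrev P\<close> at degree 3 must come from the
    monomial \<open>r0 * lrev r1\<close> or its reversal, so \<open>t\<close> is 3 or -3 and nothing
    is left at degrees 1 and 2.\<close>
  have "wd P = 3" using \<nu>nz \<eta>(2) w\<nu>(1) x(3) w\<eta> by (simp add: P_def wd_mult)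
  then have "hi (P * lrev P) = 3" using Pnz by (simp add: hi_lo_mult hi_lo_lrev wd_def)
  moreover have "P * lrev P \<noteq> 0" using Pnz by simp
  ultimately have "Poly_Mapping.lookup (P * lrev P) 3 \<noteq> 0" using hi_lo(1) by metis
  then have "t = 3 \<or> t = - 3" using PP[of 3] by (auto split: if_splits)
  then have "Poly_Mapping.lookup (P * lrev P) 1 = 0" "Poly_Mapping.lookup (P * lrev P) 2 = 0" using PP[of 1] PP[of 2] by auto
  then show False
    using middle_coefficient[OF \<nu>_def w\<alpha> _ w\<eta> \<alpha>(2) \<beta>(2) \<eta>(2) root] w\<nu>(1) x(3) unfolding P_def by simp
qed

end

section \<open>Units supported in the ball\<close>

text \<open>Even levels translate, so levels 4 and -4 of \<open>u\<close> reach further than its odd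
  levels: at one end of the product, depending on the sign of the sum of the extreme levels of
  \<open>v\<close>, a single term survives away from level 0.\<close>

lemma (in twisted_ring) two_ends:
  assumes uv: "u * v = 1" and u: "\<And>n. n < - 4 \<Longrightarrow> cf u n = 0" "\<And>n. n > 4 \<Longrightarrow> cf u n = 0"
  shows "cf u 4 = 0 \<or> cf u (- 4) = 0"
proof (rule ccontr)
  assume "\<not> ?thesis"
  then have nz: "cf u 4 \<noteq> 0" "cf u (- 4) \<noteq> 0" by auto
  have one: "cf (u * v) k = (if k = 0 then 1 else 0)" for k unfolding uv by (rule cf_one)
  have "cf v \<noteq> (\<lambda>_. 0)"
  proof
    assume z: "cf v = (\<lambda>_. 0)"
    have "cf (u * v) 0 = 0" using cf_mult_explicit[of u v 0] u z by simp
    then show False using one[of 0] by simp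
  qed
  then obtain l t where lt: "l \<le> t" "cf v l \<noteq> 0" "cf v t \<noteq> 0" and lo: "\<And>n. n < l \<Longrightarrow> cf v n = 0" and hi: "\<And>n. n > t \<Longrightarrow> cf v n = 0"
    by (rule cf_nz_extremes) blast
  show False
  proof (cases "- t \<le> l")
    case True
    have z: "cf v (4 + t + 4) = 0" "cf v (- 3 - (4 + t)) = 0" "cf v (4 + t + 2) = 0" "cf v (- 1 - (4 + t)) = 0" "cf v (4 + t) = 0"
      "cf v (1 - (4 + t)) = 0" "cf v (4 + t - 2) = 0" "cf v (3 - (4 + t)) = 0"
      using True by (intro lo hi; linarith)+
    have "cf (u * v) (4 + t) = cf u 4 * cf v t" using cf_mult_explicit[of u v "4 + t"] u z by simp
    then have "4 + t = 0" using one[of "4 + t"] nz lt by (auto split: if_splits)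
    then show False using True lt(1) by linarith
  next
    case False
    have z: "cf v (l - 4 + 2) = 0" "cf v (- 3 - (l - 4)) = 0" "cf v (l - 4 - 4) = 0" "cf v (- 1 - (l - 4)) = 0" "cf v (l - 4) = 0"
      "cf v (1 - (l - 4)) = 0" "cf v (l - 4 - 2) = 0" "cf v (3 - (l - 4)) = 0"
      using False by (intro lo hi; linarith)+
    have "cf (u * v) (l - 4) = cf u (- 4) * cf v l" using cf_mult_explicit[of u v "l - 4"] u z by simp
    then have "l - 4 = 0" using one[of "l - 4"] nz lt by (auto split: if_splits)
    then show False using False lt(1) by linarith
  qed
qed

text \<open>The anti-automorphism induced by inversion in the group. It preserves the ball,
  exchanges levels 4 and -4, and turns a left inverse into a right inverse.\<close>

definition zstar :: "ZP \<Rightarrow> ZP" where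
  "zstar w = (\<Sum>g\<in>Poly_Mapping.keys w. Poly_Mapping.single (- g) (Poly_Mapping.lookup w g))"

lemma lookup_zstar: "Poly_Mapping.lookup (zstar w) g = Poly_Mapping.lookup w (- g)"
proof -
  have "Poly_Mapping.lookup (zstar w) g = (\<Sum>k\<in>Poly_Mapping.keys w. if k = - g then Poly_Mapping.lookup w k else 0)"
    unfolding zstar_def lookup_sum by (intro sum.cong refl) (auto simp: lookup_single when_def)
  then show ?thesis by (simp add: in_keys_iff)
qed

lemma zstar_zstar [simp]: "zstar (zstar w) = w"
  by (rule poly_mapping_eqI) (simp add: lookup_zstar)

lemma zstar_single: "zstar (Poly_Mapping.single g c) = Poly_Mapping.single (- g) c"
  by (rule poly_mapping_eqI) (auto simp: lookup_zstar lookup_single when_def)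

lemma zstar_sum: "zstar (sum F I) = (\<Sum>i\<in>I. zstar (F i))"
  by (rule poly_mapping_eqI) (simp add: lookup_zstar lookup_sum)

lemma zp_decomp: "w = (\<Sum>g\<in>Poly_Mapping.keys w. Poly_Mapping.single g (Poly_Mapping.lookup w g))" for w :: ZP
  by (rule poly_mapping_eqI) (simp add: lookup_sum lookup_single when_def in_keys_iff)

lemma zstar_mult: "zstar (v * w) = zstar w * zstar v"
proof -
  have "v * w = (\<Sum>g\<in>Poly_Mapping.keys v. Poly_Mapping.single g (Poly_Mapping.lookup v g)) * (\<Sum>k\<in>Poly_Mapping.keys w. Poly_Mapping.single k (Poly_Mapping.lookup w k))"
    by (simp only: zp_decomp[symmetric])
  also have "\<dots> = (\<Sum>g\<in>Poly_Mapping.keys v. \<Sum>k\<in>Poly_Mapping.keys w. Poly_Mapping.single (g + k) (Poly_Mapping.lookup v g * Poly_Mapping.lookup w k))"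
    by (simp only: sum_product mult_single)
  finally have "zstar (v * w) = (\<Sum>g\<in>Poly_Mapping.keys v. \<Sum>k\<in>Poly_Mapping.keys w. Poly_Mapping.single (- k + - g) (Poly_Mapping.lookup w k * Poly_Mapping.lookup v g))"
    by (simp only: zstar_sum zstar_single minus_add mult.commute)
  also have "\<dots> = (\<Sum>k\<in>Poly_Mapping.keys w. \<Sum>g\<in>Poly_Mapping.keys v. Poly_Mapping.single (- k + - g) (Poly_Mapping.lookup w k * Poly_Mapping.lookup v g))"
    by (rule sum.swap)
  also have "\<dots> = zstar w * zstar v" by (simp only: zstar_def sum_product mult_single)
  finally show ?thesis .
qed

lemma zstar_one: "zstar 1 = 1"
  using zstar_single[of 0 1] by simp

lemma minus_sum_list: "- sum_list gs = sum_list (rev (map uminus gs))" for gs :: "promislow list"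
  by (induction gs) (simp_all add: minus_add)

lemma word_ball_uminus: "g \<in> word_ball n \<Longrightarrow> - g \<in> word_ball n"
proof -
  assume "g \<in> word_ball n"
  then obtain gs where gs: "g = sum_list gs" "length gs \<le> n" "set gs \<subseteq> {pa, - pa, pb, - pb}" by (auto simp: word_ball_def)
  have "set (rev (map uminus gs)) \<subseteq> {pa, - pa, pb, - pb}" using gs(3) by auto
  then show ?thesis unfolding word_ball_def using minus_sum_list[of gs] gs(1,2)
    by (intro CollectI exI[of _ "rev (map uminus gs)"]) simp
qed

lemma cf2_zstar_4:
  assumes "cf2 u 4 = 0"
  shows "cf2 (zstar u) (- 4) = 0"
  unfolding cf2_eq_0_iff
proof (intro ballI notI)
  fix g assume g: "g \<in> Poly_Mapping.keys (zstar u)" "lev g = - 4"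
  have "lev (- g + g) = 0" by (simp add: lev_def)
  then have l: "lev (- g) + sgn_par (lev (- g)) * (- 4) = 0" unfolding twisted.lev_add[OF T2_twisted, of "- g" g] g(2) .
  then have "lev (- g) = 4 \<or> lev (- g) = - 4" by (auto simp: sgn_par_def split: if_splits)
  then have "lev (- g) = 4" using l by (auto simp: sgn_par_def)
  moreover have "- g \<in> Poly_Mapping.keys u" using g(1) by (simp add: in_keys_iff lookup_zstar)
  ultimately show False using assms unfolding cf2_eq_0_iff by blast
qed

lemma lrev_zy: "lrev zy = Poly_Mapping.single (- 1) 1 * zy" "xrev zy = zy"
proof -
  have "Poly_Mapping.single (- 1) 1 * Y2 = (1 :: L2)" by (simp add: mult_single)
  then show "lrev zy = Poly_Mapping.single (- 1) 1 * zy" by (simp add: lrev_add distrib_left add.commute)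
  show "xrev zy = zy" by (simp add: coeff_hom.h_add[OF xrev_hom] xrev_single)
qed

text \<open>If one of the levels 4, 3, -3 is empty, rigidity over the plane applies. Otherwise the
  common level \<open>n\<close> of the two lines is excluded case by case:
  \<open>top_relation\<close> equates a product of levels 4 and -2 with one of levels 3 and -3, and
  the zeros of the two sides along the lines have to balance.\<close>

lemma ball_unit_mono:
  fixes u v :: ZP
  assumes uv: "u * v = 1" and u: "Poly_Mapping.keys u \<subseteq> word_ball 4" and m4: "cf2 u (- 4) = 0"
  shows "\<exists>n. mono_at (cf2 u) n"
proof -
  let ?T = "cf2 u 4" and ?B = "cf2 u (- 3)" and ?C = "cf2 u 3" and ?D = "cf2 u (- 2)"
  have z: "cf2 u n = 0" if "n < - 3 \<or> n > 4" for n using ball_supp(1)[OF u, of n] m4 that by (cases "n = - 4") auto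
  show ?thesis
  proof (cases "?T = 0 \<or> ?B = 0 \<or> ?C = 0")
    case True
    show ?thesis
    proof (cases "?T = 0")
      case T: True
      show ?thesis
      proof (rule plane_short[OF uv])
        show "cf2 u n = 0" if "n < - 3 \<or> n > 3" for n using z[of n] T that by (cases "n = 4") auto
      qed
    next
      case F: False
      have "?B = 0 \<or> ?C = 0" using True F by blast
      then have "mono_at (cf2 u) 4" by (intro plane_rigid[OF uv _ _ F]) (use z in auto)
      then show ?thesis by blast
    qed
  next
    case False
    then have nz: "?T \<noteq> 0" "?B \<noteq> 0" "?C \<noteq> 0" by auto
    have zz: "\<And>n. n < - 3 \<Longrightarrow> cf2 u n = 0" "\<And>n. n > 4 \<Longrightarrow> cf2 u n = 0" using z by auto
    have one: "cf2 (u * v) = (\<lambda>n. if n = 0 then 1 else 0)" unfolding uv by (rule ext) (rule twisted.cf_one[OF T2_twisted])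
    have eq: "?T * lrev ?D = Y2 * ?C * lrev ?B" by (rule twisted_ring.top_relation[OF T2_ring one zz nz(1)])
    obtain n where n: "mono_at (\<lambda>n. phy (cf2 u n)) n" "mono_at (\<lambda>n. phx (cf2 u n)) n" by (rule lines_mono[OF uv u m4])
    have zn: "phy (cf2 u k) = 0 \<and> phx (cf2 u k) = 0" if "k \<noteq> n" for k using n that unfolding mono_at_def by blast
    have un: "phy (cf2 u n) dvd 1" "phx (cf2 u n) dvd 1" using n unfolding mono_at_def by blast+
    have nn: "phy (cf2 u n) \<noteq> 0" "phx (cf2 u n) \<noteq> 0" using un by auto
    have lB: "- 1 \<le> i \<and> i \<le> 0" if "Poly_Mapping.lookup (lswap ?B) i \<noteq> 0" for i
      using lswap_nz_lk[OF that] ball_supp(3)[OF u] by blast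
    have lBy: "- 1 \<le> j \<and> j \<le> 1" if "Poly_Mapping.lookup ?B j \<noteq> 0" for j
      using lookup_nz_lk[OF that] ball_supp(3)[OF u] by (metis abs_le_iff minus_le_iff)
    have lC: "- 1 \<le> j \<and> j \<le> 0" if "Poly_Mapping.lookup ?C j \<noteq> 0" for j
      using lookup_nz_lk[OF that] ball_supp(4)[OF u] by blast
    have lCx: "- 1 \<le> i \<and> i \<le> 1" if "Poly_Mapping.lookup (lswap ?C) i \<noteq> 0" for i
      using lswap_nz_lk[OF that] ball_supp(4)[OF u] by (metis abs_le_iff minus_le_iff)
    have lT: "- 1 \<le> j \<and> j \<le> 1" if "Poly_Mapping.lookup ?T j \<noteq> 0" for j
      using lookup_nz_lk[OF that] ball_supp(2)[OF u] by (metis abs_le_iff minus_le_iff)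
    have lTx: "- 1 \<le> i \<and> i \<le> 1" if "Poly_Mapping.lookup (lswap ?T) i \<noteq> 0" for i
      using lswap_nz_lk[OF that] ball_supp(2)[OF u] by (metis abs_le_iff minus_le_iff)
    have sn: "lswap ?T \<noteq> 0" "lswap ?B \<noteq> 0" "lswap ?C \<noteq> 0" using nz by simp_all
    note wB = wd_le[OF sn(2) lB] and wBy = wd_le[OF nz(2) lBy] and wC = wd_le[OF nz(3) lC] and wCx = wd_le[OF sn(3) lCx]
      and wT = wd_le[OF nz(1) lT] and wTx = wd_le[OF sn(1) lTx]
    have eqx: "lswap ?T * lswap (lrev ?D) = lswap Y2 * lswap (lrev ?B) * lswap ?C"
      using arg_cong[OF eq, of lswap] unfolding lswap_mult by (simp only: mult_ac)
    have False
    proof (rule plane_structure[OF uv zz nz(1)])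
      fix a1 b1 a4 b4 d h r e n1 n4 R E eps
      assume p: "plane_data a1 b1 a4 b4 d h r e n1 n4 R E eps" and D: "?D = a1 * (d * h) * lrev (xrev a4)" and B: "?B = a1 * (d * h) * lrev (xrev b4)"
        and C: "?C = X2 * Poly_Mapping.single (- 1) 1 * b1 * lrev (d * h) * xrev a4" and T: "?T = X2 * b1 * lrev (d * h) * xrev b4"
      consider "n = - 3" | "n = 3" | "n = 4" | "n = - 2" | "n \<notin> {- 3, 3, 4, - 2}" by blast
      then show False
      proof cases
        \<comment> \<open>Levels 4 and -2 vanish on y = -1 and level -3 does not, so level 3 would
          vanish there doubly, but its width in y is at most 1.\<close>
        case 1
        show False
          by (rule double_root[OF _ _ eq XY_dvd_1(2) _ nz(3)]) (use zn[of 4] zn[of "- 2"] nn wC 1 in simp_all)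
      next
        \<comment> \<open>The mirror image: level -3 would vanish doubly on x = -1, but its width in
          x is at most 1.\<close>
        case 2
        have "lswap (lrev ?B) \<noteq> 0" using nz by simp
        moreover have "wd (lswap (lrev ?B)) \<le> 1" using wB by (simp add: lswap_lrev')
        moreover have "phy (lswap ?T) = 0" "phy (lswap (lrev ?D)) = 0" "phy (lswap ?C) \<noteq> 0"
          using zn[of 4] zn[of "- 2"] nn 2 unfolding phx_phy(1)[symmetric] by simp_all
        moreover have "lswap Y2 dvd 1" by simp
        ultimately show False using double_root[OF _ _ eqx] by blast
      next
        \<comment> \<open>Levels 3 and -3 vanish on both lines and level 4 on neither, so level -2
          vanishes doubly on both.\<close>
        case 3
        obtain G where G: "lrev ?D = zy * zy * G"
          using double_dvd[OF eq] zn[of 3] zn[of "- 3"] nn 3 by auto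
        have "?D = lrev (zy * zy * G)" unfolding G[symmetric] by simp
        then have y: "?D = zy * zy * (Poly_Mapping.single (- 1) 1 * Poly_Mapping.single (- 1) 1 * lrev G)"
          unfolding lrev_mult lrev_zy(1) by (simp only: mult_ac)
        obtain H where H: "lswap (lrev ?D) = zy * zy * H"
          using double_dvd[OF eqx] zn[of 3] zn[of "- 3"] nn 3 unfolding phx_phy(1)[symmetric] by auto
        have "lswap ?D = xrev (zy * zy * H)" unfolding H[symmetric] by (simp add: lswap_lrev' xrev_xrev)
        then have x: "lswap ?D = zy * zy * xrev H" unfolding xrev_mult lrev_zy(2) .
        have "?D = 0" by (rule D_shape_zero[OF _ y x]) (use ball_supp(5)[OF u] in blast)
        then show False using eq nz by simp
      next
        case 4
        show False
          by (rule plane_data.case_D[OF p D B C T]) (use zn[of 3] zn[of "- 3"] un wB wC wT wTx 4 in \<open>simp_all add: wx_def\<close>)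
      next
        case 5
        then have ne: "4 \<noteq> n" "3 \<noteq> n" "- 3 \<noteq> n" "- 2 \<noteq> n" by auto
        show False
          by (rule plane_data.case_zero[OF p D B C T nz(2,3)])
            (use zn[OF ne(1)] zn[OF ne(2)] zn[OF ne(3)] zn[OF ne(4)] wB wC wT wTx wBy wCx in \<open>simp_all add: wx_def\<close>)
      qed
    qed
    then show ?thesis ..
  qed
qed

lemma ball_unit_trivial:
  fixes u v :: ZP
  assumes uv: "u * v = 1" "v * u = 1" and u: "Poly_Mapping.keys u \<subseteq> word_ball 4"
  shows "\<exists>g c. \<bar>c\<bar> = 1 \<and> u = Poly_Mapping.single g c"
proof (cases "cf2 u (- 4) = 0")
  case True
  then show ?thesis using ball_unit_mono[OF uv(1) u] mono_trivial by blast
next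
  case False
  \<comment> \<open>With level -4 occupied, level 4 is free, and \<open>zstar\<close> leads back to
    the case already settled; \<open>v * u = 1\<close> provides the right inverse.\<close>
  then have "cf2 u 4 = 0" using twisted_ring.two_ends[OF T2_ring uv(1)] ball_supp(1)[OF u] by blast
  then have m4: "cf2 (zstar u) (- 4) = 0" by (rule cf2_zstar_4)
  have "zstar u * zstar v = 1" unfolding zstar_mult[symmetric] uv(2) by (rule zstar_one)
  moreover have "Poly_Mapping.keys (zstar u) \<subseteq> word_ball 4"
  proof
    fix g assume "g \<in> Poly_Mapping.keys (zstar u)"
    then have "- g \<in> Poly_Mapping.keys u" by (simp add: in_keys_iff lookup_zstar)
    then have "- g \<in> word_ball 4" using u by blast
    then show "g \<in> word_ball 4" using word_ball_uminus[of "- g"] by simp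
  qed
  ultimately obtain g c where gc: "\<bar>c\<bar> = 1" "zstar u = Poly_Mapping.single g c" using ball_unit_mono[OF _ _ m4] mono_trivial by meson
  have "u = zstar (zstar u)" by simp
  also have "\<dots> = Poly_Mapping.single (- g) c" unfolding gc(2) by (rule zstar_single)
  finally show ?thesis using gc(1) by blast
qed

theorem theorem1p2:
  "\<not> (\<exists>u :: ZP. ring_unit u \<and> Poly_Mapping.keys u \<subseteq> word_ball 4 \<and>
        \<not> trivial_unit_F2 (reduction_mod_2 u)) \<and>
   (\<forall>u :: ZP. ring_unit u \<and> Poly_Mapping.keys u \<subseteq> word_ball 4 \<longrightarrow>
        (\<exists>t. trivial_unit_Z t \<and> congruent_mod_2 u t))"
proof -
  \<comment> \<open>A unit in the ball is itself plus or minus a group element, so it serves as its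
    own trivial representative; modulo 2 the sign disappears.\<close>
  have *: "trivial_unit_Z u \<and> trivial_unit_F2 (reduction_mod_2 u) \<and> congruent_mod_2 u u"
    if unit: "ring_unit u" and ball: "Poly_Mapping.keys u \<subseteq> word_ball 4" for u :: ZP
  proof -
    obtain v where "u * v = 1" "v * u = 1" using unit unfolding ring_unit_def by blast
    then obtain g c where gc: "\<bar>c\<bar> = 1" "u = Poly_Mapping.single g c" using ball_unit_trivial[OF _ _ ball] by blast
    have c: "c = 1 \<or> c = - 1" using gc(1) by linarith
    have "reduction_mod_2 u = Poly_Mapping.single g 1"
    proof (rule poly_mapping_eqI)
      fix k
      show "Poly_Mapping.lookup (reduction_mod_2 u) k = Poly_Mapping.lookup (Poly_Mapping.single g 1) k"
        using c by (auto simp: lookup_reduction_mod_2 gc(2) lookup_single when_def)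
    qed
    moreover have "trivial_unit_Z u" using c unfolding trivial_unit_Z_def gc(2) by (auto simp: single_uminus)
    moreover have "congruent_mod_2 u u" unfolding congruent_mod_2_def by (intro exI[of _ 0]) simp
    ultimately show ?thesis unfolding trivial_unit_F2_def by blast
  qed
  then show ?thesis by blast
qed

end
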